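(* Let $A\in\Theta^\pm_\triangle(n)$, $\alpha,\lambda,\mu\in\mathbb N^n_\triangle$, $B=\sum_{1\le i\le n}\alpha_iE^\triangle_{i,i+1}$ and $C=\sum_{1\le i\le n}\alpha_iE^\triangle_{i+1,i}$. The following identities hold in $\widehat{\mathcal K}_{\mathbb Q}(n)$: (1) $$0\{\mu\}\,A\{\lambda\}=\sum_{\delta\in\mathbb N^n_\triangle,\ \delta\le\mu}\Big(\sum_{\beta\in\mathbb N^n_\triangle,\ \beta\le\mu-\delta,\ \beta\le\lambda}\binom{\mathrm{ro}(A)}{\mu-\beta-\delta}\binom{\delta+\lambda}{\beta,\delta,\lambda-\beta}\Big)A\{\lambda+\delta\};$$ (2) $$B\{\mathbf 0\}\,A\{\lambda\}=\sum_{\substack{T\in\Theta_\triangle(n),\ \delta\in\mathbb N^n_\triangle\\ \mathrm{ro}(T)=\alpha,\ \delta\le\lambda}}a(T,\delta)\prod_{\substack{1\le i\le n\\ j\in\mathbb Z,\ j\ne i}}\binom{a_{i,j}-t_{i-1,j}+t_{i,j}}{t_{i,j}}\,(A+T^\pm-\widetilde T^\pm)\{\lambda(T)+\delta\},$$ where $$a(T,\delta)=\sum_{\beta\in\mathbb N^n_\triangle,\ \beta\le\lambda(T),\ \beta\le\lambda-\delta}\binom{\lambda(\widetilde T)-\lambda(T)}{\lambda-\beta-\delta}\binom{\lambda(T)+\delta}{\beta,\delta,\lambda(T)-\beta}\in\mathbb Z;$$ (3) $$C\{\mathbf 0\}\,A\{\lambda\}=\sum_{\substack{T\in\Theta_\triangle(n),\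 \delta\in\mathbb N^n_\triangle\\ \mathrm{ro}(T)=\alpha,\ \delta\le\lambda}}b(T,\delta)\prod_{\substack{1\le i\le n\\ j\in\mathbb Z,\ j\ne i}}\binom{a_{i,j}+t_{i-1,j}-t_{i,j}}{t_{i-1,j}}\,(A-T^\pm+\widetilde T^\pm)\{\lambda(\widetilde T)+\delta\},$$ where $$b(T,\delta)=\sum_{\beta\in\mathbb N^n_\triangle,\ \beta\le\lambda(\widetilde T),\ \beta\le\lambda-\delta}\binom{\lambda(T)-\lambda(\widetilde T)}{\lambda-\beta-\delta}\binom{\lambda(\widetilde T)+\delta}{\beta,\delta,\lambda(\widetilde T)-\beta}\in\mathbb Z.$$ Moreover, for every $r\ge0$ the same formulas hold in $\mathcal S_\triangle(n,r)_{\mathbb Z}$ with every $X\{\nu\}$ replaced by $X\{\nu,r\}$.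
   Context: Matrices. Let $n\ge2$ be an integer, $\mathbb N=\{0,1,2,\dots\}$. $M_{\triangle,n}(\mathbb Z)$ is the set of integer matrices $A=(a_{i,j})_{i,j\in\mathbb Z}$ with $a_{i,j}=a_{i+n,j+n}$ and with finitely many nonzero entries in every row and column. $\widetilde\Theta_\triangle(n)=\{A\in M_{\triangle,n}(\mathbb Z): a_{i,j}\ge0\ \forall i\ne j\}$; $\Theta_\triangle(n)$ is the subset of matrices with all entries in $\mathbb N$; $\Theta^\pm_\triangle(n)=\{A\in\Theta_\triangle(n):a_{i,i}=0\ \forall i\}$. $E^\triangle_{i,j}$ is the matrix with entry $1$ at positions $(i+sn,j+sn)$, $s\in\mathbb Z$, and $0$ elsewhere. $\mathbb Z^n_\triangle$ is the set of $n$-periodic integer sequences $(\lambda_i)_{i\in\mathbb Z}$ (identified with $\mathbb Z^n$), $\mathbb N^n_\triangle$ its subset of nonnegative sequences; $\lambda\le\mu$ means $\lambda_i\le\mu_i$ for all $i$; $\mathbf 0$ is the zero sequence. $\sigma(\lambda)=\sum_{i=1}^n\lambda_i$, $\sigma(A)=\sum_{1\le i\le n,\,j\in\mathbb Z}a_{i,j}$, $\Lambda_\triangle(n,r)=\{\lambda\in\mathbb N^n_\triangle:\sigma(\lambda)=r\}$ (empty if $r<0$), $\Theta_\triangle(n,r)=\{A\in\Theta_\triangle(n):\sigma(A)=r\}$. $\mathrm{ro}(A)=(\sum_ja_{i,j})_i$, $\mathrm{co}(A)=(\sum_ia_{i,j})_j$; $\mathrm{diag}(\lambda)$ is the diagonal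 matrix with diagonal $\lambda$; ${}_aA=A+aI$. For $T=(t_{i,j})\in\Theta_\triangle(n)$: $\widetilde T$ is the matrix with $(i,j)$ entry $t_{i-1,j}$; $\lambda(T)=(t_{i,i})_i$ is the diagonal of $T$; $T^\pm$ is $T$ with diagonal entries replaced by $0$, and $\widetilde T^\pm=(\widetilde T)^\pm$. Binomials. $\binom mt=m(m-1)\cdots(m-t+1)/t!$ for $m\in\mathbb Z$, $t\in\mathbb N$; for $\mu\in\mathbb Z^n_\triangle$, $\lambda\in\mathbb N^n_\triangle$, $\binom\mu\lambda=\prod_{i=1}^n\binom{\mu_i}{\lambda_i}$; for $\lambda=\mu^{(1)}+\dots+\mu^{(s)}$ in $\mathbb N^n_\triangle$, $\binom{\lambda}{\mu^{(1)},\dots,\mu^{(s)}}=\prod_{i=1}^n\frac{\lambda_i!}{\mu^{(1)}_i!\cdots\mu^{(s)}_i!}$. Affine Schur algebras. Let $r\ge0$. $\mathfrak S_{\triangle,r}$ is the group of permutations $w$ of $\mathbb Z$ with $w(i+r)=w(i)+r$ for all $i$ (the trivial group if $r=0$). $W$ is the subgroup of those $w$ with $\sum_{i=1}^rw(i)=\sum_{i=1}^ri$; it is the affine Weyl group of type $A$ with simple reflections $s_i$ ($1\le i\le r$), $s_i(j)=j+1$ if $j\equiv i$, $j-1$ if $j\equiv i+1$, and $j$ otherwise (mod $r$) ($W$ is trivial if $r\le1$). Let $\rho(j)=j+1$; then $\mathfrak S_{\triangle,r}=\langle\rho\rangle\ltimes W$ and the length function $\ell$ of $W$ is extended by $\ell(\rho^mw)=\ell(w)$.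 $s_1,\dots,s_{r-1}$ generate the symmetric group $\mathfrak S_r$. Let $\mathcal Z=\mathbb Z[v,v^{-1}]$. The extended affine Hecke algebra $\mathcal H_\triangle(r)$ is the $\mathcal Z$-algebra with basis $\{T_w\}_{w\in\mathfrak S_{\triangle,r}}$ and relations $T_{s_i}^2=(v^2-1)T_{s_i}+v^2$, and $T_wT_{w'}=T_{ww'}$ if $\ell(ww')=\ell(w)+\ell(w')$. For $\lambda\in\Lambda_\triangle(n,r)$ let $\mathfrak S_\lambda\subseteq\mathfrak S_r$ be the standard Young subgroup of $(\lambda_1,\dots,\lambda_n)$, $x_\lambda=\sum_{w\in\mathfrak S_\lambda}T_w$, and $\mathcal S_\triangle(n,r)=\mathrm{End}_{\mathcal H_\triangle(r)}\big(\bigoplus_{\lambda\in\Lambda_\triangle(n,r)}x_\lambda\mathcal H_\triangle(r)\big)$. Let $\mathscr D_\lambda=\{d:\ell(wd)=\ell(w)+\ell(d)\ \forall w\in\mathfrak S_\lambda\}$ and $\mathscr D_{\lambda,\mu}=\mathscr D_\lambda\cap\mathscr D_\mu^{-1}$. For $d\in\mathscr D_{\lambda,\mu}$ define $\phi^d_{\lambda,\mu}(x_\nu h)=\delta_{\mu\nu}\sum_{w\in\mathfrak S_\lambda d\mathfrak S_\mu}T_wh$; these form a $\mathcal Z$-basis of $\mathcal S_\triangle(n,r)$. Put $R^\lambda_{i+kn}=\{\lambda_{k,i-1}+1,\dots,\lambda_{k,i-1}+\lambda_i\}$, $\lambda_{k,i-1}=kr+\sum_{1\le t\le i-1}\lambda_t$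 ($1\le i\le n$, $k\in\mathbb Z$). The map $(\lambda,d,\mu)\mapsto A=(|R^\lambda_k\cap dR^\mu_l|)_{k,l}$ is a bijection from triples with $\lambda,\mu\in\Lambda_\triangle(n,r)$, $d\in\mathscr D_{\lambda,\mu}$ onto $\Theta_\triangle(n,r)$; write $e_A=\phi^d_{\lambda,\mu}$ and $[A]=v^{-d_A}e_A$ with $d_A=\sum_{1\le i\le n,\ i\ge k,\ j<l}a_{i,j}a_{k,l}$. $\mathcal S_\triangle(n,r)_{\mathbb Z}$ and $\mathcal S_\triangle(n,r)_{\mathbb Q}$ are the specializations at $v=1$ over $\mathbb Z$ and $\mathbb Q$, with basis $[A]_1=[A]\otimes1$, $A\in\Theta_\triangle(n,r)$. If $\sigma(A)=r$ and some $a_{i,i}<0$, put $[A]_1=0$ there. The algebra $\mathcal K_{\mathbb Z}(n)$. $\mathcal Z_1\subset\mathbb Q[x]$ is the subring generated by $1$ and all $\binom{a+x}{t}$ ($a\in\mathbb Z,t\in\mathbb N$). For $A,B\in\widetilde\Theta_\triangle(n)$ with $\mathrm{co}(B)=\mathrm{ro}(A)$ there are unique $X_i\in\widetilde\Theta_\triangle(n)$ and $P_i\in\mathcal Z_1$ with $[{}_aB]_1[{}_aA]_1=\sum_iP_i(a)[{}_aX_i]_1$ in $\mathcal S_\triangle(n,an+\sigma(A))_{\mathbb Z}$ for all large $a$. Let $\widetilde{\mathcal K}(n)$ be the free $\mathcal Z_1$-module on $\widetilde\Theta_\triangle(n)$ with the associative product $B\cdot A=\sum_iP_i(x)X_i$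 if $\mathrm{co}(B)=\mathrm{ro}(A)$ and $B\cdot A=0$ otherwise. $\mathcal K_{\mathbb Z}(n)=\widetilde{\mathcal K}(n)\otimes_{\mathcal Z_1}\mathbb Z$ via $x\mapsto0$, with $\mathbb Z$-basis $[A]_1:=A\otimes1$. $\widehat{\mathcal K}_{\mathbb Q}(n)$ is the algebra of formal, possibly infinite, sums $\sum_{A\in\widetilde\Theta_\triangle(n)}\beta_A[A]_1$ ($\beta_A\in\mathbb Q$) such that for each $\mathbf x\in\mathbb Z^n$ the sets $\{A:\beta_A\ne0,\mathrm{ro}(A)=\mathbf x\}$ and $\{A:\beta_A\neq0,\mathrm{co}(A)=\mathbf x\}$ are finite, with product extending that of $\mathcal K_{\mathbb Z}(n)$; its unit is $\sum_{\lambda\in\mathbb Z^n_\triangle}[\mathrm{diag}(\lambda)]_1$. Special elements. For $A\in\Theta^\pm_\triangle(n)$, $\lambda\in\mathbb N^n_\triangle$: $A\{\lambda\}=\sum_{\mu\in\mathbb Z^n_\triangle}\binom\mu\lambda[A+\mathrm{diag}(\mu)]_1\in\widehat{\mathcal K}_{\mathbb Q}(n)$ and $A\{\lambda,r\}=\sum_{\mu\in\Lambda_\triangle(n,r-\sigma(A))}\binom\mu\lambda[A+\mathrm{diag}(\mu)]_1\in\mathcal S_\triangle(n,r)_{\mathbb Z}$. If $A\in M_{\triangle,n}(\mathbb Z)$ has a negative off-diagonal entry, $A\{\lambda\}=0$ and $A\{\lambda,r\}=0$. *)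

theory Defs
  imports
    "HOL-Library.FuncSet"
    "HOL-Library.Function_Algebras"
    "HOL-Library.Poly_Mapping"
    "HOL-Computational_Algebra.Polynomial"
begin

section \<open>Periodic sequences and matrices\<close>

text \<open>
  Sequences and matrices are indexed by all of \<open>\<int>\<close>; sums and differences of them are the
  pointwise ones of \<^theory>\<open>HOL-Library.Function_Algebras\<close>, and \<open>\<le>\<close> is the pointwise order.
  \<^const>\<open>Sum_any\<close> and \<^const>\<open>Prod_any\<close> are the sum and product over the (finite) support.
\<close>

type_synonym vec = "int \<Rightarrow> int"
type_synonym mat = "int \<Rightarrow> int \<Rightarrow> int"

definition Zvec :: "nat \<Rightarrow> vec set" where
  "Zvec n = {l. \<forall>i. l (i + int n) = l i}"

definition Nvec :: "nat \<Rightarrow> vec set" where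
  "Nvec n = {l \<in> Zvec n. \<forall>i. 0 \<le> l i}"

definition vsigma :: "nat \<Rightarrow> vec \<Rightarrow> int" where
  "vsigma n l = (\<Sum>i = 1..int n. l i)"

definition Lambda :: "nat \<Rightarrow> int \<Rightarrow> vec set" where
  "Lambda n r = {l \<in> Nvec n. vsigma n l = r}"

definition Mat :: "nat \<Rightarrow> mat set" where
  "Mat n = {A. (\<forall>i j. A i j = A (i + int n) (j + int n)) \<and>
               (\<forall>i. finite {j. A i j \<noteq> 0}) \<and> (\<forall>j. finite {i. A i j \<noteq> 0})}"

definition Theta_tilde :: "nat \<Rightarrow> mat set" where
  "Theta_tilde n = {A \<in> Mat n. \<forall>i j. i \<noteq> j \<longrightarrow> 0 \<le> A i j}"

definition Theta :: "nat \<Rightarrow> mat set" where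
  "Theta n = {A \<in> Mat n. \<forall>i j. 0 \<le> A i j}"

definition Theta_pm :: "nat \<Rightarrow> mat set" where
  "Theta_pm n = {A \<in> Theta n. \<forall>i. A i i = 0}"

definition msigma :: "nat \<Rightarrow> mat \<Rightarrow> int" where
  "msigma n A = (\<Sum>i = 1..int n. Sum_any (\<lambda>j. A i j))"

definition Theta_r :: "nat \<Rightarrow> nat \<Rightarrow> mat set" where
  "Theta_r n r = {A \<in> Theta n. msigma n A = int r}"

definition ro :: "mat \<Rightarrow> vec" where
  "ro A i = Sum_any (\<lambda>j. A i j)"

definition co :: "mat \<Rightarrow> vec" where
  "co A j = Sum_any (\<lambda>i. A i j)"

definition Emat :: "nat \<Rightarrow> int \<Rightarrow> int \<Rightarrow> mat" where
  "Emat n i j k l = (if \<exists>s. k = i + s * int n \<and> l = j + s * int n then 1 else 0)"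

definition diag :: "vec \<Rightarrow> mat" where
  "diag l i j = (if i = j then l i else 0)"

definition diag_of :: "mat \<Rightarrow> vec" where
  "diag_of T i = T i i"

definition off_diag :: "mat \<Rightarrow> mat" where
  "off_diag T i j = (if i = j then 0 else T i j)"

definition row_shift :: "mat \<Rightarrow> mat" where
  "row_shift T i j = T (i - 1) j"

definition add_id :: "int \<Rightarrow> mat \<Rightarrow> mat" where
  "add_id a A = A + diag (\<lambda>_. a)"

definition ibinom :: "int \<Rightarrow> nat \<Rightarrow> int" where
  "ibinom m t = (\<Prod>k<t. m - int k) div fact t"

lemma of_int_ibinom: "of_int (ibinom m t) = (of_int m :: rat) gchoose t"
proof -
  have dvd: "fact t dvd (\<Prod>k<t. m - int k)"
    by (rule dvdI[OF gbinomial_int_mult_fact[symmetric, unfolded atLeast0LessThan]])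
  have "(of_int (ibinom m t) :: rat) = of_int (\<Prod>k<t. m - int k) / of_int (fact t)"
    unfolding ibinom_def by (simp only: of_int_div[OF dvd])
  then show ?thesis
    by (simp add: gbinomial_prod_rev atLeast0LessThan)
qed

definition vbinom :: "nat \<Rightarrow> vec \<Rightarrow> vec \<Rightarrow> int" where
  "vbinom n m l = (\<Prod>i = 1..int n. ibinom (m i) (nat (l i)))"

definition vmultinom :: "nat \<Rightarrow> vec \<Rightarrow> vec list \<Rightarrow> int" where
  "vmultinom n l ms =
     (\<Prod>i = 1..int n. fact (nat (l i)) div (\<Prod>m\<leftarrow>ms. fact (nat (m i))))"


section \<open>Extended affine symmetric groups\<close>

type_synonym perm = "int \<Rightarrow> int"

definition aff_sym :: "nat \<Rightarrow> perm set" where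
  "aff_sym r = (if r = 0 then {id} else {w. bij w \<and> (\<forall>i. w (i + int r) = w i + int r)})"

definition weyl :: "nat \<Rightarrow> perm set" where
  "weyl r = {w \<in> aff_sym r. (\<Sum>i = 1..int r. w i) = (\<Sum>i = 1..int r. i)}"

definition simple_refl :: "nat \<Rightarrow> int \<Rightarrow> perm" where
  "simple_refl r i j =
     (if j mod int r = i mod int r then j + 1
      else if j mod int r = (i + 1) mod int r then j - 1 else j)"

definition simple_refls :: "nat \<Rightarrow> perm set" where
  "simple_refls r = (if r \<le> 1 then {} else simple_refl r ` {1..int r})"

definition weyl_length :: "nat \<Rightarrow> perm \<Rightarrow> nat" where
  "weyl_length r w =
     (LEAST k. \<exists>ss. length ss = k \<and> set ss \<subseteq> simple_refls r \<and> w = foldr (\<circ>) ss id)"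

text \<open>The power \<open>\<rho>\<^sup>m\<close> of \<open>\<rho>(j) = j + 1\<close> is the translation by \<open>m\<close>.\<close>

definition aff_length :: "nat \<Rightarrow> perm \<Rightarrow> nat" where
  "aff_length r w =
     weyl_length r (THE w'. w' \<in> weyl r \<and> (\<exists>m::int. w = (\<lambda>j. j + m) \<circ> w'))"


section \<open>The extended affine Hecke algebra\<close>

text \<open>
  Laurent polynomials over \<open>\<int>\<close> are finitely supported functions from exponents to
  coefficients, with the convolution product of \<^theory>\<open>HOL-Library.Poly_Mapping\<close>.
\<close>

type_synonym laurent = "int \<Rightarrow>\<^sub>0 int"

definition vpow :: "int \<Rightarrow> laurent" where
  "vpow k = Poly_Mapping.single k 1"

definition at_one :: "laurent \<Rightarrow> int" where
  "at_one p = (\<Sum>k\<in>Poly_Mapping.keys p. Poly_Mapping.lookup p k)"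

definition smul :: "'k::comm_ring_1 \<Rightarrow> ('b \<Rightarrow>\<^sub>0 'k) \<Rightarrow> ('b \<Rightarrow>\<^sub>0 'k)" where
  "smul c = Poly_Mapping.map (\<lambda>x. c * x)"

text \<open>
  The free module underlying the Hecke algebra.  The convolution product that
  \<^theory>\<open>HOL-Library.Poly_Mapping\<close> would put on this type is never used.
\<close>

type_synonym hecke = "perm \<Rightarrow>\<^sub>0 laurent"

definition hecke_carrier :: "nat \<Rightarrow> hecke set" where
  "hecke_carrier r = {h. Poly_Mapping.keys h \<subseteq> aff_sym r}"

definition TT :: "perm \<Rightarrow> hecke" where
  "TT w = Poly_Mapping.single w 1"

text \<open>
  The product is characterised as the associative unital bilinear one obeying the defining
  relations; it is set to \<open>0\<close> off the carrier so that it is unique as a HOL function.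
\<close>

definition is_hecke_product :: "nat \<Rightarrow> (hecke \<Rightarrow> hecke \<Rightarrow> hecke) \<Rightarrow> bool" where
  "is_hecke_product r m \<longleftrightarrow>
     (let H = hecke_carrier r in
      (\<forall>x y. x \<notin> H \<or> y \<notin> H \<longrightarrow> m x y = 0) \<and>
      (\<forall>x\<in>H. \<forall>y\<in>H. m x y \<in> H) \<and>
      (\<forall>x\<in>H. \<forall>y\<in>H. \<forall>z\<in>H. m (x + y) z = m x z + m y z \<and> m x (y + z) = m x y + m x z) \<and>
      (\<forall>c. \<forall>x\<in>H. \<forall>y\<in>H. m (smul c x) y = smul c (m x y) \<and> m x (smul c y) = smul c (m x y)) \<and>
      (\<forall>x\<in>H. \<forall>y\<in>H. \<forall>z\<in>H. m (m x y) z = m x (m y z)) \<and>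
      (\<forall>x\<in>H. m (TT id) x = x \<and> m x (TT id) = x) \<and>
      (\<forall>s\<in>simple_refls r. m (TT s) (TT s) = smul (vpow 2 - 1) (TT s) + smul (vpow 2) (TT id)) \<and>
      (\<forall>w\<in>aff_sym r. \<forall>w'\<in>aff_sym r.
         aff_length r (w \<circ> w') = aff_length r w + aff_length r w' \<longrightarrow>
         m (TT w) (TT w') = TT (w \<circ> w')))"

definition hmult :: "nat \<Rightarrow> hecke \<Rightarrow> hecke \<Rightarrow> hecke" where
  "hmult r = (THE m. is_hecke_product r m)"


section \<open>Affine Schur algebras\<close>

text \<open>\<open>block n r l m\<close> is \<open>R\<^sup>l\<^sub>m\<close>; write \<open>m = i + k n\<close> with \<open>1 \<le> i \<le> n\<close>.\<close>

definition block :: "nat \<Rightarrow> nat \<Rightarrow> vec \<Rightarrow> int \<Rightarrow> int set" where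
  "block n r l m =
     (let i = (m - 1) mod int n + 1; k = (m - 1) div int n;
          s = k * int r + (\<Sum>t = 1..i - 1. l t)
      in {s + 1..s + l i})"

definition young :: "nat \<Rightarrow> nat \<Rightarrow> vec \<Rightarrow> perm set" where
  "young n r l = {w \<in> aff_sym r. \<forall>i\<in>{1..int n}. w ` block n r l i = block n r l i}"

definition xelt :: "nat \<Rightarrow> nat \<Rightarrow> vec \<Rightarrow> hecke" where
  "xelt n r l = (\<Sum>w\<in>young n r l. TT w)"

text \<open>
  The direct sum of the right modules \<open>x\<^sub>l H\<close>, as families indexed by \<open>Lambda n r\<close>
  (extended by \<open>0\<close>), and its algebra of right \<open>H\<close>-module endomorphisms under composition.
\<close>

definition tensor_space :: "nat \<Rightarrow> nat \<Rightarrow> (vec \<Rightarrow> hecke) set" where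
  "tensor_space n r =
     {f. (\<forall>l\<in>Lambda n (int r). f l \<in> hmult r (xelt n r l) ` hecke_carrier r) \<and>
         (\<forall>l. l \<notin> Lambda n (int r) \<longrightarrow> f l = 0)}"

definition schur_end :: "nat \<Rightarrow> nat \<Rightarrow> ((vec \<Rightarrow> hecke) \<Rightarrow> vec \<Rightarrow> hecke) set" where
  "schur_end n r =
     {F \<in> tensor_space n r \<rightarrow>\<^sub>E tensor_space n r.
        (\<forall>f\<in>tensor_space n r. \<forall>g\<in>tensor_space n r. F (f + g) = F f + F g) \<and>
        (\<forall>f\<in>tensor_space n r. \<forall>h\<in>hecke_carrier r.
           F (\<lambda>l. hmult r (f l) h) = (\<lambda>l. hmult r (F f l) h))}"

definition summand :: "vec \<Rightarrow> hecke \<Rightarrow> vec \<Rightarrow> hecke" where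
  "summand l h = (\<lambda>k. if k = l then h else 0)"

definition dist_left :: "nat \<Rightarrow> nat \<Rightarrow> vec \<Rightarrow> perm set" where
  "dist_left n r l =
     {d \<in> aff_sym r. \<forall>w\<in>young n r l. aff_length r (w \<circ> d) = aff_length r w + aff_length r d}"

definition dist_double :: "nat \<Rightarrow> nat \<Rightarrow> vec \<Rightarrow> vec \<Rightarrow> perm set" where
  "dist_double n r l m = dist_left n r l \<inter> inv ` dist_left n r m"

definition double_coset :: "nat \<Rightarrow> nat \<Rightarrow> vec \<Rightarrow> perm \<Rightarrow> vec \<Rightarrow> perm set" where
  "double_coset n r l d m = {u \<circ> d \<circ> w | u w. u \<in> young n r l \<and> w \<in> young n r m}"

definition schur_phi :: "nat \<Rightarrow> nat \<Rightarrow> vec \<Rightarrow> perm \<Rightarrow> vec \<Rightarrow> (vec \<Rightarrow> hecke) \<Rightarrow> vec \<Rightarrow> hecke" where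
  "schur_phi n r l d m =
     (THE F. F \<in> schur_end n r \<and>
        (\<forall>k\<in>Lambda n (int r). \<forall>h\<in>hecke_carrier r.
           F (summand k (hmult r (xelt n r k) h)) =
             (if k = m then summand l (hmult r (\<Sum>w\<in>double_coset n r l d m. TT w) h) else 0)))"

definition triple_mat :: "nat \<Rightarrow> nat \<Rightarrow> vec \<Rightarrow> perm \<Rightarrow> vec \<Rightarrow> mat" where
  "triple_mat n r l d m = (\<lambda>i j. int (card (block n r l i \<inter> d ` block n r m j)))"

definition schur_e :: "nat \<Rightarrow> nat \<Rightarrow> mat \<Rightarrow> (vec \<Rightarrow> hecke) \<Rightarrow> vec \<Rightarrow> hecke" where
  "schur_e n r A =
     (case THE (l, d, m). l \<in> Lambda n (int r) \<and> m \<in> Lambda n (int r) \<and>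
             d \<in> dist_double n r l m \<and> triple_mat n r l d m = A
      of (l, d, m) \<Rightarrow> schur_phi n r l d m)"

definition dimA :: "nat \<Rightarrow> mat \<Rightarrow> int" where
  "dimA n A =
     (\<Sum>i = 1..int n. Sum_any (\<lambda>(j, k, l). if k \<le> i \<and> j < l then A i j * A k l else 0))"

definition lin_comb ::
  "nat \<Rightarrow> nat \<Rightarrow> ('b \<Rightarrow> (vec \<Rightarrow> hecke) \<Rightarrow> vec \<Rightarrow> hecke) \<Rightarrow> ('b \<Rightarrow>\<^sub>0 laurent) \<Rightarrow>
   (vec \<Rightarrow> hecke) \<Rightarrow> vec \<Rightarrow> hecke" where
  "lin_comb n r b c =
     (\<lambda>f\<in>tensor_space n r. \<lambda>l. \<Sum>C\<in>Poly_Mapping.keys c. smul (Poly_Mapping.lookup c C) (b C f l))"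

definition schur_br :: "nat \<Rightarrow> nat \<Rightarrow> mat \<Rightarrow> (vec \<Rightarrow> hecke) \<Rightarrow> vec \<Rightarrow> hecke" where
  "schur_br n r A = lin_comb n r (schur_e n r) (Poly_Mapping.single A (vpow (- dimA n A)))"

text \<open>Coefficients of \<open>[B] [A]\<close> in the basis \<open>[C]\<close>, where \<open>C\<close> ranges over \<open>Theta_r n r\<close>.\<close>

definition schur_const :: "nat \<Rightarrow> nat \<Rightarrow> mat \<Rightarrow> mat \<Rightarrow> (mat \<Rightarrow>\<^sub>0 laurent)" where
  "schur_const n r B A =
     (THE c. Poly_Mapping.keys c \<subseteq> Theta_r n r \<and>
        compose (tensor_space n r) (schur_br n r B) (schur_br n r A) =
          lin_comb n r (schur_br n r) c)"

text \<open>
  The specialisation at \<open>v = 1\<close> over \<open>'k\<close> (\<open>\<int>\<close> or \<open>\<rat>\<close>): the free \<open>'k\<close>-module on \<open>Theta_r n r\<close>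
  with the structure constants evaluated at \<open>v = 1\<close>.
\<close>

definition schur_one_carrier :: "nat \<Rightarrow> nat \<Rightarrow> (mat \<Rightarrow>\<^sub>0 'k::comm_ring_1) set" where
  "schur_one_carrier n r = {x. Poly_Mapping.keys x \<subseteq> Theta_r n r}"

definition schur_one_mult ::
  "nat \<Rightarrow> nat \<Rightarrow> (mat \<Rightarrow>\<^sub>0 'k::comm_ring_1) \<Rightarrow> (mat \<Rightarrow>\<^sub>0 'k) \<Rightarrow> (mat \<Rightarrow>\<^sub>0 'k)" where
  "schur_one_mult n r x y =
     (\<Sum>B\<in>Poly_Mapping.keys x. \<Sum>A\<in>Poly_Mapping.keys y. smul (Poly_Mapping.lookup x B * Poly_Mapping.lookup y A)
        (Poly_Mapping.map (\<lambda>p. of_int (at_one p)) (schur_const n r B A)))"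

definition br_one :: "mat \<Rightarrow> (mat \<Rightarrow>\<^sub>0 'k::comm_ring_1)" where
  "br_one A = (if \<exists>i. A i i < 0 then 0 else Poly_Mapping.single A 1)"

definition Selt :: "nat \<Rightarrow> nat \<Rightarrow> mat \<Rightarrow> vec \<Rightarrow> (mat \<Rightarrow>\<^sub>0 int)" where
  "Selt n r A l =
     (if \<exists>i j. i \<noteq> j \<and> A i j < 0 then 0
      else \<Sum>m\<in>Lambda n (int r - msigma n A). smul (vbinom n m l) (br_one (A + diag m)))"


section \<open>The algebra \<open>K\<close> and its completion\<close>

definition binom_poly :: "int \<Rightarrow> nat \<Rightarrow> rat poly" where
  "binom_poly a t = smult (1 / fact t) (\<Prod>k<t. [:of_int a - of_nat k, 1:])"

inductive_set Z1 :: "rat poly set" where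
  one: "1 \<in> Z1"
| binom: "binom_poly a t \<in> Z1"
| diff: "p \<in> Z1 \<Longrightarrow> q \<in> Z1 \<Longrightarrow> p - q \<in> Z1"
| mult: "p \<in> Z1 \<Longrightarrow> q \<in> Z1 \<Longrightarrow> p * q \<in> Z1"

text \<open>
  \<open>K_tilde_prod n B A\<close> is the product \<open>B \<cdot> A\<close> of basis elements over \<open>Z1\<close>, as a finitely
  supported coefficient function.  The identity that determines it is stated over \<open>\<rat>\<close> because
  the integers \<open>P(a)\<close> arise as values of rational polynomials; the integral form
  embeds in the rational one.
\<close>

definition K_tilde_prod :: "nat \<Rightarrow> mat \<Rightarrow> mat \<Rightarrow> (mat \<Rightarrow>\<^sub>0 rat poly)" where
  "K_tilde_prod n B A =
     (if co B = ro A then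
        (THE P. Poly_Mapping.keys P \<subseteq> {X \<in> Theta_tilde n. msigma n X = msigma n A} \<and>
           (\<forall>X. Poly_Mapping.lookup P X \<in> Z1) \<and>
           (\<forall>\<^sub>F a::nat in sequentially.
              schur_one_mult n (nat (int a * int n + msigma n A))
                (br_one (add_id (int a) B)) (br_one (add_id (int a) A)) =
              (\<Sum>X\<in>Poly_Mapping.keys P. smul (poly (Poly_Mapping.lookup P X) (of_nat a))
                 (br_one (add_id (int a) X)))))
      else 0)"

text \<open>Structure constants of \<open>K\<close>, obtained from \<open>x \<mapsto> 0\<close>.\<close>

definition K_const :: "nat \<Rightarrow> mat \<Rightarrow> mat \<Rightarrow> mat \<Rightarrow> rat" where
  "K_const n B A X = poly (Poly_Mapping.lookup (K_tilde_prod n B A) X) 0"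

text \<open>A formal sum \<open>\<Sum> b\<^sub>A [A]\<^sub>1\<close> is represented by its coefficient function \<open>b\<close>.\<close>

definition K_hat :: "nat \<Rightarrow> (mat \<Rightarrow> rat) set" where
  "K_hat n =
     {b. (\<forall>A. b A \<noteq> 0 \<longrightarrow> A \<in> Theta_tilde n) \<and>
         (\<forall>x\<in>Zvec n. finite {A. b A \<noteq> 0 \<and> ro A = x} \<and> finite {A. b A \<noteq> 0 \<and> co A = x})}"

definition K_hat_mult :: "nat \<Rightarrow> (mat \<Rightarrow> rat) \<Rightarrow> (mat \<Rightarrow> rat) \<Rightarrow> (mat \<Rightarrow> rat)" where
  "K_hat_mult n b c = (\<lambda>X. Sum_any (\<lambda>(B, A). b B * c A * K_const n B A X))"

definition K_scale :: "rat \<Rightarrow> (mat \<Rightarrow> rat) \<Rightarrow> (mat \<Rightarrow> rat)" where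
  "K_scale c b = (\<lambda>X. c * b X)"

definition Kelt :: "nat \<Rightarrow> mat \<Rightarrow> vec \<Rightarrow> (mat \<Rightarrow> rat)" where
  "Kelt n A l =
     (if \<exists>i j. i \<noteq> j \<and> A i j < 0 then 0
      else (\<lambda>X. \<Sum>m | m \<in> Zvec n \<and> X = A + diag m. of_int (vbinom n m l)))"


section \<open>Coefficients of the multiplication formulas\<close>

definition upper_mat :: "nat \<Rightarrow> vec \<Rightarrow> mat" where
  "upper_mat n a = (\<lambda>k l. \<Sum>i = 1..int n. a i * Emat n i (i + 1) k l)"

definition lower_mat :: "nat \<Rightarrow> vec \<Rightarrow> mat" where
  "lower_mat n a = (\<lambda>k l. \<Sum>i = 1..int n. a i * Emat n (i + 1) i k l)"

definition coef_zero :: "nat \<Rightarrow> mat \<Rightarrow> vec \<Rightarrow> vec \<Rightarrow> vec \<Rightarrow> int" where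
  "coef_zero n A l m d =
     (\<Sum>b | b \<in> Nvec n \<and> b \<le> m - d \<and> b \<le> l.
        vbinom n (ro A) (m - b - d) * vmultinom n (d + l) [b, d, l - b])"

definition coef_a :: "nat \<Rightarrow> vec \<Rightarrow> mat \<Rightarrow> vec \<Rightarrow> int" where
  "coef_a n l T d =
     (\<Sum>b | b \<in> Nvec n \<and> b \<le> diag_of T \<and> b \<le> l - d.
        vbinom n (diag_of (row_shift T) - diag_of T) (l - b - d) *
        vmultinom n (diag_of T + d) [b, d, diag_of T - b])"

definition coef_b :: "nat \<Rightarrow> vec \<Rightarrow> mat \<Rightarrow> vec \<Rightarrow> int" where
  "coef_b n l T d =
     (\<Sum>b | b \<in> Nvec n \<and> b \<le> diag_of (row_shift T) \<and> b \<le> l - d.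
        vbinom n (diag_of T - diag_of (row_shift T)) (l - b - d) *
        vmultinom n (diag_of (row_shift T) + d) [b, d, diag_of (row_shift T) - b])"

definition upper_binom :: "nat \<Rightarrow> mat \<Rightarrow> mat \<Rightarrow> int" where
  "upper_binom n A T =
     (\<Prod>i = 1..int n. Prod_any (\<lambda>j. if j = i then 1
        else ibinom (A i j - T (i - 1) j + T i j) (nat (T i j))))"

definition lower_binom :: "nat \<Rightarrow> mat \<Rightarrow> mat \<Rightarrow> int" where
  "lower_binom n A T =
     (\<Prod>i = 1..int n. Prod_any (\<lambda>j. if j = i then 1
        else ibinom (A i j + T (i - 1) j - T i j) (nat (T (i - 1) j))))"

definition index_set :: "nat \<Rightarrow> vec \<Rightarrow> vec \<Rightarrow> (mat \<times> vec) set" where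
  "index_set n a l = {(T, d). T \<in> Theta n \<and> d \<in> Nvec n \<and> ro T = a \<and> d \<le> l}"


section \<open>Well-definedness of the special elements and of the sums\<close>

lemma ro_add_diag:
  assumes "A \<in> Mat n" shows "ro (A + diag m) = ro A + m"
proof
  fix i
  have "Sum_any (\<lambda>j. A i j + (if i = j then m i else 0)) = Sum_any (A i) + Sum_any (\<lambda>j. if i = j then m i else 0)"
    using assms by (intro Sum_any.distrib) (auto simp: Mat_def)
  then show "ro (A + diag m) i = (ro A + m) i"
    by (simp add: ro_def diag_def Sum_any.delta')
qed

lemma co_add_diag:
  assumes "A \<in> Mat n" shows "co (A + diag m) = co A + m"
proof
  fix j
  have "Sum_any (\<lambda>i. A i j + (if i = j then m i else 0)) = Sum_any (\<lambda>i. A i j) + Sum_any (\<lambda>i. if i = j then m i else 0)"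
    using assms by (intro Sum_any.distrib) (auto simp: Mat_def)
  then show "co (A + diag m) j = (co A + m) j"
    by (simp add: co_def diag_def Sum_any.delta)
qed

lemma add_diag_Mat:
  assumes A: "A \<in> Mat n" and m: "m \<in> Zvec n" shows "A + diag m \<in> Mat n"
proof -
  have "finite {j. A i j + diag m i j \<noteq> 0}" for i
    by (rule finite_subset[of _ "{j. A i j \<noteq> 0} \<union> {i}"]) (use A in \<open>auto simp: Mat_def diag_def\<close>)
  moreover have "finite {i. A i j + diag m i j \<noteq> 0}" for j
    by (rule finite_subset[of _ "{i. A i j \<noteq> 0} \<union> {j}"]) (use A in \<open>auto simp: Mat_def diag_def\<close>)
  moreover have "A i j + diag m i j = A (i + int n) (j + int n) + diag m (i + int n) (j + int n)" for i j
    using A m by (auto simp: Mat_def Zvec_def diag_def)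
  ultimately show ?thesis by (auto simp: Mat_def)
qed

lemma Kelt_in_K_hat:
  assumes "A \<in> Mat n" shows "Kelt n A l \<in> K_hat n"
proof (cases "\<exists>i j. i \<noteq> j \<and> A i j < 0")
  case True then show ?thesis by (simp add: Kelt_def K_hat_def)
next
  case False
  have sup: "\<exists>m\<in>Zvec n. X = A + diag m" if "Kelt n A l X \<noteq> 0" for X
  proof (rule ccontr)
    assume "\<not> ?thesis"
    then have "{m. m \<in> Zvec n \<and> X = A + diag m} = {}" by auto
    with that False show False by (simp add: Kelt_def)
  qed
  have 1: "A + diag m \<in> Theta_tilde n" if "m \<in> Zvec n" for m
    using add_diag_Mat[OF assms that] False by (force simp: Theta_tilde_def diag_def)
  have 2: "finite {X. Kelt n A l X \<noteq> 0 \<and> ro X = x}" for x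
    by (rule finite_subset[of _ "{A + diag (x - ro A)}"])
       (use sup ro_add_diag[OF assms] in \<open>fastforce\<close>, simp)
  have 3: "finite {X. Kelt n A l X \<noteq> 0 \<and> co X = x}" for x
    by (rule finite_subset[of _ "{A + diag (x - co A)}"])
       (use sup co_add_diag[OF assms] in \<open>fastforce\<close>, simp)
  show ?thesis using sup 1 2 3 unfolding K_hat_def by blast
qed

lemma Selt_in_carrier:
  assumes A: "A \<in> Theta_pm n" shows "Selt n r A l \<in> schur_one_carrier n r"
proof -
  have AT: "A \<in> Theta n" and AM: "A \<in> Mat n" using A by (auto simp: Theta_pm_def Theta_def)
  have nn: "\<not> A i j < 0" for i j using AT by (simp add: Theta_def not_less)
  have "Poly_Mapping.keys (smul (vbinom n m l) (br_one (A + diag m) :: mat \<Rightarrow>\<^sub>0 int)) \<subseteq> Theta_r n r"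
    if m: "m \<in> Lambda n (int r - msigma n A)" for m
  proof -
    have m': "m \<in> Nvec n" "vsigma n m = int r - msigma n A" using m by (auto simp: Lambda_def)
    have "A + diag m \<in> Mat n" using m'(1) AM by (intro add_diag_Mat) (auto simp: Nvec_def)
    moreover have "0 \<le> (A + diag m) i j" for i j using AT m'(1) by (simp add: Theta_def Nvec_def diag_def)
    ultimately have 1: "A + diag m \<in> Theta n" by (simp add: Theta_def)
    have "msigma n (A + diag m) = (\<Sum>i = 1..int n. ro (A + diag m) i)" by (simp add: msigma_def ro_def)
    also have "\<dots> = msigma n A + vsigma n m"
      by (simp add: ro_add_diag[OF AM] sum.distrib msigma_def ro_def vsigma_def)
    finally have "A + diag m \<in> Theta_r n r" using 1 m'(2) by (simp add: Theta_r_def)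
    moreover have "Poly_Mapping.keys (smul c (br_one X :: mat \<Rightarrow>\<^sub>0 int)) \<subseteq> {X}" for c X
      by (auto simp: in_keys_iff smul_def Poly_Mapping.map.rep_eq br_one_def when_def lookup_single split: if_splits)
    ultimately show ?thesis by blast
  qed
  moreover have "Selt n r A l =
      (\<Sum>m\<in>Lambda n (int r - msigma n A). smul (vbinom n m l) (br_one (A + diag m)))"
    using nn by (simp add: Selt_def)
  ultimately have "Poly_Mapping.keys (Selt n r A l) \<subseteq> Theta_r n r"
    using Poly_Mapping.keys_sum[of "\<lambda>m. smul (vbinom n m l) (br_one (A + diag m) :: mat \<Rightarrow>\<^sub>0 int)"
        "Lambda n (int r - msigma n A)"] by (auto dest!: subsetD)
  then show ?thesis by (simp add: schur_one_carrier_def)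
qed

lemma Zvec_shift:
  assumes "c \<in> Zvec n" shows "c (i + k * int n) = c i"
proof (induction k arbitrary: i rule: int_induct[where k = 0])
  case (step1 k)
  have "c (i + (k + 1) * int n) = c ((i + k * int n) + int n)" by (simp add: algebra_simps)
  then show ?case using step1 assms by (simp add: Zvec_def)
next
  case (step2 k)
  have "c (i + (k - 1) * int n) = c ((i + (k - 1) * int n) + int n)" using assms by (simp add: Zvec_def)
  then show ?case using step2 by (simp add: algebra_simps)
qed simp

lemma Mat_shift:
  assumes "A \<in> Mat n" shows "A (i + k * int n) (j + k * int n) = A i j"
proof -
  have "(\<lambda>s. A (i + s) (j + s)) \<in> Zvec n"
    using assms by (simp add: Mat_def Zvec_def) (metis add.assoc)
  from Zvec_shift[OF this, of 0 k] show ?thesis by simp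
qed

lemma residue:
  assumes "n > 0" obtains k where "(i::int) + k * int n \<in> {1..int n}"
proof
  have "i + - ((i - 1) div int n) * int n = (i - 1) mod int n + 1"
    by (simp add: minus_div_mult_eq_mod[symmetric])
  moreover have "0 \<le> (i - 1) mod int n" "(i - 1) mod int n < int n" using assms by simp_all
  ultimately show "i + - ((i - 1) div int n) * int n \<in> {1..int n}"
    unfolding atLeastAtMost_iff by linarith
qed

lemma finite_vec_le:
  assumes n: "n > 0" shows "finite {d \<in> Nvec n. d \<le> m}"
proof -
  let ?f = "\<lambda>d. restrict d {1..int n}"
  have inj: "inj_on ?f (Zvec n)"
  proof (intro inj_onI ext)
    fix d e i assume d: "d \<in> Zvec n" "e \<in> Zvec n" and eq: "?f d = ?f e"
    obtain k where k: "i + k * int n \<in> {1..int n}" using residue[OF n] .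
    have "d (i + k * int n) = e (i + k * int n)" using eq k by (metis restrict_apply')
    then show "d i = e i" using d by (simp add: Zvec_shift)
  qed
  have "?f ` {d \<in> Nvec n. d \<le> m} \<subseteq> (\<Pi>\<^sub>E i\<in>{1..int n}. {0..m i})"
    by (auto simp: Nvec_def le_fun_def)
  then have "finite (?f ` {d \<in> Nvec n. d \<le> m})"
    by (rule finite_subset) (auto intro: finite_PiE)
  then show ?thesis
    by (rule finite_imageD) (rule inj_on_subset[OF inj], auto simp: Nvec_def)
qed

lemma finite_Lambda:
  assumes n: "n > 0" shows "finite (Lambda n r)"
proof (rule finite_subset[OF _ finite_vec_le[OF n]])
  show "Lambda n r \<subseteq> {d \<in> Nvec n. d \<le> (\<lambda>_. r)}"
  proof (clarsimp simp: Lambda_def le_fun_def)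
    fix l i assume l: "l \<in> Nvec n"
    obtain k where k: "i + k * int n \<in> {1..int n}" using residue[OF n] .
    have "l (i + k * int n) \<le> vsigma n l"
      unfolding vsigma_def using k l by (intro member_le_sum) (auto simp: Nvec_def)
    then show "l i \<le> vsigma n l" using l by (simp add: Zvec_shift Nvec_def)
  qed
qed

lemma Mat_band:
  assumes n: "n > 0" and A: "A \<in> Mat n"
  obtains M where "M \<ge> 0" "\<And>i j. A i j \<noteq> 0 \<Longrightarrow> \<bar>i - j\<bar> \<le> M"
proof -
  let ?D = "\<Union>i\<in>{1..int n}. (\<lambda>j. \<bar>i - j\<bar>) ` {j. A i j \<noteq> 0}"
  have fin: "finite (insert 0 ?D)" using A by (auto simp: Mat_def)
  have "\<bar>i - j\<bar> \<le> Max (insert 0 ?D)" if "A i j \<noteq> 0" for i j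
  proof -
    obtain k where k: "i + k * int n \<in> {1..int n}" using residue[OF n] .
    have "A (i + k * int n) (j + k * int n) \<noteq> 0" using that Mat_shift[OF A] by simp
    then have "\<bar>(i + k * int n) - (j + k * int n)\<bar> \<in> ?D" using k by blast
    then show ?thesis using fin by (simp add: Max_ge)
  qed
  then show thesis using that[of "Max (insert 0 ?D)"] fin by (simp add: Max_ge)
qed

lemma card_le_ro:
  assumes T: "T \<in> Theta n" and J: "finite J" "\<And>j. j \<in> J \<Longrightarrow> T i j \<noteq> 0"
  shows "int (card J) \<le> ro T i"
proof -
  have fin: "finite {j. T i j \<noteq> 0}" and pos: "\<And>j. 0 \<le> T i j" using T by (auto simp: Theta_def Mat_def)
  have "int (card J) = (\<Sum>j\<in>J. 1)" by simp
  also have "\<dots> \<le> (\<Sum>j\<in>J. T i j)" using J pos by (intro sum_mono) (metis int_one_le_iff_zero_less order_le_less)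
  also have "\<dots> \<le> (\<Sum>j | T i j \<noteq> 0. T i j)" using J fin pos by (intro sum_mono2) auto
  finally show ?thesis by (simp add: ro_def Sum_any.expand_set)
qed

lemma entry_le_ro:
  assumes T: "T \<in> Theta n" shows "T i j \<le> ro T i"
proof (cases "T i j = 0")
  case True then show ?thesis using card_le_ro[OF T, of "{}" i] by simp
next
  case False
  have fin: "finite {j. T i j \<noteq> 0}" and pos: "\<And>j. 0 \<le> T i j" using T by (auto simp: Theta_def Mat_def)
  have "T i j \<le> (\<Sum>j | T i j \<noteq> 0. T i j)" using fin pos False by (intro member_le_sum) auto
  then show ?thesis by (simp add: ro_def Sum_any.expand_set)
qed

lemma finite_band:
  assumes n: "n > 0"
  shows "finite {T \<in> Theta n. ro T = a \<and> (\<forall>i j. T i j \<noteq> 0 \<longrightarrow> \<bar>i - j\<bar> \<le> K)}" (is "finite ?S")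
proof -
  let ?I = "{1..int n} \<times> {- K..int n + K}"
  let ?f = "\<lambda>T. restrict (\<lambda>(i, j). T i j) ?I"
  have inj: "inj_on ?f ?S"
  proof (intro inj_onI ext)
    fix T U i j assume T: "T \<in> ?S" and U: "U \<in> ?S" and eq: "?f T = ?f U"
    have M: "T \<in> Mat n" "U \<in> Mat n" using T U by (auto simp: Theta_def)
    obtain k where k: "i + k * int n \<in> {1..int n}" using residue[OF n] .
    have "T (i + k * int n) (j + k * int n) = U (i + k * int n) (j + k * int n)"
    proof (cases "\<bar>i - j\<bar> \<le> K")
      case True
      then have "(i + k * int n, j + k * int n) \<in> ?I" using k by auto
      then show ?thesis using fun_cong[OF eq, of "(i + k * int n, j + k * int n)"] by simp
    next
      case False
      then have "\<not> \<bar>(i + k * int n) - (j + k * int n)\<bar> \<le> K" by simp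
      with T U show ?thesis by (metis (mono_tags, lifting) mem_Collect_eq)
    qed
    then show "T i j = U i j" using M by (simp add: Mat_shift)
  qed
  have "?f ` ?S \<subseteq> (\<Pi>\<^sub>E p\<in>?I. {0..a (fst p)})"
  proof
    fix g assume "g \<in> ?f ` ?S"
    then obtain T where T: "T \<in> ?S" and g: "g = ?f T" by blast
    then have "0 \<le> T i j \<and> T i j \<le> a i" for i j using entry_le_ro[of T n i j] by (auto simp: Theta_def)
    then show "g \<in> (\<Pi>\<^sub>E p\<in>?I. {0..a (fst p)})" unfolding g by auto
  qed
  then have "finite (?f ` ?S)" by (rule finite_subset) (auto intro: finite_PiE)
  then show ?thesis by (rule finite_imageD[OF _ inj])
qed

text \<open>A strictly positive run in one column of \<open>T\<close> occupies boundedly many rows.\<close>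

lemma run_bound:
  assumes n: "n > 0" and T: "T \<in> Theta n" and s: "\<And>i. ro T i \<le> s"
    and run: "\<And>k. 0 \<le> k \<Longrightarrow> k \<le> L \<Longrightarrow> T (i + k) j \<noteq> 0"
  shows "L < int n * (s + 1)"
proof (rule ccontr)
  assume L: "\<not> ?thesis"
  have TM: "T \<in> Mat n" using T by (simp add: Theta_def)
  have s0: "0 \<le> s" using s[of i] card_le_ro[OF T, of "{}" i] by simp
  let ?J = "(\<lambda>k. j - k * int n) ` {0..s}"
  have "T i x \<noteq> 0" if "x \<in> ?J" for x
  proof -
    from that obtain k where k: "x = j - k * int n" "0 \<le> k" "k \<le> s" unfolding image_iff by (metis atLeastAtMost_iff)
    have "k * int n \<le> int n * (s + 1)" using k n by (simp add: mult.commute mult_left_mono)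
    then have "T (i + k * int n) (x + k * int n) \<noteq> 0" using run[of "k * int n"] k L by simp
    then show ?thesis using Mat_shift[OF TM] by simp
  qed
  then have "int (card ?J) \<le> s" using card_le_ro[OF T, of ?J i] s[of i] by fastforce
  moreover have "card ?J = nat (s + 1)" using n by (subst card_image) (auto simp: inj_on_def)
  ultimately show False using s0 by simp
qed

lemma ro_bound:
  assumes n: "n > 0" and T: "T \<in> Theta n"
  shows "ro T i \<le> msigma n T"
proof -
  have TM: "T \<in> Mat n" using T by (simp add: Theta_def)
  obtain k where k: "i + k * int n \<in> {1..int n}" using residue[OF n] .
  have "ro T (i + k * int n) = ro T i"
  proof -
    have "bij (\<lambda>x::int. x + k * int n)"
      by (rule o_bij[where g = "\<lambda>x. x - k * int n"]) (auto simp: fun_eq_iff)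
    moreover have "T (i + k * int n) \<circ> (\<lambda>x. x + k * int n) = T i"
      using Mat_shift[OF TM] by (simp add: fun_eq_iff)
    ultimately have "Sum_any (T (i + k * int n)) = Sum_any (T i)"
      by (rule Sum_any.reindex_cong)
    then show ?thesis by (simp add: ro_def)
  qed
  moreover have "ro T (i + k * int n) \<le> (\<Sum>i = 1..int n. ro T i)"
    using k card_le_ro[OF T, of "{}"] by (intro member_le_sum) auto
  ultimately show ?thesis by (simp add: msigma_def ro_def)
qed

lemma finite_upper_index:
  assumes n: "n > 0" and A: "A \<in> Mat n"
  shows "finite {T \<in> Theta n. ro T = a \<and>
           (\<forall>i j. i \<noteq> j \<longrightarrow> 0 \<le> (A + off_diag T - off_diag (row_shift T)) i j)}" (is "finite ?S")
proof -
  obtain M where M: "M \<ge> 0" "\<And>i j. A i j \<noteq> 0 \<Longrightarrow> \<bar>i - j\<bar> \<le> M" using Mat_band[OF n A] by blast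
  define s where "s = (\<Sum>i = 1..int n. a i)"
  let ?K = "M + int n * (s + 1) + 1"
  have "\<bar>i - j\<bar> \<le> ?K" if T: "T \<in> ?S" and nz: "T i j \<noteq> 0" for T i j
  proof -
    have Th: "T \<in> Theta n" and ra: "ro T = a" using T by auto
    have s: "ro T i \<le> s" for i using ro_bound[OF n Th, of i] ra by (simp add: s_def msigma_def ro_def fun_eq_iff)
    have s0: "0 \<le> s" using s[of i] card_le_ro[OF Th, of "{}" i] by simp
    have pos: "0 \<le> T i j" for i j using Th by (simp add: Theta_def)
    have forth: "T (i + 1) j \<noteq> 0" if "T i j \<noteq> 0" "i + 1 \<noteq> j" "\<bar>i + 1 - j\<bar> > M" for i j
    proof -
      have "A (i + 1) j = 0" using M(2)[of "i + 1" j] that(3) by linarith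
      moreover have "0 \<le> (A + off_diag T - off_diag (row_shift T)) (i + 1) j" using T that(2) by blast
      ultimately show ?thesis using that pos[of i j] by (simp add: off_diag_def row_shift_def)
    qed
    have run: "T (i + k) j \<noteq> 0" if "0 \<le> k" "\<And>l. 0 < l \<Longrightarrow> l \<le> k \<Longrightarrow> i + l \<noteq> j \<and> \<bar>i + l - j\<bar> > M" for k
      using that
    proof (induction k rule: int_ge_induct)
      case base then show ?case using nz by simp
    next
      case (step k)
      then show ?case using forth[of "i + k" j]
        by (simp add: add.assoc)
    qed
    show ?thesis
    proof (rule ccontr)
      assume "\<not> ?thesis"
      then consider "i - j > ?K" | "j - i > ?K" by linarith
      then show False
      proof cases
        case 1
        have "int n * (s + 1) \<ge> 0" using s0 by simp
        then have "T (i + k) j \<noteq> 0" if "0 \<le> k" for k using run[OF that] 1 M(1) by auto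
        then have "L < int n * (s + 1)" for L using run_bound[OF n Th s, of L i j] by blast
        then show False by blast
      next
        case 2
        have "T (i + k) j \<noteq> 0" if "0 \<le> k" "k \<le> int n * (s + 1)" for k
          using run[OF that(1)] that(2) 2 M(1) by auto
        from run_bound[OF n Th s, of "int n * (s + 1)" i j, OF this] show False by simp
      qed
    qed
  qed
  then show ?thesis by (intro finite_subset[OF _ finite_band[OF n, of a ?K]]) blast
qed

lemma finite_lower_index:
  assumes n: "n > 0" and A: "A \<in> Mat n"
  shows "finite {T \<in> Theta n. ro T = a \<and>
           (\<forall>i j. i \<noteq> j \<longrightarrow> 0 \<le> (A - off_diag T + off_diag (row_shift T)) i j)}" (is "finite ?S")
proof -
  obtain M where M: "M \<ge> 0" "\<And>i j. A i j \<noteq> 0 \<Longrightarrow> \<bar>i - j\<bar> \<le> M" using Mat_band[OF n A] by blast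
  define s where "s = (\<Sum>i = 1..int n. a i)"
  let ?K = "M + int n * (s + 1) + 1"
  have "\<bar>i - j\<bar> \<le> ?K" if T: "T \<in> ?S" and nz: "T i j \<noteq> 0" for T i j
  proof -
    have Th: "T \<in> Theta n" and ra: "ro T = a" using T by auto
    have s: "ro T i \<le> s" for i using ro_bound[OF n Th, of i] ra by (simp add: s_def msigma_def ro_def fun_eq_iff)
    have s0: "0 \<le> s" using s[of i] card_le_ro[OF Th, of "{}" i] by simp
    have pos: "0 \<le> T i j" for i j using Th by (simp add: Theta_def)
    have bwd: "T (i - 1) j \<noteq> 0" if "T i j \<noteq> 0" "i \<noteq> j" "\<bar>i - j\<bar> > M" for i j
    proof -
      have "A i j = 0" using M(2)[of i j] that(3) by linarith
      moreover have "0 \<le> (A - off_diag T + off_diag (row_shift T)) i j" using T that(2) by blast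
      ultimately show ?thesis using that pos[of i j] by (simp add: off_diag_def row_shift_def)
    qed
    have run: "T (i - k) j \<noteq> 0" if "0 \<le> k" "\<And>l. 0 \<le> l \<Longrightarrow> l < k \<Longrightarrow> i - l \<noteq> j \<and> \<bar>i - l - j\<bar> > M" for k
      using that
    proof (induction k rule: int_ge_induct)
      case base then show ?case using nz by simp
    next
      case (step k)
      then show ?case using bwd[of "i - k" j] by (simp add: diff_diff_eq)
    qed
    show ?thesis
    proof (rule ccontr)
      assume "\<not> ?thesis"
      then consider "i - j > ?K" | "j - i > ?K" by linarith
      then show False
      proof cases
        case 1
        have "T (i - int n * (s + 1) + k) j \<noteq> 0" if "0 \<le> k" "k \<le> int n * (s + 1)" for k
          using run[of "int n * (s + 1) - k"] that 1 M(1) by (auto simp: algebra_simps)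
        from run_bound[OF n Th s, of "int n * (s + 1)" "i - int n * (s + 1)" j, OF this] show False by simp
      next
        case 2
        have "int n * (s + 1) \<ge> 0" using s0 by simp
        then have r: "T (i - k) j \<noteq> 0" if "0 \<le> k" for k using run[OF that] 2 M(1) by auto
        have "L < int n * (s + 1)" for L
        proof (rule run_bound[OF n Th s, of L "i - L" j])
          fix k assume "0 \<le> k" "k \<le> L"
          with r[of "L - k"] show "T (i - L + k) j \<noteq> 0" by (simp add: algebra_simps)
        qed
        then show False by blast
      qed
    qed
  qed
  then show ?thesis by (intro finite_subset[OF _ finite_band[OF n, of a ?K]]) blast
qed

text \<open>
  In the sums over \<^const>\<open>index_set\<close> the term of \<open>(T, d)\<close> vanishes as soon as the matrix
  occurring in it has a negative off-diagonal entry; so, although \<^const>\<open>index_set\<close> is infinite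
  in general, only finitely many terms are nonzero.
\<close>

lemma finite_upper_support:
  assumes n: "n > 0" and A: "A \<in> Mat n"
  shows "finite {(T, d) \<in> index_set n a l.
           \<forall>i j. i \<noteq> j \<longrightarrow> 0 \<le> (A + off_diag T - off_diag (row_shift T)) i j}"
  by (rule finite_subset[OF _ finite_cartesian_product[OF finite_upper_index[OF n A, of a] finite_vec_le[OF n, of l]]])
     (auto simp: index_set_def)

lemma finite_lower_support:
  assumes n: "n > 0" and A: "A \<in> Mat n"
  shows "finite {(T, d) \<in> index_set n a l.
           \<forall>i j. i \<noteq> j \<longrightarrow> 0 \<le> (A - off_diag T + off_diag (row_shift T)) i j}"
  by (rule finite_subset[OF _ finite_cartesian_product[OF finite_lower_index[OF n A, of a] finite_vec_le[OF n, of l]]])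
     (auto simp: index_set_def)

end

theory Submission
  imports Defs "HOL-Computational_Algebra.Formal_Power_Series"
begin

text \<open>
  At \<open>v = 1\<close> the extended affine Hecke algebra becomes the group algebra of the periodic
  permutations, and a basis element \<open>[A]\<^sub>1\<close> of the affine Schur algebra becomes the double coset of
  Young subgroups whose matrix is \<open>A\<close>. Fix \<open>w\<close> in the double coset of \<open>C\<close>. The coefficient of \<open>[C]\<^sub>1\<close> in
  \<open>[B]\<^sub>1 [A]\<^sub>1\<close> is then the number of shortest coset representatives \<open>u\<close> in the double coset of \<open>B\<close> with
  \<open>u\<^sup>-\<^sup>1 w\<close> in that of \<open>A\<close> (\<open>at_one_schur_const\<close>). Such a \<open>u\<close> amounts to a flag, namely a periodic
  function \<open>f\<close> on the integers whose position relative to the block function \<open>b\<close> of the rows is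
  given by \<open>B\<close>, and whose position relative to the function \<open>h\<close>, which gives the block of \<open>w\<^sup>-\<^sup>1 x\<close>, is
  given by \<open>A\<close> (\<open>representatives_flags\<close>).

  If \<open>B\<close> has entries only on the diagonal and on the parallel at offset \<open>e\<close>, then \<open>f x\<close> is \<open>b x\<close> or \<open>b x
  + e\<close>, so \<open>f\<close> is just a periodic set of integers: the \<open>x\<close> with \<open>f x = b x + e\<close>. Let \<open>U i k\<close> be the size
  of its part in the cell \<open>b x = i\<close>, \<open>h x = k\<close>, which has \<open>C i k\<close> elements. Counting rows and columns
  gives \<open>ro U\<close> and \<open>A + U - U' = C\<close>, where \<open>U'\<close> is \<open>U\<close> with its rows shifted by \<open>e\<close>, and the number of
  sets with given \<open>U\<close> is the product of the binomial coefficients of \<open>C i k\<close> over \<open>U i k\<close>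
  (\<open>flags_card\<close>). So \<open>[B]\<^sub>1 [A]\<^sub>1\<close> is the sum over \<open>U\<close> of such products times \<open>[A + U - U']\<^sub>1\<close>
  (\<open>schur_product\<close>).

  Now multiply the sums over diagonals. For every diagonal of the right factor only one diagonal
  of the left factor matches. For fixed \<open>U\<close> the off-diagonal cells contribute the product in the
  theorem, whatever the diagonal \<open>m\<close> of the product is; the diagonal cells contribute the binomial
  coefficient of \<open>m\<close> over the diagonal \<open>\<tau>\<close> of \<open>U\<close>, and the right factor that of \<open>m + \<kappa>\<close> over
  \<open>\<lambda>\<close>, with \<open>\<kappa>\<close> depending on \<open>U\<close> only. A consequence of Vandermonde's identity
  (\<open>vector_identity\<close>) rewrites this as a combination of binomial coefficients of \<open>m\<close> over \<open>\<tau> +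
  \<delta>\<close>, which are the coefficients of the elements on the right-hand side (\<open>Selt_formula\<close>). The
  first formula is the case of a diagonal left factor, where the same identity is applied with
  the roles of the two factors exchanged.

  In the completed algebra the diagonals range over all integer vectors. Its structure constants
  are values at \<open>0\<close> of polynomials that are determined by the products after a large multiple of
  the identity has been added, and the products of binomial coefficients above are such
  polynomials (\<open>K_const_formula\<close>). So the same computation applies (\<open>Kelt_formula\<close>).

  The left factors \<open>B\<close> and \<open>C\<close> of the theorem are the cases \<open>e = 1\<close> and \<open>e = - 1\<close>. For \<open>B\<close> the matrix \<open>T\<close> is
  \<open>U\<close>; for \<open>C\<close> it is \<open>U\<close> with its rows shifted back by one.

  The Hecke product, the basis of the Schur algebra and its structure constants are given by
  unique descriptions, so existence and uniqueness come first. The length of a periodic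
  permutation is its number of inversions. The Hecke algebra is realised by the operators on its
  regular module that commute with right multiplication by generators. The double cosets of
  Young subgroups correspond to matrices, because two labellings of the integers that use every
  label equally often differ by a periodic permutation (\<open>matching\<close>).
\<close>

section \<open>Periodic permutations of the integers\<close>

lemma aff_sym_bij: "w \<in> aff_sym r \<Longrightarrow> bij w"
  by (auto simp: aff_sym_def split: if_splits)

lemma aff_sym_shift1: "w \<in> aff_sym r \<Longrightarrow> w (i + int r) = w i + int r"
  by (auto simp: aff_sym_def split: if_splits)

lemma aff_sym_shift: assumes "w \<in> aff_sym r" shows "w (i + t * int r) = w i + t * int r"
proof -
  have "(\<lambda>x. w x - x) \<in> Zvec r" using aff_sym_shift1[OF assms] by (simp add: Zvec_def)
  from Zvec_shift[OF this, of i t] show ?thesis by simp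
qed

lemma aff_symI:
  assumes "r > 0" "bij w" "\<And>i. w (i + int r) = w i + int r" shows "w \<in> aff_sym r"
  using assms by (simp add: aff_sym_def)

lemma aff_sym_zero [simp]: "aff_sym 0 = {id}"
  by (simp add: aff_sym_def)

lemma aff_sym_id [simp]: "id \<in> aff_sym r"
  by (simp add: aff_sym_def)

lemma aff_sym_inv_left [simp]: "w \<in> aff_sym r \<Longrightarrow> inv w (w x) = x"
  by (simp add: aff_sym_bij bij_is_inj)

lemma aff_sym_inv_right [simp]: "w \<in> aff_sym r \<Longrightarrow> w (inv w x) = x"
  by (simp add: aff_sym_bij bij_is_surj surj_f_inv_f)

lemma aff_sym_comp: "w \<in> aff_sym r \<Longrightarrow> u \<in> aff_sym r \<Longrightarrow> w \<circ> u \<in> aff_sym r"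
  by (auto simp: aff_sym_def bij_comp split: if_splits)

lemma aff_sym_eq_iff: "w \<in> aff_sym r \<Longrightarrow> w x = w y \<longleftrightarrow> x = y"
  by (metis aff_sym_inv_left)

lemma aff_sym_inv: assumes w: "w \<in> aff_sym r" shows "inv w \<in> aff_sym r"
proof (cases "r = 0")
  case True then show ?thesis using w by simp
next
  case False
  show ?thesis
  proof (rule aff_symI)
    show "bij (inv w)" using w by (simp add: aff_sym_bij bij_imp_bij_inv)
    fix i
    have "w (inv w i + int r) = i + int r" using w by (simp add: aff_sym_shift1)
    then show "inv w (i + int r) = inv w i + int r" by (metis w aff_sym_inv_left)
  qed (use False in simp)
qed

lemma aff_sym_inv_inv [simp]: "w \<in> aff_sym r \<Longrightarrow> inv (inv w) = w"
  by (simp add: aff_sym_bij inv_inv_eq)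

lemma aff_sym_inv_comp:
  "w \<in> aff_sym r \<Longrightarrow> u \<in> aff_sym r \<Longrightarrow> inv (w \<circ> u) = inv u \<circ> inv w"
  by (simp add: aff_sym_bij o_inv_distrib)

lemma aff_sym_comp_inv [simp]:
  assumes "w \<in> aff_sym r" shows "w \<circ> inv w = id" "inv w \<circ> w = id"
  using assms by (auto simp: fun_eq_iff)

definition transl :: "int \<Rightarrow> perm" where "transl m = (\<lambda>j. j + m)"

lemma transl_apply [simp]: "transl m j = j + m" by (simp add: transl_def)

lemma transl_0 [simp]: "transl 0 = id" by (auto simp: fun_eq_iff)

lemma transl_aff: "r > 0 \<Longrightarrow> transl m \<in> aff_sym r"
  by (rule aff_symI) (auto intro!: o_bij[where g = "transl (- m)"] simp del: transl_0 simp: fun_eq_iff)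

lemma inv_transl [simp]: "inv (transl m) = transl (- m)"
  by (rule inv_equality) auto

section \<open>Simple reflections\<close>

lemma simple_refl_eq:
  assumes "r \<ge> 2"
  shows "simple_refl r k j =
    (if \<exists>t. j = k + t * int r then j + 1 else if \<exists>t. j = k + 1 + t * int r then j - 1 else j)"
proof -
  have "j mod int r = a mod int r \<longleftrightarrow> (\<exists>t. j = a + t * int r)" for a
    by (metis add_diff_cancel_left' diff_add_cancel dvd_def add.commute mod_eq_dvd_iff mult.commute)
  then show ?thesis by (simp add: simple_refl_def)
qed

lemma not_consecutive_mod:
  assumes "r \<ge> 2" shows "(k :: int) + t * int r \<noteq> k + 1 + t' * int r"
proof
  assume "k + t * int r = k + 1 + t' * int r"
  then have "(t - t') * int r = 1" by (simp add: algebra_simps)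
  then have "int r dvd 1" by (metis dvd_triv_right)
  with assms show False by simp
qed

lemma simple_refl_at: assumes "r \<ge> 2"
  shows "simple_refl r k (k + t * int r) = k + 1 + t * int r"
    and "simple_refl r k (k + 1 + t * int r) = k + t * int r"
proof -
  show "simple_refl r k (k + t * int r) = k + 1 + t * int r"
    unfolding simple_refl_eq[OF assms] by auto
  have "\<not> (\<exists>t'. k + 1 + t * int r = k + t' * int r)"
    using not_consecutive_mod[OF assms, of k _ t] by (metis)
  then show "simple_refl r k (k + 1 + t * int r) = k + t * int r"
    unfolding simple_refl_eq[OF assms] by auto
qed

lemma simple_refl_simps [simp]: assumes "r \<ge> 2"
  shows "simple_refl r k k = k + 1" "simple_refl r k (k + 1) = k"
  using simple_refl_at[OF assms, of k 0] by simp_all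

lemma simple_refl_cases:
  assumes "r \<ge> 2"
  obtains t where "j = k + t * int r" "simple_refl r k j = j + 1"
  | t where "j = k + 1 + t * int r" "simple_refl r k j = j - 1"
  | "\<And>t. j \<noteq> k + t * int r" "\<And>t. j \<noteq> k + 1 + t * int r" "simple_refl r k j = j"
  using simple_refl_eq[OF assms, of k j] simple_refl_at[OF assms, of k] by (smt (verit))

lemma simple_refl_invol [simp]:
  assumes "r \<ge> 2" shows "simple_refl r k (simple_refl r k j) = j"
  by (rule simple_refl_cases[OF assms, of j k]) (use simple_refl_at[OF assms, of k] in \<open>auto\<close>)

lemma simple_refl_comp_self [simp]:
  assumes "r \<ge> 2" shows "simple_refl r k \<circ> simple_refl r k = id"
  using assms by (auto simp: fun_eq_iff)

lemma simple_refl_comp_self' [simp]: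
  assumes "r \<ge> 2"
  shows "simple_refl r k \<circ> (simple_refl r k \<circ> w) = w" "w \<circ> simple_refl r k \<circ> simple_refl r k = w"
  using assms by (auto simp: fun_eq_iff)

lemma inv_simple_refl [simp]: "r \<ge> 2 \<Longrightarrow> inv (simple_refl r k) = simple_refl r k"
  by (rule inv_equality) auto

lemma simple_refl_aff: assumes "r \<ge> 2" shows "simple_refl r k \<in> aff_sym r"
proof (rule aff_symI)
  show "bij (simple_refl r k)" using simple_refl_comp_self[OF assms] by (intro o_bij)
  fix i
  show "simple_refl r k (i + int r) = simple_refl r k i + int r"
    by (simp add: simple_refl_def)
qed (use assms in simp)

lemma simple_refl_mod: "simple_refl r (k + t * int r) = simple_refl r k"
proof -
  have "(k + t * int r + 1) mod int r = ((k + 1) + t * int r) mod int r" by (simp add: algebra_simps)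
  then have "(k + t * int r + 1) mod int r = (k + 1) mod int r" by (simp only: mod_mult_self1)
  then show ?thesis by (auto simp: simple_refl_def fun_eq_iff)
qed

lemma simple_refls_eq: "r \<ge> 2 \<Longrightarrow> simple_refls r = range (simple_refl r)"
proof -
  assume r: "r \<ge> 2"
  have "simple_refl r k \<in> simple_refl r ` {1..int r}" for k
    using residue[of r k] r simple_refl_mod by (metis imageI not_numeral_le_zero not_gr_zero)
  then show ?thesis using r by (auto simp: simple_refls_def)
qed

lemma simple_refls_iff: "s \<in> simple_refls r \<longleftrightarrow> r \<ge> 2 \<and> (\<exists>k. s = simple_refl r k)"
  using simple_refls_eq[of r] by (cases "r \<ge> 2") (auto simp: simple_refls_def)

lemma simple_refl_less:
  assumes r: "r \<ge> 2" and ab: "a < b" "\<And>t. \<not> (a = k + t * int r \<and> b = k + 1 + t * int r)"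
  shows "simple_refl r k a < simple_refl r k b"
proof -
  have ne: "simple_refl r k a \<noteq> simple_refl r k b"
    using aff_sym_eq_iff[OF simple_refl_aff[OF r]] ab(1) by simp
  have "simple_refl r k a \<le> a \<or> simple_refl r k a = a + 1 \<and> b \<noteq> a + 1"
  proof (rule simple_refl_cases[OF r, of a k])
    fix t assume "a = k + t * int r" "simple_refl r k a = a + 1"
    then show ?thesis using ab(2)[of t] by auto
  qed auto
  moreover have "b \<le> simple_refl r k b \<or> simple_refl r k b = b - 1"
    by (rule simple_refl_cases[OF r, of b k]) auto
  ultimately show ?thesis using ne ab(1) by linarith
qed

lemma simple_refl_less_iff:
  assumes r: "r \<ge> 2" and "\<And>t. {a, b} \<noteq> {k + t * int r, k + 1 + t * int r}"
  shows "simple_refl r k a < simple_refl r k b \<longleftrightarrow> a < b"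
proof -
  have 1: "\<not> (a = k + t * int r \<and> b = k + 1 + t * int r)" for t using assms(2)[of t] by auto
  have 2: "\<not> (b = k + t * int r \<and> a = k + 1 + t * int r)" for t using assms(2)[of t] by auto
  show ?thesis
    using simple_refl_less[OF r _ 1] simple_refl_less[OF r _ 2] by (metis less_asym linorder_neqE)
qed

section \<open>Inversions and length\<close>

text \<open>
  Each coordinate function that translation raises by \<open>r\<close> cuts out a fundamental domain for the
  translation of pairs. Passing from one to another exchanges row and column sums of a periodic
  matrix, and compares the inversions of a permutation with those of its inverse.
\<close>

lemma window_sum:
  fixes f :: "int \<times> int \<Rightarrow> 'a::comm_monoid_add" and \<phi> \<psi> :: "int \<times> int \<Rightarrow> int"
  assumes r: "r > 0"
    and per: "\<And>i j. f (i + r, j + r) = f (i, j)" "\<And>i j. \<phi> (i + r, j + r) = \<phi> (i, j) + r"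
      "\<And>i j. \<psi> (i + r, j + r) = \<psi> (i, j) + r"
  shows "sum f {p. f p \<noteq> 0 \<and> \<phi> p \<in> {1..r}} = sum f {p. f p \<noteq> 0 \<and> \<psi> p \<in> {1..r}}"
proof -
  define sh where "sh t p = (fst p + t * r, snd p + t * r)" for t and p :: "int \<times> int"
  have shift: "g (i + t * r, j + t * r) = g (i, j) + t * c"
    if "\<And>i j. g (i + r, j + r) = g (i, j) + c" for g :: "int \<times> int \<Rightarrow> int" and i j t c
  proof (induction t rule: int_induct[where k = 0])
    case (step1 t) then show ?case using that[of "i + t * r" "j + t * r"] by (simp add: algebra_simps)
  next
    case (step2 t) then show ?case
      using that[of "i + (t - 1) * r" "j + (t - 1) * r"] by (simp add: algebra_simps)
  qed simp
  have f: "f (i + t * r, j + t * r) = f (i, j)" for i j t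
  proof (induction t rule: int_induct[where k = 0])
    case (step1 t) then show ?case using per(1)[of "i + t * r" "j + t * r"] by (simp add: algebra_simps)
  next
    case (step2 t) then show ?case
      using per(1)[of "i + (t - 1) * r" "j + (t - 1) * r"] by (simp add: algebra_simps)
  qed simp
  have fsh: "f (sh t p) = f p" and phsh: "\<phi> (sh t p) = \<phi> p + t * r" and pssh: "\<psi> (sh t p) = \<psi> p + t * r"
    for t p using f shift[of \<phi>, OF per(2)] shift[of \<psi>, OF per(3)] by (simp_all add: sh_def)
  have shsh: "sh s (sh t p) = sh (s + t) p" and sh0: "sh 0 p = p" for s t p
    by (auto simp: sh_def algebra_simps)
  (* Translate a pair until its coordinate given by \<chi> lies in the window. *)
  define nm where "nm \<chi> p = sh (- ((\<chi> p - 1) div r)) p" for \<chi> :: "int \<times> int \<Rightarrow> int" and p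
  have win: "a - (a - 1) div r * r \<in> {1..r}" for a
  proof -
    have "a - (a - 1) div r * r = (a - 1) mod r + 1" by (simp add: minus_div_mult_eq_mod[symmetric])
    then show ?thesis using r pos_mod_bound[of r "a - 1"] pos_mod_sign[of r "a - 1"]
      unfolding atLeastAtMost_iff by linarith
  qed
  have quot: "(a + t * r - 1) div r = t" if "a \<in> {1..r}" for a t
  proof -
    have "(a - 1 + t * r) div r = t + (a - 1) div r" using r by simp
    moreover have "(a - 1) div r = 0" using that by (intro div_pos_pos_trivial) auto
    ultimately show ?thesis by (simp add: algebra_simps)
  qed
  have nm_nm: "nm \<chi> (nm \<chi>' p) = p"
    if "\<chi> p \<in> {1..r}" "\<And>t. \<chi> (sh t p) = \<chi> p + t * r" for \<chi> \<chi>' p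
  proof -
    have "nm \<chi> (sh t p) = p" for t
      using quot[OF that(1), of t] by (simp add: nm_def that(2) shsh sh0)
    then show ?thesis by (simp add: nm_def[of \<chi>'])
  qed
  have nm_win: "f (nm \<chi> p) = f p" "\<phi> (nm \<phi> p) \<in> {1..r}" "\<psi> (nm \<psi> p) \<in> {1..r}" for \<chi> p
    using win by (simp_all add: nm_def fsh phsh pssh)
  show ?thesis
    by (rule sum.reindex_bij_witness[where i = "nm \<phi>" and j = "nm \<psi>"])
       (auto simp: nm_nm phsh pssh fsh nm_win simp del: atLeastAtMost_iff)
qed

definition inversions :: "nat \<Rightarrow> perm \<Rightarrow> (int \<times> int) set" where
  "inversions r w = {(i, j). i \<in> {1..int r} \<and> i < j \<and> w j < w i}"

definition ninv :: "nat \<Rightarrow> perm \<Rightarrow> nat" where "ninv r w = card (inversions r w)"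

lemma finite_inversions: assumes w: "w \<in> aff_sym r" shows "finite (inversions r w)"
proof (cases "r = 0")
  case True then show ?thesis by (simp add: inversions_def)
next
  case False
  define d where "d = (\<lambda>x. \<bar>w x - x\<bar>) ` {1..int r}"
  define M where "M = Max d"
  have M: "\<bar>w x - x\<bar> \<le> M" for x
  proof -
    obtain k where k: "x + k * int r \<in> {1..int r}" using residue[of r x] False by auto
    have "\<bar>w x - x\<bar> = \<bar>w (x + k * int r) - (x + k * int r)\<bar>" by (simp add: aff_sym_shift[OF w])
    then have "\<bar>w x - x\<bar> \<in> d" using k d_def by blast
    then show ?thesis unfolding M_def by (intro Max_ge) (auto simp: d_def)
  qed
  have "inversions r w \<subseteq> {1..int r} \<times> {0..int r + 2 * M}"
  proof (rule subrelI)
    fix i j assume "(i, j) \<in> inversions r w"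
    then have "1 \<le> i" "i \<le> int r" "i < j" "w j < w i" by (auto simp: inversions_def)
    then show "(i, j) \<in> {1..int r} \<times> {0..int r + 2 * M}" using M[of i] M[of j] by auto
  qed
  then show ?thesis by (rule finite_subset) simp
qed

lemma ninv_transl [simp]: "ninv r (transl m \<circ> w) = ninv r w"
  by (simp add: ninv_def inversions_def)

lemma ninv_transl_alone [simp]: "ninv r (transl m) = 0" "ninv r id = 0"
  by (auto simp: ninv_def inversions_def card_eq_0_iff)

text \<open>The only inversion created is the pair of places where \<open>w\<close> takes the values \<open>k\<close> and \<open>k + 1\<close>.\<close>

lemma ninv_simple_refl_up:
  assumes r: "r \<ge> 2" and w: "w \<in> aff_sym r" and up: "inv w k < inv w (k + 1)"
  shows "ninv r (simple_refl r k \<circ> w) = ninv r w + 1"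
proof -
  define p where "p = inv w k" define q where "q = inv w (k + 1)"
  have wp: "w p = k" and wq: "w q = k + 1" using w by (auto simp: p_def q_def)
  obtain t where t: "p + t * int r \<in> {1..int r}" using residue[of r p] r by auto
  let ?e = "(p + t * int r, q + t * int r)"
  have pr: "w (p + t * int r) = k + t * int r" "w (q + t * int r) = k + 1 + t * int r" for t
    by (simp_all add: aff_sym_shift[OF w] wp wq)
  have "inversions r (simple_refl r k \<circ> w) = insert ?e (inversions r w)" (is "?L = ?R")
  proof (intro set_eqI, clarify)
    fix i j
    show "(i, j) \<in> ?L \<longleftrightarrow> (i, j) \<in> ?R"
    proof (cases "\<exists>s. {w j, w i} = {k + s * int r, k + 1 + s * int r}")
      case False
      then have "simple_refl r k (w j) < simple_refl r k (w i) \<longleftrightarrow> w j < w i"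
        by (intro simple_refl_less_iff[OF r]) blast
      moreover have "(i, j) \<noteq> ?e" using False pr by (metis insert_commute prod.inject)
      ultimately show ?thesis by (auto simp: inversions_def)
    next
      case True
      then obtain s where s: "{w j, w i} = {k + s * int r, k + 1 + s * int r}" by blast
      then consider "i = p + s * int r" "j = q + s * int r" | "i = q + s * int r" "j = p + s * int r"
        using pr[of s] by (metis aff_sym_eq_iff[OF w] doubleton_eq_iff)
      then show ?thesis
      proof cases
        case 1
        have "i \<in> {1..int r} \<longleftrightarrow> s = t"
        proof
          assume "i \<in> {1..int r}"
          then have "p + s * int r \<in> {1..int r}" using 1 by simp
          then have "\<bar>(s - t) * int r\<bar> < int r" using t by (auto simp: algebra_simps)
          then show "s = t" using r by (simp add: abs_mult)
        qed (use 1 t in simp)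
        moreover have "i < j" "w i < w j" "simple_refl r k (w j) < simple_refl r k (w i)"
          using 1 up pr simple_refl_at[OF r, of k s] by (simp_all add: p_def q_def)
        ultimately show ?thesis using 1 r by (auto simp: inversions_def)
      next
        case 2
        have "\<not> i < j" using 2 up by (simp add: p_def q_def)
        moreover have "(i, j) \<noteq> ?e" using 2 up by (auto simp: p_def q_def)
        ultimately show ?thesis by (auto simp: inversions_def)
      qed
    qed
  qed
  moreover have "?e \<notin> inversions r w" using pr[of t] by (auto simp: inversions_def)
  ultimately show ?thesis using finite_inversions[OF w] by (simp add: ninv_def)
qed

lemma ninv_simple_refl_down:
  assumes r: "r \<ge> 2" and w: "w \<in> aff_sym r" and "inv w (k + 1) < inv w k"
  shows "ninv r w = ninv r (simple_refl r k \<circ> w) + 1"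
proof -
  have "ninv r (simple_refl r k \<circ> (simple_refl r k \<circ> w)) = ninv r (simple_refl r k \<circ> w) + 1"
    using assms by (intro ninv_simple_refl_up aff_sym_comp simple_refl_aff)
      (simp_all add: aff_sym_inv_comp[OF simple_refl_aff[OF r] w] r)
  then show ?thesis using r by simp
qed

text \<open>
  An inversion is a pair of positions, and read as a pair of values it is one of the inverse.
  The first count has the smaller position in the window, the second the smaller value;
  \<open>window_sum\<close> compares the two.
\<close>

lemma ninv_inv: assumes w: "w \<in> aff_sym r" shows "ninv r (inv w) = ninv r w"
proof (cases "r = 0")
  case True then show ?thesis using w by simp
next
  case False
  define f :: "int \<times> int \<Rightarrow> nat" where "f p = (if fst p < snd p \<and> w (snd p) < w (fst p) then 1 else 0)" for p
  have "sum f {p. f p \<noteq> 0 \<and> fst p \<in> {1..int r}} = sum f {p. f p \<noteq> 0 \<and> w (snd p) \<in> {1..int r}}"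
    using False by (intro window_sum) (auto simp: f_def aff_sym_shift1[OF w])
  moreover have "sum f {p. f p \<noteq> 0 \<and> g p \<in> {1..int r}} = card {p. f p \<noteq> 0 \<and> g p \<in> {1..int r}}" for g
    unfolding card_eq_sum by (intro sum.cong) (auto simp: f_def split: if_splits)
  ultimately have c: "card {p. f p \<noteq> 0 \<and> fst p \<in> {1..int r}} = card {p. f p \<noteq> 0 \<and> w (snd p) \<in> {1..int r}}"
    by simp
  have "inversions r w = {p. f p \<noteq> 0 \<and> fst p \<in> {1..int r}}" by (auto simp: inversions_def f_def)
  moreover have "card (inversions r (inv w)) = card {p. f p \<noteq> 0 \<and> w (snd p) \<in> {1..int r}}"
    by (rule bij_betw_same_card[of "\<lambda>(a, b). (inv w b, inv w a)"],
        rule bij_betwI[where g = "\<lambda>(i, j). (w j, w i)"])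
       (auto simp: inversions_def f_def aff_sym_inv_left[OF w] aff_sym_inv_right[OF w] split: if_splits)
  ultimately show ?thesis using c by (simp add: ninv_def)
qed

lemma ninv_simple_refl_right_up:
  assumes r: "r \<ge> 2" and w: "w \<in> aff_sym r" and up: "w k < w (k + 1)"
  shows "ninv r (w \<circ> simple_refl r k) = ninv r w + 1"
proof -
  note s = simple_refl_aff[OF r, of k]
  have "ninv r (w \<circ> simple_refl r k) = ninv r (simple_refl r k \<circ> inv w)"
    using ninv_inv[OF aff_sym_comp[OF w s]] aff_sym_inv_comp[OF w s] r by simp
  also have "\<dots> = ninv r (inv w) + 1"
    using assms by (intro ninv_simple_refl_up aff_sym_inv) simp_all
  finally show ?thesis using ninv_inv[OF w] by simp
qed

lemma ninv_simple_refl_right_down: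
  assumes r: "r \<ge> 2" and w: "w \<in> aff_sym r" and "w (k + 1) < w k"
  shows "ninv r w = ninv r (w \<circ> simple_refl r k) + 1"
proof -
  have "ninv r (w \<circ> simple_refl r k \<circ> simple_refl r k) = ninv r (w \<circ> simple_refl r k) + 1"
    using assms by (intro ninv_simple_refl_right_up aff_sym_comp simple_refl_aff) simp_all
  then show ?thesis using r by simp
qed

lemma ninv_transl_right [simp]:
  assumes "w \<in> aff_sym r" "r > 0" shows "ninv r (w \<circ> transl m) = ninv r w"
proof -
  have "ninv r (w \<circ> transl m) = ninv r (inv (w \<circ> transl m))"
    using assms by (intro ninv_inv[symmetric] aff_sym_comp transl_aff)
  also have "inv (w \<circ> transl m) = transl (- m) \<circ> inv w"
    using aff_sym_inv_comp[OF assms(1) transl_aff[OF assms(2)]] by (simp only: inv_transl)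
  finally show ?thesis using ninv_inv[OF assms(1)] by (simp only: ninv_transl)
qed

lemma increasing_imp_strict:
  fixes w :: perm assumes "\<And>k. w k < w (k + 1)" "a < b" shows "w a < w b"
proof -
  have "w a < w (a + 1 + int m)" for m
  proof (induction m)
    case (Suc m) then show ?case using assms(1)[of "a + 1 + int m"] by (simp add: algebra_simps)
  qed (use assms(1) in simp)
  from this[of "nat (b - a - 1)"] show ?thesis using assms(2) by simp
qed

text \<open>An increasing surjection of the integers skips no value.\<close>

lemma increasing_imp_transl:
  assumes w: "w \<in> aff_sym r" and up: "\<And>k. w k < w (k + 1)"
  shows "w = transl (w 0)"
proof -
  note mono = increasing_imp_strict[of w, OF up]
  have step: "w (k + 1) = w k + 1" for k
  proof (rule ccontr)
    assume "w (k + 1) \<noteq> w k + 1"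
    then have 1: "w k < w k + 1" "w k + 1 < w (k + 1)" using up[of k] by auto
    define x where "x = inv w (w k + 1)"
    have "w x = w k + 1" using w by (simp add: x_def)
    then have "k < x" "x < k + 1" using 1 mono by (metis not_less_iff_gr_or_eq)+
    then show False by simp
  qed
  have lin: "w k = k + w 0" for k
  proof (induction k rule: int_induct[where k = 0])
    case (step1 k) then show ?case using step[of k] by simp
  next
    case (step2 k) then show ?case using step[of "k - 1"] by simp
  qed simp
  show ?thesis unfolding transl_def by (rule ext) (rule lin)
qed

lemma aff_sym_small_transl:
  assumes w: "w \<in> aff_sym r" and r: "\<not> r \<ge> 2" shows "w = transl (w 0)"
proof (cases "r = 0")
  case True then show ?thesis using w by simp
next
  case False
  then have "r = 1" using r by simp
  then show ?thesis using w aff_sym_shift1[OF w] by (intro increasing_imp_transl) auto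
qed

text \<open>Induction on the length: a permutation that is not a translation has a descent.\<close>

lemma aff_sym_left_induct [consumes 1, case_names transl refl]:
  assumes w: "w \<in> aff_sym r"
    and tr: "\<And>m. transl m \<in> aff_sym r \<Longrightarrow> P (transl m)"
    and st: "\<And>k w. r \<ge> 2 \<Longrightarrow> w \<in> aff_sym r \<Longrightarrow> inv w k < inv w (k + 1) \<Longrightarrow> P w \<Longrightarrow> P (simple_refl r k \<circ> w)"
  shows "P w"
  using w
proof (induction "ninv r w" arbitrary: w rule: less_induct)
  case less
  show ?case
  proof (cases "r \<ge> 2 \<and> (\<exists>k. inv w (k + 1) < inv w k)")
    case True
    then obtain k where r: "r \<ge> 2" and k: "inv w (k + 1) < inv w k" by blast
    define u where "u = simple_refl r k \<circ> w"
    have u: "u \<in> aff_sym r" using less.prems r by (simp add: u_def aff_sym_comp simple_refl_aff)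
    have "inv u k < inv u (k + 1)"
      using k r less.prems by (simp add: u_def aff_sym_inv_comp[OF simple_refl_aff])
    moreover have "P u"
      using ninv_simple_refl_down[OF r less.prems k] by (intro less.hyps u) (simp add: u_def)
    ultimately have "P (simple_refl r k \<circ> u)" using st[OF r u] by blast
    then show ?thesis using r by (simp add: u_def)
  next
    case False
    have "w = transl (w 0)"
    proof (cases "r \<ge> 2")
      case True
      have "inv w k < inv w (k + 1)" for k
        using False True aff_sym_eq_iff[OF aff_sym_inv[OF less.prems], of k "k + 1"]
        by (metis add_cancel_right_right linorder_neqE one_neq_zero)
      then have "inv w = transl (inv w 0)"
        using increasing_imp_transl[OF aff_sym_inv[OF less.prems]] by blast
      then have "inv (inv w) = transl (- inv w 0)" by (metis inv_transl)
      then have "w = transl (- inv w 0)" using less.prems by simp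
      then show ?thesis by (metis add_0 transl_apply)
    qed (use less.prems aff_sym_small_transl in blast)
    then show ?thesis using tr less.prems by metis
  qed
qed

lemma aff_sym_right_induct [consumes 1, case_names transl refl]:
  assumes w: "w \<in> aff_sym r"
    and tr: "\<And>m. transl m \<in> aff_sym r \<Longrightarrow> P (transl m)"
    and st: "\<And>k w. r \<ge> 2 \<Longrightarrow> w \<in> aff_sym r \<Longrightarrow> w k < w (k + 1) \<Longrightarrow> P w \<Longrightarrow> P (w \<circ> simple_refl r k)"
  shows "P w"
proof -
  have "P (inv u)" if "u \<in> aff_sym r" for u
    using that
  proof (induction rule: aff_sym_left_induct)
    case (transl m)
    have "transl (- m) \<in> aff_sym r" using aff_sym_inv[OF transl] by (simp only: inv_transl)
    then have "P (transl (- m))" by (rule tr)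
    then show ?case by (simp only: inv_transl)
  next
    case (refl k u)
    have "P (inv u \<circ> simple_refl r k)" using refl by (intro st aff_sym_inv) auto
    then show ?case
      by (simp only: aff_sym_inv_comp[OF simple_refl_aff[OF refl(1)] refl(2)] inv_simple_refl[OF refl(1)])
  qed
  from this[OF aff_sym_inv[OF w]] w show ?thesis by simp
qed


text \<open>A simple reflection changes the number of inversions by at most one.\<close>

lemma ninv_comp_le:
  assumes w: "w \<in> aff_sym r" and u: "u \<in> aff_sym r"
  shows "ninv r (w \<circ> u) \<le> ninv r w + ninv r u"
  using u w
proof (induction arbitrary: w rule: aff_sym_left_induct)
  case (transl m)
  have "ninv r (w \<circ> transl m) \<le> ninv r w + ninv r (transl m)"
  proof (cases "r = 0")
    case True then show ?thesis using transl by simp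
  next
    case False then show ?thesis using transl by simp
  qed
  then show ?case .
next
  case (refl k u)
  have ne: "w k \<noteq> w (k + 1)" using aff_sym_eq_iff[OF refl.prems] by simp
  have "ninv r (w \<circ> simple_refl r k) \<le> ninv r w + 1"
    using ninv_simple_refl_right_up[OF refl(1) refl.prems, of k]
      ninv_simple_refl_right_down[OF refl(1) refl.prems, of k] ne by linarith
  moreover have "ninv r (w \<circ> simple_refl r k \<circ> u) \<le> ninv r (w \<circ> simple_refl r k) + ninv r u"
    using refl by (intro refl.IH aff_sym_comp simple_refl_aff)
  ultimately have "ninv r (w \<circ> (simple_refl r k \<circ> u)) \<le> ninv r w + ninv r (simple_refl r k \<circ> u)"
    using ninv_simple_refl_up[OF refl(1-3)] by (simp add: comp_assoc)
  then show ?case .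
qed

text \<open>
  A homomorphism to the integers, with the affine Weyl group as its kernel; it tells
  translations apart.
\<close>

definition drift :: "nat \<Rightarrow> perm \<Rightarrow> int" where "drift r w = (\<Sum>i = 1..int r. w i - i)"

lemma weyl_iff_drift: "w \<in> weyl r \<longleftrightarrow> w \<in> aff_sym r \<and> drift r w = 0"
  by (auto simp: weyl_def drift_def sum_subtractf)

lemma sum_periodic_reindex:
  fixes g :: "int \<Rightarrow> 'a::comm_monoid_add"
  assumes u: "u \<in> aff_sym r" and r: "r > 0" and g: "\<And>x t. g (x + t * int r) = g x"
  shows "(\<Sum>i = 1..int r. g (u i)) = (\<Sum>i = 1..int r. g i)"
proof -
  define nm where "nm x = (x - 1) mod int r + 1" for x
  have nm: "nm x = x + - ((x - 1) div int r) * int r" for x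
    by (simp add: nm_def minus_div_mult_eq_mod[symmetric])
  have inj: "inj_on (\<lambda>i. nm (u i)) {1..int r}"
  proof (rule inj_onI)
    fix i j assume ij: "i \<in> {1..int r}" "j \<in> {1..int r}" and eq: "nm (u i) = nm (u j)"
    define t where "t = (u i - 1) div int r - (u j - 1) div int r"
    have "u i = u j + t * int r" using eq unfolding nm t_def by (simp add: algebra_simps)
    then have i: "i = j + t * int r" using aff_sym_shift[OF u, of j t] aff_sym_eq_iff[OF u] by metis
    then have "\<bar>t * int r\<bar> < int r" using ij by auto
    then show "i = j" using r i by (simp add: abs_mult)
  qed
  have sub: "(\<lambda>i. nm (u i)) ` {1..int r} \<subseteq> {1..int r}"
  proof clarify
    fix i
    have "0 \<le> (u i - 1) mod int r" "(u i - 1) mod int r < int r" using r by simp_all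
    then show "nm (u i) \<in> {1..int r}" unfolding nm_def atLeastAtMost_iff by linarith
  qed
  have "(\<Sum>i = 1..int r. g i) = (\<Sum>i\<in>(\<lambda>i. nm (u i)) ` {1..int r}. g i)"
    using endo_inj_surj[OF _ sub inj] by simp
  also have "\<dots> = (\<Sum>i = 1..int r. g (nm (u i)))" using sum.reindex[OF inj, of g] by (simp add: o_def)
  also have "\<dots> = (\<Sum>i = 1..int r. g (u i))" unfolding nm g ..
  finally show ?thesis by simp
qed

lemma drift_comp:
  assumes w: "w \<in> aff_sym r" and u: "u \<in> aff_sym r"
  shows "drift r (w \<circ> u) = drift r w + drift r u"
proof (cases "r = 0")
  case True then show ?thesis by (simp add: drift_def)
next
  case False
  have "(\<Sum>i = 1..int r. w (u i) - u i) = (\<Sum>i = 1..int r. w i - i)"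
    using sum_periodic_reindex[OF u, of "\<lambda>x. w x - x"] False by (simp add: aff_sym_shift[OF w])
  moreover have "drift r (w \<circ> u) = (\<Sum>i = 1..int r. (w (u i) - u i) + (u i - i))"
    by (simp add: drift_def)
  ultimately show ?thesis by (simp only: sum.distrib drift_def)
qed

lemma drift_transl [simp]: "drift r (transl m) = m * int r"
  by (simp add: drift_def)

lemma drift_simple_refl [simp]: assumes r: "r \<ge> 2" shows "drift r (simple_refl r k) = 0"
proof -
  note s = simple_refl_aff[OF r, of k]
  have "drift r (simple_refl r k \<circ> simple_refl r k) = 0" using r by (simp add: drift_def)
  then show ?thesis using drift_comp[OF s s] by simp
qed

lemma refl_word:
  assumes r: "set ss \<subseteq> simple_refls r"
  shows "foldr (\<circ>) ss id \<in> weyl r \<and> ninv r (foldr (\<circ>) ss id) \<le> length ss"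
  using assms
proof (induction ss)
  case Nil
  have "id \<in> weyl r \<and> ninv r id \<le> 0" by (simp add: weyl_iff_drift drift_def)
  then have "foldr (\<circ>) [] id \<in> weyl r \<and> ninv r (foldr (\<circ>) [] id) \<le> length []" by simp
  then show ?case .
next
  case (Cons s ss)
  obtain k where k: "r \<ge> 2" "s = simple_refl r k" using Cons.prems by (auto simp: simple_refls_iff)
  define u where "u = foldr (\<circ>) ss id"
  have u: "u \<in> aff_sym r" "drift r u = 0" "ninv r u \<le> length ss"
  proof -
    have "set ss \<subseteq> simple_refls r" using Cons.prems by simp
    note Cons.IH[OF this, folded u_def]
    then show "u \<in> aff_sym r" "drift r u = 0" "ninv r u \<le> length ss"
      unfolding weyl_iff_drift by blast+
  qed
  have s: "s \<in> aff_sym r" using simple_refl_aff k by simp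
  have "inv u k \<noteq> inv u (k + 1)" using aff_sym_eq_iff[OF aff_sym_inv[OF u(1)]] by simp
  then have "ninv r (s \<circ> u) \<le> ninv r u + 1"
    using ninv_simple_refl_up[OF k(1) u(1), of k] ninv_simple_refl_down[OF k(1) u(1), of k]
    unfolding k(2) by linarith
  moreover have "drift r (s \<circ> u) = 0" using drift_comp[OF s u(1)] u k by simp
  ultimately have "foldr (\<circ>) (s # ss) id \<in> weyl r \<and> ninv r (foldr (\<circ>) (s # ss) id) \<le> length (s # ss)"
    using aff_sym_comp[OF s u(1)] u by (simp add: weyl_iff_drift u_def)
  then show ?case .
qed

text \<open>
  Removing descents one at a time produces a word with as many letters as there are inversions;
  by \<open>refl_word\<close> no shorter word has the same product.
\<close>

lemma reduced_word_exists:
  assumes w: "w \<in> aff_sym r"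
  shows "\<exists>ss m. set ss \<subseteq> simple_refls r \<and> length ss = ninv r w \<and> transl m \<in> aff_sym r
     \<and> w = foldr (\<circ>) ss id \<circ> transl m"
  using w
proof (induction rule: aff_sym_left_induct)
  case (transl m)
  have "transl m = foldr (\<circ>) [] id \<circ> transl m" "length [] = ninv r (transl m)" by simp_all
  with transl show ?case by (metis empty_subsetI list.set(1))
next
  case (refl k w)
  then obtain ss m where ss: "set ss \<subseteq> simple_refls r" "length ss = ninv r w" "transl m \<in> aff_sym r"
    "w = foldr (\<circ>) ss id \<circ> transl m" by blast
  have "set (simple_refl r k # ss) \<subseteq> simple_refls r"
    "length (simple_refl r k # ss) = ninv r (simple_refl r k \<circ> w)"
    "simple_refl r k \<circ> w = foldr (\<circ>) (simple_refl r k # ss) id \<circ> transl m"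
    using ss refl(1) ninv_simple_refl_up[OF refl(1-3)] by (auto simp: simple_refls_iff comp_assoc)
  with ss(3) show ?case by blast
qed

lemma weyl_length_eq_ninv: assumes w: "w \<in> weyl r" shows "weyl_length r w = ninv r w"
proof -
  have wa: "w \<in> aff_sym r" and d: "drift r w = 0" using w by (auto simp: weyl_iff_drift)
  obtain ss m where ss: "set ss \<subseteq> simple_refls r" "length ss = ninv r w" "transl m \<in> aff_sym r"
    "w = foldr (\<circ>) ss id \<circ> transl m" using reduced_word_exists[OF wa] by blast
  have "drift r w = 0 + m * int r"
    using refl_word[OF ss(1)] drift_comp[OF _ ss(3)] ss(4) by (simp add: weyl_iff_drift)
  then have "m = 0 \<or> r = 0" using d by simp
  then have "transl m = id" using ss(3) by auto
  then have "w = foldr (\<circ>) ss id" using ss(4) by simp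
  then show ?thesis unfolding weyl_length_def
    using ss refl_word by (intro Least_equality) auto
qed

text \<open>
  The drift singles out the translation that takes \<open>w\<close> into the Weyl group, and translations do
  not affect inversions.
\<close>

lemma aff_length_eq_ninv: assumes w: "w \<in> aff_sym r" shows "aff_length r w = ninv r w"
proof -
  obtain ss m where ss: "set ss \<subseteq> simple_refls r" "transl m \<in> aff_sym r"
    "w = foldr (\<circ>) ss id \<circ> transl m" using reduced_word_exists[OF w] by blast
  have dw: "drift r w = m * int r"
    using refl_word[OF ss(1)] drift_comp[OF _ ss(2)] ss(3) by (simp add: weyl_iff_drift)
  have tm: "transl (- m) \<in> aff_sym r" using aff_sym_inv[OF ss(2)] by (simp only: inv_transl)
  define P where "P w' \<longleftrightarrow> w' \<in> weyl r \<and> (\<exists>m::int. w = (\<lambda>j. j + m) \<circ> w')" for w'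
  have P: "P (transl (- m) \<circ> w)"
    using aff_sym_comp[OF tm w] drift_comp[OF tm w] dw
    by (auto simp: P_def weyl_iff_drift fun_eq_iff intro!: exI[of _ m])
  have uniq: "w1 = transl (- m) \<circ> w" if w1: "P w1" for w1
  proof -
    obtain m1 where m1: "w = transl m1 \<circ> w1" and w1: "w1 \<in> aff_sym r" "drift r w1 = 0"
      using w1 by (auto simp: P_def transl_def weyl_iff_drift)
    have "m1 = m"
    proof (cases "r = 0")
      case True
      then have "transl m1 = id" "transl m = id" using m1 w w1 ss by auto
      then show ?thesis by (metis add_0 id_apply transl_apply)
    next
      case False
      have "drift r w = m1 * int r"
        using drift_comp[OF transl_aff w1(1), of m1] False w1 m1 by simp
      then show ?thesis using dw False by simp
    qed
    then show ?thesis using m1 by (auto simp: fun_eq_iff)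
  qed
  have "(THE w'. P w') = transl (- m) \<circ> w" using P uniq by (rule the_equality)
  then have "aff_length r w = weyl_length r (transl (- m) \<circ> w)" by (simp only: aff_length_def P_def)
  also have "\<dots> = ninv r w" using P weyl_length_eq_ninv by (simp add: P_def)
  finally show ?thesis .
qed

section \<open>Matching labelled integers\<close>

lemma rank_bij:
  fixes A :: "int set" assumes "finite A"
  shows "bij_betw (\<lambda>x. card {y \<in> A. y < x}) A {..<card A}"
proof -
  have mono: "card {y \<in> A. y < x} < card {y \<in> A. y < x'}" if "x < x'" "x \<in> A" for x x'
    using that assms by (intro psubset_card_mono) auto
  have inj: "inj_on (\<lambda>x. card {y \<in> A. y < x}) A"
  proof (rule inj_onI)
    fix x x' assume "x \<in> A" "x' \<in> A" "card {y \<in> A. y < x} = card {y \<in> A. y < x'}"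
    then show "x = x'" using mono[of x x'] mono[of x' x] by (cases x x' rule: linorder_cases) auto
  qed
  have "(\<lambda>x. card {y \<in> A. y < x}) ` A \<subseteq> {..<card A}"
    using assms by (auto intro!: psubset_card_mono)
  moreover have "card ((\<lambda>x. card {y \<in> A. y < x}) ` A) = card {..<card A}"
    using card_image[OF inj] by simp
  ultimately have "(\<lambda>x. card {y \<in> A. y < x}) ` A = {..<card A}" by (intro card_subset_eq) auto
  then show ?thesis using inj by (simp add: bij_betw_def)
qed

text \<open>
  Send an integer to the one with the same label and the same rank among the integers so
  labelled. Every label is used equally often, so this is a bijection; translation preserves
  ranks, so it is periodic.
\<close>

lemma matching:
  fixes F F' :: "int \<Rightarrow> 'a"
  assumes r: "r > 0" and \<tau>: "inj \<tau>"
    and F: "\<And>x. F (x + int r) = \<tau> (F x)" and F': "\<And>x. F' (x + int r) = \<tau> (F' x)"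
    and fin: "\<And>a. finite {x. F x = a}" "\<And>a. finite {x. F' x = a}"
    and card: "\<And>a. card {x. F x = a} = card {x. F' x = a}"
  obtains g where "g \<in> aff_sym r" "\<And>x. F' (g x) = F x" "\<And>x y. x < y \<Longrightarrow> F x = F y \<Longrightarrow> g x < g y"
proof -
  define rk where "rk G x = card {y. G y = G x \<and> y < x}" for G :: "int \<Rightarrow> 'a" and x
  have rk_bij: "bij_betw (rk G) {x. G x = a} {..<card {x. G x = a}}" if "finite {x. G x = a}" for G :: "int \<Rightarrow> 'a" and a
    using rank_bij[OF that] by (rule bij_betw_cong[THEN iffD1, rotated]) (auto simp: rk_def)
  have rk_shift: "rk G (x + int r) = rk G x" if "\<And>x. G (x + int r) = \<tau> (G x)" for G x
  proof -
    have "{y. G y = G (x + int r) \<and> y < x + int r} = (\<lambda>y. y + int r) ` {y. G y = G x \<and> y < x}"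
    proof (intro set_eqI iffI)
      fix y assume "y \<in> {y. G y = G (x + int r) \<and> y < x + int r}"
      then have "\<tau> (G (y - int r)) = \<tau> (G x)" "y < x + int r" using that[of x] that[of "y - int r"] by auto
      then show "y \<in> (\<lambda>y. y + int r) ` {y. G y = G x \<and> y < x}"
        using injD[OF \<tau>] by (intro image_eqI[of _ _ "y - int r"]) auto
    qed (use that in auto)
    then show ?thesis by (simp add: rk_def card_image)
  qed
  have ex1: "\<exists>!y. F' y = F x \<and> rk F' y = rk F x" for x
  proof -
    have "rk F x \<in> {..<card {y. F y = F x}}" using rk_bij[OF fin(1), of "F x"] by (auto simp: bij_betw_def)
    then have "rk F x \<in> {..<card {y. F' y = F x}}" using card by simp
    then have "rk F x \<in> rk F' ` {y. F' y = F x}" using rk_bij[OF fin(2), of "F x"] by (simp add: bij_betw_def)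
    then obtain y where y: "F' y = F x" "rk F' y = rk F x" by auto
    have "z = y" if "F' z = F x" "rk F' z = rk F x" for z
      by (rule inj_onD[OF bij_betw_imp_inj_on[OF rk_bij[OF fin(2), of "F x"]]]) (use y that in auto)
    with y show ?thesis by blast
  qed
  define g where "g x = (THE y. F' y = F x \<and> rk F' y = rk F x)" for x
  have g: "F' (g x) = F x" "rk F' (g x) = rk F x" for x using theI'[OF ex1[of x]] by (auto simp: g_def)
  have g_eq: "y = g x" if "F' y = F x" "rk F' y = rk F x" for x y using ex1[of x] that g by blast
  have "inj g"
  proof (rule injI)
    fix x y assume "g x = g y"
    then have "F x = F y" "rk F x = rk F y" using g by metis+
    then show "x = y"
      by (intro inj_onD[OF bij_betw_imp_inj_on[OF rk_bij[OF fin(1), of "F x"]]]) auto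
  qed
  moreover have "surj g"
  proof (rule surjI)
    fix y
    define x where "x = (SOME x. F x = F' y \<and> rk F x = rk F' y)"
    have "rk F' y \<in> {..<card {z. F' z = F' y}}" using rk_bij[OF fin(2), of "F' y"] by (auto simp: bij_betw_def)
    then have "rk F' y \<in> rk F ` {x. F x = F' y}"
      using card rk_bij[OF fin(1), of "F' y"] by (simp add: bij_betw_def)
    then have "\<exists>x. F x = F' y \<and> rk F x = rk F' y" by auto
    then have "F x = F' y \<and> rk F x = rk F' y" unfolding x_def by (rule someI_ex)
    then show "g x = y" using g_eq[of y x] by simp
  qed
  moreover have "g (x + int r) = g x + int r" for x
    using g by (intro g_eq[symmetric]) (simp_all add: F F' rk_shift)
  ultimately have gaff: "g \<in> aff_sym r" using r by (intro aff_symI) (auto simp: bij_def)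
  have "g x < g y" if "x < y" "F x = F y" for x y
  proof (rule ccontr)
    assume "\<not> g x < g y"
    then have "rk F' (g y) \<le> rk F' (g x)" unfolding rk_def
      using that g fin(2)[of "F' (g x)"] by (intro card_mono) (auto elim: finite_subset[rotated])
    moreover have "rk F x < rk F y" unfolding rk_def
      using that fin(1)[of "F y"] by (intro psubset_card_mono) (auto elim: finite_subset[rotated])
    ultimately show False using g by simp
  qed
  then show thesis using that gaff g by blast
qed

section \<open>Free modules of finitely supported functions\<close>

lemma lookup_smul [simp]: "Poly_Mapping.lookup (smul c x) k = c * Poly_Mapping.lookup x k"
  by (simp add: smul_def Poly_Mapping.map.rep_eq when_def)

lemma smul_simps [simp]:
  "smul c 0 = 0" "smul 0 x = 0" "smul 1 x = x"
  "smul c (x + y) = smul c x + smul c y" "smul c (smul d x) = smul (c * d) x"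
  by (auto intro!: poly_mapping_eqI simp: lookup_add algebra_simps)

lemma smul_add_left: "smul (c + d) x = smul c x + smul d x"
  by (auto intro!: poly_mapping_eqI simp: lookup_add algebra_simps)

lemma smul_sum: "smul c (sum f I) = (\<Sum>i\<in>I. smul c (f i))"
  by (induction I rule: infinite_finite_induct) auto

lemma keys_smul: "Poly_Mapping.keys (smul c x) \<subseteq> Poly_Mapping.keys x"
  by (auto simp: in_keys_iff)

lemma lookup_TT: "Poly_Mapping.lookup (TT w) u = (if u = w then 1 else 0)"
  by (simp add: TT_def lookup_single when_def)

definition pm_of :: "('a \<Rightarrow> 'b::zero) \<Rightarrow> ('a \<Rightarrow>\<^sub>0 'b)" where "pm_of f = Abs_poly_mapping f"

lemma lookup_pm_of: "finite {x. f x \<noteq> 0} \<Longrightarrow> Poly_Mapping.lookup (pm_of f) = f"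
  by (simp add: pm_of_def)

lemma hecke_carrier_iff: "x \<in> hecke_carrier r \<longleftrightarrow> (\<forall>w. w \<notin> aff_sym r \<longrightarrow> Poly_Mapping.lookup x w = 0)"
  by (auto simp: hecke_carrier_def in_keys_iff)

lemma hecke_carrier_closed [simp, intro]:
  "0 \<in> hecke_carrier r"
  "x \<in> hecke_carrier r \<Longrightarrow> y \<in> hecke_carrier r \<Longrightarrow> x + y \<in> hecke_carrier r"
  "x \<in> hecke_carrier r \<Longrightarrow> smul c x \<in> hecke_carrier r"
  "w \<in> aff_sym r \<Longrightarrow> TT w \<in> hecke_carrier r"
  by (auto simp: hecke_carrier_iff lookup_add lookup_TT)

lemma hecke_carrier_sum: "(\<And>i. i \<in> I \<Longrightarrow> f i \<in> hecke_carrier r) \<Longrightarrow> sum f I \<in> hecke_carrier r"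
  by (induction I rule: infinite_finite_induct) auto

lemma hecke_expansion: "x = (\<Sum>w\<in>Poly_Mapping.keys x. smul (Poly_Mapping.lookup x w) (TT w))"
proof (rule poly_mapping_eqI)
  fix u
  have "Poly_Mapping.lookup (\<Sum>w\<in>Poly_Mapping.keys x. smul (Poly_Mapping.lookup x w) (TT w)) u
     = (\<Sum>w\<in>Poly_Mapping.keys x. if u = w then Poly_Mapping.lookup x w else 0)"
    by (simp add: lookup_sum lookup_TT if_distrib cong: if_cong)
  also have "\<dots> = Poly_Mapping.lookup x u" by (simp add: in_keys_iff)
  finally show "Poly_Mapping.lookup x u =
      Poly_Mapping.lookup (\<Sum>w\<in>Poly_Mapping.keys x. smul (Poly_Mapping.lookup x w) (TT w)) u" by simp
qed

lemma hecke_induct [consumes 1, case_names zero add smul TT]: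
  assumes x: "x \<in> hecke_carrier r" and 0: "P 0"
    and add: "\<And>x y. x \<in> hecke_carrier r \<Longrightarrow> y \<in> hecke_carrier r \<Longrightarrow> P x \<Longrightarrow> P y \<Longrightarrow> P (x + y)"
    and smul: "\<And>c x. x \<in> hecke_carrier r \<Longrightarrow> P x \<Longrightarrow> P (smul c x)"
    and TT: "\<And>w. w \<in> aff_sym r \<Longrightarrow> P (TT w)"
  shows "P x"
proof -
  have "P (\<Sum>w\<in>I. smul (c w) (TT w)) \<and> (\<Sum>w\<in>I. smul (c w) (TT w)) \<in> hecke_carrier r"
    if "I \<subseteq> aff_sym r" "finite I" for I and c :: "perm \<Rightarrow> laurent"
    using that(2,1) by (induction I rule: finite_induct) (auto intro!: 0 add smul TT)
  moreover have "Poly_Mapping.keys x \<subseteq> aff_sym r" using x by (simp add: hecke_carrier_def)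
  ultimately show ?thesis using hecke_expansion[of x] by (metis finite_keys)
qed

section \<open>The extended affine Hecke algebra\<close>

abbreviation (input) qq :: laurent where "qq \<equiv> vpow 2"

text \<open>
  Multiplication by a generator, written in coordinates.  Coordinates make these maps visibly
  linear, and reduce the identities between them to case distinctions.
\<close>

definition lop :: "nat \<Rightarrow> int \<Rightarrow> hecke \<Rightarrow> hecke" where
  "lop r k h = pm_of (\<lambda>w.
     if inv w k < inv w (k + 1) then qq * Poly_Mapping.lookup h (simple_refl r k \<circ> w)
     else Poly_Mapping.lookup h (simple_refl r k \<circ> w) + (qq - 1) * Poly_Mapping.lookup h w)"

definition rop :: "nat \<Rightarrow> int \<Rightarrow> hecke \<Rightarrow> hecke" where
  "rop r k h = pm_of (\<lambda>w.
     if w k < w (k + 1) then qq * Poly_Mapping.lookup h (w \<circ> simple_refl r k)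
     else Poly_Mapping.lookup h (w \<circ> simple_refl r k) + (qq - 1) * Poly_Mapping.lookup h w)"

definition lsh :: "int \<Rightarrow> hecke \<Rightarrow> hecke" where
  "lsh m h = pm_of (\<lambda>w. Poly_Mapping.lookup h (transl (- m) \<circ> w))"

definition rsh :: "int \<Rightarrow> hecke \<Rightarrow> hecke" where
  "rsh m h = pm_of (\<lambda>w. Poly_Mapping.lookup h (w \<circ> transl (- m)))"

lemma lookup_lop: assumes r: "r \<ge> 2"
  shows "Poly_Mapping.lookup (lop r k h) w =
    (if inv w k < inv w (k + 1) then qq * Poly_Mapping.lookup h (simple_refl r k \<circ> w)
     else Poly_Mapping.lookup h (simple_refl r k \<circ> w) + (qq - 1) * Poly_Mapping.lookup h w)"
    (is "_ = ?f w")
proof -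
  have "{w. ?f w \<noteq> 0} \<subseteq> Poly_Mapping.keys h \<union> (\<lambda>w. simple_refl r k \<circ> w) ` Poly_Mapping.keys h"
  proof
    fix w assume "w \<in> {w. ?f w \<noteq> 0}"
    then have "w \<in> Poly_Mapping.keys h \<or> simple_refl r k \<circ> w \<in> Poly_Mapping.keys h"
      by (auto simp: in_keys_iff split: if_splits)
    moreover have "w = simple_refl r k \<circ> (simple_refl r k \<circ> w)" using r by simp
    ultimately show "w \<in> Poly_Mapping.keys h \<union> (\<lambda>w. simple_refl r k \<circ> w) ` Poly_Mapping.keys h" by blast
  qed
  then have "finite {w. ?f w \<noteq> 0}" by (rule finite_subset) simp
  from fun_cong[OF lookup_pm_of[OF this], of w] show ?thesis unfolding lop_def .
qed

lemma lookup_rop: assumes r: "r \<ge> 2"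
  shows "Poly_Mapping.lookup (rop r k h) w =
    (if w k < w (k + 1) then qq * Poly_Mapping.lookup h (w \<circ> simple_refl r k)
     else Poly_Mapping.lookup h (w \<circ> simple_refl r k) + (qq - 1) * Poly_Mapping.lookup h w)"
    (is "_ = ?f w")
proof -
  have "{w. ?f w \<noteq> 0} \<subseteq> Poly_Mapping.keys h \<union> (\<lambda>w. w \<circ> simple_refl r k) ` Poly_Mapping.keys h"
  proof
    fix w assume "w \<in> {w. ?f w \<noteq> 0}"
    then have "w \<in> Poly_Mapping.keys h \<or> w \<circ> simple_refl r k \<in> Poly_Mapping.keys h"
      by (auto simp: in_keys_iff split: if_splits)
    moreover have "w = (w \<circ> simple_refl r k) \<circ> simple_refl r k" using r by simp
    ultimately show "w \<in> Poly_Mapping.keys h \<union> (\<lambda>w. w \<circ> simple_refl r k) ` Poly_Mapping.keys h" by blast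
  qed
  then have "finite {w. ?f w \<noteq> 0}" by (rule finite_subset) simp
  from fun_cong[OF lookup_pm_of[OF this], of w] show ?thesis unfolding rop_def .
qed

lemma lookup_lsh: "Poly_Mapping.lookup (lsh m h) w = Poly_Mapping.lookup h (transl (- m) \<circ> w)"
proof -
  have "{w. Poly_Mapping.lookup h (transl (- m) \<circ> w) \<noteq> 0} \<subseteq> (\<lambda>w. transl m \<circ> w) ` Poly_Mapping.keys h"
  proof
    fix w assume "w \<in> {w. Poly_Mapping.lookup h (transl (- m) \<circ> w) \<noteq> 0}"
    then show "w \<in> (\<lambda>w. transl m \<circ> w) ` Poly_Mapping.keys h"
      by (intro image_eqI[of _ _ "transl (- m) \<circ> w"]) (auto simp: in_keys_iff fun_eq_iff)
  qed
  then have "finite {w. Poly_Mapping.lookup h (transl (- m) \<circ> w) \<noteq> 0}" by (rule finite_subset) simp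
  from fun_cong[OF lookup_pm_of[OF this], of w] show ?thesis unfolding lsh_def .
qed

lemma lookup_rsh: "Poly_Mapping.lookup (rsh m h) w = Poly_Mapping.lookup h (w \<circ> transl (- m))"
proof -
  have "{w. Poly_Mapping.lookup h (w \<circ> transl (- m)) \<noteq> 0} \<subseteq> (\<lambda>w. w \<circ> transl m) ` Poly_Mapping.keys h"
  proof
    fix w assume "w \<in> {w. Poly_Mapping.lookup h (w \<circ> transl (- m)) \<noteq> 0}"
    then show "w \<in> (\<lambda>w. w \<circ> transl m) ` Poly_Mapping.keys h"
      by (intro image_eqI[of _ _ "w \<circ> transl (- m)"]) (auto simp: in_keys_iff fun_eq_iff)
  qed
  then have "finite {w. Poly_Mapping.lookup h (w \<circ> transl (- m)) \<noteq> 0}" by (rule finite_subset) simp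
  from fun_cong[OF lookup_pm_of[OF this], of w] show ?thesis unfolding rsh_def .
qed

lemma op_linear:
  "r \<ge> 2 \<Longrightarrow> lop r k (x + y) = lop r k x + lop r k y" "r \<ge> 2 \<Longrightarrow> lop r k (smul c x) = smul c (lop r k x)"
  "r \<ge> 2 \<Longrightarrow> rop r k (x + y) = rop r k x + rop r k y" "r \<ge> 2 \<Longrightarrow> rop r k (smul c x) = smul c (rop r k x)"
  "lsh m (x + y) = lsh m x + lsh m y" "lsh m (smul c x) = smul c (lsh m x)"
  "rsh m (x + y) = rsh m x + rsh m y" "rsh m (smul c x) = smul c (rsh m x)"
  by (rule poly_mapping_eqI, simp add: lookup_lop lookup_rop lookup_lsh lookup_rsh lookup_add algebra_simps)+

lemma op_carrier:
  assumes x: "x \<in> hecke_carrier r"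
  shows "r \<ge> 2 \<Longrightarrow> lop r k x \<in> hecke_carrier r" "r \<ge> 2 \<Longrightarrow> rop r k x \<in> hecke_carrier r"
    "transl m \<in> aff_sym r \<Longrightarrow> lsh m x \<in> hecke_carrier r"
    "transl m \<in> aff_sym r \<Longrightarrow> rsh m x \<in> hecke_carrier r"
proof -
  have x0: "Poly_Mapping.lookup x w = 0" if "w \<notin> aff_sym r" for w using x that by (simp add: hecke_carrier_iff)
  have "simple_refl r k \<circ> w \<notin> aff_sym r" "w \<circ> simple_refl r k \<notin> aff_sym r" if "r \<ge> 2" "w \<notin> aff_sym r" for w
    using that aff_sym_comp[OF simple_refl_aff[OF that(1), of k], of "simple_refl r k \<circ> w"]
      aff_sym_comp[OF _ simple_refl_aff[OF that(1), of k], of "w \<circ> simple_refl r k"] by auto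
  then show "r \<ge> 2 \<Longrightarrow> lop r k x \<in> hecke_carrier r" "r \<ge> 2 \<Longrightarrow> rop r k x \<in> hecke_carrier r"
    using x0 by (auto simp: hecke_carrier_iff lookup_lop lookup_rop simp del: o_apply)
  have "transl (- m) \<circ> w \<notin> aff_sym r" "w \<circ> transl (- m) \<notin> aff_sym r" if "transl m \<in> aff_sym r" "w \<notin> aff_sym r" for w
  proof -
    have "w = transl m \<circ> (transl (- m) \<circ> w)" "w = (w \<circ> transl (- m)) \<circ> transl m" by (auto simp: fun_eq_iff)
    then show "transl (- m) \<circ> w \<notin> aff_sym r" "w \<circ> transl (- m) \<notin> aff_sym r"
      using that aff_sym_comp by metis+
  qed
  then show "transl m \<in> aff_sym r \<Longrightarrow> lsh m x \<in> hecke_carrier r"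
    "transl m \<in> aff_sym r \<Longrightarrow> rsh m x \<in> hecke_carrier r"
    using x0 by (auto simp: hecke_carrier_iff lookup_lsh lookup_rsh simp del: o_apply)
qed

lemma inv_refl_comp:
  assumes "r \<ge> 2" "w \<in> aff_sym r"
  shows "inv (simple_refl r k \<circ> w) x = inv w (simple_refl r k x)"
  using assms by (simp add: aff_sym_inv_comp[OF simple_refl_aff])

lemma lop_TT: assumes r: "r \<ge> 2" and w: "w \<in> aff_sym r" and up: "inv w k < inv w (k + 1)"
  shows "lop r k (TT w) = TT (simple_refl r k \<circ> w)"
proof (rule poly_mapping_eqI)
  fix v
  have *: "simple_refl r k \<circ> v = w \<longleftrightarrow> v = simple_refl r k \<circ> w" using r by (metis simple_refl_comp_self'(1))
  have dn: "\<not> inv (simple_refl r k \<circ> w) k < inv (simple_refl r k \<circ> w) (k + 1)"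
    unfolding inv_refl_comp[OF r w] using r up by simp
  have ne: "simple_refl r k \<circ> w \<noteq> w" using dn up by auto
  show "Poly_Mapping.lookup (lop r k (TT w)) v = Poly_Mapping.lookup (TT (simple_refl r k \<circ> w)) v"
    using dn up ne r by (auto simp: lookup_lop[OF r] lookup_TT * simp del: o_apply)
qed

lemma rop_TT: assumes r: "r \<ge> 2" and w: "w \<in> aff_sym r" and up: "w k < w (k + 1)"
  shows "rop r k (TT w) = TT (w \<circ> simple_refl r k)"
proof (rule poly_mapping_eqI)
  fix v
  have *: "v \<circ> simple_refl r k = w \<longleftrightarrow> v = w \<circ> simple_refl r k" using r by (metis simple_refl_comp_self'(2))
  have dn: "\<not> (w \<circ> simple_refl r k) k < (w \<circ> simple_refl r k) (k + 1)" using r up by simp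
  have ne: "w \<circ> simple_refl r k \<noteq> w" using dn up by metis
  show "Poly_Mapping.lookup (rop r k (TT w)) v = Poly_Mapping.lookup (TT (w \<circ> simple_refl r k)) v"
    using dn up ne r by (auto simp: lookup_rop[OF r] lookup_TT * simp del: o_apply)
qed

lemma lsh_TT: "lsh m (TT w) = TT (transl m \<circ> w)"
proof (rule poly_mapping_eqI)
  fix v
  have "transl (- m) \<circ> v = w \<longleftrightarrow> v = transl m \<circ> w" unfolding fun_eq_iff by (simp add: algebra_simps diff_eq_eq)
  then show "Poly_Mapping.lookup (lsh m (TT w)) v = Poly_Mapping.lookup (TT (transl m \<circ> w)) v"
    by (simp add: lookup_lsh lookup_TT del: o_apply)
qed

lemma rsh_TT: "rsh m (TT w) = TT (w \<circ> transl m)"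
proof (rule poly_mapping_eqI)
  fix v :: perm
  have "v \<circ> transl (- m) \<circ> transl m = v" "w \<circ> transl m \<circ> transl (- m) = w" by (auto simp: fun_eq_iff)
  then have "v \<circ> transl (- m) = w \<longleftrightarrow> v = w \<circ> transl m" by metis
  then show "Poly_Mapping.lookup (rsh m (TT w)) v = Poly_Mapping.lookup (TT (w \<circ> transl m)) v"
    by (simp add: lookup_rsh lookup_TT del: o_apply)
qed

text \<open>
  Right multiplication by \<open>s\<^sub>j\<close> reverses the places of \<open>k\<close> and \<open>k + 1\<close> only if it exchanges them, and
  then \<open>s\<^sub>k w = w s\<^sub>j\<close>.
\<close>

lemma left_ascent_right_mult:
  assumes r: "r \<ge> 2" and w: "w \<in> aff_sym r" and ne: "simple_refl r k \<circ> w \<noteq> w \<circ> simple_refl r j"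
  shows "inv (w \<circ> simple_refl r j) k < inv (w \<circ> simple_refl r j) (k + 1) \<longleftrightarrow> inv w k < inv w (k + 1)"
proof -
  have "inv (w \<circ> simple_refl r j) x = simple_refl r j (inv w x)" for x
    using aff_sym_inv_comp[OF w simple_refl_aff[OF r]] r by simp
  moreover have "simple_refl r j (inv w k) < simple_refl r j (inv w (k + 1)) \<longleftrightarrow> inv w k < inv w (k + 1)"
  proof (rule simple_refl_less_iff[OF r], rule notI)
    fix t assume t: "{inv w k, inv w (k + 1)} = {j + t * int r, j + 1 + t * int r}"
    have "simple_refl r k (w x) = w (simple_refl r j x)" for x
    proof -
      define p q where "p = inv w k" and "q = inv w (k + 1)"
      have wp: "w (p + s * int r) = k + s * int r" "w (q + s * int r) = k + 1 + s * int r" for s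
        using w by (simp_all add: p_def q_def aff_sym_shift[OF w])
      have pq: "p = j + t * int r \<and> q = j + 1 + t * int r \<or> q = j + t * int r \<and> p = j + 1 + t * int r"
        using t by (simp add: p_def q_def doubleton_eq_iff) blast
      have A: "j + s * int r = p + (s - t) * int r \<and> j + 1 + s * int r = q + (s - t) * int r
         \<or> j + s * int r = q + (s - t) * int r \<and> j + 1 + s * int r = p + (s - t) * int r" for s
        using pq by (auto simp: algebra_simps)
      show ?thesis
      proof (rule simple_refl_cases[OF r, of x j])
        fix s assume x: "x = j + s * int r" and sx: "simple_refl r j x = x + 1"
        have "simple_refl r j x = j + 1 + s * int r" using x sx by simp
        then show ?thesis using A[of s] wp[of "s - t"] x simple_refl_at[OF r, of k "s - t"] by auto
      next
        fix s assume x: "x = j + 1 + s * int r" and sx: "simple_refl r j x = x - 1"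
        have "simple_refl r j x = j + s * int r" using x sx by simp
        then show ?thesis using A[of s] wp[of "s - t"] x simple_refl_at[OF r, of k "s - t"] by auto
      next
        assume n: "\<And>t. x \<noteq> j + t * int r" "\<And>t. x \<noteq> j + 1 + t * int r" and "simple_refl r j x = x"
        moreover have "simple_refl r k (w x) = w x"
        proof (rule simple_refl_cases[OF r, of "w x" k])
          fix s assume "w x = k + s * int r"
          then have "x = p + s * int r" using wp(1)[of s] aff_sym_eq_iff[OF w] by metis
          then have "x = j + (s + t) * int r \<or> x = j + 1 + (s + t) * int r"
            using pq by (auto simp: algebra_simps)
          then show ?thesis using n by blast
        next
          fix s assume "w x = k + 1 + s * int r"
          then have "x = q + s * int r" using wp(2)[of s] aff_sym_eq_iff[OF w] by metis
          then have "x = j + (s + t) * int r \<or> x = j + 1 + (s + t) * int r"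
            using pq by (auto simp: algebra_simps)
          then show ?thesis using n by blast
        qed
        ultimately show ?thesis by simp
      qed
    qed
    then show False using ne by (auto simp: fun_eq_iff)
  qed
  ultimately show ?thesis by simp
qed

lemma right_ascent_left_mult:
  assumes r: "r \<ge> 2" and w: "w \<in> aff_sym r" and ne: "simple_refl r k \<circ> w \<noteq> w \<circ> simple_refl r j"
  shows "(simple_refl r k \<circ> w) j < (simple_refl r k \<circ> w) (j + 1) \<longleftrightarrow> w j < w (j + 1)"
proof -
  have "simple_refl r j \<circ> inv w \<noteq> inv w \<circ> simple_refl r k"
  proof
    assume "simple_refl r j \<circ> inv w = inv w \<circ> simple_refl r k"
    then have "w \<circ> (simple_refl r j \<circ> inv w) \<circ> w = w \<circ> (inv w \<circ> simple_refl r k) \<circ> w" by simp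
    then show False using ne w by (auto simp: fun_eq_iff)
  qed
  from left_ascent_right_mult[OF r aff_sym_inv[OF w] this]
  show ?thesis using w r by (simp add: aff_sym_inv_comp[OF aff_sym_inv[OF w] simple_refl_aff[OF r]])
qed

lemma ascents_agree:
  assumes r: "r \<ge> 2" and w: "w \<in> aff_sym r" and eq: "simple_refl r k \<circ> w = w \<circ> simple_refl r j"
  shows "inv w k < inv w (k + 1) \<longleftrightarrow> w j < w (j + 1)"
proof -
  have e: "simple_refl r k (w x) = w (simple_refl r j x)" for x using fun_cong[OF eq, of x] by simp
  have ij: "inv w (k + s * int r) = inv w k + s * int r" "inv w (k + 1 + s * int r) = inv w (k + 1) + s * int r" for s
    using aff_sym_shift[OF aff_sym_inv[OF w]] by auto
  have e1: "simple_refl r k (w j) = w (j + 1)" using e[of j] r by simp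
  have ne: "w j \<noteq> w (j + 1)" using aff_sym_eq_iff[OF w] by simp
  show ?thesis
  proof (rule simple_refl_cases[OF r, of "w j" k])
    fix t assume t: "w j = k + t * int r" "simple_refl r k (w j) = w j + 1"
    then have "w (j + 1) = k + 1 + t * int r" using e1 by simp
    then have "j + 1 = inv w (k + 1) + t * int r" "j = inv w k + t * int r"
      using t ij[of t] by (metis aff_sym_inv_left[OF w])+
    then show ?thesis using t e1 by simp
  next
    fix t assume t: "w j = k + 1 + t * int r" "simple_refl r k (w j) = w j - 1"
    then have "w (j + 1) = k + t * int r" using e1 by simp
    then have "j + 1 = inv w k + t * int r" "j = inv w (k + 1) + t * int r"
      using t ij[of t] by (metis aff_sym_inv_left[OF w])+
    then show ?thesis using t e1 by simp
  next
    assume "simple_refl r k (w j) = w j" then show ?thesis using e1 ne by simp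
  qed
qed

text \<open>
  At a permutation \<open>w\<close> with \<open>s\<^sub>k w \<noteq> w s\<^sub>j\<close> left and right ascents do not affect each other, and
  the two operators use independent coordinates. In the exceptional case \<open>w\<close> ascends on both sides
  or descends on both, so the two operators agree there.
\<close>

lemma lop_rop_commute:
  assumes r: "r \<ge> 2" and x: "x \<in> hecke_carrier r"
  shows "lop r k (rop r j x) = rop r j (lop r k x)"
proof (rule poly_mapping_eqI)
  fix w
  let ?s = "simple_refl r k" and ?t = "simple_refl r j"
  show "Poly_Mapping.lookup (lop r k (rop r j x)) w = Poly_Mapping.lookup (rop r j (lop r k x)) w"
  proof (cases "w \<in> aff_sym r")
    case False
    have "lop r k (rop r j x) \<in> hecke_carrier r" "rop r j (lop r k x) \<in> hecke_carrier r"
      using op_carrier r x by auto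
    then show ?thesis using False by (simp add: hecke_carrier_iff)
  next
    case w: True
    define a where "a \<longleftrightarrow> inv w k < inv w (k + 1)"
    define b where "b \<longleftrightarrow> w j < w (j + 1)"
    show ?thesis
    proof (cases "?s \<circ> w = w \<circ> ?t")
      case False
      note L = left_ascent_right_mult[OF r w False] and R = right_ascent_left_mult[OF r w False]
      show ?thesis
        unfolding lookup_lop[OF r] lookup_rop[OF r] L R a_def[symmetric] b_def[symmetric]
        by (cases a; cases b) (simp_all only: comp_assoc if_True if_False simp_thms, simp_all add: algebra_simps del: o_apply)
    next
      case True
      have ab: "b = a" using ascents_agree[OF r w True] by (simp add: a_def b_def)
      have na: "inv (w \<circ> ?t) k < inv (w \<circ> ?t) (k + 1) \<longleftrightarrow> \<not> a"
        unfolding True[symmetric] inv_refl_comp[OF r w] a_def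
        using r aff_sym_eq_iff[OF aff_sym_inv[OF w], of k "k + 1"] by (simp add: less_le_not_le) linarith
      have nb: "(w \<circ> ?t) j < (w \<circ> ?t) (j + 1) \<longleftrightarrow> \<not> a"
        unfolding ab[symmetric] b_def
        using r aff_sym_eq_iff[OF w, of j "j + 1"] by (simp add: less_le_not_le) linarith
      have e: "?s \<circ> (w \<circ> ?t) = w" "w \<circ> ?t \<circ> ?t = w" using True r by (metis simple_refl_comp_self'(1), simp)
      show ?thesis
        unfolding lookup_lop[OF r] lookup_rop[OF r] True na nb e a_def[symmetric] b_def[symmetric] ab
        by (cases a) (simp_all add: algebra_simps del: o_apply)
    qed
  qed
qed


text \<open>
  The algebra is realised on its own regular module: an operator that commutes with all right
  multiplications is determined by the image of \<open>T\<^sub>1\<close>, which can be any element.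
\<close>

definition right_linear :: "nat \<Rightarrow> (hecke \<Rightarrow> hecke) \<Rightarrow> bool" where
  "right_linear r F \<longleftrightarrow>
     (\<forall>x\<in>hecke_carrier r. F x \<in> hecke_carrier r) \<and>
     (\<forall>x\<in>hecke_carrier r. \<forall>y\<in>hecke_carrier r. F (x + y) = F x + F y) \<and>
     (\<forall>c. \<forall>x\<in>hecke_carrier r. F (smul c x) = smul c (F x)) \<and>
     (\<forall>k. \<forall>x\<in>hecke_carrier r. r \<ge> 2 \<longrightarrow> F (rop r k x) = rop r k (F x)) \<and>
     (\<forall>m. \<forall>x\<in>hecke_carrier r. transl m \<in> aff_sym r \<longrightarrow> F (rsh m x) = rsh m (F x))"

text \<open>Right multiplications by generators lead from \<open>T\<^sub>1\<close> to every basis element.\<close>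

lemma right_linear_unique:
  assumes F: "right_linear r F" and G: "right_linear r G" and eq: "F (TT id) = G (TT id)"
    and x: "x \<in> hecke_carrier r"
  shows "F x = G x"
  using x
proof (induction rule: hecke_induct)
  case zero
  have "F (smul 0 0) = G (smul 0 0)" using F G unfolding right_linear_def by (metis smul_simps(2) hecke_carrier_closed(1))
  then show ?case by simp
next
  case (TT w)
  then show ?case
  proof (induction rule: aff_sym_right_induct)
    case (transl m)
    have "F (rsh m (TT id)) = G (rsh m (TT id))"
      using F G eq transl unfolding right_linear_def by (metis aff_sym_id hecke_carrier_closed(4))
    then have "F (TT (transl m)) = G (TT (transl m))" by (simp add: rsh_TT)
    then show ?case .
  next
    case (refl k w)
    then have "F (rop r k (TT w)) = G (rop r k (TT w))"
      using F G unfolding right_linear_def by (metis hecke_carrier_closed(4))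
    then have "F (TT (w \<circ> simple_refl r k)) = G (TT (w \<circ> simple_refl r k))" using refl by (simp add: rop_TT)
    then show ?case .
  qed
qed (use F G in \<open>auto simp: right_linear_def\<close>)

lemma right_linear_lop: "r \<ge> 2 \<Longrightarrow> right_linear r (lop r k)"
proof -
  assume r: "r \<ge> 2"
  have "lop r k (rsh m x) = rsh m (lop r k x)" if "transl m \<in> aff_sym r" "x \<in> hecke_carrier r" for m x
  proof (rule poly_mapping_eqI)
    fix w
    show "Poly_Mapping.lookup (lop r k (rsh m x)) w = Poly_Mapping.lookup (rsh m (lop r k x)) w"
    proof (cases "w \<in> aff_sym r")
      case False
      have "lop r k (rsh m x) \<in> hecke_carrier r" "rsh m (lop r k x) \<in> hecke_carrier r"
        using that op_carrier r by auto
      then show ?thesis using False by (simp add: hecke_carrier_iff)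
    next
      case True
      have tm: "transl (- m) \<in> aff_sym r" using aff_sym_inv[OF that(1)] by (simp only: inv_transl)
      have "inv (w \<circ> transl (- m)) = transl m \<circ> inv w"
        using aff_sym_inv_comp[OF True tm] by (simp only: inv_transl minus_minus)
      then have "inv (w \<circ> transl (- m)) k < inv (w \<circ> transl (- m)) (k + 1) \<longleftrightarrow> inv w k < inv w (k + 1)"
        by simp
      then show ?thesis by (simp add: lookup_lop[OF r] lookup_rsh comp_assoc del: o_apply)
    qed
  qed
  then show ?thesis using r by (auto simp: right_linear_def op_linear op_carrier lop_rop_commute)
qed

lemma right_linear_lsh: assumes "transl m \<in> aff_sym r" shows "right_linear r (lsh m)"
proof -
  have "lsh m (rop r k x) = rop r k (lsh m x)" if "r \<ge> 2" for k x
    by (rule poly_mapping_eqI) (simp add: lookup_lsh lookup_rop[OF that] comp_assoc del: o_apply, simp)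
  moreover have "lsh m (rsh m' x) = rsh m' (lsh m x)" for m' x
    by (rule poly_mapping_eqI) (simp add: lookup_lsh lookup_rsh comp_assoc del: o_apply)
  ultimately show ?thesis using assms by (simp add: right_linear_def op_linear op_carrier)
qed

lemma right_linear_comp:
  "right_linear r F \<Longrightarrow> right_linear r G \<Longrightarrow> right_linear r (\<lambda>x. F (G x))"
  by (simp add: right_linear_def)

lemma right_linear_add:
  "right_linear r F \<Longrightarrow> right_linear r G \<Longrightarrow> right_linear r (\<lambda>x. F x + G x)"
  by (simp add: right_linear_def op_linear algebra_simps)

lemma right_linear_smul: "right_linear r F \<Longrightarrow> right_linear r (\<lambda>x. smul c (F x))"
  by (simp add: right_linear_def op_linear algebra_simps)

lemma op_0: "r \<ge> 2 \<Longrightarrow> rop r k 0 = 0" "rsh m 0 = 0"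
  using op_linear(4)[of r k 0 0] op_linear(8)[of m 0 0] by simp_all

text \<open>
  For a basis element compose the left multiplications along a reduced word; they commute with
  the right multiplications.
\<close>

lemma right_linear_exists:
  assumes x: "x \<in> hecke_carrier r"
  shows "\<exists>F. right_linear r F \<and> F (TT id) = x"
  using x
proof (induction rule: hecke_induct)
  case zero
  show ?case by (intro exI[of _ "\<lambda>x. 0"]) (simp add: right_linear_def op_0)
next
  case (add x y)
  then obtain F G where "right_linear r F" "right_linear r G" "F (TT id) = x" "G (TT id) = y" by blast
  then have "right_linear r (\<lambda>z. F z + G z) \<and> F (TT id) + G (TT id) = x + y" by (simp add: right_linear_add)
  then show ?case by blast
next
  case (smul c x)
  then obtain F where "right_linear r F" "F (TT id) = x" by blast
  then have "right_linear r (\<lambda>z. smul c (F z)) \<and> smul c (F (TT id)) = smul c x" by (simp add: right_linear_smul)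
  then show ?case by blast
next
  case (TT w)
  then show ?case
  proof (induction rule: aff_sym_left_induct)
    case (transl m)
    then have "right_linear r (lsh m) \<and> lsh m (TT id) = TT (transl m)" by (simp add: right_linear_lsh lsh_TT)
    then show ?case by blast
  next
    case (refl k w)
    then obtain F where F: "right_linear r F" "F (TT id) = TT w" by blast
    have "right_linear r (\<lambda>x. lop r k (F x))" 
      by (rule right_linear_comp[OF right_linear_lop[OF refl(1)] F(1)])
    moreover have "lop r k (F (TT id)) = TT (simple_refl r k \<circ> w)" using lop_TT refl F by simp
    ultimately show ?case by blast
  qed
qed

definition left_mult :: "nat \<Rightarrow> hecke \<Rightarrow> hecke \<Rightarrow> hecke" where
  "left_mult r x = (SOME F. right_linear r F \<and> F (TT id) = x)"

definition hecke_prod :: "nat \<Rightarrow> hecke \<Rightarrow> hecke \<Rightarrow> hecke" where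
  "hecke_prod r x y = (if x \<in> hecke_carrier r \<and> y \<in> hecke_carrier r then left_mult r x y else 0)"

lemma left_mult:
  assumes "x \<in> hecke_carrier r" shows "right_linear r (left_mult r x)" "left_mult r x (TT id) = x"
  using someI_ex[OF right_linear_exists[OF assms]] by (auto simp: left_mult_def)

lemma left_mult_eqI:
  assumes "x \<in> hecke_carrier r" "right_linear r F" "F (TT id) = x" "y \<in> hecke_carrier r"
  shows "left_mult r x y = F y"
  using right_linear_unique[OF left_mult(1)[OF assms(1)] assms(2)] assms left_mult(2) by simp

lemma hecke_prod_rop:
  assumes x: "x \<in> hecke_carrier r" and r: "r \<ge> 2"
  shows "hecke_prod r x (TT (simple_refl r k)) = rop r k x"
proof -
  have i: "TT id \<in> hecke_carrier r" by simp
  have "TT (simple_refl r k) = rop r k (TT id)" using rop_TT[OF r aff_sym_id, of k] by simp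
  moreover have "left_mult r x (rop r k (TT id)) = rop r k (left_mult r x (TT id))"
    using left_mult(1)[OF x] r i unfolding right_linear_def by blast
  moreover have "TT (simple_refl r k) \<in> hecke_carrier r" using r by (simp add: simple_refl_aff)
  ultimately show ?thesis using x left_mult(2)[OF x] by (simp add: hecke_prod_def)
qed

lemma hecke_prod_rsh:
  assumes x: "x \<in> hecke_carrier r" and m: "transl m \<in> aff_sym r"
  shows "hecke_prod r x (TT (transl m)) = rsh m x"
proof -
  have i: "TT id \<in> hecke_carrier r" by simp
  have "TT (transl m) = rsh m (TT id)" by (simp add: rsh_TT)
  moreover have "left_mult r x (rsh m (TT id)) = rsh m (left_mult r x (TT id))"
    using left_mult(1)[OF x] m i unfolding right_linear_def by blast
  moreover have "TT (transl m) \<in> hecke_carrier r" using m by simp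
  ultimately show ?thesis using x left_mult(2)[OF x] by (simp add: hecke_prod_def)
qed

lemma hecke_prod_lop:
  assumes x: "x \<in> hecke_carrier r" and r: "r \<ge> 2"
  shows "hecke_prod r (TT (simple_refl r k)) x = lop r k x"
  using x r left_mult_eqI[OF _ right_linear_lop[OF r] _ x, of "TT (simple_refl r k)" k]
    lop_TT[OF r aff_sym_id, of k]
  by (simp add: hecke_prod_def simple_refl_aff)

lemma hecke_prod_lsh:
  assumes x: "x \<in> hecke_carrier r" and m: "transl m \<in> aff_sym r"
  shows "hecke_prod r (TT (transl m)) x = lsh m x"
  using x m left_mult_eqI[OF _ right_linear_lsh[OF m] _ x, of "TT (transl m)"]
  by (simp add: hecke_prod_def lsh_TT)

lemma hecke_prod_carrier: "hecke_prod r x y \<in> hecke_carrier r"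
  using left_mult(1)[of x r] by (simp add: hecke_prod_def right_linear_def)

lemma hecke_prod_assoc:
  assumes x: "x \<in> hecke_carrier r" and y: "y \<in> hecke_carrier r" and z: "z \<in> hecke_carrier r"
  shows "hecke_prod r (hecke_prod r x y) z = hecke_prod r x (hecke_prod r y z)"
proof -
  have "left_mult r (hecke_prod r x y) z = left_mult r x (left_mult r y z)"
    using x y left_mult(2)[OF y]
    by (intro left_mult_eqI[OF _ right_linear_comp[OF left_mult(1)[OF x] left_mult(1)[OF y]] _ z] hecke_prod_carrier)
       (simp add: hecke_prod_def)
  then show ?thesis using x y z hecke_prod_carrier[of r x y] hecke_prod_carrier[of r y z]
    by (simp add: hecke_prod_def)
qed

text \<open>
  Move the letters of a reduced word of the second factor to the first one by one. Subadditivity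
  of the number of inversions shows that the first factor ascends at every letter.
\<close>

lemma hecke_prod_length_additive:
  assumes u: "u \<in> aff_sym r" and w: "w \<in> aff_sym r" and l: "ninv r (w \<circ> u) = ninv r w + ninv r u"
  shows "hecke_prod r (TT w) (TT u) = TT (w \<circ> u)"
  using u w l
proof (induction arbitrary: w rule: aff_sym_left_induct)
  case (transl m)
  then have "hecke_prod r (TT w) (TT (transl m)) = TT (w \<circ> transl m)" by (simp add: hecke_prod_rsh rsh_TT)
  then show ?case .
next
  case (refl k u)
  note r = refl(1) note s = simple_refl_aff[OF r, of k]
  let ?s = "simple_refl r k"
  have up: "ninv r (?s \<circ> u) = ninv r u + 1" by (rule ninv_simple_refl_up[OF r refl(2,3)])
  have "ninv r (w \<circ> ?s \<circ> u) \<le> ninv r (w \<circ> ?s) + ninv r u"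
    by (intro ninv_comp_le aff_sym_comp s refl)
  moreover have l: "ninv r (w \<circ> (?s \<circ> u)) = ninv r w + ninv r (?s \<circ> u)" using refl.prems(2) .
  ultimately have ge: "ninv r (w \<circ> ?s) \<ge> ninv r w + 1" using up by (simp add: comp_assoc)
  have wk: "w k < w (k + 1)"
  proof (rule ccontr)
    assume "\<not> w k < w (k + 1)"
    then have "w (k + 1) < w k" using aff_sym_eq_iff[OF refl.prems(1), of k "k + 1"] by linarith
    then show False using ninv_simple_refl_right_down[OF r refl.prems(1), of k] ge by simp
  qed
  note ws = ninv_simple_refl_right_up[OF r refl.prems(1) wk]
  have eq: "ninv r (w \<circ> ?s \<circ> u) = ninv r (w \<circ> ?s) + ninv r u" using l up ws by (simp add: comp_assoc)
  have "hecke_prod r (TT ?s) (TT u) = TT (?s \<circ> u)"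
    using lop_TT[OF r refl(2,3)] hecke_prod_lop[OF _ r, of "TT u" k] refl(2) by simp
  then have "hecke_prod r (TT w) (TT (?s \<circ> u)) = hecke_prod r (TT w) (hecke_prod r (TT ?s) (TT u))" by simp
  also have "\<dots> = hecke_prod r (hecke_prod r (TT w) (TT ?s)) (TT u)"
    using refl s by (simp add: hecke_prod_assoc)
  also have "hecke_prod r (TT w) (TT ?s) = TT (w \<circ> ?s)"
    using hecke_prod_rop[OF _ r, of "TT w" k] rop_TT[OF r refl.prems(1) wk] refl.prems by simp
  also have "hecke_prod r (TT (w \<circ> ?s)) (TT u) = TT (w \<circ> ?s \<circ> u)"
    by (rule refl.IH[OF aff_sym_comp[OF refl.prems(1) s] eq])
  finally have "hecke_prod r (TT w) (TT (?s \<circ> u)) = TT (w \<circ> ?s \<circ> u)" .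
  then have "hecke_prod r (TT w) (TT (?s \<circ> u)) = TT (w \<circ> (?s \<circ> u))" by (simp only: comp_assoc)
  then show ?case .
qed

lemma hecke_prod_is_hecke_product: "is_hecke_product r (hecke_prod r)"
proof -
  let ?H = "hecke_carrier r" and ?m = "hecke_prod r"
  have add1: "?m (x + y) z = ?m x z + ?m y z" if "x \<in> ?H" "y \<in> ?H" "z \<in> ?H" for x y z
  proof -
    have "left_mult r (x + y) z = left_mult r x z + left_mult r y z"
      using that by (intro left_mult_eqI[OF _ right_linear_add[OF left_mult(1)[OF that(1)] left_mult(1)[OF that(2)]]])
        (auto simp: left_mult)
    then show ?thesis using that by (simp add: hecke_prod_def)
  qed
  have add2: "?m x (y + z) = ?m x y + ?m x z" if "x \<in> ?H" "y \<in> ?H" "z \<in> ?H" for x y z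
    using that left_mult(1)[OF that(1)] by (simp add: hecke_prod_def right_linear_def)
  have smul1: "?m (smul c x) y = smul c (?m x y)" if "x \<in> ?H" "y \<in> ?H" for c x y
  proof -
    have "left_mult r (smul c x) y = smul c (left_mult r x y)"
      using that by (intro left_mult_eqI[OF _ right_linear_smul[OF left_mult(1)[OF that(1)]]]) (auto simp: left_mult)
    then show ?thesis using that by (simp add: hecke_prod_def)
  qed
  have smul2: "?m x (smul c y) = smul c (?m x y)" if "x \<in> ?H" "y \<in> ?H" for c x y
    using that left_mult(1)[OF that(1)] by (simp add: hecke_prod_def right_linear_def)
  have unit: "?m (TT id) x = x" "?m x (TT id) = x" if "x \<in> ?H" for x
  proof -
    have "right_linear r (\<lambda>x. x)" by (simp add: right_linear_def)
    then have "left_mult r (TT id) x = x" using that by (intro left_mult_eqI) auto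
    then show "?m (TT id) x = x" "?m x (TT id) = x" using that left_mult(2)[OF that] by (auto simp: hecke_prod_def)
  qed
  have quad: "?m (TT s) (TT s) = smul (qq - 1) (TT s) + smul qq (TT id)" if sr: "s \<in> simple_refls r" for s
  proof -
    obtain k where r: "r \<ge> 2" and s: "s = simple_refl r k" using sr simple_refls_iff[of s r] by blast
    note sa = simple_refl_aff[OF r, of k]
    have *: "simple_refl r k \<circ> w = simple_refl r k \<longleftrightarrow> w = id" "simple_refl r k \<circ> w = id \<longleftrightarrow> w = simple_refl r k" for w
      using r by (metis simple_refl_comp_self'(1) simple_refl_comp_self comp_id)+
    have ne: "simple_refl r k \<noteq> id"
    proof
      assume "simple_refl r k = id"
      then have "simple_refl r k k = k" by (simp only: id_apply)
      then show False using r by simp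
    qed
    have "?m (TT s) (TT s) = lop r k (TT (simple_refl r k))"
      using hecke_prod_lop[OF _ r] sa s by simp
    also have "\<dots> = smul (qq - 1) (TT s) + smul qq (TT id)"
    proof (rule poly_mapping_eqI)
      fix w
      show "Poly_Mapping.lookup (lop r k (TT (simple_refl r k))) w =
          Poly_Mapping.lookup (smul (qq - 1) (TT s) + smul qq (TT id)) w"
        using r ne ne[symmetric] by (auto simp: lookup_lop[OF r] lookup_TT lookup_add * s simp del: o_apply)
    qed
    finally show ?thesis .
  qed
  show ?thesis unfolding is_hecke_product_def Let_def
    using hecke_prod_carrier hecke_prod_assoc add1 add2 smul1 smul2 unit quad
    by (auto simp: aff_length_eq_ninv aff_sym_comp hecke_prod_length_additive)
       (auto simp: hecke_prod_def)
qed

text \<open>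
  Conversely the relations determine right multiplication by each generator, hence the product.
\<close>

lemma is_hecke_product_unique:
  assumes m: "is_hecke_product r m" shows "m = hecke_prod r"
proof -
  let ?H = "hecke_carrier r"
  note M = m[unfolded is_hecke_product_def Let_def]
  have off: "x \<notin> ?H \<or> y \<notin> ?H \<Longrightarrow> m x y = 0" and cl: "x \<in> ?H \<Longrightarrow> y \<in> ?H \<Longrightarrow> m x y \<in> ?H"
    and ad: "x \<in> ?H \<Longrightarrow> y \<in> ?H \<Longrightarrow> z \<in> ?H \<Longrightarrow> m (x + y) z = m x z + m y z \<and> m x (y + z) = m x y + m x z"
    and sc: "x \<in> ?H \<Longrightarrow> y \<in> ?H \<Longrightarrow> m (smul c x) y = smul c (m x y) \<and> m x (smul c y) = smul c (m x y)"
    and as: "x \<in> ?H \<Longrightarrow> y \<in> ?H \<Longrightarrow> z \<in> ?H \<Longrightarrow> m (m x y) z = m x (m y z)"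
    and un: "x \<in> ?H \<Longrightarrow> m (TT id) x = x \<and> m x (TT id) = x" for x y z c
    using M by blast+
  have qd: "r \<ge> 2 \<Longrightarrow> m (TT (simple_refl r k)) (TT (simple_refl r k)) =
      smul (qq - 1) (TT (simple_refl r k)) + smul qq (TT id)" for k
    using M simple_refls_iff by blast
  have le: "m (TT w) (TT u) = TT (w \<circ> u)"
    if "w \<in> aff_sym r" "u \<in> aff_sym r" "ninv r (w \<circ> u) = ninv r w + ninv r u" for w u
    using M that by (simp add: aff_length_eq_ninv aff_sym_comp)
  have z: "m 0 y = 0" "m x 0 = 0" for x y
    using sc[of 0 y 0] sc[of x 0 0] off[of 0 y] off[of x 0] by fastforce+
  have ms: "m x (TT (simple_refl r k)) = rop r k x" if r: "r \<ge> 2" and x: "x \<in> ?H" for k x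
    using x
  proof (induction rule: hecke_induct)
    case zero then show ?case using z op_0 r by simp
  next
    case (add x y) then show ?case using ad[of x y "TT (simple_refl r k)"] r by (simp add: op_linear simple_refl_aff)
  next
    case (smul c x) then show ?case using sc[of x "TT (simple_refl r k)" c] r by (simp add: op_linear simple_refl_aff)
  next
    case (TT w)
    let ?s = "simple_refl r k"
    note s = simple_refl_aff[OF r, of k]
    show ?case
    proof (cases "w k < w (k + 1)")
      case True
      have s1: "ninv r ?s = 1" using ninv_simple_refl_up[OF r aff_sym_id, of k] by simp
      have "ninv r (w \<circ> ?s) = ninv r w + ninv r ?s"
        using ninv_simple_refl_right_up[OF r TT True] s1 by simp
      then show ?thesis using le[OF TT s] rop_TT[OF r TT True] by simp
    next
      case False
      have s1: "ninv r ?s = 1" using ninv_simple_refl_up[OF r aff_sym_id, of k] by simp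
      (* At a descent write w = u s; associativity and the quadratic relation for s then give the
         value. *)
      define u where "u = w \<circ> ?s"
      have u: "u \<in> aff_sym r" using TT s by (simp add: u_def aff_sym_comp)
      have up: "u k < u (k + 1)" using False r aff_sym_eq_iff[OF TT, of k "k + 1"] by (simp add: u_def)
      have w: "w = u \<circ> ?s" using r by (simp add: u_def)
      have mu: "m (TT u) (TT ?s) = TT w"
        using le[OF u s] ninv_simple_refl_right_up[OF r u up] s1 by (simp add: w)
      have "m (TT w) (TT ?s) = m (TT u) (m (TT ?s) (TT ?s))" using mu as[of "TT u" "TT ?s" "TT ?s"] u s by simp
      also have "\<dots> = smul (qq - 1) (TT w) + smul qq (TT u)"
        unfolding qd[OF r] using u s mu un[of "TT u"] ad[of "TT u" "smul (qq - 1) (TT ?s)" "smul qq (TT id)"]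
          sc[of "TT u" "TT ?s" "qq - 1"] sc[of "TT u" "TT id" qq] by simp
      also have "\<dots> = rop r k (TT w)"
      proof (rule poly_mapping_eqI)
        fix v
        have *: "v \<circ> ?s = w \<longleftrightarrow> v = u" using r by (metis simple_refl_comp_self'(2) u_def)
        have ne: "u \<noteq> w" using up False by auto
        show "Poly_Mapping.lookup (smul (qq - 1) (TT w) + smul qq (TT u)) v = Poly_Mapping.lookup (rop r k (TT w)) v"
          using up False ne by (auto simp: lookup_rop[OF r] lookup_TT lookup_add * simp del: o_apply)
      qed
      finally show ?thesis .
    qed
  qed
  have mt: "m x (TT (transl t)) = rsh t x" if t: "transl t \<in> aff_sym r" and x: "x \<in> ?H" for t x
    using x
  proof (induction rule: hecke_induct)
    case zero
    have "m 0 (TT (transl t)) = rsh t 0" using z op_0 by simp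
    then show ?case .
  next
    case (add x y)
    have "m x (TT (transl t)) = rsh t x" "m y (TT (transl t)) = rsh t y" using add.IH .
    then have "m (x + y) (TT (transl t)) = rsh t (x + y)"
      using add.hyps ad[of x y "TT (transl t)"] t by (simp add: op_linear)
    then show ?case .
  next
    case (smul c x)
    have "m x (TT (transl t)) = rsh t x" using smul.IH .
    then have "m (smul c x) (TT (transl t)) = rsh t (smul c x)"
      using smul.hyps sc[of x "TT (transl t)" c] t by (simp add: op_linear)
    then show ?case .
  next
    case (TT w)
    have "ninv r (w \<circ> transl t) = ninv r w + ninv r (transl t)"
    proof (cases "r = 0")
      case True then show ?thesis using t by simp
    next
      case False then show ?thesis using TT by simp
    qed
    then have "m (TT w) (TT (transl t)) = rsh t (TT w)" using le[OF TT t] by (simp add: rsh_TT)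
    then show ?case .
  qed
  have basis: "m x (TT w) = hecke_prod r x (TT w)" if "w \<in> aff_sym r" "x \<in> ?H" for x w
    using that
  proof (induction arbitrary: x rule: aff_sym_left_induct)
    case (transl t)
    then have "m x (TT (transl t)) = hecke_prod r x (TT (transl t))" by (simp add: mt hecke_prod_rsh)
    then show ?case .
  next
    case (refl k w)
    let ?s = "simple_refl r k"
    note s = simple_refl_aff[OF refl(1), of k]
    have s1: "ninv r ?s = 1" using ninv_simple_refl_up[OF refl(1) aff_sym_id, of k] by simp
    have l: "ninv r (?s \<circ> w) = ninv r ?s + ninv r w" using ninv_simple_refl_up[OF refl(1-3)] s1 by simp
    have "m x (TT (?s \<circ> w)) = m (m x (TT ?s)) (TT w)"
      using le[OF s refl(2) l] as[of x "TT ?s" "TT w"] s refl by simp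
    also have "\<dots> = hecke_prod r (hecke_prod r x (TT ?s)) (TT w)"
      using refl by (simp add: ms hecke_prod_rop op_carrier)
    also have "\<dots> = hecke_prod r x (TT (?s \<circ> w))"
      using hecke_prod_length_additive[OF refl(2) s l] hecke_prod_assoc[of x r "TT ?s" "TT w"] s refl by simp
    finally show ?case .
  qed
  have "m x y = hecke_prod r x y" if "y \<in> ?H" "x \<in> ?H" for x y
    using that
  proof (induction rule: hecke_induct)
    case zero
    have "left_mult r x (smul 0 0) = smul 0 (left_mult r x 0)"
      using left_mult(1)[OF that(2)] unfolding right_linear_def by blast
    then show ?case using z by (simp add: hecke_prod_def)
  next
    case (add y y')
    then show ?case using ad[of x y y'] left_mult(1)[of x r] by (simp add: hecke_prod_def right_linear_def)
  next
    case (smul c y)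
    then show ?case using sc[of x y c] left_mult(1)[of x r] by (simp add: hecke_prod_def right_linear_def)
  next
    case (TT w) then show ?case by (rule basis)
  qed
  then show ?thesis using off by (auto simp: fun_eq_iff hecke_prod_def)
qed

lemma hmult_eq: "hmult r = hecke_prod r"
  unfolding hmult_def by (rule the_equality) (auto intro: hecke_prod_is_hecke_product is_hecke_product_unique)

lemmas hmult_rop = hecke_prod_rop[folded hmult_eq] and hmult_rsh = hecke_prod_rsh[folded hmult_eq]
  and hmult_lop = hecke_prod_lop[folded hmult_eq] and hmult_lsh = hecke_prod_lsh[folded hmult_eq]
  and hmult_carrier = hecke_prod_carrier[folded hmult_eq] and hmult_assoc = hecke_prod_assoc[folded hmult_eq]
  and hmult_TT = hecke_prod_length_additive[folded hmult_eq]

lemma hmult_is_product: "is_hecke_product r (hmult r)"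
  by (simp add: hmult_eq hecke_prod_is_hecke_product)

lemma hmult_bilinear:
  "x \<in> hecke_carrier r \<Longrightarrow> y \<in> hecke_carrier r \<Longrightarrow> z \<in> hecke_carrier r \<Longrightarrow> hmult r (x + y) z = hmult r x z + hmult r y z"
  "x \<in> hecke_carrier r \<Longrightarrow> y \<in> hecke_carrier r \<Longrightarrow> z \<in> hecke_carrier r \<Longrightarrow> hmult r x (y + z) = hmult r x y + hmult r x z"
  "x \<in> hecke_carrier r \<Longrightarrow> y \<in> hecke_carrier r \<Longrightarrow> hmult r (smul c x) y = smul c (hmult r x y)"
  "x \<in> hecke_carrier r \<Longrightarrow> y \<in> hecke_carrier r \<Longrightarrow> hmult r x (smul c y) = smul c (hmult r x y)"
  using hmult_is_product[of r] unfolding is_hecke_product_def Let_def by blast+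

lemma hmult_unit: "x \<in> hecke_carrier r \<Longrightarrow> hmult r (TT id) x = x" "x \<in> hecke_carrier r \<Longrightarrow> hmult r x (TT id) = x"
  using hmult_is_product[of r] unfolding is_hecke_product_def Let_def by blast+

lemma hmult_zero [simp]: "hmult r 0 y = 0" "hmult r x 0 = 0"
proof -
  have off: "x \<notin> hecke_carrier r \<or> y \<notin> hecke_carrier r \<Longrightarrow> hmult r x y = 0" for x y
    using hmult_is_product[of r] unfolding is_hecke_product_def Let_def by blast
  show "hmult r 0 y = 0"
    using hmult_bilinear(3)[of 0 r y 0] off[of 0 y] by (cases "y \<in> hecke_carrier r") auto
  show "hmult r x 0 = 0"
    using hmult_bilinear(4)[of x r 0 0] off[of x 0] by (cases "x \<in> hecke_carrier r") auto
qed

lemma hmult_sum_left: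
  assumes "\<And>i. i \<in> I \<Longrightarrow> f i \<in> hecke_carrier r" "y \<in> hecke_carrier r"
  shows "hmult r (sum f I) y = (\<Sum>i\<in>I. hmult r (f i) y)"
  using assms(1)
  by (induction I rule: infinite_finite_induct) (simp_all add: hmult_bilinear(1)[OF _ _ assms(2)] hecke_carrier_sum)

lemma hmult_sum_right:
  assumes "\<And>i. i \<in> I \<Longrightarrow> f i \<in> hecke_carrier r" "y \<in> hecke_carrier r"
  shows "hmult r y (sum f I) = (\<Sum>i\<in>I. hmult r y (f i))"
  using assms(1)
  by (induction I rule: infinite_finite_induct) (simp_all add: hmult_bilinear(2)[OF assms(2)] hecke_carrier_sum)

section \<open>Specialisation at one\<close>

lemma at_one_eq_sum: "finite K \<Longrightarrow> Poly_Mapping.keys p \<subseteq> K \<Longrightarrow> at_one p = sum (Poly_Mapping.lookup p) K"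
  unfolding at_one_def by (rule sum.mono_neutral_left) (auto simp: in_keys_iff)

lemma at_one_add: "at_one (p + q) = at_one p + at_one q"
proof -
  let ?K = "Poly_Mapping.keys p \<union> Poly_Mapping.keys q"
  have "at_one (p + q) = sum (Poly_Mapping.lookup (p + q)) ?K" by (rule at_one_eq_sum) (simp_all add: keys_add)
  also have "\<dots> = sum (Poly_Mapping.lookup p) ?K + sum (Poly_Mapping.lookup q) ?K"
    by (simp add: lookup_add sum.distrib)
  also have "\<dots> = at_one p + at_one q" using at_one_eq_sum[of ?K p] at_one_eq_sum[of ?K q] by simp
  finally show ?thesis .
qed

lemma at_one_0 [simp]: "at_one 0 = 0" by (simp add: at_one_def)

lemma at_one_single [simp]: "at_one (Poly_Mapping.single k c) = c"
  by (simp add: at_one_def)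

lemma at_one_1 [simp]: "at_one 1 = 1"
  unfolding single_one[symmetric] by (rule at_one_single)

lemma at_one_vpow [simp]: "at_one (vpow k) = 1"
  by (simp add: vpow_def)

lemma at_one_sum: "at_one (sum f I) = (\<Sum>i\<in>I. at_one (f i))"
  by (induction I rule: infinite_finite_induct) (auto simp: at_one_add)

lemma at_one_diff: "at_one (p - q) = at_one p - at_one q"
  using at_one_add[of "p - q" q] by simp

lemma sum_monomials:
  "(\<Sum>k\<in>Poly_Mapping.keys p. Poly_Mapping.single k (Poly_Mapping.lookup p k)) = p"
proof (rule poly_mapping_eqI)
  fix j
  have "Poly_Mapping.lookup (\<Sum>k\<in>Poly_Mapping.keys p. Poly_Mapping.single k (Poly_Mapping.lookup p k)) j
     = (\<Sum>k\<in>Poly_Mapping.keys p. if k = j then Poly_Mapping.lookup p k else 0)"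
    by (simp add: lookup_sum lookup_single when_def)
  also have "\<dots> = Poly_Mapping.lookup p j" by (simp add: in_keys_iff)
  finally show "Poly_Mapping.lookup (\<Sum>k\<in>Poly_Mapping.keys p. Poly_Mapping.single k (Poly_Mapping.lookup p k)) j
     = Poly_Mapping.lookup p j" .
qed

lemma at_one_mult: "at_one (p * q) = at_one p * at_one q"
proof -
  let ?s = "\<lambda>p. \<Sum>k\<in>Poly_Mapping.keys p. Poly_Mapping.single k (Poly_Mapping.lookup p k)"
  have "p * q = ?s p * ?s q" by (simp only: sum_monomials)
  also have "\<dots> = (\<Sum>k\<in>Poly_Mapping.keys p. \<Sum>l\<in>Poly_Mapping.keys q.
      Poly_Mapping.single (k + l) (Poly_Mapping.lookup p k * Poly_Mapping.lookup q l))"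
    by (simp add: sum_product mult_single)
  finally have "at_one (p * q) = (\<Sum>k\<in>Poly_Mapping.keys p. \<Sum>l\<in>Poly_Mapping.keys q.
      Poly_Mapping.lookup p k * Poly_Mapping.lookup q l)" by (simp only: at_one_sum at_one_single)
  then show ?thesis by (simp add: at_one_def sum_product)
qed

text \<open>At \<open>v = 1\<close> the Hecke algebra becomes the group algebra.\<close>

lemma at_one_hmult_TT:
  assumes "u \<in> aff_sym r" "y \<in> hecke_carrier r"
  shows "at_one (Poly_Mapping.lookup (hmult r (TT u) y) w) = at_one (Poly_Mapping.lookup y (inv u \<circ> w))"
  using assms(1)
proof (induction arbitrary: w rule: aff_sym_left_induct)
  case (transl m)
  have "at_one (Poly_Mapping.lookup (hmult r (TT (transl m)) y) w) = at_one (Poly_Mapping.lookup y (inv (transl m) \<circ> w))"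
    unfolding inv_transl hmult_lsh[OF assms(2) transl] lookup_lsh ..
  then show ?case .
next
  case (refl k u)
  let ?s = "simple_refl r k"
  note s = simple_refl_aff[OF refl(1), of k]
  have "ninv r ?s = 1" using ninv_simple_refl_up[OF refl(1) aff_sym_id, of k] by simp
  then have "TT (?s \<circ> u) = hmult r (TT ?s) (TT u)"
    using hmult_TT[OF refl(2) s] ninv_simple_refl_up[OF refl(1-3)] by simp
  then have "hmult r (TT (?s \<circ> u)) y = lop r k (hmult r (TT u) y)"
    using hmult_assoc[of "TT ?s" r "TT u" y] hmult_lop[OF hmult_carrier refl(1)] s refl(2) assms(2) by simp
  then have "at_one (Poly_Mapping.lookup (hmult r (TT (?s \<circ> u)) y) w)
      = at_one (Poly_Mapping.lookup (hmult r (TT u) y) (?s \<circ> w))"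
    by (simp add: lookup_lop[OF refl(1)] at_one_mult at_one_add at_one_diff del: o_apply)
  also have "\<dots> = at_one (Poly_Mapping.lookup y (inv u \<circ> (?s \<circ> w)))" by (rule refl.IH)
  also have "inv u \<circ> (?s \<circ> w) = inv (?s \<circ> u) \<circ> w"
    unfolding aff_sym_inv_comp[OF s refl(2)] inv_simple_refl[OF refl(1)] by (simp only: comp_assoc)
  finally show ?case .
qed

lemma at_one_hmult:
  assumes x: "x \<in> hecke_carrier r" and y: "y \<in> hecke_carrier r"
  shows "at_one (Poly_Mapping.lookup (hmult r x y) w) =
    (\<Sum>u\<in>Poly_Mapping.keys x. at_one (Poly_Mapping.lookup x u) * at_one (Poly_Mapping.lookup y (inv u \<circ> w)))"
proof -
  have k: "u \<in> aff_sym r" if "u \<in> Poly_Mapping.keys x" for u using x that by (auto simp: hecke_carrier_def)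
  have "hmult r x y = hmult r (\<Sum>u\<in>Poly_Mapping.keys x. smul (Poly_Mapping.lookup x u) (TT u)) y"
    by (simp only: hecke_expansion[of x, symmetric])
  also have "\<dots> = (\<Sum>u\<in>Poly_Mapping.keys x. smul (Poly_Mapping.lookup x u) (hmult r (TT u) y))"
    using k y by (subst hmult_sum_left) (auto simp: hmult_bilinear intro!: sum.cong)
  finally show ?thesis using k y
    by (simp add: lookup_sum at_one_sum at_one_mult at_one_hmult_TT del: o_apply)
qed

section \<open>Blocks and Young subgroups\<close>

definition block_offset :: "nat \<Rightarrow> nat \<Rightarrow> vec \<Rightarrow> int \<Rightarrow> int" where
  "block_offset n r l m = (m - 1) div int n * int r + (\<Sum>t = 1..(m - 1) mod int n. l t)"

lemma Lambda_Zvec: "l \<in> Lambda n r \<Longrightarrow> l \<in> Zvec n" and Lambda_nonneg: "l \<in> Lambda n r \<Longrightarrow> 0 \<le> l i"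
  by (auto simp: Lambda_def Nvec_def)

lemma Lambda_zero_iff: assumes n: "n > 0" shows "l \<in> Lambda n 0 \<longleftrightarrow> l = 0"
proof
  assume l: "l \<in> Lambda n 0"
  show "l = 0"
  proof (rule ext)
    fix i
    obtain k where k: "i + k * int n \<in> {1..int n}" using residue[OF n] .
    have "l (i + k * int n) \<le> vsigma n l"
      unfolding vsigma_def using k Lambda_nonneg[OF l] by (intro member_le_sum) auto
    then have "l i \<le> 0" using l by (simp add: Zvec_shift[OF Lambda_Zvec[OF l]] Lambda_def)
    then show "l i = 0 i" using Lambda_nonneg[OF l, of i] by simp
  qed
qed (simp add: Lambda_def Nvec_def Zvec_def vsigma_def)

lemma block_block_offset:
  assumes n: "n > 0" and l: "l \<in> Lambda n (int r)"
  shows "block n r l m = {block_offset n r l m + 1..block_offset n r l m + l m}"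
proof -
  have "l ((m - 1) mod int n + 1 + (m - 1) div int n * int n) = l ((m - 1) mod int n + 1)"
    by (rule Zvec_shift[OF Lambda_Zvec[OF l]])
  moreover have "(m - 1) mod int n + 1 + (m - 1) div int n * int n = m"
    by (simp add: minus_div_mult_eq_mod[symmetric])
  ultimately have "l m = l ((m - 1) mod int n + 1)" by simp
  then show ?thesis by (simp add: block_def block_offset_def Let_def)
qed

lemma block_offset_Suc:
  assumes n: "n > 0" and l: "l \<in> Lambda n (int r)"
  shows "block_offset n r l (m + 1) = block_offset n r l m + l m"
proof -
  define a b where "a = (m - 1) div int n" and "b = (m - 1) mod int n"
  have b: "0 \<le> b" "b < int n" using n by (auto simp: b_def)
  have m: "m = a * int n + b + 1" by (simp add: a_def b_def)
  have lm: "l m = l (b + 1)"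
    using Zvec_shift[OF Lambda_Zvec[OF l], of "b + 1" a] by (simp add: m algebra_simps)
  show ?thesis
  proof (cases "b + 1 < int n")
    case True
    have "m div int n = a" "m mod int n = b + 1"
      using True b by (auto simp: m add.assoc div_mult_self3 intro: div_pos_pos_trivial mod_pos_pos_trivial)
    moreover have "{1..b + 1} = insert (b + 1) {1..b}" using b by auto
    ultimately show ?thesis by (simp add: block_offset_def a_def[symmetric] b_def[symmetric] lm)
  next
    case False
    then have bn: "b + 1 = int n" using b by simp
    then have "m = (a + 1) * int n" by (simp add: m algebra_simps)
    then have "m div int n = a + 1" "m mod int n = 0" using n by simp_all
    moreover have "(\<Sum>t = 1..b. l t) + l (b + 1) = int r"
    proof -
      have "{1..int n} = insert (b + 1) {1..b}" using bn b by auto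
      then have "vsigma n l = l (b + 1) + (\<Sum>t = 1..b. l t)" by (simp add: vsigma_def)
      then show ?thesis using l by (simp add: Lambda_def)
    qed
    ultimately show ?thesis by (simp add: block_offset_def a_def[symmetric] b_def[symmetric] lm algebra_simps)
  qed
qed

lemma block_offset_shift:
  assumes n: "n > 0" shows "block_offset n r l (m + t * int n) = block_offset n r l m + t * int r"
proof -
  have "m + t * int n - 1 = (m - 1) + t * int n" by simp
  then have "(m + t * int n - 1) div int n = (m - 1) div int n + t" "(m + t * int n - 1) mod int n = (m - 1) mod int n"
    using n by (simp_all only: div_mult_self1 mod_mult_self1)
  then show ?thesis by (simp add: block_offset_def algebra_simps)
qed

lemma block_offset_1 [simp]: "block_offset n r l 1 = 0"
  by (simp add: block_offset_def)

lemma block_offset_mono: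
  assumes n: "n > 0" and l: "l \<in> Lambda n (int r)" and "m \<le> m'"
  shows "block_offset n r l m \<le> block_offset n r l m'"
  using assms(3)
proof (induction m' rule: int_ge_induct)
  case (step i) then show ?case using block_offset_Suc[OF n l, of i] Lambda_nonneg[OF l, of i] by simp
qed simp

lemma block_iff:
  assumes n: "n > 0" and l: "l \<in> Lambda n (int r)"
  shows "x \<in> block n r l m \<longleftrightarrow> block_offset n r l m < x \<and> x \<le> block_offset n r l (m + 1)"
  unfolding block_block_offset[OF n l] block_offset_Suc[OF n l] by auto

lemma card_block:
  assumes "n > 0" and "l \<in> Lambda n (int r)"
  shows "int (card (block n r l m)) = l m"
  using Lambda_nonneg[OF assms(2), of m] by (simp add: block_block_offset[OF assms])

lemma finite_block [simp]: "finite (block n r l m)"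
  by (simp add: block_def Let_def)

lemma block_zero:
  assumes "n > 0" "l \<in> Lambda n (int 0)" shows "block n 0 l m = {}"
  using assms by (simp add: block_block_offset Lambda_zero_iff)

lemma block_disjoint:
  assumes n: "n > 0" and l: "l \<in> Lambda n (int r)" and x: "x \<in> block n r l m" "x \<in> block n r l m'"
  shows "m = m'"
proof (cases m m' rule: linorder_cases)
  case less
  then show ?thesis using x block_offset_mono[OF n l, of "m + 1" m'] by (simp add: block_iff[OF n l])
next
  case greater
  then show ?thesis using x block_offset_mono[OF n l, of "m' + 1" m] by (simp add: block_iff[OF n l])
qed

lemma block_exists:
  assumes n: "n > 0" and l: "l \<in> Lambda n (int r)" and r: "r > 0"
  shows "\<exists>m. x \<in> block n r l m"
proof -
  have step: "\<exists>m. f m < x \<and> x \<le> f (m + 1)" if "f a < x" "x \<le> f (a + int k)" for f :: "int \<Rightarrow> int" and a k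
    using that
  proof (induction k)
    case (Suc k)
    then show ?case by (cases "x \<le> f (a + int k)") (auto simp: algebra_simps intro!: exI[of _ "a + int k"])
  qed auto
  define t where "t = (x - 1) div int r"
  have x: "x = t * int r + (x - 1) mod int r + 1" by (simp add: t_def)
  have b: "0 \<le> (x - 1) mod int r" "(x - 1) mod int r < int r" using r by simp_all
  have 1: "block_offset n r l (1 + t * int n) < x" using x b by (simp add: block_offset_shift[OF n])
  have "block_offset n r l (1 + (t + 1) * int n) = (t + 1) * int r" by (simp only: block_offset_shift[OF n] block_offset_1)
  moreover have "1 + (t + 1) * int n = 1 + t * int n + int n" by (simp add: algebra_simps)
  ultimately have 2: "x \<le> block_offset n r l (1 + t * int n + int n)" using x b by (simp add: algebra_simps)
  from step[of "block_offset n r l", OF 1 2] show ?thesis by (simp add: block_iff[OF n l])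
qed

lemma block_shift:
  assumes n: "n > 0" and l: "l \<in> Lambda n (int r)"
  shows "x + t * int r \<in> block n r l (m + t * int n) \<longleftrightarrow> x \<in> block n r l m"
proof -
  have "m + t * int n + 1 = m + 1 + t * int n" by simp
  then show ?thesis by (simp only: block_iff[OF n l] block_offset_shift[OF n]) simp
qed

text \<open>The labelling by blocks, to which \<open>matching\<close> will be applied.\<close>

definition block_index :: "nat \<Rightarrow> nat \<Rightarrow> vec \<Rightarrow> int \<Rightarrow> int" where
  "block_index n r l x = (THE m. x \<in> block n r l m)"

lemma block_index_iff:
  assumes n: "n > 0" and l: "l \<in> Lambda n (int r)" and r: "r > 0"
  shows "block_index n r l x = m \<longleftrightarrow> x \<in> block n r l m"
proof -
  obtain m' where m': "x \<in> block n r l m'" using block_exists[OF assms] by blast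
  have "block_index n r l x = m'" unfolding block_index_def
    by (rule the_equality[where P = "\<lambda>m. x \<in> block n r l m", OF m']) (rule block_disjoint[OF n l _ m'])
  then show ?thesis using m' block_disjoint[OF n l] by blast
qed

lemma block_index_shift:
  assumes n: "n > 0" and l: "l \<in> Lambda n (int r)" and r: "r > 0"
  shows "block_index n r l (x + t * int r) = block_index n r l x + t * int n"
  using block_shift[OF n l, of x t "block_index n r l x"] block_index_iff[OF assms, of x "block_index n r l x"]
  by (subst block_index_iff[OF assms]) simp

lemma block_index_mono:
  assumes n: "n > 0" and l: "l \<in> Lambda n (int r)" and r: "r > 0" and "x \<le> y"
  shows "block_index n r l x \<le> block_index n r l y"
proof (rule ccontr)
  assume "\<not> ?thesis"
  then have "block_offset n r l (block_index n r l y + 1) \<le> block_offset n r l (block_index n r l x)" by (intro block_offset_mono[OF n l]) simp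
  moreover have "x \<in> block n r l (block_index n r l x)" "y \<in> block n r l (block_index n r l y)"
    using block_index_iff[OF n l r] by blast+
  ultimately show False using assms(4) by (simp add: block_iff[OF n l])
qed

lemma mem_image_aff: "w \<in> aff_sym r \<Longrightarrow> x \<in> w ` B \<longleftrightarrow> inv w x \<in> B"
  by (auto intro!: image_eqI[of _ w "inv w x"])

lemma image_block_shift:
  assumes n: "n > 0" and l: "l \<in> Lambda n (int r)" and w: "w \<in> aff_sym r"
  shows "x + t * int r \<in> w ` block n r l (m + t * int n) \<longleftrightarrow> x \<in> w ` block n r l m"
proof -
  have *: "x \<in> w ` B \<longleftrightarrow> inv w x \<in> B" for x B using w by (rule mem_image_aff)
  show ?thesis unfolding * aff_sym_shift[OF aff_sym_inv[OF w]] block_shift[OF n l] ..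
qed

lemma young_iff:
  assumes n: "n > 0" and l: "l \<in> Lambda n (int r)"
  shows "w \<in> young n r l \<longleftrightarrow> w \<in> aff_sym r \<and> (\<forall>m x. w x \<in> block n r l m \<longleftrightarrow> x \<in> block n r l m)"
proof
  assume y: "w \<in> young n r l"
  then have w: "w \<in> aff_sym r" by (simp add: young_def)
  have "w x \<in> block n r l m \<longleftrightarrow> x \<in> block n r l m" for m x
  proof -
    obtain k where k: "m + k * int n \<in> {1..int n}" using residue[OF n] .
    have "w ` block n r l (m + k * int n) = block n r l (m + k * int n)" using y k by (auto simp: young_def)
    then have "w (x + k * int r) \<in> block n r l (m + k * int n) \<longleftrightarrow> x + k * int r \<in> block n r l (m + k * int n)"
      by (metis mem_image_aff[OF w] aff_sym_inv_left[OF w])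
    then show ?thesis unfolding aff_sym_shift[OF w] block_shift[OF n l] .
  qed
  with w show "w \<in> aff_sym r \<and> (\<forall>m x. w x \<in> block n r l m \<longleftrightarrow> x \<in> block n r l m)" by blast
next
  assume a: "w \<in> aff_sym r \<and> (\<forall>m x. w x \<in> block n r l m \<longleftrightarrow> x \<in> block n r l m)"
  then have w: "w \<in> aff_sym r" by blast
  have "w ` block n r l m = block n r l m" for m
    using a by (auto simp: mem_image_aff[OF w]) (metis aff_sym_inv_right[OF w])
  with w show "w \<in> young n r l" by (simp add: young_def)
qed

lemma young_aff: "w \<in> young n r l \<Longrightarrow> w \<in> aff_sym r"
  by (simp add: young_def)

lemma young_group:
  assumes n: "n > 0" and l: "l \<in> Lambda n (int r)"
  shows "id \<in> young n r l" "w \<in> young n r l \<Longrightarrow> u \<in> young n r l \<Longrightarrow> w \<circ> u \<in> young n r l"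
    "w \<in> young n r l \<Longrightarrow> inv w \<in> young n r l"
proof -
  show "id \<in> young n r l" by (simp add: young_iff[OF n l])
  show "w \<in> young n r l \<Longrightarrow> u \<in> young n r l \<Longrightarrow> w \<circ> u \<in> young n r l"
    by (simp add: young_iff[OF n l] aff_sym_comp)
  show "w \<in> young n r l \<Longrightarrow> inv w \<in> young n r l"
    by (simp add: young_iff[OF n l] aff_sym_inv) (metis aff_sym_inv_right)
qed

lemma young_block_index:
  assumes n: "n > 0" and l: "l \<in> Lambda n (int r)" and r: "r > 0"
  shows "w \<in> young n r l \<longleftrightarrow> w \<in> aff_sym r \<and> (\<forall>x. block_index n r l (w x) = block_index n r l x)"
  unfolding young_iff[OF n l] block_index_iff[OF n l r, symmetric] by auto

lemma finite_young:
  assumes n: "n > 0" and l: "l \<in> Lambda n (int r)" shows "finite (young n r l)"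
proof (cases "r = 0")
  case True then show ?thesis using finite_subset[of "young n r l" "{id}"] by (auto simp: young_def)
next
  case False
  then have r: "r > 0" by simp
  have inj: "inj_on (\<lambda>w. restrict w {1..int r}) (young n r l)"
  proof (rule inj_onI, rule ext)
    fix w u x
    assume wu: "w \<in> young n r l" "u \<in> young n r l" "restrict w {1..int r} = restrict u {1..int r}"
    obtain k where "x + k * int r \<in> {1..int r}" using residue[OF r] .
    then have "w (x + k * int r) = u (x + k * int r)" using wu(3) by (metis restrict_apply')
    then show "w x = u x" using wu by (simp add: aff_sym_shift[OF young_aff])
  qed
  have "w x \<in> block n r l (block_index n r l x)" if "w \<in> young n r l" for w x
    using that block_index_iff[OF n l r, of "w x"] unfolding young_block_index[OF n l r] by blast
  then have "(\<lambda>w. restrict w {1..int r}) ` young n r l \<subseteq> (\<Pi>\<^sub>E x\<in>{1..int r}. block n r l (block_index n r l x))"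
    by auto
  moreover have "finite (\<Pi>\<^sub>E x\<in>{1..int r}. block n r l (block_index n r l x))" by (rule finite_PiE) simp_all
  ultimately have "finite ((\<lambda>w. restrict w {1..int r}) ` young n r l)" by (rule finite_subset)
  then show ?thesis by (rule finite_imageD[OF _ inj])
qed

lemma simple_refl_young:
  assumes n: "n > 0" and l: "l \<in> Lambda n (int r)" and r: "r \<ge> 2"
    and k: "k \<in> block n r l m" "k + 1 \<in> block n r l m"
  shows "simple_refl r k \<in> young n r l"
  unfolding young_block_index[OF n l order.strict_trans2[OF zero_less_numeral r]]
proof (intro conjI allI simple_refl_aff r)
  fix x
  have r0: "r > 0" using r by simp
  note b = block_index_shift[OF n l r0] have km: "block_index n r l k = m" "block_index n r l (k + 1) = m" using k block_index_iff[OF n l r0] by blast+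
  show "block_index n r l (simple_refl r k x) = block_index n r l x"
  proof (rule simple_refl_cases[OF r, of x k])
    fix t assume "x = k + t * int r" "simple_refl r k x = x + 1"
    then have "x = k + t * int r" "simple_refl r k x = k + 1 + t * int r" by auto
    then show ?thesis by (simp only: b km)
  next
    fix t assume "x = k + 1 + t * int r" "simple_refl r k x = x - 1"
    then have "x = k + 1 + t * int r" "simple_refl r k x = k + t * int r" by auto
    then show ?thesis by (simp only: b km)
  qed simp
qed

section \<open>Distinguished coset representatives\<close>

definition incr :: "nat \<Rightarrow> nat \<Rightarrow> vec \<Rightarrow> perm \<Rightarrow> bool" where
  "incr n r l u \<longleftrightarrow> (\<forall>m x y. x \<in> block n r l m \<longrightarrow> y \<in> block n r l m \<longrightarrow> x < y \<longrightarrow> u x < u y)"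

lemma block_convex:
  assumes n: "n > 0" and l: "l \<in> Lambda n (int r)"
    and "x \<in> block n r l m" "y \<in> block n r l m" "x \<le> z" "z \<le> y" shows "z \<in> block n r l m"
  using assms(3-) by (simp add: block_iff[OF n l])

lemma not_incr_descent:
  assumes n: "n > 0" and l: "l \<in> Lambda n (int r)" and w: "w \<in> aff_sym r" and ni: "\<not> incr n r l w"
  obtains k m where "r \<ge> 2" "k \<in> block n r l m" "k + 1 \<in> block n r l m" "w (k + 1) < w k"
proof -
  obtain m x y where xy: "x \<in> block n r l m" "y \<in> block n r l m" "x < y" "\<not> w x < w y"
    using ni by (auto simp: incr_def)
  have "\<exists>k. x \<le> k \<and> k + 1 \<le> y \<and> \<not> w k < w (k + 1)"
  proof (rule ccontr)
    assume a: "\<not> ?thesis"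
    have "j \<le> y \<longrightarrow> w x < w j" if "x + 1 \<le> j" for j
      using that
    proof (induction j rule: int_ge_induct)
      case base then show ?case using a by auto
    next
      case (step j)
      then have "j + 1 \<le> y \<Longrightarrow> w j < w (j + 1)" using a by auto
      then show ?case using step by force
    qed
    then show False using xy by auto
  qed
  then obtain k where k: "x \<le> k" "k + 1 \<le> y" "\<not> w k < w (k + 1)" by blast
  then have d: "w (k + 1) < w k" using aff_sym_eq_iff[OF w, of k "k + 1"] by linarith
  have "r \<ge> 2"
  proof (rule ccontr)
    assume "\<not> r \<ge> 2"
    from aff_sym_small_transl[OF w this] obtain c where "w = transl c" by blast
    then show False using d by simp
  qed
  moreover have "k \<in> block n r l m" "k + 1 \<in> block n r l m"
    using k by (auto intro!: block_convex[OF n l xy(1,2)])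
  ultimately show thesis using that d by blast
qed

text \<open>
  Such a permutation increases inside the blocks and from each block to the next, so it is a
  translation; one that preserves the blocks is trivial.
\<close>

lemma young_incr_id:
  assumes n: "n > 0" and l: "l \<in> Lambda n (int r)" and y: "y \<in> young n r l" and i: "incr n r l y"
  shows "y = id"
proof (cases "r = 0")
  case True then show ?thesis using young_aff[OF y] by simp
next
  case False
  then have r: "r > 0" by simp
  note yb = y[unfolded young_block_index[OF n l r]]
  have "y k < y (k + 1)" for k
  proof (cases "block_index n r l k = block_index n r l (k + 1)")
    case True
    then have "k \<in> block n r l (block_index n r l k)" "k + 1 \<in> block n r l (block_index n r l k)"
      using block_index_iff[OF n l r] by metis+
    then show ?thesis using i by (simp add: incr_def)
  next
    case False
    then have "block_index n r l (y k) < block_index n r l (y (k + 1))"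
      using block_index_mono[OF n l r, of k "k + 1"] yb by simp
    then show ?thesis using block_index_mono[OF n l r, of "y (k + 1)" "y k"] by linarith
  qed
  then obtain c where c: "y = transl c" using increasing_imp_transl[OF young_aff[OF y]] by blast
  have "block_index n r l (int j * c) = block_index n r l 0" for j
  proof (induction j)
    case (Suc j)
    have "block_index n r l (y (int j * c)) = block_index n r l (int j * c)" using yb by blast
    then show ?case using Suc by (simp add: c algebra_simps)
  qed simp
  from this[of r] block_index_shift[OF n l r, of 0 c] have "c = 0" using n by (simp add: mult.commute)
  then show ?thesis by (simp add: c)
qed

text \<open>
  Every descent of the second factor inside a block persists in the product, because the first
  factor increases there.
\<close>

lemma incr_young_length:
  assumes n: "n > 0" and l: "l \<in> Lambda n (int r)"
    and u: "u \<in> aff_sym r" "incr n r l u" and y: "y \<in> young n r l"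
  shows "ninv r (u \<circ> y) = ninv r u + ninv r y"
  using y
proof (induction "ninv r y" arbitrary: y rule: less_induct)
  case less
  show ?case
  proof (cases "incr n r l y")
    case True then show ?thesis using young_incr_id[OF n l less.prems] by simp
  next
    case False
    note ya = young_aff[OF less.prems]
    obtain k m where k: "r \<ge> 2" "k \<in> block n r l m" "k + 1 \<in> block n r l m" "y (k + 1) < y k"
      using not_incr_descent[OF n l ya False] .
    let ?s = "simple_refl r k"
    have y': "y \<circ> ?s \<in> young n r l"
      using young_group(2)[OF n l less.prems] simple_refl_young[OF n l k(1-3)] by blast
    have d: "ninv r y = ninv r (y \<circ> ?s) + 1" by (rule ninv_simple_refl_right_down[OF k(1) ya k(4)])
    have "y k \<in> block n r l m" "y (k + 1) \<in> block n r l m"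
      using less.prems k(2,3) by (simp_all add: young_iff[OF n l])
    then have "(u \<circ> y) (k + 1) < (u \<circ> y) k" using u(2) k(4) by (simp add: incr_def)
    then have "ninv r (u \<circ> y) = ninv r (u \<circ> y \<circ> ?s) + 1"
      by (rule ninv_simple_refl_right_down[OF k(1) aff_sym_comp[OF u(1) ya]])
    moreover have "ninv r (u \<circ> (y \<circ> ?s)) = ninv r u + ninv r (y \<circ> ?s)"
      using d by (intro less.hyps y') simp
    ultimately show ?thesis using d by (simp add: comp_assoc)
  qed
qed

text \<open>
  A descent inside a block can be removed by a simple reflection of the Young subgroup, which
  lowers the number of inversions.
\<close>

lemma coset_factor:
  assumes n: "n > 0" and l: "l \<in> Lambda n (int r)" and w: "w \<in> aff_sym r"
  shows "\<exists>u y. u \<in> aff_sym r \<and> incr n r l u \<and> y \<in> young n r l \<and> w = u \<circ> y"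
  using w
proof (induction "ninv r w" arbitrary: w rule: less_induct)
  case less
  show ?case
  proof (cases "incr n r l w")
    case True
    then show ?thesis using young_group(1)[OF n l] less.prems by (intro exI[of _ w] exI[of _ id]) auto
  next
    case False
    obtain k m where k: "r \<ge> 2" "k \<in> block n r l m" "k + 1 \<in> block n r l m" "w (k + 1) < w k"
      using not_incr_descent[OF n l less.prems False] .
    let ?s = "simple_refl r k"
    have "w \<circ> ?s \<in> aff_sym r" using less.prems simple_refl_aff[OF k(1)] by (simp add: aff_sym_comp)
    moreover have "ninv r (w \<circ> ?s) < ninv r w" using ninv_simple_refl_right_down[OF k(1) less.prems k(4)] by simp
    ultimately obtain u y where uy: "u \<in> aff_sym r" "incr n r l u" "y \<in> young n r l" "w \<circ> ?s = u \<circ> y"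
      using less.hyps by blast
    have "y \<circ> ?s \<in> young n r l" using young_group(2)[OF n l uy(3)] simple_refl_young[OF n l k(1-3)] by blast
    moreover have "w = u \<circ> (y \<circ> ?s)" using uy(4) k(1) by (metis comp_assoc simple_refl_comp_self'(2))
    ultimately show ?thesis using uy by blast
  qed
qed

lemma coset_factor_unique:
  assumes n: "n > 0" and l: "l \<in> Lambda n (int r)"
    and u: "u \<in> aff_sym r" "incr n r l u" "u' \<in> aff_sym r" "incr n r l u'"
    and y: "y \<in> young n r l" "y' \<in> young n r l" and eq: "u \<circ> y = u' \<circ> y'"
  shows "u = u' \<and> y = y'"
proof -
  define z where "z = y' \<circ> inv y"
  have z: "z \<in> young n r l" using young_group(2,3)[OF n l] y by (simp add: z_def)
  have uz: "u = u' \<circ> z"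
    using eq young_aff[OF y(1)] by (simp add: z_def flip: comp_assoc) (simp add: comp_assoc flip: eq)
  have "incr n r l z" unfolding incr_def
  proof (intro allI impI)
    fix m a b assume ab: "a \<in> block n r l m" "b \<in> block n r l m" "a < b"
    then have zab: "z a \<in> block n r l m" "z b \<in> block n r l m" using z by (auto simp: young_iff[OF n l])
    have "u' (z a) < u' (z b)" using u(2) ab uz by (auto simp: incr_def)
    then show "z a < z b" using u(4) zab unfolding incr_def by (metis linorder_cases order.asym)
  qed
  then have "z = id" by (rule young_incr_id[OF n l z])
  then have "u = u'" using uz by simp
  moreover have "y = y'" using eq \<open>u = u'\<close> aff_sym_eq_iff[OF u(1)] by (auto simp: fun_eq_iff)
  ultimately show ?thesis by blast
qed

lemma bij_coset_factor:
  assumes n: "n > 0" and l: "l \<in> Lambda n (int r)" and D: "D \<subseteq> aff_sym r"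
    and inv: "\<And>w y. w \<in> D \<Longrightarrow> y \<in> young n r l \<Longrightarrow> w \<circ> y \<in> D"
  shows "bij_betw (\<lambda>(u, y). u \<circ> y) ({u \<in> D. incr n r l u} \<times> young n r l) D"
  unfolding bij_betw_def
proof
  show "inj_on (\<lambda>(u, y). u \<circ> y) ({u \<in> D. incr n r l u} \<times> young n r l)"
  proof (rule inj_onI, clarify)
    fix u y u' y' assume "u \<in> D" "incr n r l u" "y \<in> young n r l" "u' \<in> D" "incr n r l u'" "y' \<in> young n r l"
      "u \<circ> y = u' \<circ> y'"
    then show "u = u' \<and> y = y'" using D by (intro coset_factor_unique[OF n l]) auto
  qed
  show "(\<lambda>(u, y). u \<circ> y) ` ({u \<in> D. incr n r l u} \<times> young n r l) = D"
  proof (intro equalityI subsetI)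
    fix w assume w: "w \<in> D"
    obtain u y where uy: "u \<in> aff_sym r" "incr n r l u" "y \<in> young n r l" "w = u \<circ> y"
      using coset_factor[OF n l] w D by blast
    have "u = w \<circ> inv y" using uy(4) young_aff[OF uy(3)] by (simp add: comp_assoc)
    then have "u \<in> D" using inv[OF w] young_group(3)[OF n l uy(3)] by simp
    then show "w \<in> (\<lambda>(u, y). u \<circ> y) ` ({u \<in> D. incr n r l u} \<times> young n r l)" using uy by force
  qed (use inv in auto)
qed

definition T_sum :: "perm set \<Rightarrow> hecke" where "T_sum D = (\<Sum>w\<in>D. TT w)"

lemma hmult_sum_sum:
  assumes "\<And>i. i \<in> I \<Longrightarrow> f i \<in> hecke_carrier r" "\<And>j. j \<in> J \<Longrightarrow> g j \<in> hecke_carrier r"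
  shows "hmult r (sum f I) (sum g J) = (\<Sum>i\<in>I. \<Sum>j\<in>J. hmult r (f i) (g j))"
  using assms by (simp add: hmult_sum_left hmult_sum_right hecke_carrier_sum) (rule sum.swap)

lemma T_sum_carrier: "D \<subseteq> aff_sym r \<Longrightarrow> T_sum D \<in> hecke_carrier r"
  unfolding T_sum_def by (rule hecke_carrier_sum) auto

lemma lookup_T_sum: "finite D \<Longrightarrow> Poly_Mapping.lookup (T_sum D) w = (if w \<in> D then 1 else 0)"
  by (simp add: T_sum_def lookup_sum lookup_TT)

lemma keys_T_sum: "finite D \<Longrightarrow> Poly_Mapping.keys (T_sum D) = D"
  by (auto simp: in_keys_iff lookup_T_sum split: if_splits)

lemma xelt_T_sum: "xelt n r l = T_sum (young n r l)"
  by (simp add: xelt_def T_sum_def)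

text \<open>
  Every element of \<open>D\<close> is uniquely a shortest representative times an element of the Young
  subgroup, and lengths add in this product.
\<close>

lemma T_sum_right_factor:
  assumes n: "n > 0" and l: "l \<in> Lambda n (int r)" and D: "D \<subseteq> aff_sym r"
    and inv: "\<And>w y. w \<in> D \<Longrightarrow> y \<in> young n r l \<Longrightarrow> w \<circ> y \<in> D"
  shows "T_sum D = hmult r (T_sum {u \<in> D. incr n r l u}) (xelt n r l)"
proof -
  let ?U = "{u \<in> D. incr n r l u}"
  have mem: "TT u \<in> hecke_carrier r" if "u \<in> ?U" for u using that D by auto
  have memy: "TT y \<in> hecke_carrier r" if "y \<in> young n r l" for y using young_aff[OF that] by simp
  have "hmult r (T_sum ?U) (xelt n r l) = (\<Sum>u\<in>?U. \<Sum>y\<in>young n r l. hmult r (TT u) (TT y))"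
    unfolding T_sum_def xelt_def by (intro hmult_sum_sum mem memy)
  also have "\<dots> = (\<Sum>u\<in>?U. \<Sum>y\<in>young n r l. TT (u \<circ> y))"
  proof (intro sum.cong refl)
    fix u y assume uy: "u \<in> ?U" "y \<in> young n r l"
    then show "hmult r (TT u) (TT y) = TT (u \<circ> y)"
      using D incr_young_length[OF n l _ _ uy(2), of u] young_aff[OF uy(2)] by (intro hmult_TT) auto
  qed
  also have "\<dots> = (\<Sum>p\<in>?U \<times> young n r l. TT ((\<lambda>(u, y). u \<circ> y) p))"
    by (simp add: sum.cartesian_product split_def)
  also have "\<dots> = T_sum D"
    unfolding T_sum_def by (rule sum.reindex_bij_betw[OF bij_coset_factor[OF n l D inv]])
  finally show ?thesis by simp
qed

text \<open>The mirror image of the previous factorisation: inverses exchange the two sides.\<close>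

lemma T_sum_left_factor:
  assumes n: "n > 0" and l: "l \<in> Lambda n (int r)" and D: "D \<subseteq> aff_sym r"
    and inv: "\<And>w y. w \<in> D \<Longrightarrow> y \<in> young n r l \<Longrightarrow> y \<circ> w \<in> D"
  shows "T_sum D = hmult r (xelt n r l) (T_sum {u \<in> D. incr n r l (inv u)})"
proof -
  let ?U = "{u \<in> D. incr n r l (inv u)}"
  have mem: "TT u \<in> hecke_carrier r" if "u \<in> ?U" for u using that D by auto
  have memy: "TT y \<in> hecke_carrier r" if "y \<in> young n r l" for y using young_aff[OF that] by simp
  define D' where "D' = inv ` D"
  have D': "D' \<subseteq> aff_sym r" using D by (auto simp: D'_def aff_sym_inv)
  have inv_comp: "inv (y \<circ> w) = inv w \<circ> inv y" if "w \<in> D" "y \<in> young n r l" for w y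
    using aff_sym_inv_comp[OF young_aff[OF that(2)]] that(1) D by blast
  have iD: "inv (inv w) = w" if "w \<in> D" for w using that D by auto
  have inv': "w \<circ> y \<in> D'" if wy: "w \<in> D'" "y \<in> young n r l" for w y
  proof -
    obtain v where v: "v \<in> D" "w = inv v" using wy(1) by (auto simp: D'_def)
    have "inv (inv y \<circ> v) = inv v \<circ> inv (inv y)" by (rule inv_comp[OF v(1) young_group(3)[OF n l wy(2)]])
    then have "w \<circ> y = inv (inv y \<circ> v)" using v(2) aff_sym_inv_inv[OF young_aff[OF wy(2)]] by simp
    then show ?thesis using inv[OF v(1) young_group(3)[OF n l wy(2)]] by (simp add: D'_def)
  qed
  have bi: "bij_betw (\<lambda>(u, y). u \<circ> y) ({u \<in> D'. incr n r l u} \<times> young n r l) D'"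
    by (rule bij_coset_factor[OF n l D' inv'])
  have bi2: "bij_betw (\<lambda>(y, u). y \<circ> u) (young n r l \<times> ?U) D"
    unfolding bij_betw_def
  proof
    show "inj_on (\<lambda>(y, u). y \<circ> u) (young n r l \<times> ?U)"
    proof (rule inj_onI, clarify)
      fix y u y' u' assume a: "y \<in> young n r l" "u \<in> D" "incr n r l (inv u)" "y' \<in> young n r l" "u' \<in> D"
        "incr n r l (inv u')" "y \<circ> u = y' \<circ> u'"
      have "inv u \<circ> inv y = inv u' \<circ> inv y'"
        using inv_comp[OF a(2,1)] inv_comp[OF a(5,4)] a(7) by simp
      moreover have "inv u \<in> aff_sym r" "inv u' \<in> aff_sym r" using a D by (auto intro!: aff_sym_inv)
      moreover have "inv y \<in> young n r l" "inv y' \<in> young n r l" using a young_group(3)[OF n l] by auto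
      ultimately have e: "inv u = inv u' \<and> inv y = inv y'"
        using a(3,6) by (intro coset_factor_unique[OF n l])
      have "inv (inv u) = inv (inv u')" "inv (inv y) = inv (inv y')" using e by simp_all
      then show "y = y' \<and> u = u'"
        using iD[OF a(2)] iD[OF a(5)] aff_sym_inv_inv[OF young_aff[OF a(1)]] aff_sym_inv_inv[OF young_aff[OF a(4)]]
        by simp
    qed
    show "(\<lambda>(y, u). y \<circ> u) ` (young n r l \<times> ?U) = D"
    proof (intro equalityI subsetI)
      fix w assume w: "w \<in> D"
      then have "inv w \<in> D'" by (simp add: D'_def)
      then obtain u y where uy: "u \<in> D'" "incr n r l u" "y \<in> young n r l" "inv w = u \<circ> y"
        using bi unfolding bij_betw_def by force
      obtain v where v: "v \<in> D" "u = inv v" using uy(1) by (auto simp: D'_def)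
      have "inv (inv w) = inv y \<circ> v"
        unfolding uy(4) using aff_sym_inv_comp[of u r y] D' uy young_aff[OF uy(3)] v iD by auto
      then have "w = inv y \<circ> v" using iD[OF w] by simp
      moreover have "inv y \<in> young n r l" by (rule young_group(3)[OF n l uy(3)])
      ultimately show "w \<in> (\<lambda>(y, u). y \<circ> u) ` (young n r l \<times> ?U)" using v uy by force
    qed (use inv in auto)
  qed
  have "hmult r (xelt n r l) (T_sum ?U) = (\<Sum>y\<in>young n r l. \<Sum>u\<in>?U. hmult r (TT y) (TT u))"
    unfolding T_sum_def xelt_def by (intro hmult_sum_sum mem memy)
  also have "\<dots> = (\<Sum>y\<in>young n r l. \<Sum>u\<in>?U. TT (y \<circ> u))"
  proof (intro sum.cong refl)
    fix u y assume uy: "y \<in> young n r l" "u \<in> ?U"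
    then have ua: "u \<in> aff_sym r" and ya: "y \<in> aff_sym r" using D young_aff by auto
    have "ninv r (inv u \<circ> inv y) = ninv r (inv u) + ninv r (inv y)"
      using uy ua by (intro incr_young_length[OF n l] aff_sym_inv young_group(3)[OF n l]) auto
    then have "ninv r (inv (y \<circ> u)) = ninv r (inv u) + ninv r (inv y)" using inv_comp uy by simp
    then have "ninv r (y \<circ> u) = ninv r y + ninv r u"
      using ninv_inv[OF ua] ninv_inv[OF ya] ninv_inv[OF aff_sym_comp[OF ya ua]] by simp
    then show "hmult r (TT y) (TT u) = TT (y \<circ> u)" by (rule hmult_TT[OF ua ya])
  qed
  also have "\<dots> = (\<Sum>p\<in>young n r l \<times> ?U. TT ((\<lambda>(y, u). y \<circ> u) p))"
    by (simp add: sum.cartesian_product split_def)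
  also have "\<dots> = T_sum D"
    unfolding T_sum_def by (rule sum.reindex_bij_betw[OF bi2])
  finally show ?thesis by simp
qed

lemma qq_cancel: "qq * a = qq * b \<Longrightarrow> a = b" for a b :: laurent
proof -
  assume "qq * a = qq * b"
  then have "vpow (-2) * (qq * a) = vpow (-2) * (qq * b)" by simp
  moreover have "vpow (-2) * qq = 1" by (simp add: vpow_def mult_single)
  ultimately show "a = b" by (simp flip: mult.assoc)
qed

lemma lop_xelt:
  assumes n: "n > 0" and l: "l \<in> Lambda n (int r)" and r: "r \<ge> 2" and s: "simple_refl r k \<in> young n r l"
  shows "lop r k (xelt n r l) = smul qq (xelt n r l)"
proof (rule poly_mapping_eqI)
  fix w
  have "simple_refl r k \<circ> w \<in> young n r l \<longleftrightarrow> w \<in> young n r l"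
    using young_group(2)[OF n l s] r by (metis simple_refl_comp_self'(1))
  then show "Poly_Mapping.lookup (lop r k (xelt n r l)) w = Poly_Mapping.lookup (smul qq (xelt n r l)) w"
    by (simp add: lookup_lop[OF r] xelt_T_sum lookup_T_sum[OF finite_young[OF n l]] algebra_simps del: o_apply)
qed

lemma rop_xelt:
  assumes n: "n > 0" and l: "l \<in> Lambda n (int r)" and r: "r \<ge> 2" and s: "simple_refl r k \<in> young n r l"
  shows "rop r k (xelt n r l) = smul qq (xelt n r l)"
proof (rule poly_mapping_eqI)
  fix w
  have "w \<circ> simple_refl r k \<in> young n r l \<longleftrightarrow> w \<in> young n r l"
    using young_group(2)[OF n l _ s] r by (metis simple_refl_comp_self'(2))
  then show "Poly_Mapping.lookup (rop r k (xelt n r l)) w = Poly_Mapping.lookup (smul qq (xelt n r l)) w"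
    by (simp add: lookup_rop[OF r] xelt_T_sum lookup_T_sum[OF finite_young[OF n l]] algebra_simps del: o_apply)
qed

lemma young_induct [consumes 3, case_names id refl]:
  assumes n: "n > 0" and l: "l \<in> Lambda n (int r)" and y: "y \<in> young n r l"
    and id: "P id"
    and step: "\<And>k y. r \<ge> 2 \<Longrightarrow> simple_refl r k \<in> young n r l \<Longrightarrow> y \<in> young n r l \<Longrightarrow> P y \<Longrightarrow> P (y \<circ> simple_refl r k)"
  shows "P y"
  using y
proof (induction "ninv r y" arbitrary: y rule: less_induct)
  case less
  show ?case
  proof (cases "incr n r l y")
    case True then show ?thesis using young_incr_id[OF n l less.prems] id by simp
  next
    case False
    note ya = young_aff[OF less.prems]
    obtain k m where k: "r \<ge> 2" "k \<in> block n r l m" "k + 1 \<in> block n r l m" "y (k + 1) < y k"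
      using not_incr_descent[OF n l ya False] .
    let ?s = "simple_refl r k"
    have s: "?s \<in> young n r l" by (rule simple_refl_young[OF n l k(1-3)])
    have y': "y \<circ> ?s \<in> young n r l" using young_group(2)[OF n l less.prems s] .
    have "P (y \<circ> ?s)" using ninv_simple_refl_right_down[OF k(1) ya k(4)] by (intro less.hyps y') simp
    from step[OF k(1) s y' this] show ?thesis using k(1) by simp
  qed
qed

text \<open>
  For a simple reflection \<open>s\<close> of the Young subgroup \<open>T\<^sub>s\<close> multiplies \<open>x\<^sub>l\<close> by \<open>v\<^sup>2\<close>, hence also every \<open>x\<^sub>l h\<close>.
  Comparing coefficients equates those at \<open>w\<close> and \<open>s w\<close>.
\<close>

lemma left_multiple_invariant:
  assumes n: "n > 0" and l: "l \<in> Lambda n (int r)" and h: "h \<in> hecke_carrier r" and y: "y \<in> young n r l"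
  shows "Poly_Mapping.lookup (hmult r (xelt n r l) h) (y \<circ> w) = Poly_Mapping.lookup (hmult r (xelt n r l) h) w"
  using n l y
proof (induction arbitrary: w rule: young_induct)
  case (refl k y)
  let ?z = "hmult r (xelt n r l) h" and ?s = "simple_refl r k"
  have x: "xelt n r l \<in> hecke_carrier r" unfolding xelt_T_sum by (rule T_sum_carrier) (auto simp: young_aff)
  have s: "TT ?s \<in> hecke_carrier r" using simple_refl_aff[OF refl.hyps(1)] by simp
  have "lop r k ?z = hmult r (TT ?s) ?z" using hmult_lop[OF hmult_carrier refl.hyps(1)] by simp
  also have "\<dots> = hmult r (lop r k (xelt n r l)) h"
    using hmult_assoc[OF s x h] hmult_lop[OF x refl.hyps(1)] by simp
  also have "\<dots> = smul qq ?z" using lop_xelt[OF n l refl.hyps(1,2)] hmult_bilinear(3)[OF x h] by simp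
  finally have e: "Poly_Mapping.lookup (lop r k ?z) v = qq * Poly_Mapping.lookup ?z v" for v by simp
  have "Poly_Mapping.lookup ?z (?s \<circ> v) = Poly_Mapping.lookup ?z v" for v
  proof (cases "inv v k < inv v (k + 1)")
    case True
    have "qq * Poly_Mapping.lookup ?z (?s \<circ> v) = qq * Poly_Mapping.lookup ?z v"
      using e[of v] True unfolding lookup_lop[OF refl.hyps(1)] by (simp only: if_True)
    then show ?thesis by (rule qq_cancel)
  next
    case False
    have "Poly_Mapping.lookup ?z (?s \<circ> v) + (qq - 1) * Poly_Mapping.lookup ?z v = qq * Poly_Mapping.lookup ?z v"
      using e[of v] False unfolding lookup_lop[OF refl.hyps(1)] by (simp only: if_False)
    then show ?thesis by (simp add: left_diff_distrib del: o_apply)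
  qed
  then have "Poly_Mapping.lookup ?z (y \<circ> (?s \<circ> w)) = Poly_Mapping.lookup ?z w" using refl.IH by metis
  then have "Poly_Mapping.lookup ?z (y \<circ> ?s \<circ> w) = Poly_Mapping.lookup ?z w" by (simp only: comp_assoc)
  then show ?case .
qed simp

lemma right_multiple_invariant:
  assumes n: "n > 0" and l: "l \<in> Lambda n (int r)" and h: "h \<in> hecke_carrier r" and y: "y \<in> young n r l"
  shows "Poly_Mapping.lookup (hmult r h (xelt n r l)) (w \<circ> y) = Poly_Mapping.lookup (hmult r h (xelt n r l)) w"
  using n l y
proof (induction arbitrary: w rule: young_induct)
  case (refl k y)
  let ?z = "hmult r h (xelt n r l)" and ?s = "simple_refl r k"
  have x: "xelt n r l \<in> hecke_carrier r" unfolding xelt_T_sum by (rule T_sum_carrier) (auto simp: young_aff)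
  have s: "TT ?s \<in> hecke_carrier r" using simple_refl_aff[OF refl.hyps(1)] by simp
  have "rop r k ?z = hmult r ?z (TT ?s)" using hmult_rop[OF hmult_carrier refl.hyps(1)] by simp
  also have "\<dots> = hmult r h (rop r k (xelt n r l))"
    using hmult_assoc[OF h x s] hmult_rop[OF x refl.hyps(1)] by simp
  also have "\<dots> = smul qq ?z" using rop_xelt[OF n l refl.hyps(1,2)] hmult_bilinear(4)[OF h x] by simp
  finally have e: "Poly_Mapping.lookup (rop r k ?z) v = qq * Poly_Mapping.lookup ?z v" for v by simp
  have "Poly_Mapping.lookup ?z (v \<circ> ?s) = Poly_Mapping.lookup ?z v" for v
  proof (cases "v k < v (k + 1)")
    case True
    have "qq * Poly_Mapping.lookup ?z (v \<circ> ?s) = qq * Poly_Mapping.lookup ?z v"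
      using e[of v] True unfolding lookup_rop[OF refl.hyps(1)] by (simp only: if_True)
    then show ?thesis by (rule qq_cancel)
  next
    case False
    have "Poly_Mapping.lookup ?z (v \<circ> ?s) + (qq - 1) * Poly_Mapping.lookup ?z v = qq * Poly_Mapping.lookup ?z v"
      using e[of v] False unfolding lookup_rop[OF refl.hyps(1)] by (simp only: if_False)
    then show ?thesis by (simp add: left_diff_distrib del: o_apply)
  qed
  then have "Poly_Mapping.lookup ?z (w \<circ> y \<circ> ?s) = Poly_Mapping.lookup ?z w" using refl.IH by metis
  then have "Poly_Mapping.lookup ?z (w \<circ> (y \<circ> ?s)) = Poly_Mapping.lookup ?z w" by (simp only: comp_assoc)
  then show ?case .
qed simp

section \<open>Matrices of double cosets\<close>

text \<open>
  A descent of \<open>d\<^sup>-\<^sup>1\<close> inside a block would be removed by a reflection of the Young subgroup, which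
  contradicts additivity of lengths. Conversely additivity is \<open>incr_young_length\<close> for the
  inverses.
\<close>

lemma dist_left_iff:
  assumes n: "n > 0" and l: "l \<in> Lambda n (int r)"
  shows "d \<in> dist_left n r l \<longleftrightarrow> d \<in> aff_sym r \<and> incr n r l (inv d)"
proof
  assume d: "d \<in> dist_left n r l"
  then have da: "d \<in> aff_sym r" by (simp add: dist_left_def)
  have "incr n r l (inv d)"
  proof (rule ccontr)
    assume "\<not> incr n r l (inv d)"
    then obtain k m where k: "r \<ge> 2" "k \<in> block n r l m" "k + 1 \<in> block n r l m" "inv d (k + 1) < inv d k"
      using not_incr_descent[OF n l aff_sym_inv[OF da]] by blast
    let ?s = "simple_refl r k"
    have s: "?s \<in> young n r l" by (rule simple_refl_young[OF n l k(1-3)])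
    then have "aff_length r (?s \<circ> d) = aff_length r ?s + aff_length r d" using d by (simp add: dist_left_def)
    then have "ninv r (?s \<circ> d) = ninv r ?s + ninv r d"
      using young_aff[OF s] da by (simp add: aff_length_eq_ninv aff_sym_comp)
    then show False using ninv_simple_refl_down[OF k(1) da k(4)] by simp
  qed
  with da show "d \<in> aff_sym r \<and> incr n r l (inv d)" by blast
next
  assume d: "d \<in> aff_sym r \<and> incr n r l (inv d)"
  have "aff_length r (w \<circ> d) = aff_length r w + aff_length r d" if w: "w \<in> young n r l" for w
  proof -
    note wa = young_aff[OF w]
    have da: "d \<in> aff_sym r" using d by blast
    have "ninv r (inv d \<circ> inv w) = ninv r (inv d) + ninv r (inv w)"
      using d by (intro incr_young_length[OF n l] aff_sym_inv young_group(3)[OF n l w]) auto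
    then have "ninv r (inv (w \<circ> d)) = ninv r (inv d) + ninv r (inv w)"
      unfolding aff_sym_inv_comp[OF wa da] .
    then show ?thesis
      using ninv_inv[OF aff_sym_comp[OF wa da]] ninv_inv[OF da] ninv_inv[OF wa]
      by (simp add: aff_length_eq_ninv[OF aff_sym_comp[OF wa da]] aff_length_eq_ninv[OF wa] aff_length_eq_ninv[OF da])
  qed
  with d show "d \<in> dist_left n r l" by (simp add: dist_left_def)
qed

lemma dist_double_iff:
  assumes n: "n > 0" and l: "l \<in> Lambda n (int r)" and m: "m \<in> Lambda n (int r)"
  shows "d \<in> dist_double n r l m \<longleftrightarrow> d \<in> aff_sym r \<and> incr n r l (inv d) \<and> incr n r m d"
proof -
  have "d \<in> inv ` dist_left n r m \<longleftrightarrow> d \<in> aff_sym r \<and> incr n r m d"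
  proof
    assume "d \<in> inv ` dist_left n r m"
    then show "d \<in> aff_sym r \<and> incr n r m d" by (auto simp: dist_left_iff[OF n m] aff_sym_inv)
  next
    assume d: "d \<in> aff_sym r \<and> incr n r m d"
    then have "inv (inv d) = d" by auto
    with d show "d \<in> inv ` dist_left n r m"
      by (intro image_eqI[of _ _ "inv d"]) (auto simp: dist_left_iff[OF n m] aff_sym_inv)
  qed
  then show ?thesis by (auto simp: dist_double_def dist_left_iff[OF n l])
qed

lemma triple_mat_invariant:
  assumes n: "n > 0" and l: "l \<in> Lambda n (int r)" and m: "m \<in> Lambda n (int r)" and w: "w \<in> aff_sym r"
    and u: "u \<in> young n r l" and y: "y \<in> young n r m"
  shows "triple_mat n r l (u \<circ> w \<circ> y) m = triple_mat n r l w m"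
proof (intro ext)
  fix i j
  have yB: "y ` block n r m j = block n r m j"
    using y by (auto simp: mem_image_aff[OF young_aff[OF y]] young_iff[OF n m])
      (metis aff_sym_inv_right[OF young_aff[OF y]])
  have uB: "u ` block n r l i = block n r l i"
    using u by (auto simp: mem_image_aff[OF young_aff[OF u]] young_iff[OF n l])
      (metis aff_sym_inv_right[OF young_aff[OF u]])
  have inj: "inj u" using young_aff[OF u] by (simp add: aff_sym_bij bij_is_inj)
  have "(u \<circ> w \<circ> y) ` block n r m j = u ` (w ` block n r m j)" using yB by (metis image_comp)
  then have "block n r l i \<inter> (u \<circ> w \<circ> y) ` block n r m j = u ` (block n r l i \<inter> w ` block n r m j)"
    using uB inj by (simp add: image_Int)
  then show "triple_mat n r l (u \<circ> w \<circ> y) m i j = triple_mat n r l w m i j"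
    using inj by (simp add: triple_mat_def card_image inj_on_def inj_def)
qed

lemma card_fibres:
  assumes "finite A" "finite J"
  shows "card {x \<in> A. f x \<in> J} = (\<Sum>j\<in>J. card {x \<in> A. f x = j})"
proof -
  have "{x \<in> A. f x \<in> J} = (\<Union>j\<in>J. {x \<in> A. f x = j})" by auto
  then show ?thesis using assms by (simp add: card_UN_disjoint disjoint_iff)
qed

lemma Sum_any_card_fibres:
  assumes A: "finite A" shows "Sum_any (\<lambda>j. int (card {x \<in> A. f x = j})) = int (card A)"
proof -
  have "Sum_any (\<lambda>j. int (card {x \<in> A. f x = j})) = (\<Sum>j\<in>f ` A. int (card {x \<in> A. f x = j}))"
    using A by (intro Sum_any.expand_superset) (auto simp: card_gt_0_iff)
  also have "\<dots> = int (card {x \<in> A. f x \<in> f ` A})" using card_fibres[OF A, of "f ` A" f] A by simp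
  also have "{x \<in> A. f x \<in> f ` A} = A" by auto
  finally show ?thesis .
qed

lemma triple_mat_fibre:
  assumes n: "n > 0" and l: "l \<in> Lambda n (int r)" and m: "m \<in> Lambda n (int r)" and w: "w \<in> aff_sym r" and r: "r > 0"
  shows "block n r l i \<inter> w ` block n r m j = {x. block_index n r l x = i \<and> block_index n r m (inv w x) = j}"
  unfolding set_eq_iff Int_iff mem_image_aff[OF w] mem_Collect_eq block_index_iff[OF n l r] block_index_iff[OF n m r] by blast

lemma triple_mat_zero:
  assumes "n > 0" "l \<in> Lambda n (int 0)" shows "triple_mat n 0 l w m = 0"
  using assms by (simp add: triple_mat_def block_zero fun_eq_iff)

lemma ro_triple_mat:
  assumes n: "n > 0" and l: "l \<in> Lambda n (int r)" and m: "m \<in> Lambda n (int r)" and w: "w \<in> aff_sym r"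
  shows "ro (triple_mat n r l w m) = l"
proof (cases "r = 0")
  case True
  then show ?thesis using l n by (simp add: triple_mat_zero Lambda_zero_iff ro_def fun_eq_iff)
next
  case False
  then have r: "r > 0" by simp
  have "ro (triple_mat n r l w m) i = l i" for i
  proof -
    have "block n r l i \<inter> w ` block n r m j = {x \<in> block n r l i. block_index n r m (inv w x) = j}" for j
      unfolding triple_mat_fibre[OF n l m w r] using block_index_iff[OF n l r] by auto
    then show ?thesis
      using Sum_any_card_fibres[of "block n r l i" "\<lambda>x. block_index n r m (inv w x)"] card_block[OF n l]
      by (simp add: ro_def triple_mat_def)
  qed
  then show ?thesis by blast
qed

lemma co_triple_mat:
  assumes n: "n > 0" and l: "l \<in> Lambda n (int r)" and m: "m \<in> Lambda n (int r)" and w: "w \<in> aff_sym r"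
  shows "co (triple_mat n r l w m) = m"
proof (cases "r = 0")
  case True
  then show ?thesis using l m n by (simp add: triple_mat_zero Lambda_zero_iff co_def fun_eq_iff)
next
  case False
  then have r: "r > 0" by simp
  have "co (triple_mat n r l w m) j = m j" for j
  proof -
    have "block n r l i \<inter> w ` block n r m j = {x \<in> w ` block n r m j. block_index n r l x = i}" for i
      using block_index_iff[OF n l r] by auto
    moreover have "card (w ` block n r m j) = card (block n r m j)"
      using w by (intro card_image) (auto simp: inj_on_def aff_sym_eq_iff)
    ultimately show ?thesis
      using Sum_any_card_fibres[of "w ` block n r m j" "\<lambda>x. block_index n r l x"] card_block[OF n m]
      by (simp add: co_def triple_mat_def)
  qed
  then show ?thesis by blast
qed

lemma triple_mat_Theta:
  assumes n: "n > 0" and l: "l \<in> Lambda n (int r)" and m: "m \<in> Lambda n (int r)" and w: "w \<in> aff_sym r"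
  shows "triple_mat n r l w m \<in> Theta_r n r"
proof -
  have "msigma n (triple_mat n r l w m) = (\<Sum>i = 1..int n. ro (triple_mat n r l w m) i)"
    by (simp add: msigma_def ro_def)
  then have ms: "msigma n (triple_mat n r l w m) = int r"
    using l by (simp add: ro_triple_mat[OF assms] Lambda_def vsigma_def)
  have "triple_mat n r l w m \<in> Mat n"
  proof (cases "r = 0")
    case True then show ?thesis using l n by (simp add: triple_mat_zero Mat_def)
  next
    case False
    then have r: "r > 0" by simp
    have per: "triple_mat n r l w m (i + int n) (j + int n) = triple_mat n r l w m i j" for i j
    proof -
      have "block n r l (i + int n) \<inter> w ` block n r m (j + int n) = (\<lambda>x. x + int r) ` (block n r l i \<inter> w ` block n r m j)"
      proof (intro set_eqI)
        fix x
        have "x \<in> (\<lambda>x. x + int r) ` (block n r l i \<inter> w ` block n r m j) \<longleftrightarrow> x - int r \<in> block n r l i \<inter> w ` block n r m j"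
          by (metis (no_types, lifting) add_diff_cancel diff_add_cancel image_iff)
        moreover have "x - int r \<in> block n r l i \<longleftrightarrow> x \<in> block n r l (i + int n)"
          using block_shift[OF n l, of "x - int r" 1 i] by simp
        moreover have "x - int r \<in> w ` block n r m j \<longleftrightarrow> x \<in> w ` block n r m (j + int n)"
          using image_block_shift[OF n m w, of "x - int r" 1 j] by simp
        ultimately show "x \<in> block n r l (i + int n) \<inter> w ` block n r m (j + int n) \<longleftrightarrow>
          x \<in> (\<lambda>x. x + int r) ` (block n r l i \<inter> w ` block n r m j)" by blast
      qed
      then show ?thesis by (simp add: triple_mat_def card_image)
    qed
    have "finite {j. triple_mat n r l w m i j \<noteq> 0}" for i
    proof (rule finite_subset)
      show "{j. triple_mat n r l w m i j \<noteq> 0} \<subseteq> (\<lambda>x. block_index n r m (inv w x)) ` block n r l i"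
      proof
        fix j assume "j \<in> {j. triple_mat n r l w m i j \<noteq> 0}"
        then have "block n r l i \<inter> w ` block n r m j \<noteq> {}" by (auto simp: triple_mat_def)
        then obtain x where "x \<in> block n r l i" "block_index n r m (inv w x) = j"
          unfolding triple_mat_fibre[OF n l m w r] using block_index_iff[OF n l r] by blast
        then show "j \<in> (\<lambda>x. block_index n r m (inv w x)) ` block n r l i" by blast
      qed
    qed simp
    moreover have "finite {i. triple_mat n r l w m i j \<noteq> 0}" for j
    proof (rule finite_subset)
      show "{i. triple_mat n r l w m i j \<noteq> 0} \<subseteq> block_index n r l ` w ` block n r m j"
      proof
        fix i assume "i \<in> {i. triple_mat n r l w m i j \<noteq> 0}"
        then have "block n r l i \<inter> w ` block n r m j \<noteq> {}" by (auto simp: triple_mat_def)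
        then obtain x where x: "x \<in> block n r l i" "x \<in> w ` block n r m j" by blast
        then have "i = block_index n r l x" using block_index_iff[OF n l r, of x i] by simp
        then show "i \<in> block_index n r l ` w ` block n r m j" using x(2) by (rule image_eqI)
      qed
    qed simp
    ultimately show ?thesis using per by (simp add: Mat_def)
  qed
  then show ?thesis using ms by (simp add: Theta_r_def Theta_def triple_mat_def)
qed

text \<open>
  Label an integer by its block and by the block of its preimage. Equal matrices mean that both
  permutations give equally distributed labels, so \<open>matching\<close> yields an element of the left Young
  subgroup that carries one labelling to the other.
\<close>

lemma same_matrix_same_coset:
  assumes n: "n > 0" and l: "l \<in> Lambda n (int r)" and m: "m \<in> Lambda n (int r)"
    and w: "w \<in> aff_sym r" and w': "w' \<in> aff_sym r"
    and eq: "triple_mat n r l w m = triple_mat n r l w' m"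
  shows "w' \<in> double_coset n r l w m"
proof (cases "r = 0")
  case True
  then have "w' = id \<circ> w \<circ> id" using w w' by simp
  then show ?thesis unfolding double_coset_def using young_group(1)[OF n l] young_group(1)[OF n m] by blast
next
  case False
  then have r: "r > 0" by simp
  define F where "F x = (block_index n r l x, block_index n r m (inv w x))" for x
  define F' where "F' x = (block_index n r l x, block_index n r m (inv w' x))" for x
  define \<tau> :: "int \<times> int \<Rightarrow> int \<times> int" where "\<tau> = (\<lambda>(a, b). (a + int n, b + int n))"
  have fib: "{x. F x = (i, j)} = block n r l i \<inter> w ` block n r m j"
    "{x. F' x = (i, j)} = block n r l i \<inter> w' ` block n r m j" for i j
    unfolding triple_mat_fibre[OF n l m w r] triple_mat_fibre[OF n l m w' r] by (auto simp: F_def F'_def)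
  have b1: "block_index n r k (x + int r) = block_index n r k x + int n" if "k \<in> Lambda n (int r)" for k x
    using block_index_shift[OF n that r, of x 1] by simp
  have "inj \<tau>" by (auto simp: \<tau>_def inj_def)
  moreover have "F (x + int r) = \<tau> (F x)" "F' (x + int r) = \<tau> (F' x)" for x
    by (simp_all add: F_def F'_def \<tau>_def b1[OF l] b1[OF m] aff_sym_shift1[OF aff_sym_inv[OF w]] aff_sym_shift1[OF aff_sym_inv[OF w']])
  moreover have "finite {x. F x = a}" "finite {x. F' x = a}" "card {x. F x = a} = card {x. F' x = a}" for a
    using fun_cong[OF fun_cong[OF eq, of "fst a"], of "snd a"] fib[of "fst a" "snd a"]
    by (simp_all add: triple_mat_def)
  ultimately obtain g where g: "g \<in> aff_sym r" "\<And>x. F' (g x) = F x"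
    using matching[OF r, of \<tau> F F'] by metis
  have gl: "g \<in> young n r l" using g by (simp add: young_block_index[OF n l r] F_def F'_def)
  define y where "y = inv w' \<circ> (g \<circ> w)"
  have "y \<in> aff_sym r" unfolding y_def by (intro aff_sym_comp aff_sym_inv w w' g)
  moreover have "block_index n r m (y x) = block_index n r m x" for x
    using g(2)[of "w x"] by (simp add: y_def F_def F'_def aff_sym_inv_left[OF w])
  ultimately have y: "y \<in> young n r m" by (simp add: young_block_index[OF n m r])
  have "w' \<circ> y = g \<circ> w" using w' by (simp add: y_def flip: comp_assoc)
  then have "w' \<circ> y \<circ> inv y = g \<circ> w \<circ> inv y" by simp
  then have "w' = g \<circ> w \<circ> inv y" using young_aff[OF y] by (simp add: comp_assoc)
  then show ?thesis unfolding double_coset_def using gl young_group(3)[OF n m y] by blast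
qed

lemma double_coset_eq:
  assumes n: "n > 0" and l: "l \<in> Lambda n (int r)" and m: "m \<in> Lambda n (int r)" and w: "w \<in> aff_sym r"
  shows "double_coset n r l w m = {w' \<in> aff_sym r. triple_mat n r l w' m = triple_mat n r l w m}"
proof (intro equalityI subsetI)
  fix w' assume "w' \<in> double_coset n r l w m"
  then obtain u y where uy: "u \<in> young n r l" "y \<in> young n r m" "w' = u \<circ> w \<circ> y"
    by (auto simp: double_coset_def)
  then show "w' \<in> {w' \<in> aff_sym r. triple_mat n r l w' m = triple_mat n r l w m}"
    using triple_mat_invariant[OF n l m w uy(1,2)] by (simp add: aff_sym_comp w young_aff)
qed (auto intro: same_matrix_same_coset[OF n l m w])

lemma finite_double_coset:
  assumes "n > 0" "l \<in> Lambda n (int r)" "m \<in> Lambda n (int r)"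
  shows "finite (double_coset n r l w m)"
proof -
  have "double_coset n r l w m = (\<lambda>(u, y). u \<circ> w \<circ> y) ` (young n r l \<times> young n r m)"
    by (auto simp: double_coset_def)
  then show ?thesis using assms by (simp add: finite_young)
qed

text \<open>
  By \<open>double_coset_eq\<close> this is a double coset or empty. Describing it by the matrix avoids the
  choice of a representative.
\<close>

definition Dset :: "nat \<Rightarrow> nat \<Rightarrow> mat \<Rightarrow> perm set" where
  "Dset n r C = {w \<in> aff_sym r. triple_mat n r (ro C) w (co C) = C}"

lemma Sum_any_rows:
  fixes f :: "int \<Rightarrow> int \<Rightarrow> int"
  assumes "\<And>i. finite {j. f i j \<noteq> 0}" "finite I"
  shows "(\<Sum>i\<in>I. Sum_any (f i)) = (\<Sum>p\<in>{p. f (fst p) (snd p) \<noteq> 0 \<and> fst p \<in> I}. f (fst p) (snd p))"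
proof -
  have "(\<Sum>i\<in>I. Sum_any (f i)) = (\<Sum>i\<in>I. \<Sum>j\<in>{j. f i j \<noteq> 0}. f i j)" by (simp add: Sum_any.expand_set)
  also have "\<dots> = (\<Sum>p\<in>(SIGMA i:I. {j. f i j \<noteq> 0}). f (fst p) (snd p))"
    using assms by (subst sum.Sigma) (auto simp: split_def)
  also have "(SIGMA i:I. {j. f i j \<noteq> 0}) = {p. f (fst p) (snd p) \<noteq> 0 \<and> fst p \<in> I}" by auto
  finally show ?thesis .
qed

lemma vsigma_co:
  assumes n: "n > 0" and A: "A \<in> Mat n" shows "vsigma n (co A) = msigma n A"
proof -
  let ?f = "\<lambda>p. A (fst p) (snd p)"
  have "msigma n A = (\<Sum>p\<in>{p. ?f p \<noteq> 0 \<and> fst p \<in> {1..int n}}. ?f p)"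
    unfolding msigma_def by (rule Sum_any_rows) (use A in \<open>auto simp: Mat_def\<close>)
  also have "\<dots> = (\<Sum>p\<in>{p. ?f p \<noteq> 0 \<and> snd p \<in> {1..int n}}. ?f p)"
    using n A by (intro window_sum) (auto simp: Mat_def)
  also have "\<dots> = (\<Sum>p\<in>{p. A (snd p) (fst p) \<noteq> 0 \<and> fst p \<in> {1..int n}}. A (snd p) (fst p))"
    by (rule sum.reindex_bij_witness[where i = prod.swap and j = prod.swap]) auto
  also have "\<dots> = vsigma n (co A)"
    unfolding vsigma_def co_def by (rule Sum_any_rows[symmetric]) (use A in \<open>auto simp: Mat_def\<close>)
  finally show ?thesis by simp
qed

lemma ro_Zvec: assumes A: "A \<in> Mat n" shows "ro A \<in> Zvec n"
proof -
  have "ro A (i + int n) = ro A i" for i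
  proof -
    have "bij (\<lambda>x::int. x + int n)"
      by (rule o_bij[where g = "\<lambda>x. x - int n"]) (auto simp: fun_eq_iff)
    moreover have "A (i + int n) \<circ> (\<lambda>x. x + int n) = A i"
      using A by (simp add: fun_eq_iff Mat_def)
    ultimately have "Sum_any (A (i + int n)) = Sum_any (A i)" by (rule Sum_any.reindex_cong)
    then show ?thesis by (simp add: ro_def)
  qed
  then show ?thesis by (simp add: Zvec_def)
qed

lemma co_Zvec: assumes A: "A \<in> Mat n" shows "co A \<in> Zvec n"
proof -
  have "co A (j + int n) = co A j" for j
  proof -
    have "bij (\<lambda>x::int. x + int n)"
      by (rule o_bij[where g = "\<lambda>x. x - int n"]) (auto simp: fun_eq_iff)
    moreover have "(\<lambda>i. A i (j + int n)) \<circ> (\<lambda>x. x + int n) = (\<lambda>i. A i j)"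
      using A by (simp add: fun_eq_iff Mat_def)
    ultimately have "Sum_any (\<lambda>i. A i (j + int n)) = Sum_any (\<lambda>i. A i j)" by (rule Sum_any.reindex_cong)
    then show ?thesis by (simp add: co_def)
  qed
  then show ?thesis by (simp add: Zvec_def)
qed

lemma ro_co_Lambda:
  assumes n: "n > 0" and C: "C \<in> Theta_r n r"
  shows "ro C \<in> Lambda n (int r)" "co C \<in> Lambda n (int r)"
proof -
  have CM: "C \<in> Mat n" "\<And>i j. 0 \<le> C i j" "msigma n C = int r" using C by (auto simp: Theta_r_def Theta_def)
  have "0 \<le> ro C i" "0 \<le> co C i" for i
    using CM(2) by (auto simp: ro_def co_def Sum_any.expand_set intro!: sum_nonneg)
  moreover have "vsigma n (ro C) = int r" using CM(3) by (simp add: vsigma_def ro_def msigma_def)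
  moreover have "vsigma n (co C) = int r" using CM vsigma_co[OF n CM(1)] by simp
  ultimately show "ro C \<in> Lambda n (int r)" "co C \<in> Lambda n (int r)"
    using ro_Zvec[OF CM(1)] co_Zvec[OF CM(1)] by (auto simp: Lambda_def Nvec_def)
qed

lemma Theta_r_zero: assumes n: "n > 0" and C: "C \<in> Theta_r n 0" shows "C = 0"
proof (intro ext)
  fix i j
  have "C \<in> Theta n" "msigma n C = 0" using C by (auto simp: Theta_r_def)
  then have "C i j \<le> 0" "0 \<le> C i j"
    using entry_le_ro[of C n i j] ro_bound[OF n, of C i] by (auto simp: Theta_def)
  then show "C i j = 0 i j" by simp
qed

lemma labelling_exists:
  fixes c :: "int \<Rightarrow> int"
  assumes A: "finite A" and c: "\<And>k. 0 \<le> c k" "finite {k. c k \<noteq> 0}" "Sum_any c = int (card A)"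
  shows "\<exists>h. \<forall>k. int (card {x \<in> A. h x = k}) = c k"
proof -
  define B where "B = (SIGMA k:{k. c k \<noteq> 0}. {..<nat (c k)})"
  have "int (card B) = (\<Sum>k\<in>{k. c k \<noteq> 0}. c k)" using c by (simp add: B_def card_SigmaI)
  then have "card B = card A" using c(3) by (simp add: Sum_any.expand_set)
  moreover have fB: "finite B" using c by (auto simp: B_def)
  ultimately obtain f where f: "bij_betw f A B" using A by (metis finite_same_card_bij)
  have "int (card {x \<in> A. (fst \<circ> f) x = k}) = c k" for k
  proof -
    have "bij_betw f {x \<in> A. (fst \<circ> f) x = k} {b \<in> B. fst b = k}"
      using f by (auto simp: bij_betw_def inj_on_def)
    then have "card {x \<in> A. (fst \<circ> f) x = k} = card {b \<in> B. fst b = k}" by (rule bij_betw_same_card)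
    also have "{b \<in> B. fst b = k} = Pair k ` {..<nat (c k)}" by (auto simp: B_def)
    also have "int (card \<dots>) = c k" using c(1)[of k] by (simp add: card_image inj_on_def)
    finally show ?thesis .
  qed
  then show ?thesis by blast
qed

text \<open>
  Give the elements of each block in one period labels with the multiplicities in the
  corresponding row of \<open>C\<close>, and extend this labelling periodically. It uses every label as often
  as the labelling by the blocks of the column sums does; a permutation that matches the two has
  matrix \<open>C\<close>.
\<close>

lemma Dset_nonempty:
  assumes n: "n > 0" and C: "C \<in> Theta_r n r" shows "\<exists>w. w \<in> Dset n r C"
proof (cases "r = 0")
  case True
  have "C = 0" using Theta_r_zero[OF n] C True by simp
  moreover have "id \<in> aff_sym r" by simp
  ultimately show ?thesis using ro_co_Lambda[OF n C] True n
    by (intro exI[of _ id]) (simp add: Dset_def triple_mat_zero)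
next
  case False
  then have r: "r > 0" by simp
  note L = ro_co_Lambda[OF n C]
  let ?l = "ro C" and ?m = "co C"
  have CM: "C \<in> Mat n" "\<And>i j. 0 \<le> C i j" using C by (auto simp: Theta_r_def Theta_def)
  have fin: "finite {j. C i j \<noteq> 0}" "finite {i. C i j \<noteq> 0}" for i j using CM by (auto simp: Mat_def)
  have "\<exists>h. \<forall>k. int (card {x \<in> block n r ?l i. h x = k}) = C i k" for i
    using CM fin card_block[OF n L(1), of i] by (intro labelling_exists) (auto simp: ro_def)
  then obtain H where H: "int (card {x \<in> block n r ?l i. H i x = k}) = C i k" for i k by metis
  (* q x is the number of the period that contains the block of x; the labels H of the first
     period are carried over to it. *)
  define q where "q x = (block_index n r ?l x - 1) div int n" for x
  define h where "h x = H (block_index n r ?l x - q x * int n) (x - q x * int r) + q x * int n" for x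
  note bs = block_index_shift[OF n L(1) r]
  have qs: "q (x + t * int r) = q x + t" for x t
  proof -
    have "block_index n r ?l x + t * int n - 1 = (block_index n r ?l x - 1) + t * int n" by simp
    then show ?thesis unfolding q_def bs using n by (simp only: div_mult_self1)
  qed
  have hs: "h (x + t * int r) = h x + t * int n" for x t
    unfolding h_def qs bs by (simp add: algebra_simps)
  have cell: "int (card {x. block_index n r ?l x = i \<and> h x = k}) = C i k" for i k
  proof -
    define t where "t = (i - 1) div int n"
    have "bij_betw (\<lambda>x. x + t * int r) {x \<in> block n r ?l (i - t * int n). H (i - t * int n) x = k - t * int n}
      {x. block_index n r ?l x = i \<and> h x = k}"
    proof (rule bij_betwI[where g = "\<lambda>x. x - t * int r"])
      show "(\<lambda>x. x + t * int r) \<in> {x \<in> block n r ?l (i - t * int n). H (i - t * int n) x = k - t * int n} \<rightarrow>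
          {x. block_index n r ?l x = i \<and> h x = k}"
      proof
        fix x assume x: "x \<in> {x \<in> block n r ?l (i - t * int n). H (i - t * int n) x = k - t * int n}"
        then have b: "block_index n r ?l x = i - t * int n" using block_index_iff[OF n L(1) r] by blast
        then have b': "block_index n r ?l (x + t * int r) = i" by (simp add: bs)
        then have "q (x + t * int r) = t" by (simp add: q_def t_def)
        then have "h (x + t * int r) = k" using x b' by (simp add: h_def)
        with b' show "x + t * int r \<in> {x. block_index n r ?l x = i \<and> h x = k}" by simp
      qed
      show "(\<lambda>x. x - t * int r) \<in> {x. block_index n r ?l x = i \<and> h x = k} \<rightarrow>
          {x \<in> block n r ?l (i - t * int n). H (i - t * int n) x = k - t * int n}"
      proof
        fix x assume x: "x \<in> {x. block_index n r ?l x = i \<and> h x = k}"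
        then have "q x = t" by (simp add: q_def t_def)
        then have "H (i - t * int n) (x - t * int r) = k - t * int n" using x by (auto simp: h_def)
        moreover have "block_index n r ?l (x - t * int r) = i - t * int n" using bs[of x "- t"] x by simp
        ultimately show "x - t * int r \<in> {x \<in> block n r ?l (i - t * int n). H (i - t * int n) x = k - t * int n}"
          using block_index_iff[OF n L(1) r] by auto
      qed
    qed auto
    then have "card {x. block_index n r ?l x = i \<and> h x = k} =
        card {x \<in> block n r ?l (i - t * int n). H (i - t * int n) x = k - t * int n}"
      by (rule bij_betw_same_card[symmetric])
    then show ?thesis using H[of "i - t * int n" "k - t * int n"] Mat_shift[OF CM(1), of i "- t" k] by simp
  qed
  have cfin: "finite {x. block_index n r ?l x = i \<and> h x = k}" for i k
    by (rule finite_subset[of _ "block n r ?l i"]) (use block_index_iff[OF n L(1) r] in auto)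
  have hfib: "finite {x. h x = k}" "int (card {x. h x = k}) = ?m k" for k
  proof -
    let ?I = "{i. C i k \<noteq> 0}"
    have eq: "{x. h x = k} = (\<Union>i\<in>?I. {x. block_index n r ?l x = i \<and> h x = k})"
    proof (intro equalityI subsetI)
      fix x assume x: "x \<in> {x. h x = k}"
      have "card {z. block_index n r ?l z = block_index n r ?l x \<and> h z = k} \<noteq> 0" using x cfin by auto
      then have "C (block_index n r ?l x) k \<noteq> 0" using cell[of "block_index n r ?l x" k] by linarith
      with x show "x \<in> (\<Union>i\<in>?I. {x. block_index n r ?l x = i \<and> h x = k})" by blast
    qed auto
    show "finite {x. h x = k}" unfolding eq using fin cfin by blast
    have "card {x. h x = k} = (\<Sum>i\<in>?I. card {x. block_index n r ?l x = i \<and> h x = k})"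
      unfolding eq using fin cfin by (intro card_UN_disjoint) auto
    then show "int (card {x. h x = k}) = ?m k" by (simp add: cell co_def Sum_any.expand_set)
  qed
  have "inj (\<lambda>k. k + int n)" by (simp add: inj_def)
  moreover have "block_index n r ?m (x + int r) = block_index n r ?m x + int n" for x using block_index_shift[OF n L(2) r, of x 1] by simp
  moreover have "h (x + int r) = h x + int n" for x using hs[of x 1] by simp
  moreover have "{x. block_index n r ?m x = k} = block n r ?m k" for k using block_index_iff[OF n L(2) r] by auto
  then have "finite {x. block_index n r ?m x = k}" "card {x. block_index n r ?m x = k} = card {x. h x = k}" for k
    using hfib(2)[of k] card_block[OF n L(2), of k] by simp_all
  ultimately obtain g where g: "g \<in> aff_sym r" "\<And>x. h (g x) = block_index n r ?m x"
    using matching[OF r, of "\<lambda>k. k + int n" "block_index n r ?m" h] hfib(1) by metis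
  have "triple_mat n r ?l g ?m = C"
  proof (intro ext)
    fix i k
    have "h x = k \<longleftrightarrow> block_index n r ?m (inv g x) = k" for x using g(2)[of "inv g x"] g(1) by simp
    then have "block n r ?l i \<inter> g ` block n r ?m k = {x. block_index n r ?l x = i \<and> h x = k}"
      unfolding triple_mat_fibre[OF n L g(1) r] by auto
    then show "triple_mat n r ?l g ?m i k = C i k" by (simp add: triple_mat_def cell)
  qed
  then show ?thesis using g(1) by (auto simp: Dset_def)
qed

text \<open>
  If \<open>f x < f' x\<close>, the elements where \<open>f\<close> is at most \<open>f x\<close> include everything up to \<open>x\<close>, while those
  where \<open>f'\<close> is at most \<open>f x\<close> lie strictly below \<open>x\<close>; but both sets have the same size.
\<close>

lemma monotone_determined_by_fibres:
  fixes f f' :: "int \<Rightarrow> int"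
  assumes A: "finite A"
    and mono: "\<And>x y. x \<in> A \<Longrightarrow> y \<in> A \<Longrightarrow> x \<le> y \<Longrightarrow> f x \<le> f y" "\<And>x y. x \<in> A \<Longrightarrow> y \<in> A \<Longrightarrow> x \<le> y \<Longrightarrow> f' x \<le> f' y"
    and card: "\<And>k. card {x \<in> A. f x = k} = card {x \<in> A. f' x = k}"
    and x: "x \<in> A"
  shows "f x = f' x"
proof -
  have main: False
    if m: "\<And>x y. x \<in> A \<Longrightarrow> y \<in> A \<Longrightarrow> x \<le> y \<Longrightarrow> f x \<le> f y" "\<And>x y. x \<in> A \<Longrightarrow> y \<in> A \<Longrightarrow> x \<le> y \<Longrightarrow> f' x \<le> f' y"
      and c: "\<And>k. card {x \<in> A. f x = k} = card {x \<in> A. f' x = k}" and lt: "f x < f' x" for f f' :: "int \<Rightarrow> int"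
  proof -
    let ?J = "{j \<in> f ` A \<union> f' ` A. j \<le> f x}"
    have "{y \<in> A. f y \<le> f x} = {y \<in> A. f y \<in> ?J}" "{y \<in> A. f' y \<le> f x} = {y \<in> A. f' y \<in> ?J}" by auto
    then have eq: "card {y \<in> A. f y \<le> f x} = card {y \<in> A. f' y \<le> f x}"
      using card_fibres[OF A, of ?J f] card_fibres[OF A, of ?J f'] A c by simp
    have "card {y \<in> A. f' y \<le> f x} \<le> card {y \<in> A. y < x}"
      using A m(2)[OF x] lt by (intro card_mono) (auto simp: not_le[symmetric], fastforce)
    also have "\<dots> < card {y \<in> A. y \<le> x}" using A x by (intro psubset_card_mono) auto
    also have "\<dots> \<le> card {y \<in> A. f y \<le> f x}" using A m(1) x by (intro card_mono) auto
    finally show False using eq by simp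
  qed
  show ?thesis
  proof (cases "f x" "f' x" rule: linorder_cases)
    case less then show ?thesis using main[of f f'] mono card by blast
  next
    case greater
    have "card {x \<in> A. f' x = k} = card {x \<in> A. f x = k}" for k using card by simp
    then show ?thesis using main[of f' f] mono greater by blast
  qed
qed

text \<open>
  The inverse of a distinguished representative followed by \<^const>\<open>block_index\<close> is monotone on each
  block, and the matrix prescribes the sizes of its fibres.
\<close>

lemma dist_double_unique:
  assumes n: "n > 0" and l: "l \<in> Lambda n (int r)" and m: "m \<in> Lambda n (int r)"
    and d: "d \<in> dist_double n r l m" and d': "d' \<in> dist_double n r l m"
    and eq: "triple_mat n r l d m = triple_mat n r l d' m"
  shows "d = d'"
proof (cases "r = 0")
  case True
  have "d \<in> aff_sym r" "d' \<in> aff_sym r" using d d' by (simp_all add: dist_double_iff[OF n l m])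
  then show ?thesis using True by simp
next
  case False
  then have r: "r > 0" by simp
  note D = d[unfolded dist_double_iff[OF n l m]] and D' = d'[unfolded dist_double_iff[OF n l m]]
  have da: "d \<in> aff_sym r" and da': "d' \<in> aff_sym r" using D D' by auto
  have mono: "block_index n r m (inv e x) \<le> block_index n r m (inv e y)"
    if "incr n r l (inv e)" "x \<in> block n r l i" "y \<in> block n r l i" "x \<le> y" for e x y i
    using that by (intro block_index_mono[OF n m r]) (force simp: incr_def order_le_less)
  have "block_index n r m (inv d x) = block_index n r m (inv d' x)" for x
  proof (rule monotone_determined_by_fibres[of "block n r l (block_index n r l x)" "\<lambda>x. block_index n r m (inv d x)" "\<lambda>x. block_index n r m (inv d' x)"])
    fix k
    have "{z \<in> block n r l i. block_index n r m (inv e z) = k} = block n r l i \<inter> e ` block n r m k" if "e \<in> aff_sym r" for e i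
      unfolding triple_mat_fibre[OF n l m that r] using block_index_iff[OF n l r] by auto
    then show "card {z \<in> block n r l (block_index n r l x). block_index n r m (inv d z) = k} =
        card {z \<in> block n r l (block_index n r l x). block_index n r m (inv d' z) = k}"
      using fun_cong[OF fun_cong[OF eq, of "block_index n r l x"], of k] da da' by (simp add: triple_mat_def)
  next
    show "x \<in> block n r l (block_index n r l x)" using block_index_iff[OF n l r, of x] by blast
  next
    fix a b assume "a \<in> block n r l (block_index n r l x)" "b \<in> block n r l (block_index n r l x)" "a \<le> b"
    then show "block_index n r m (inv d a) \<le> block_index n r m (inv d b)" using mono D by blast
  next
    fix a b assume "a \<in> block n r l (block_index n r l x)" "b \<in> block n r l (block_index n r l x)" "a \<le> b"
    then show "block_index n r m (inv d' a) \<le> block_index n r m (inv d' b)" using mono D' by blast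
  qed simp
  then have f: "block_index n r m (inv d x) = block_index n r m (inv d' x)" for x .
  define y where "y = inv d \<circ> d'"
  have "y \<in> young n r m" unfolding young_block_index[OF n m r]
    using f aff_sym_inv_left[OF da'] by (simp add: y_def aff_sym_comp aff_sym_inv da da')
  moreover have "d' \<circ> id = d \<circ> y" using da by (simp add: y_def flip: comp_assoc)
  ultimately have "d' = d \<and> id = y"
    using D D' by (intro coset_factor_unique[OF n m] young_group(1)[OF n m]) auto
  then show ?thesis by simp
qed

text \<open>
  An element of minimal length in the double coset has no descent inside a block on either side.
\<close>

lemma dist_double_exists:
  assumes n: "n > 0" and C: "C \<in> Theta_r n r"
  shows "\<exists>d. d \<in> dist_double n r (ro C) (co C) \<and> d \<in> Dset n r C"
proof -
  note L = ro_co_Lambda[OF n C]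
  define N where "N = (LEAST k. \<exists>w \<in> Dset n r C. ninv r w = k)"
  have ex: "\<exists>k. \<exists>w \<in> Dset n r C. ninv r w = k" using Dset_nonempty[OF n C] by blast
  obtain d where d: "d \<in> Dset n r C" "ninv r d = N" using LeastI_ex[OF ex] unfolding N_def by blast
  have least: "N \<le> ninv r w" if "w \<in> Dset n r C" for w
    unfolding N_def using that by (intro Least_le) blast
  have da: "d \<in> aff_sym r" using d by (simp add: Dset_def)
  have "incr n r (co C) d"
  proof (rule ccontr)
    assume "\<not> ?thesis"
    then obtain k m where k: "r \<ge> 2" "k \<in> block n r (co C) m" "k + 1 \<in> block n r (co C) m" "d (k + 1) < d k"
      using not_incr_descent[OF n L(2) da] by blast
    have s: "simple_refl r k \<in> young n r (co C)" by (rule simple_refl_young[OF n L(2) k(1-3)])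
    have "d \<circ> simple_refl r k \<in> Dset n r C"
      using triple_mat_invariant[OF n L da young_group(1)[OF n L(1)] s] d aff_sym_comp[OF da young_aff[OF s]]
      by (simp add: Dset_def)
    then show False using least ninv_simple_refl_right_down[OF k(1) da k(4)] d(2) by fastforce
  qed
  moreover have "incr n r (ro C) (inv d)"
  proof (rule ccontr)
    assume "\<not> ?thesis"
    then obtain k m where k: "r \<ge> 2" "k \<in> block n r (ro C) m" "k + 1 \<in> block n r (ro C) m" "inv d (k + 1) < inv d k"
      using not_incr_descent[OF n L(1) aff_sym_inv[OF da]] by blast
    have s: "simple_refl r k \<in> young n r (ro C)" by (rule simple_refl_young[OF n L(1) k(1-3)])
    have "simple_refl r k \<circ> d \<in> Dset n r C"
      using triple_mat_invariant[OF n L da s young_group(1)[OF n L(2)]] d aff_sym_comp[OF young_aff[OF s] da]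
      by (simp add: Dset_def)
    then show False using least ninv_simple_refl_down[OF k(1) da k(4)] d(2) by fastforce
  qed
  ultimately show ?thesis using d da by (auto simp: dist_double_iff[OF n L])
qed

lemma Dset_eq_double_coset:
  assumes n: "n > 0" and C: "C \<in> Theta_r n r" and w: "w \<in> Dset n r C"
  shows "Dset n r C = double_coset n r (ro C) w (co C)"
  using w by (auto simp: Dset_def double_coset_eq[OF n ro_co_Lambda[OF n C]])

lemma Dset_aff: "Dset n r C \<subseteq> aff_sym r"
  by (auto simp: Dset_def)

lemma finite_Dset: assumes n: "n > 0" and C: "C \<in> Theta_r n r" shows "finite (Dset n r C)"
proof -
  obtain w where "w \<in> Dset n r C" using Dset_nonempty[OF n C] by blast
  then show ?thesis using Dset_eq_double_coset[OF n C] finite_double_coset[OF n ro_co_Lambda[OF n C]] by metis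
qed

lemma Dset_invariant:
  assumes n: "n > 0" and C: "C \<in> Theta_r n r" and w: "w \<in> Dset n r C"
  shows "y \<in> young n r (co C) \<Longrightarrow> w \<circ> y \<in> Dset n r C" "u \<in> young n r (ro C) \<Longrightarrow> u \<circ> w \<in> Dset n r C"
proof -
  note L = ro_co_Lambda[OF n C]
  have wa: "w \<in> aff_sym r" using w by (simp add: Dset_def)
  show "y \<in> young n r (co C) \<Longrightarrow> w \<circ> y \<in> Dset n r C"
    using triple_mat_invariant[OF n L wa young_group(1)[OF n L(1)], of y] w aff_sym_comp[OF wa young_aff, of y]
    by (simp add: Dset_def)
  show "u \<in> young n r (ro C) \<Longrightarrow> u \<circ> w \<in> Dset n r C"
    using triple_mat_invariant[OF n L wa _ young_group(1)[OF n L(2)], of u] w aff_sym_comp[OF young_aff wa, of u]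
    by (simp add: Dset_def)
qed

section \<open>Structure constants of the affine Schur algebra\<close>

lemma xelt_carrier: "xelt n r l \<in> hecke_carrier r"
  unfolding xelt_T_sum by (rule T_sum_carrier) (auto simp: young_aff)

text \<open>
  The basis element of a matrix acts by left multiplication with the sum over the shortest
  representatives of the left cosets in its double coset; this makes it visibly well defined.
\<close>

definition coset_rep_sum :: "nat \<Rightarrow> nat \<Rightarrow> mat \<Rightarrow> hecke" where
  "coset_rep_sum n r C = T_sum {u \<in> Dset n r C. incr n r (co C) u}"

definition coset_rep_sum' :: "nat \<Rightarrow> nat \<Rightarrow> mat \<Rightarrow> hecke" where
  "coset_rep_sum' n r C = T_sum {u \<in> Dset n r C. incr n r (ro C) (inv u)}"

lemma coset_rep_sum_carrier [simp]: "coset_rep_sum n r C \<in> hecke_carrier r" "coset_rep_sum' n r C \<in> hecke_carrier r"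
  "T_sum (Dset n r C) \<in> hecke_carrier r"
  using Dset_aff[of n r C] by (auto simp: coset_rep_sum_def coset_rep_sum'_def intro!: T_sum_carrier)

text \<open>
  The first factorisation computes the action of the basis element on \<open>x\<^sub>\<mu>\<close>, the second shows
  that the image lies in \<open>x\<^sub>\<lambda> H\<close>.
\<close>

lemma coset_rep_sum_factor:
  assumes n: "n > 0" and C: "C \<in> Theta_r n r"
  shows "hmult r (coset_rep_sum n r C) (xelt n r (co C)) = T_sum (Dset n r C)"
    and "hmult r (xelt n r (ro C)) (coset_rep_sum' n r C) = T_sum (Dset n r C)"
  unfolding coset_rep_sum_def coset_rep_sum'_def
  using T_sum_right_factor[OF n ro_co_Lambda(2)[OF n C] Dset_aff Dset_invariant(1)[OF n C]]
    T_sum_left_factor[OF n ro_co_Lambda(1)[OF n C] Dset_aff Dset_invariant(2)[OF n C]] by simp_all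

lemma tensor_spaceD:
  assumes "f \<in> tensor_space n r"
  shows "l \<in> Lambda n (int r) \<Longrightarrow> \<exists>h \<in> hecke_carrier r. f l = hmult r (xelt n r l) h"
    and "f l \<in> hecke_carrier r"
proof -
  show "l \<in> Lambda n (int r) \<Longrightarrow> \<exists>h \<in> hecke_carrier r. f l = hmult r (xelt n r l) h"
    using assms by (auto simp: tensor_space_def)
  then show "f l \<in> hecke_carrier r"
    using assms hmult_carrier by (cases "l \<in> Lambda n (int r)") (auto simp: tensor_space_def)
qed

lemma tensor_space_0: "0 \<in> tensor_space n r"
  by (auto simp: tensor_space_def intro!: image_eqI[of _ _ 0])

lemma tensor_space_add:
  assumes "f \<in> tensor_space n r" "g \<in> tensor_space n r" shows "f + g \<in> tensor_space n r"
proof -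
  have "(f + g) l \<in> hmult r (xelt n r l) ` hecke_carrier r" if l: "l \<in> Lambda n (int r)" for l
  proof -
    obtain h h' where h: "h \<in> hecke_carrier r" "f l = hmult r (xelt n r l) h"
      and h': "h' \<in> hecke_carrier r" "g l = hmult r (xelt n r l) h'"
      using tensor_spaceD(1)[OF assms(1) l] tensor_spaceD(1)[OF assms(2) l] by blast
    then have "(f + g) l = hmult r (xelt n r l) (h + h')"
      by (simp add: hmult_bilinear(2)[OF xelt_carrier])
    then show ?thesis using h h' by blast
  qed
  then show ?thesis using assms by (auto simp: tensor_space_def)
qed

lemma tensor_space_mult:
  assumes "f \<in> tensor_space n r" "h \<in> hecke_carrier r" shows "(\<lambda>l. hmult r (f l) h) \<in> tensor_space n r"
proof -
  have "hmult r (f l) h \<in> hmult r (xelt n r l) ` hecke_carrier r" if l: "l \<in> Lambda n (int r)" for l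
  proof -
    obtain h' where h': "h' \<in> hecke_carrier r" "f l = hmult r (xelt n r l) h'"
      using tensor_spaceD(1)[OF assms(1) l] by blast
    then have "hmult r (f l) h = hmult r (xelt n r l) (hmult r h' h)"
      using hmult_assoc[OF xelt_carrier h'(1) assms(2)] by simp
    then show ?thesis using hmult_carrier by blast
  qed
  then show ?thesis using assms by (auto simp: tensor_space_def)
qed

lemma summand_tensor_space:
  assumes "l \<in> Lambda n (int r)" "z = hmult r (xelt n r l) h" "h \<in> hecke_carrier r"
  shows "summand l z \<in> tensor_space n r"
  using assms by (auto simp: tensor_space_def summand_def intro!: image_eqI[of _ _ 0])

lemma summand_apply: "summand l z k = (if k = l then z else 0)"
  by (simp add: summand_def)

lemma summand_add: "summand l (x + y) = summand l x + summand l y"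
  by (auto simp: summand_def fun_eq_iff)

lemma summand_0 [simp]: "summand l 0 = 0"
  by (auto simp: summand_def fun_eq_iff)

lemma sum_fun_at: "sum F I k = (\<Sum>i\<in>I. F i k)" for F :: "'i \<Rightarrow> 'k \<Rightarrow> 'b::comm_monoid_add"
  by (induction I rule: infinite_finite_induct) simp_all

lemma tensor_space_expand:
  assumes n: "n > 0" and f: "f \<in> tensor_space n r"
  shows "f = (\<Sum>l\<in>Lambda n (int r). summand l (f l))"
proof
  fix k
  have "(\<Sum>l\<in>Lambda n (int r). summand l (f l)) k = (\<Sum>l\<in>Lambda n (int r). summand l (f l) k)"
    by (rule sum_fun_at)
  also have "\<dots> = (\<Sum>l\<in>Lambda n (int r). if k = l then f l else 0)" by (simp add: summand_def)
  also have "\<dots> = f k" using finite_Lambda[OF n] f by (simp add: tensor_space_def)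
  finally show "f k = (\<Sum>l\<in>Lambda n (int r). summand l (f l)) k" by simp
qed

definition schur_act :: "nat \<Rightarrow> nat \<Rightarrow> mat \<Rightarrow> (vec \<Rightarrow> hecke) \<Rightarrow> vec \<Rightarrow> hecke" where
  "schur_act n r C = (\<lambda>f\<in>tensor_space n r. summand (ro C) (hmult r (coset_rep_sum n r C) (f (co C))))"

lemma coset_rep_sum_mult_xelt:
  assumes n: "n > 0" and C: "C \<in> Theta_r n r" and h: "h \<in> hecke_carrier r"
  shows "hmult r (coset_rep_sum n r C) (hmult r (xelt n r (co C)) h) = hmult r (T_sum (Dset n r C)) h"
  using hmult_assoc[OF coset_rep_sum_carrier(1) xelt_carrier h] coset_rep_sum_factor(1)[OF n C] by metis

lemma schur_act_end:
  assumes n: "n > 0" and C: "C \<in> Theta_r n r"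
  shows "schur_act n r C \<in> schur_end n r"
proof -
  note L = ro_co_Lambda[OF n C]
  have into: "summand (ro C) (hmult r (coset_rep_sum n r C) (f (co C))) \<in> tensor_space n r"
    if f: "f \<in> tensor_space n r" for f
  proof -
    obtain h where h: "h \<in> hecke_carrier r" "f (co C) = hmult r (xelt n r (co C)) h"
      using tensor_spaceD(1)[OF f L(2)] by blast
    have "hmult r (coset_rep_sum n r C) (f (co C)) = hmult r (xelt n r (ro C)) (hmult r (coset_rep_sum' n r C) h)"
      using coset_rep_sum_mult_xelt[OF n C h(1)] coset_rep_sum_factor(2)[OF n C] hmult_assoc[OF xelt_carrier coset_rep_sum_carrier(2) h(1)] h(2)
      by metis
    then show ?thesis by (intro summand_tensor_space[OF L(1)]) (auto simp: hmult_carrier)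
  qed
  have add: "schur_act n r C (f + g) = schur_act n r C f + schur_act n r C g"
    if "f \<in> tensor_space n r" "g \<in> tensor_space n r" for f g
    using that tensor_space_add[OF that] tensor_spaceD(2)
    by (simp add: schur_act_def hmult_bilinear(2)[OF coset_rep_sum_carrier(1)] flip: summand_add)
  have mult: "schur_act n r C (\<lambda>l. hmult r (f l) h) = (\<lambda>l. hmult r (schur_act n r C f l) h)"
    if "f \<in> tensor_space n r" "h \<in> hecke_carrier r" for f h
    using that tensor_space_mult[OF that] hmult_assoc[OF coset_rep_sum_carrier(1) tensor_spaceD(2)[OF that(1)] that(2)]
    by (auto simp: schur_act_def summand_def fun_eq_iff)
  show ?thesis unfolding schur_end_def using into add mult by (auto simp: schur_act_def)
qed

text \<open>The summands \<open>x\<^sub>k H\<close> span the tensor space, and the maps are additive.\<close>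

lemma schur_end_determined:
  assumes n: "n > 0" and F: "F \<in> schur_end n r" and G: "G \<in> schur_end n r"
    and eq: "\<And>k h. k \<in> Lambda n (int r) \<Longrightarrow> h \<in> hecke_carrier r \<Longrightarrow>
      F (summand k (hmult r (xelt n r k) h)) = G (summand k (hmult r (xelt n r k) h))"
  shows "F = G"
proof -
  have add: "E (f + g) = E f + E g" if "E \<in> schur_end n r" "f \<in> tensor_space n r" "g \<in> tensor_space n r" for E f g
    using that by (simp add: schur_end_def)
  have zero: "E 0 = 0" if "E \<in> schur_end n r" for E
  proof -
    have "E (0 + 0) = E 0 + E 0" by (rule add[OF that tensor_space_0 tensor_space_0])
    then have "E 0 = E 0 + E 0" by simp
    then have "E 0 l = E 0 l + E 0 l" for l by (metis plus_fun_apply)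
    then show ?thesis by (auto simp: fun_eq_iff)
  qed
  have "F f = G f" if f: "f \<in> tensor_space n r" for f
  proof -
    have "F (\<Sum>l\<in>I. summand l (f l)) = G (\<Sum>l\<in>I. summand l (f l)) \<and> (\<Sum>l\<in>I. summand l (f l)) \<in> tensor_space n r"
      if "finite I" "I \<subseteq> Lambda n (int r)" for I
      using that
    proof (induction I rule: finite_induct)
      case empty
      have "F 0 = G 0 \<and> 0 \<in> tensor_space n r" using zero[OF F] zero[OF G] tensor_space_0 by simp
      then show ?case by (simp only: sum.empty)
    next
      case (insert l I)
      then have l: "l \<in> Lambda n (int r)" by simp
      obtain h where h: "h \<in> hecke_carrier r" "f l = hmult r (xelt n r l) h" using tensor_spaceD(1)[OF f l] by blast
      have s: "summand l (f l) \<in> tensor_space n r" by (rule summand_tensor_space[OF l h(2,1)])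
      have "F (summand l (f l)) = G (summand l (f l))" using eq[OF l h(1)] h(2) by simp
      moreover have "(\<Sum>l\<in>insert l I. summand l (f l)) = summand l (f l) + (\<Sum>l\<in>I. summand l (f l))"
        using insert by simp
      ultimately show ?case using insert s by (simp only: add[OF F] add[OF G] tensor_space_add insert_subset simp_thms)
    qed
    from this[OF finite_Lambda[OF n] subset_refl] show ?thesis using tensor_space_expand[OF n f] by simp
  qed
  moreover have "F \<in> tensor_space n r \<rightarrow>\<^sub>E tensor_space n r" "G \<in> tensor_space n r \<rightarrow>\<^sub>E tensor_space n r"
    using F G by (simp_all add: schur_end_def)
  ultimately show ?thesis by (metis PiE_ext)
qed

lemma schur_act_summand:
  assumes n: "n > 0" and C: "C \<in> Theta_r n r" and k: "k \<in> Lambda n (int r)" and h: "h \<in> hecke_carrier r"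
  shows "schur_act n r C (summand k (hmult r (xelt n r k) h)) =
    (if k = co C then summand (ro C) (hmult r (T_sum (Dset n r C)) h) else 0)"
proof -
  have "summand k (hmult r (xelt n r k) h) \<in> tensor_space n r" by (rule summand_tensor_space[OF k refl h])
  then have e: "schur_act n r C (summand k (hmult r (xelt n r k) h)) =
      summand (ro C) (hmult r (coset_rep_sum n r C) (summand k (hmult r (xelt n r k) h) (co C)))"
    by (simp add: schur_act_def)
  show ?thesis
  proof (cases "k = co C")
    case True then show ?thesis unfolding e using coset_rep_sum_mult_xelt[OF n C h] by (simp add: summand_def)
  next
    case False
    then have "summand k (hmult r (xelt n r k) h) (co C) = 0" by (simp add: summand_def)
    then show ?thesis unfolding e using False by simp
  qed
qed

text \<open>
  The triple described by the matrix is unique, and so is the endomorphism with prescribed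
  values on the summands.
\<close>

lemma schur_e_eq:
  assumes n: "n > 0" and C: "C \<in> Theta_r n r" shows "schur_e n r C = schur_act n r C"
proof -
  note L = ro_co_Lambda[OF n C]
  obtain d where d: "d \<in> dist_double n r (ro C) (co C)" "d \<in> Dset n r C"
    using dist_double_exists[OF n C] by blast
  have "(THE (l, d, m). l \<in> Lambda n (int r) \<and> m \<in> Lambda n (int r) \<and>
             d \<in> dist_double n r l m \<and> triple_mat n r l d m = C) = (ro C, d, co C)"
  proof (rule the_equality)
    show "case (ro C, d, co C) of (l, d, m) \<Rightarrow> l \<in> Lambda n (int r) \<and> m \<in> Lambda n (int r) \<and>
             d \<in> dist_double n r l m \<and> triple_mat n r l d m = C"
      using L d by (simp add: Dset_def)
  next
    fix p assume p: "case p of (l, d, m) \<Rightarrow> l \<in> Lambda n (int r) \<and> m \<in> Lambda n (int r) \<and>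
             d \<in> dist_double n r l m \<and> triple_mat n r l d m = C"
    obtain l e m where pe: "p = (l, e, m)" by (cases p)
    have q: "l \<in> Lambda n (int r)" "m \<in> Lambda n (int r)" "e \<in> dist_double n r l m" "triple_mat n r l e m = C"
      using p by (auto simp: pe)
    have ea: "e \<in> aff_sym r" using q(3) by (simp add: dist_double_iff[OF n q(1,2)])
    have lm: "l = ro C" "m = co C"
      using ro_triple_mat[OF n q(1,2) ea] co_triple_mat[OF n q(1,2) ea] q(4) by auto
    have "e = d" using dist_double_unique[OF n L, of e d] q d unfolding lm by (simp add: Dset_def)
    then show "p = (ro C, d, co C)" by (simp add: pe lm)
  qed
  then have 1: "schur_e n r C = schur_phi n r (ro C) d (co C)" unfolding schur_e_def by simp
  have D: "(\<Sum>w\<in>double_coset n r (ro C) d (co C). TT w) = T_sum (Dset n r C)"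
    using Dset_eq_double_coset[OF n C d(2)] by (simp add: T_sum_def)
  have "schur_phi n r (ro C) d (co C) = schur_act n r C"
    unfolding schur_phi_def D
  proof (rule the_equality, intro conjI ballI)
    show "schur_act n r C \<in> schur_end n r" by (rule schur_act_end[OF n C])
    show "schur_act n r C (summand k (hmult r (xelt n r k) h)) =
        (if k = co C then summand (ro C) (hmult r (T_sum (Dset n r C)) h) else 0)"
      if "k \<in> Lambda n (int r)" "h \<in> hecke_carrier r" for k h
      by (rule schur_act_summand[OF n C that])
    fix F assume F: "F \<in> schur_end n r \<and> (\<forall>k\<in>Lambda n (int r). \<forall>h\<in>hecke_carrier r.
         F (summand k (hmult r (xelt n r k) h)) =
           (if k = co C then summand (ro C) (hmult r (T_sum (Dset n r C)) h) else 0))"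
    show "F = schur_act n r C"
      using F by (intro schur_end_determined[OF n _ schur_act_end[OF n C]]) (auto simp: schur_act_summand[OF n C])
  qed
  with 1 show ?thesis by simp
qed

lemma vpow_ne_0 [simp]: "vpow k \<noteq> 0"
proof
  assume "vpow k = 0"
  then have "Poly_Mapping.lookup (vpow k) k = 0" by simp
  then show False by (simp add: vpow_def)
qed

lemma vpow_mult: "vpow a * vpow b = vpow (a + b)"
  by (simp add: vpow_def mult_single)

lemma vpow_0: "vpow 0 = 1"
  by (simp add: vpow_def)

lemma schur_br_apply:
  assumes n: "n > 0" and A: "A \<in> Theta_r n r" and f: "f \<in> tensor_space n r"
  shows "schur_br n r A f = summand (ro A) (smul (vpow (- dimA n A)) (hmult r (coset_rep_sum n r A) (f (co A))))"
proof -
  have "schur_br n r A f = (\<lambda>l. smul (vpow (- dimA n A)) (schur_e n r A f l))"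
    using f by (simp add: schur_br_def lin_comb_def)
  also have "\<dots> = (\<lambda>l. smul (vpow (- dimA n A)) (summand (ro A) (hmult r (coset_rep_sum n r A) (f (co A))) l))"
    using f by (simp add: schur_e_eq[OF n A] schur_act_def)
  finally show ?thesis by (auto simp: summand_def fun_eq_iff)
qed

lemma Dset_disjoint:
  assumes "w \<in> Dset n r C" "w \<in> Dset n r C'" "ro C = ro C'" "co C = co C'" shows "C = C'"
  using assms by (simp add: Dset_def)

text \<open>
  The value at \<open>x\<^sub>\<mu>\<close> is a combination of sums over disjoint double cosets, so the coefficient at
  \<open>w\<close> sees only the basis element of the double coset of \<open>w\<close>.
\<close>

lemma lin_comb_coefficient:
  assumes n: "n > 0" and c: "Poly_Mapping.keys c \<subseteq> Theta_r n r" and C: "C \<in> Theta_r n r" and w: "w \<in> Dset n r C"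
  shows "Poly_Mapping.lookup (lin_comb n r (schur_br n r) c (summand (co C) (xelt n r (co C))) (ro C)) w =
    Poly_Mapping.lookup c C * vpow (- dimA n C)"
proof -
  note L = ro_co_Lambda[OF n C]
  let ?f = "summand (co C) (xelt n r (co C))"
  have f: "?f \<in> tensor_space n r"
    by (rule summand_tensor_space[OF L(2), of _ "TT id"]) (simp_all add: hmult_unit xelt_carrier)
  have single: "Poly_Mapping.lookup (schur_br n r C' ?f (ro C)) w = (if C' = C then vpow (- dimA n C) else 0)"
    if C': "C' \<in> Theta_r n r" for C'
  proof (cases "ro C' = ro C \<and> co C' = co C")
    case True
    have "hmult r (coset_rep_sum n r C') (xelt n r (co C)) = T_sum (Dset n r C')"
      using coset_rep_sum_factor(1)[OF n C'] True by simp
    moreover have "w \<in> Dset n r C' \<longleftrightarrow> C' = C" using True Dset_disjoint[OF w] w by metis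
    ultimately show ?thesis using True
      by (simp add: schur_br_apply[OF n C' f] summand_apply lookup_T_sum[OF finite_Dset[OF n C']])
  next
    case False
    then show ?thesis by (auto simp: schur_br_apply[OF n C' f] summand_apply)
  qed
  have "Poly_Mapping.lookup (lin_comb n r (schur_br n r) c ?f (ro C)) w =
      (\<Sum>C'\<in>Poly_Mapping.keys c. Poly_Mapping.lookup c C' * (if C' = C then vpow (- dimA n C) else 0))"
    using f c by (simp add: lin_comb_def lookup_sum single subset_iff)
  also have "\<dots> = Poly_Mapping.lookup c C * vpow (- dimA n C)"
    by (simp add: if_distrib[of "(*) _"] in_keys_iff cong: if_cong)
  finally show ?thesis .
qed

lemma lin_comb_unique:
  assumes n: "n > 0" and c: "Poly_Mapping.keys c \<subseteq> Theta_r n r" and c': "Poly_Mapping.keys c' \<subseteq> Theta_r n r"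
    and eq: "lin_comb n r (schur_br n r) c = lin_comb n r (schur_br n r) c'"
  shows "c = c'"
proof (rule poly_mapping_eqI)
  fix C
  show "Poly_Mapping.lookup c C = Poly_Mapping.lookup c' C"
  proof (cases "C \<in> Theta_r n r")
    case True
    obtain w where w: "w \<in> Dset n r C" using Dset_nonempty[OF n True] by blast
    have "Poly_Mapping.lookup c C * vpow (- dimA n C) = Poly_Mapping.lookup c' C * vpow (- dimA n C)"
      using lin_comb_coefficient[OF n c True w] lin_comb_coefficient[OF n c' True w] eq by simp
    then have "Poly_Mapping.lookup c C * vpow (- dimA n C) * vpow (dimA n C)
       = Poly_Mapping.lookup c' C * vpow (- dimA n C) * vpow (dimA n C)" by simp
    then show ?thesis by (simp add: mult.assoc vpow_mult vpow_0)
  next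
    case False
    then show ?thesis using c c' by (metis in_keys_iff subsetD)
  qed
qed

text \<open>
  A composite of basis elements is left multiplication by an element that is both a right multiple
  of \<open>x\<^sub>\<lambda>\<close> and a left multiple of \<open>x\<^sub>\<nu>\<close>.  So its coefficients are constant on double cosets, and it
  is a combination of the sums over double cosets.
\<close>

lemma composite_coefficients:
  assumes n: "n > 0" and B: "B \<in> Theta_r n r" and A: "A \<in> Theta_r n r" and BA: "co B = ro A"
  defines "z \<equiv> hmult r (coset_rep_sum n r B) (T_sum (Dset n r A))"
  defines "K \<equiv> (\<lambda>w. triple_mat n r (ro B) w (co A)) ` Poly_Mapping.keys z"
  shows "\<And>C. C \<in> K \<Longrightarrow> C \<in> Theta_r n r \<and> ro C = ro B \<and> co C = co A"
    and "\<And>C w. C \<in> Theta_r n r \<Longrightarrow> ro C = ro B \<Longrightarrow> co C = co A \<Longrightarrow> w \<in> Dset n r C \<Longrightarrow> w' \<in> Dset n r C \<Longrightarrow>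
      Poly_Mapping.lookup z w = Poly_Mapping.lookup z w'"
    and "z = (\<Sum>C\<in>K. smul (Poly_Mapping.lookup z (SOME w. w \<in> Dset n r C)) (T_sum (Dset n r C)))"
proof -
  note LB = ro_co_Lambda[OF n B] and LA = ro_co_Lambda[OF n A]
  have zc: "z \<in> hecke_carrier r" by (simp add: z_def hmult_carrier)
  have za: "w \<in> aff_sym r" if "w \<in> Poly_Mapping.keys z" for w using zc that by (auto simp: hecke_carrier_def)
  show K: "C \<in> Theta_r n r \<and> ro C = ro B \<and> co C = co A" if "C \<in> K" for C
    using that za triple_mat_Theta[OF n LB(1) LA(2)] ro_triple_mat[OF n LB(1) LA(2)] co_triple_mat[OF n LB(1) LA(2)]
    by (auto simp: K_def)
  have z1: "z = hmult r (xelt n r (ro B)) (hmult r (coset_rep_sum' n r B) (coset_rep_sum' n r A))"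
  proof -
    have "z = hmult r (coset_rep_sum n r B) (hmult r (xelt n r (co B)) (coset_rep_sum' n r A))"
      using coset_rep_sum_factor(2)[OF n A] by (simp add: z_def BA)
    also have "\<dots> = hmult r (hmult r (xelt n r (ro B)) (coset_rep_sum' n r B)) (coset_rep_sum' n r A)"
      using coset_rep_sum_mult_xelt[OF n B coset_rep_sum_carrier(2)] coset_rep_sum_factor(2)[OF n B] by simp
    finally show ?thesis by (simp add: hmult_assoc xelt_carrier)
  qed
  have z2: "z = hmult r (hmult r (coset_rep_sum n r B) (coset_rep_sum n r A)) (xelt n r (co A))"
    using coset_rep_sum_factor(1)[OF n A] by (simp add: z_def hmult_assoc xelt_carrier)
  show const: "Poly_Mapping.lookup z w = Poly_Mapping.lookup z w'"
    if C: "C \<in> Theta_r n r" "ro C = ro B" "co C = co A" "w \<in> Dset n r C" "w' \<in> Dset n r C" for C w w'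
  proof -
    have "w' \<in> double_coset n r (ro B) w (co A)" using Dset_eq_double_coset[OF n C(1,4)] C by simp
    then obtain u y where uy: "u \<in> young n r (ro B)" "y \<in> young n r (co A)" "w' = u \<circ> w \<circ> y"
      by (auto simp: double_coset_def)
    have "Poly_Mapping.lookup z (u \<circ> w \<circ> y) = Poly_Mapping.lookup z (u \<circ> w)"
      unfolding z2 by (rule right_multiple_invariant[OF n LA(2) hmult_carrier uy(2)])
    also have "\<dots> = Poly_Mapping.lookup z w"
      unfolding z1 by (rule left_multiple_invariant[OF n LB(1) hmult_carrier uy(1)])
    finally show ?thesis unfolding uy(3) by (rule sym)
  qed
  have fK: "finite K" by (simp add: K_def)
  show "z = (\<Sum>C\<in>K. smul (Poly_Mapping.lookup z (SOME w. w \<in> Dset n r C)) (T_sum (Dset n r C)))"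
  proof (rule poly_mapping_eqI)
    fix w
    have "Poly_Mapping.lookup (\<Sum>C\<in>K. smul (Poly_Mapping.lookup z (SOME w. w \<in> Dset n r C)) (T_sum (Dset n r C))) w
       = (\<Sum>C\<in>K. if w \<in> Dset n r C then Poly_Mapping.lookup z w else 0)"
      unfolding lookup_sum
    proof (rule sum.cong[OF refl])
      fix C assume C: "C \<in> K"
      have "Poly_Mapping.lookup z (SOME w. w \<in> Dset n r C) = Poly_Mapping.lookup z w" if w: "w \<in> Dset n r C"
      proof (rule const)
        show "(SOME w. w \<in> Dset n r C) \<in> Dset n r C" by (rule someI[of "\<lambda>w. w \<in> Dset n r C", OF w])
      qed (use K[OF C] w in auto)
      then show "Poly_Mapping.lookup (smul (Poly_Mapping.lookup z (SOME w. w \<in> Dset n r C)) (T_sum (Dset n r C))) w =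
         (if w \<in> Dset n r C then Poly_Mapping.lookup z w else 0)"
        using K[OF C] by (simp add: lookup_T_sum finite_Dset[OF n])
    qed
    also have "\<dots> = Poly_Mapping.lookup z w"
    proof (cases "w \<in> Poly_Mapping.keys z")
      case True
      define C where "C = triple_mat n r (ro B) w (co A)"
      have CK: "C \<in> K" using True by (simp add: C_def K_def)
      have "w \<in> Dset n r C' \<longleftrightarrow> C' = C" if "C' \<in> K" for C'
        using K[OF that] za[OF True] by (auto simp: Dset_def C_def)
      then have "(\<Sum>C\<in>K. if w \<in> Dset n r C then Poly_Mapping.lookup z w else 0)
          = (\<Sum>C'\<in>K. if C' = C then Poly_Mapping.lookup z w else 0)" by (intro sum.cong) auto
      then show ?thesis using CK fK by simp
    next
      case False
      then have z: "Poly_Mapping.lookup z w = 0" by (simp add: in_keys_iff)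
      show ?thesis unfolding z by simp
    qed
    finally show "Poly_Mapping.lookup z w =
      Poly_Mapping.lookup (\<Sum>C\<in>K. smul (Poly_Mapping.lookup z (SOME w. w \<in> Dset n r C)) (T_sum (Dset n r C))) w" by simp
  qed
qed

lemma schur_br_tensor_space:
  assumes n: "n > 0" and A: "A \<in> Theta_r n r" and f: "f \<in> tensor_space n r"
  shows "schur_br n r A f \<in> tensor_space n r"
proof -
  note L = ro_co_Lambda[OF n A]
  obtain h where h: "h \<in> hecke_carrier r" "f (co A) = hmult r (xelt n r (co A)) h"
    using tensor_spaceD(1)[OF f L(2)] by blast
  have e: "hmult r (coset_rep_sum n r A) (f (co A)) = hmult r (xelt n r (ro A)) (hmult r (coset_rep_sum' n r A) h)"
    using coset_rep_sum_mult_xelt[OF n A h(1)] coset_rep_sum_factor(2)[OF n A] hmult_assoc[OF xelt_carrier coset_rep_sum_carrier(2) h(1)] h(2)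
    by metis
  show ?thesis
    unfolding schur_br_apply[OF n A f] e
    by (rule summand_tensor_space[OF L(1), of _ "smul (vpow (- dimA n A)) (hmult r (coset_rep_sum' n r A) h)"])
       (simp_all add: hmult_bilinear(4) xelt_carrier hmult_carrier hecke_carrier_closed)
qed

lemma compose_schur_br_zero:
  assumes n: "n > 0" and B: "B \<in> Theta_r n r" and A: "A \<in> Theta_r n r" and BA: "co B \<noteq> ro A"
  shows "compose (tensor_space n r) (schur_br n r B) (schur_br n r A) = lin_comb n r (schur_br n r) 0"
proof
  fix f
  show "compose (tensor_space n r) (schur_br n r B) (schur_br n r A) f = lin_comb n r (schur_br n r) 0 f"
  proof (cases "f \<in> tensor_space n r")
    case True
    have "schur_br n r A f \<in> tensor_space n r" by (rule schur_br_tensor_space[OF n A True])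
    moreover have "schur_br n r A f (co B) = 0" using BA by (simp add: schur_br_apply[OF n A True] summand_apply)
    ultimately have "schur_br n r B (schur_br n r A f) = 0" by (simp add: schur_br_apply[OF n B])
    then show ?thesis using True by (simp add: compose_def lin_comb_def zero_fun_def)
  qed (simp add: compose_def lin_comb_def)
qed

lemma compose_schur_br:
  assumes n: "n > 0" and B: "B \<in> Theta_r n r" and A: "A \<in> Theta_r n r" and BA: "co B = ro A"
  defines "z \<equiv> hmult r (coset_rep_sum n r B) (T_sum (Dset n r A))"
  defines "K \<equiv> (\<lambda>w. triple_mat n r (ro B) w (co A)) ` Poly_Mapping.keys z"
  defines "c \<equiv> (\<Sum>C\<in>K. Poly_Mapping.single C
     (Poly_Mapping.lookup z (SOME w. w \<in> Dset n r C) * vpow (dimA n C - dimA n A - dimA n B)))"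
  shows "compose (tensor_space n r) (schur_br n r B) (schur_br n r A) = lin_comb n r (schur_br n r) c"
    and "Poly_Mapping.keys c \<subseteq> K"
proof -
  note CC = composite_coefficients[OF n B A BA, folded z_def, folded K_def]
  note L = ro_co_Lambda[OF n A]
  have fK: "finite K" by (simp add: K_def)
  let ?a = "\<lambda>C. Poly_Mapping.lookup z (SOME w. w \<in> Dset n r C)"
  have lc: "Poly_Mapping.lookup c C = (if C \<in> K then ?a C * vpow (dimA n C - dimA n A - dimA n B) else 0)" for C
    using fK by (simp add: c_def lookup_sum lookup_single when_def)
  show kc: "Poly_Mapping.keys c \<subseteq> K" by (auto simp: in_keys_iff lc split: if_splits)
  show "compose (tensor_space n r) (schur_br n r B) (schur_br n r A) = lin_comb n r (schur_br n r) c"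
  proof
    fix f
    show "compose (tensor_space n r) (schur_br n r B) (schur_br n r A) f = lin_comb n r (schur_br n r) c f"
    proof (cases "f \<in> tensor_space n r")
      case f: True
      obtain h where h: "h \<in> hecke_carrier r" "f (co A) = hmult r (xelt n r (co A)) h"
        using tensor_spaceD(1)[OF f L(2)] by blast
      let ?q = "vpow (- dimA n A - dimA n B)"
      have "schur_br n r B (schur_br n r A f) = summand (ro B) (smul (vpow (- dimA n B))
          (hmult r (coset_rep_sum n r B) (smul (vpow (- dimA n A)) (hmult r (coset_rep_sum n r A) (f (co A))))))"
        unfolding schur_br_apply[OF n B schur_br_tensor_space[OF n A f]]
        by (simp add: schur_br_apply[OF n A f] summand_apply BA)
      also have "hmult r (coset_rep_sum n r B) (smul (vpow (- dimA n A)) (hmult r (coset_rep_sum n r A) (f (co A)))) =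
          smul (vpow (- dimA n A)) (hmult r z h)"
        using coset_rep_sum_mult_xelt[OF n A h(1)] h
        by (simp add: hmult_bilinear(4) hmult_carrier z_def hmult_assoc)
      finally have lhs: "schur_br n r B (schur_br n r A f) = summand (ro B) (smul ?q (hmult r z h))"
        by (simp add: vpow_mult algebra_simps)
      have "lin_comb n r (schur_br n r) c f l = summand (ro B) (smul ?q (hmult r z h)) l" for l
      proof -
        have "lin_comb n r (schur_br n r) c f l =
            (\<Sum>C\<in>K. smul (Poly_Mapping.lookup c C) (schur_br n r C f l))"
          using f kc fK by (simp add: lin_comb_def) (rule sum.mono_neutral_left, auto simp: in_keys_iff)
        also have "\<dots> = (\<Sum>C\<in>K. if l = ro B then smul ?q (smul (?a C) (hmult r (T_sum (Dset n r C)) h)) else 0)"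
        proof (rule sum.cong[OF refl])
          fix C assume C: "C \<in> K"
          then have C': "C \<in> Theta_r n r" "ro C = ro B" "co C = co A" using CC(1) by auto
          have "hmult r (coset_rep_sum n r C) (f (co C)) = hmult r (T_sum (Dset n r C)) h"
            using coset_rep_sum_mult_xelt[OF n C'(1) h(1)] h(2) C'(3) by simp
          moreover have "vpow (dimA n C - dimA n A - dimA n B) * vpow (- dimA n C) = ?q"
            by (simp add: vpow_mult)
          ultimately show "smul (Poly_Mapping.lookup c C) (schur_br n r C f l) =
              (if l = ro B then smul ?q (smul (?a C) (hmult r (T_sum (Dset n r C)) h)) else 0)"
            using C C' by (simp add: schur_br_apply[OF n C'(1) f] summand_apply lc mult.assoc mult.commute[of ?q])
        qed
        also have "\<dots> = (if l = ro B then smul ?q (hmult r z h) else 0)"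
        proof -
          have "hmult r z h = hmult r (\<Sum>C\<in>K. smul (?a C) (T_sum (Dset n r C))) h" using CC(3) by simp
          also have "\<dots> = (\<Sum>C\<in>K. smul (?a C) (hmult r (T_sum (Dset n r C)) h))"
            using h(1) by (simp add: hmult_sum_left hmult_bilinear(3))
          finally show ?thesis by (simp only: smul_sum) simp
        qed
        finally show ?thesis by (simp add: summand_apply)
      qed
      then show ?thesis using lhs f by (simp add: compose_def fun_eq_iff)
    qed (simp add: compose_def lin_comb_def)
  qed
qed

lemma schur_const_unique:
  assumes n: "n > 0" and "Poly_Mapping.keys c \<subseteq> Theta_r n r"
    and "compose (tensor_space n r) (schur_br n r B) (schur_br n r A) = lin_comb n r (schur_br n r) c"
  shows "schur_const n r B A = c"
  unfolding schur_const_def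
proof (rule the_equality)
  fix c' assume c': "Poly_Mapping.keys c' \<subseteq> Theta_r n r \<and>
    compose (tensor_space n r) (schur_br n r B) (schur_br n r A) = lin_comb n r (schur_br n r) c'"
  have "lin_comb n r (schur_br n r) c' = lin_comb n r (schur_br n r) c" using c' assms(3) by simp
  with c' assms(2) show "c' = c" by (intro lin_comb_unique[OF n]) simp_all
qed (use assms in simp)

lemma schur_const_mismatch:
  assumes n: "n > 0" and B: "B \<in> Theta_r n r" and A: "A \<in> Theta_r n r" and BA: "co B \<noteq> ro A"
  shows "schur_const n r B A = 0"
proof -
  have k: "Poly_Mapping.keys (0 :: mat \<Rightarrow>\<^sub>0 laurent) \<subseteq> Theta_r n r" by simp
  have z: "compose (tensor_space n r) (schur_br n r B) (schur_br n r A) = lin_comb n r (schur_br n r) 0"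
    by (rule compose_schur_br_zero[OF n B A BA])
  show ?thesis using schur_const_unique[OF n k z] .
qed

lemma keys_schur_const:
  assumes n: "n > 0" and B: "B \<in> Theta_r n r" and A: "A \<in> Theta_r n r"
    and C: "C \<in> Poly_Mapping.keys (schur_const n r B A)"
  shows "C \<in> Theta_r n r \<and> ro C = ro B \<and> co C = co A \<and> co B = ro A"
proof (cases "co B = ro A")
  case True
  define K where "K = (\<lambda>w. triple_mat n r (ro B) w (co A)) ` Poly_Mapping.keys (hmult r (coset_rep_sum n r B) (T_sum (Dset n r A)))"
  note K1 = composite_coefficients(1)[OF n B A True, folded K_def]
  obtain c where c: "compose (tensor_space n r) (schur_br n r B) (schur_br n r A) = lin_comb n r (schur_br n r) c"
    "Poly_Mapping.keys c \<subseteq> K"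
    using compose_schur_br[OF n B A True, folded K_def] by (rule that)
  have "Poly_Mapping.keys c \<subseteq> Theta_r n r" using c(2) K1 by auto
  then have "schur_const n r B A = c" by (rule schur_const_unique[OF n _ c(1)])
  then have "C \<in> K" using C c(2) by auto
  then show ?thesis using K1 True by simp
next
  case False
  then have "schur_const n r B A = 0" by (rule schur_const_mismatch[OF n B A])
  then show ?thesis using C by simp
qed

text \<open>
  The structure constant is, up to a power of \<open>v\<close>, the coefficient at \<open>w\<close> of the product \<open>z\<close> of a sum
  of representatives and the sum over a double coset. In the group algebra this coefficient
  counts the ways to write \<open>w\<close> as a product of summands.
\<close>

lemma at_one_schur_const:
  assumes n: "n > 0" and B: "B \<in> Theta_r n r" and A: "A \<in> Theta_r n r" and BA: "co B = ro A"
    and C: "C \<in> Theta_r n r" "ro C = ro B" "co C = co A" and w: "w \<in> Dset n r C"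
  shows "at_one (Poly_Mapping.lookup (schur_const n r B A) C) =
    int (card {u \<in> Dset n r B. incr n r (co B) u \<and> inv u \<circ> w \<in> Dset n r A})"
proof -
  define z where "z = hmult r (coset_rep_sum n r B) (T_sum (Dset n r A))"
  define K where "K = (\<lambda>w. triple_mat n r (ro B) w (co A)) ` Poly_Mapping.keys z"
  define c where "c = (\<Sum>C\<in>K. Poly_Mapping.single C
     (Poly_Mapping.lookup z (SOME w. w \<in> Dset n r C) * vpow (dimA n C - dimA n A - dimA n B)))"
  note cc = compose_schur_br[OF n B A BA, folded z_def, folded K_def, folded c_def]
  note CC = composite_coefficients[OF n B A BA, folded z_def, folded K_def]
  have "Poly_Mapping.keys c \<subseteq> Theta_r n r" using cc(2) CC(1) by auto
  then have "schur_const n r B A = c" by (rule schur_const_unique[OF n _ cc(1)])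
  moreover have "at_one (Poly_Mapping.lookup c C) = at_one (Poly_Mapping.lookup z w)"
  proof (cases "C \<in> K")
    case True
    have "Poly_Mapping.lookup c C =
        Poly_Mapping.lookup z (SOME w. w \<in> Dset n r C) * vpow (dimA n C - dimA n A - dimA n B)"
      using True by (simp add: c_def lookup_sum lookup_single when_def K_def)
    moreover have "Poly_Mapping.lookup z (SOME w. w \<in> Dset n r C) = Poly_Mapping.lookup z w"
    proof (rule CC(2))
      show "(SOME w. w \<in> Dset n r C) \<in> Dset n r C" by (rule someI[of "\<lambda>w. w \<in> Dset n r C", OF w])
    qed (use C w in auto)
    ultimately show ?thesis by (simp add: at_one_mult)
  next
    case False
    have "w \<notin> Poly_Mapping.keys z" using False w C by (auto simp: K_def Dset_def)
    moreover have "C \<notin> Poly_Mapping.keys c" using False cc(2) by blast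
    ultimately show ?thesis by (simp add: in_keys_iff)
  qed
  moreover have "at_one (Poly_Mapping.lookup z w) =
      int (card {u \<in> Dset n r B. incr n r (co B) u \<and> inv u \<circ> w \<in> Dset n r A})"
  proof -
    let ?U = "{u \<in> Dset n r B. incr n r (co B) u}"
    have fU: "finite ?U" using finite_Dset[OF n B] by simp
    have "at_one (Poly_Mapping.lookup z w) = (\<Sum>u\<in>?U. at_one (Poly_Mapping.lookup (coset_rep_sum n r B) u) *
        at_one (Poly_Mapping.lookup (T_sum (Dset n r A)) (inv u \<circ> w)))"
      unfolding z_def at_one_hmult[OF coset_rep_sum_carrier(1) coset_rep_sum_carrier(3)] by (simp add: coset_rep_sum_def keys_T_sum[OF fU])
    also have "\<dots> = (\<Sum>u\<in>?U. if inv u \<circ> w \<in> Dset n r A then 1 else 0)"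
      by (intro sum.cong) (auto simp: coset_rep_sum_def lookup_T_sum[OF fU] lookup_T_sum[OF finite_Dset[OF n A]] simp del: o_apply)
    also have "\<dots> = int (card {u \<in> ?U. inv u \<circ> w \<in> Dset n r A})" using fU by (simp add: sum.If_cases Int_def)
    finally show ?thesis by (simp add: conj_ac)
  qed
  ultimately show ?thesis by simp
qed

section \<open>Counting flags\<close>

lemma ibinom_of_nat: "ibinom (int a) t = int (a choose t)"
proof -
  have "(of_int (ibinom (int a) t) :: rat) = of_int (int (a choose t))"
    by (simp add: of_int_ibinom binomial_gbinomial)
  then show ?thesis by (simp only: of_int_eq_iff)
qed

lemma ibinom_nonneg_eq: "0 \<le> m \<Longrightarrow> ibinom m t = int (nat m choose t)"
  using ibinom_of_nat[of "nat m" t] by simp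

text \<open>
  With \<open>e = 1\<close> or \<open>e = - 1\<close> these cover both raising and lowering: the entry \<open>U i k\<close> counts what is
  moved from row \<open>i + e\<close> of the right factor to row \<open>i\<close> of the product within column \<open>k\<close>.
\<close>

definition row_shift_by :: "int \<Rightarrow> mat \<Rightarrow> mat" where "row_shift_by e U i k = U (i - e) k"

definition shifted_diag :: "int \<Rightarrow> vec \<Rightarrow> mat" where "shifted_diag e g i j = (if j = i + e then g i else 0)"

text \<open>
  The number of ways to choose \<open>U i k\<close> elements from each of the cells of sizes \<open>C i k\<close> in one
  period of rows.
\<close>

definition cell_choices :: "nat \<Rightarrow> mat \<Rightarrow> mat \<Rightarrow> int" where
  "cell_choices n C U = (\<Prod>i = 1..int n. Prod_any (\<lambda>k. ibinom (C i k) (nat (U i k))))"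

lemma periodic_shift:
  fixes b :: "int \<Rightarrow> int"
  assumes "\<And>x. b (x + int r) = b x + int n" shows "b (x + t * int r) = b x + t * int n"
proof (induction t rule: int_induct[where k = 0])
  case (step1 t) then show ?case using assms[of "x + t * int r"] by (simp add: algebra_simps)
next
  case (step2 t) then show ?case using assms[of "x + (t - 1) * int r"] by (simp add: algebra_simps)
qed simp

lemma periodic_set_shift:
  assumes "\<And>x. x + int r \<in> S \<longleftrightarrow> x \<in> S" shows "x + t * int r \<in> S \<longleftrightarrow> x \<in> S"
proof (induction t rule: int_induct[where k = 0])
  case (step1 t) then show ?case using assms[of "x + t * int r"] by (simp add: algebra_simps)
next
  case (step2 t) then show ?case using assms[of "x + (t - 1) * int r"] by (simp add: algebra_simps)
qed simp

lemma finite_periodic_fibre: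
  fixes f :: "int \<Rightarrow> int"
  assumes n: "n > 0" and r: "r > 0" and f: "\<And>x. f (x + int r) = f x + int n"
  shows "finite {x. f x = j}"
proof (rule finite_subset)
  show "{x. f x = j} \<subseteq> (\<lambda>y. y + (j - f y) div int n * int r) ` {1..int r}"
  proof
    fix x assume x: "x \<in> {x. f x = j}"
    obtain t where t: "x + t * int r \<in> {1..int r}" using residue[OF r] .
    have "f (x + t * int r) = j + t * int n" using periodic_shift[of f r n, OF f] x by simp
    then have "(j - f (x + t * int r)) div int n = - t" using n
      by (metis add_diff_cancel_left' minus_diff_eq minus_mult_left nonzero_mult_div_cancel_right of_nat_0_less_iff order_less_irrefl)
    then show "x \<in> (\<lambda>y. y + (j - f y) div int n * int r) ` {1..int r}"
      using t by (intro image_eqI[of _ _ "x + t * int r"]) auto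
  qed
qed simp

text \<open>A periodic set of integers is a choice of a subset of each cell in one period.\<close>

lemma count_periodic_subsets:
  fixes b h :: "int \<Rightarrow> int" and C U :: mat
  assumes n: "n > 0" and r: "r > 0"
    and b: "\<And>x. b (x + int r) = b x + int n" and h: "\<And>x. h (x + int r) = h x + int n"
    and C: "C \<in> Mat n" "\<And>i k. int (card {x. b x = i \<and> h x = k}) = C i k"
    and U: "U \<in> Theta n"
  shows "int (card {S. (\<forall>x. x + int r \<in> S \<longleftrightarrow> x \<in> S) \<and> (\<forall>i k. int (card (S \<inter> {x. b x = i \<and> h x = k})) = U i k)})
    = cell_choices n C U"
proof -
  define cell where "cell i k = {x. b x = i \<and> h x = k}" for i k
  define \<S> where "\<S> = {S. (\<forall>x. x + int r \<in> S \<longleftrightarrow> x \<in> S) \<and> (\<forall>i k. int (card (S \<inter> cell i k)) = U i k)}"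
  have UM: "U \<in> Mat n" and U0: "\<And>i k. 0 \<le> U i k" using U by (auto simp: Theta_def)
  note bs = periodic_shift[of b r n, OF b] and hs = periodic_shift[of h r n, OF h]
  have cfin: "finite (cell i k)" for i k
    by (rule finite_subset[OF _ finite_periodic_fibre[of n r b i, OF n r b]]) (auto simp: cell_def)
  have ccard: "int (card (cell i k)) = C i k" for i k by (simp add: cell_def C(2))
  have csh: "x + t * int r \<in> cell (i + t * int n) (k + t * int n) \<longleftrightarrow> x \<in> cell i k" for x t i k
    by (simp add: cell_def bs hs)
  (* Outside these finitely many columns the row i has no cell and asks for no elements. *)
  define K where "K i = {k. C i k \<noteq> 0 \<or> U i k \<noteq> 0}" for i
  have Kfin: "finite (K i)" for i
  proof -
    have "K i = {k. C i k \<noteq> 0} \<union> {k. U i k \<noteq> 0}" by (auto simp: K_def)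
    then show ?thesis using C(1) UM by (simp add: Mat_def)
  qed
  define I where "I = (SIGMA i:{1..int n}. K i)"
  define G where "G = (\<Pi>\<^sub>E p\<in>I. {s. s \<subseteq> cell (fst p) (snd p) \<and> card s = nat (U (fst p) (snd p))})"
  define Phi where "Phi S = restrict (\<lambda>p. S \<inter> cell (fst p) (snd p)) I" for S
  (* Psi translates the chosen subsets of the cells in one period to all other periods. *)
  define Psi where "Psi s = {x. let t = (b x - 1) div int n in x - t * int r \<in> s (b x - t * int n, h x - t * int n)}"
    for s :: "int \<times> int \<Rightarrow> int set"
  have win: "i - (i - 1) div int n * int n \<in> {1..int n}" for i
  proof -
    have "i - (i - 1) div int n * int n = (i - 1) mod int n + 1" by (simp add: minus_div_mult_eq_mod[symmetric])
    moreover have "0 \<le> (i - 1) mod int n" "(i - 1) mod int n < int n" using n by simp_all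
    ultimately show ?thesis unfolding atLeastAtMost_iff by linarith
  qed
  have div0: "(i - 1) div int n = 0" if "i \<in> {1..int n}" for i using that by (intro div_pos_pos_trivial) auto
  have "bij_betw Phi \<S> G"
  proof (rule bij_betwI[where g = Psi])
    show "Phi \<in> \<S> \<rightarrow> G"
    proof
      fix S assume S: "S \<in> \<S>"
      have "card (S \<inter> cell i k) = nat (U i k)" for i k
      proof -
        have "int (card (S \<inter> cell i k)) = U i k" using S by (simp add: \<S>_def)
        then show ?thesis by linarith
      qed
      then show "Phi S \<in> G" by (auto simp: Phi_def G_def)
    qed
    show "Psi \<in> G \<rightarrow> \<S>"
    proof
      fix s assume s: "s \<in> G"
      have "x + int r \<in> Psi s \<longleftrightarrow> x \<in> Psi s" for x
      proof -
        have "(b x + int n - 1) div int n = (b x - 1) div int n + 1"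
          using n div_add_self2[of "int n" "b x - 1"] by (simp add: algebra_simps)
        then show ?thesis by (simp add: Psi_def b h Let_def algebra_simps)
      qed
      moreover have "int (card (Psi s \<inter> cell i k)) = U i k" for i k
      proof -
        define t where "t = (i - 1) div int n"
        let ?p = "(i - t * int n, k - t * int n)"
        have Cp: "C (i - t * int n) (k - t * int n) = C i k" "U (i - t * int n) (k - t * int n) = U i k"
          using Mat_shift[OF C(1), of i "- t" k] Mat_shift[OF UM, of i "- t" k] by simp_all
        show ?thesis
        proof (cases "?p \<in> I")
          case False
          then have "C i k = 0" "U i k = 0" using Cp win[of i] by (auto simp: I_def K_def t_def)
          then have "cell i k = {}" using ccard[of i k] cfin by simp
          then show ?thesis using \<open>U i k = 0\<close> by simp
        next
          case True
          then have sp: "s ?p \<subseteq> cell (i - t * int n) (k - t * int n)" "card (s ?p) = nat (U i k)"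
            using s Cp by (auto simp: G_def dest!: PiE_mem)
          have "Psi s \<inter> cell i k = (\<lambda>x. x + t * int r) ` s ?p"
          proof (intro equalityI subsetI)
            fix x assume x: "x \<in> Psi s \<inter> cell i k"
            then have "b x = i" "h x = k" by (auto simp: cell_def)
            then have "x - t * int r \<in> s ?p" using x by (simp add: Psi_def Let_def t_def)
            then show "x \<in> (\<lambda>x. x + t * int r) ` s ?p" by (intro image_eqI[of _ _ "x - t * int r"]) simp_all
          next
            fix x assume "x \<in> (\<lambda>x. x + t * int r) ` s ?p"
            then obtain y where y: "x = y + t * int r" "y \<in> s ?p" by blast
            then have "y \<in> cell (i - t * int n) (k - t * int n)" using sp by blast
            then have xc: "x \<in> cell i k" using csh[of y t "i - t * int n" "k - t * int n"] y(1) by simp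
            then have "b x = i" "h x = k" by (auto simp: cell_def)
            then have "x \<in> Psi s" using y by (simp add: Psi_def Let_def flip: t_def)
            with xc show "x \<in> Psi s \<inter> cell i k" by blast
          qed
          then show ?thesis using sp(2) U0[of i k] by (simp add: card_image)
        qed
      qed
      ultimately show "Psi s \<in> \<S>" by (simp add: \<S>_def)
    qed
    show "Psi (Phi S) = S" if S: "S \<in> \<S>" for S
    proof (intro set_eqI)
      fix x
      define t where "t = (b x - 1) div int n"
      let ?p = "(b x - t * int n, h x - t * int n)"
      have xc: "x - t * int r \<in> cell (b x - t * int n) (h x - t * int n)"
        using bs[of x "- t"] hs[of x "- t"] by (simp add: cell_def)
      then have "card (cell (b x - t * int n) (h x - t * int n)) \<noteq> 0" using cfin by auto
      then have "C (b x - t * int n) (h x - t * int n) \<noteq> 0" using ccard by (metis of_nat_eq_0_iff)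
      then have "?p \<in> I" using win[of "b x"] by (simp add: I_def K_def t_def)
      then have "x \<in> Psi (Phi S) \<longleftrightarrow> x - t * int r \<in> S" using xc by (simp add: Psi_def Phi_def Let_def flip: t_def)
      also have "\<dots> \<longleftrightarrow> x \<in> S" using periodic_set_shift[of r S x "- t"] S by (simp add: \<S>_def)
      finally show "x \<in> Psi (Phi S) \<longleftrightarrow> x \<in> S" .
    qed
    show "Phi (Psi s) = s" if s: "s \<in> G" for s
    proof
      fix p
      show "Phi (Psi s) p = s p"
      proof (cases "p \<in> I")
        case True
        obtain i k where p: "p = (i, k)" by (cases p)
        have i: "i \<in> {1..int n}" using True by (simp add: I_def p)
        have "s p \<subseteq> cell i k" using s True p by (auto simp: G_def dest!: PiE_mem)
        moreover have "x \<in> Psi s \<longleftrightarrow> x \<in> s (i, k)" if "x \<in> cell i k" for x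
          using that div0[OF i] by (auto simp: Psi_def cell_def Let_def)
        ultimately show ?thesis using True by (auto simp: Phi_def p)
      next
        case False
        moreover have "s p = undefined" using s False unfolding G_def by (rule PiE_arb)
        ultimately show ?thesis by (simp add: Phi_def)
      qed
    qed
  qed
  from bij_betw_same_card[OF this] have "int (card \<S>) = int (card G)" by simp
  also have "card G = (\<Prod>p\<in>I. card {s. s \<subseteq> cell (fst p) (snd p) \<and> card s = nat (U (fst p) (snd p))})"
    unfolding G_def by (rule card_PiE) (simp add: I_def Kfin)
  also have "int \<dots> = (\<Prod>p\<in>I. ibinom (C (fst p) (snd p)) (nat (U (fst p) (snd p))))"
    unfolding of_nat_prod by (intro prod.cong refl) (simp add: n_subsets[OF cfin] ibinom_of_nat flip: ccard)
  also have "\<dots> = (\<Prod>i = 1..int n. \<Prod>k\<in>K i. ibinom (C i k) (nat (U i k)))"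
    unfolding I_def by (subst prod.Sigma) (auto simp: Kfin split_def)
  also have "\<dots> = cell_choices n C U" unfolding cell_choices_def
  proof (intro prod.cong refl)
    fix i
    have "ibinom 0 0 = 1" using ibinom_of_nat[of 0 0] by simp
    then show "(\<Prod>k\<in>K i. ibinom (C i k) (nat (U i k))) = Prod_any (\<lambda>k. ibinom (C i k) (nat (U i k)))"
      by (intro Prod_any.expand_superset[symmetric] Kfin) (auto simp: K_def)
  qed
  finally show ?thesis by (simp add: \<S>_def cell_def)
qed

text \<open>
  A difference of two solutions is unchanged by shifting the rows, but has finite columns.
\<close>

lemma row_shift_by_injective:
  assumes e: "e \<noteq> 0" and fin: "\<And>k. finite {i. U i k \<noteq> 0}" "\<And>k. finite {i. U' i k \<noteq> 0}"
    and eq: "U - row_shift_by e U = U' - row_shift_by e U'"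
  shows "U = U'"
proof (intro ext, rule ccontr)
  fix i k assume ne: "U i k \<noteq> U' i k"
  define D where "D j = U j k - U' j k" for j
  have step: "D j = D (j - e)" for j
    using fun_cong[OF fun_cong[OF eq, of j], of k] by (simp add: D_def row_shift_by_def)
  have "D (i + int m * e) = D i" for m
  proof (induction m)
    case (Suc m) then show ?case using step[of "i + int (Suc m) * e"] by (simp add: algebra_simps)
  qed simp
  then have "range (\<lambda>m. i + int m * e) \<subseteq> {j. U j k \<noteq> 0} \<union> {j. U' j k \<noteq> 0}"
    using ne by (auto simp: D_def) (metis diff_zero eq_iff_diff_eq_0)
  then have "finite (range (\<lambda>m. i + int m * e))" using fin finite_subset by blast
  moreover have "inj (\<lambda>m. i + int m * e)" using e by (simp add: inj_def)
  ultimately show False using finite_imageD infinite_UNIV_nat by blast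
qed

text \<open>
  A flag whose relative position to \<open>b\<close> only has entries on the diagonal and next to it is
  determined by the set of integers where it differs from \<open>b\<close>.
\<close>

lemma flags_card:
  fixes b h :: "int \<Rightarrow> int" and A B C :: mat
  assumes n: "n > 0" and r: "r > 0" and e: "e \<noteq> 0"
    and b: "\<And>x. b (x + int r) = b x + int n" and h: "\<And>x. h (x + int r) = h x + int n"
    and C: "C \<in> Theta n" "\<And>i k. int (card {x. b x = i \<and> h x = k}) = C i k"
    and B: "B = shifted_diag e g + diag \<beta>" and lam: "\<And>i. int (card {x. b x = i}) = \<beta> i + g i"
  shows "int (card {f. (\<forall>x. f (x + int r) = f x + int n) \<and> (\<forall>i j. int (card {x. b x = i \<and> f x = j}) = B i j) \<and>
      (\<forall>j k. int (card {x. f x = j \<and> h x = k}) = A j k)})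
    = (\<Sum>U | U \<in> Theta n \<and> ro U = g \<and> A + U - row_shift_by e U = C. cell_choices n C U)"
proof -
  define FL where "FL = {f. (\<forall>x. f (x + int r) = f x + int n) \<and> (\<forall>i j. int (card {x. b x = i \<and> f x = j}) = B i j) \<and>
      (\<forall>j k. int (card {x. f x = j \<and> h x = k}) = A j k)}"
  define cell where "cell i k = {x. b x = i \<and> h x = k}" for i k
  define \<U> where "\<U> = {U. U \<in> Theta n \<and> ro U = g \<and> A + U - row_shift_by e U = C}"
  define cnt where "cnt S i k = int (card (S \<inter> cell i k))" for S i k
  have CM: "C \<in> Mat n" and C0: "\<And>i k. 0 \<le> C i k" using C(1) by (auto simp: Theta_def)
  have rfin: "finite {x. b x = i}" for i by (rule finite_periodic_fibre[of n r b, OF n r b])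
  have cfin: "finite (cell i k)" for i k
    by (rule finite_subset[OF _ rfin[of i]]) (auto simp: cell_def)
  have ccard: "int (card (cell i k)) = C i k" for i k by (simp add: cell_def C(2))
  have B_eq: "B i j = (if j = i then \<beta> i else 0) + (if j = i + e then g i else 0)" for i j
    by (simp add: B shifted_diag_def diag_def)
  have row: "ro (cnt S) i = int (card (S \<inter> {x. b x = i}))" for S i
  proof -
    have "S \<inter> cell i k = {x \<in> S \<inter> {x. b x = i}. h x = k}" for k by (auto simp: cell_def)
    then show ?thesis using Sum_any_card_fibres[of "S \<inter> {x. b x = i}" h] rfin[of i]
      by (simp add: ro_def cnt_def)
  qed
  (* The fibre of f over j loses S from the row j of b and gains S from the row j - e. *)
  have column: "int (card {x. f x = j \<and> h x = k}) = C j k - cnt S j k + cnt S (j - e) k"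
    if f: "\<And>x. f x = (if x \<in> S then b x + e else b x)" for f S j k
  proof -
    have "{x. f x = j \<and> h x = k} = (cell j k - S) \<union> (S \<inter> cell (j - e) k)"
      using e by (auto simp: f cell_def split: if_splits)
    moreover have "(cell j k - S) \<inter> (S \<inter> cell (j - e) k) = {}" by auto
    ultimately have "card {x. f x = j \<and> h x = k} = card (cell j k - S) + card (S \<inter> cell (j - e) k)"
      using cfin by (simp add: card_Un_disjoint)
    moreover have "card (cell j k) = card (cell j k - S) + card (S \<inter> cell j k)"
      using card_Int_Diff[OF cfin[of j k], of S] by (simp add: Int_commute)
    ultimately show ?thesis using ccard[of j k] by (simp add: cnt_def)
  qed
  (* B has no other nonzero entries in the row b x. *)
  have flag: "f x = (if x \<in> {x. f x = b x + e} then b x + e else b x)" if f: "f \<in> FL" for f x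
  proof -
    have "finite {y. b y = b x \<and> f y = f x}" by (rule finite_subset[OF _ rfin[of "b x"]]) auto
    then have "card {y. b y = b x \<and> f y = f x} \<noteq> 0" by auto
    moreover have "int (card {y. b y = b x \<and> f y = f x}) = B (b x) (f x)" using f unfolding FL_def by blast
    ultimately have "B (b x) (f x) \<noteq> 0" by linarith
    then show ?thesis by (auto simp: B_eq split: if_splits)
  qed
  have per: "x + int r \<in> {x. f x = b x + e} \<longleftrightarrow> x \<in> {x. f x = b x + e}" if f: "f \<in> FL" for f x
    using f b[of x] by (simp add: FL_def)
  have cntU: "cnt {x. f x = b x + e} \<in> \<U>" if f: "f \<in> FL" for f
  proof -
    let ?S = "{x. f x = b x + e}"
    have "cnt ?S (i + int n) (k + int n) = cnt ?S i k" for i k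
    proof -
      have "?S \<inter> cell (i + int n) (k + int n) = (\<lambda>x. x + int r) ` (?S \<inter> cell i k)"
      proof (intro equalityI subsetI)
        fix x assume x: "x \<in> ?S \<inter> cell (i + int n) (k + int n)"
        then have "x - int r \<in> ?S \<inter> cell i k"
          using per[OF f, of "x - int r"] b[of "x - int r"] h[of "x - int r"] by (auto simp: cell_def)
        then show "x \<in> (\<lambda>x. x + int r) ` (?S \<inter> cell i k)" by (intro image_eqI[of _ _ "x - int r"]) simp_all
      next
        fix x assume "x \<in> (\<lambda>x. x + int r) ` (?S \<inter> cell i k)"
        then obtain y where "x = y + int r" "y \<in> ?S" "y \<in> cell i k" by blast
        then show "x \<in> ?S \<inter> cell (i + int n) (k + int n)" using per[OF f, of y] b[of y] h[of y] by (auto simp: cell_def)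
      qed
      then show ?thesis by (simp add: cnt_def card_image)
    qed
    moreover
    have le: "cnt ?S i k \<le> C i k" for i k
    proof -
      have "card (?S \<inter> cell i k) \<le> card (cell i k)" using cfin by (intro card_mono) auto
      then show ?thesis using ccard[of i k] by (simp add: cnt_def)
    qed
    have c0: "cnt ?S i k = 0" if "C i k = 0" for i k
    proof -
      have "cnt ?S i k \<le> 0" using le[of i k] that by simp
      moreover have "0 \<le> cnt ?S i k" by (simp add: cnt_def)
      ultimately show ?thesis by (rule order.antisym)
    qed
    moreover have "finite {k. cnt ?S i k \<noteq> 0}" for i
    proof (rule finite_subset)
      show "{k. cnt ?S i k \<noteq> 0} \<subseteq> {k. C i k \<noteq> 0}"
        using c0 by blast
    qed (use CM in \<open>simp add: Mat_def\<close>)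
    moreover have "finite {i. cnt ?S i k \<noteq> 0}" for k
    proof (rule finite_subset)
      show "{i. cnt ?S i k \<noteq> 0} \<subseteq> {i. C i k \<noteq> 0}"
        using c0 by blast
    qed (use CM in \<open>simp add: Mat_def\<close>)
    ultimately have "cnt ?S \<in> Theta n" by (simp add: Theta_def Mat_def) (simp add: cnt_def)
    moreover have "ro (cnt ?S) = g"
    proof
      fix i
      have "?S \<inter> {x. b x = i} = {x. b x = i \<and> f x = i + e}" by auto
      then show "ro (cnt ?S) i = g i" using f e by (simp add: row FL_def B_eq)
    qed
    moreover have "A + cnt ?S - row_shift_by e (cnt ?S) = C"
    proof (intro ext)
      fix j k
      have "int (card {x. f x = j \<and> h x = k}) = A j k" using f unfolding FL_def by blast
      then show "(A + cnt ?S - row_shift_by e (cnt ?S)) j k = C j k"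
        using column[of f ?S j k, OF flag[OF f]] by (simp add: row_shift_by_def)
    qed
    ultimately show ?thesis by (simp add: \<U>_def)
  qed
  have diff: "U - row_shift_by e U = C - A" if "U \<in> \<U>" for U
  proof (intro ext)
    fix i k
    have "A + U - row_shift_by e U = C" using that by (simp add: \<U>_def)
    from fun_cong[OF fun_cong[OF this, of i], of k] show "(U - row_shift_by e U) i k = (C - A) i k" by simp
  qed
  (* A fixes U - row_shift_by e U and thereby U, so the sum has at most one term. *)
  have uniq: "U = U'" if "U \<in> \<U>" "U' \<in> \<U>" for U U'
  proof (rule row_shift_by_injective[OF e])
    show "U - row_shift_by e U = U' - row_shift_by e U'" using diff that by metis
  qed (use that in \<open>auto simp: \<U>_def Theta_def Mat_def\<close>)
  have "int (card FL) = (\<Sum>U\<in>\<U>. cell_choices n C U)"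
  proof (cases "\<U> = {}")
    case True
    then have "FL = {}" using cntU by blast
    then show ?thesis using True by simp
  next
    case False
    then obtain U where U: "U \<in> \<U>" by blast
    then have U1: "\<U> = {U}" using uniq by blast
    have Ut: "U \<in> Theta n" "ro U = g" "A + U - row_shift_by e U = C" using U by (auto simp: \<U>_def)
    let ?\<S> = "{S. (\<forall>x. x + int r \<in> S \<longleftrightarrow> x \<in> S) \<and> (\<forall>i k. int (card (S \<inter> {x. b x = i \<and> h x = k})) = U i k)}"
    have "bij_betw (\<lambda>f. {x. f x = b x + e}) FL ?\<S>"
    proof (rule bij_betwI[where g = "\<lambda>S x. if x \<in> S then b x + e else b x"])
      show "(\<lambda>f. {x. f x = b x + e}) \<in> FL \<rightarrow> ?\<S>"
      proof
        fix f assume f: "f \<in> FL"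
        have "cnt {x. f x = b x + e} = U" using cntU[OF f] U1 by blast
        then have "int (card ({x. f x = b x + e} \<inter> {x. b x = i \<and> h x = k})) = U i k" for i k
          by (auto simp: cnt_def cell_def fun_eq_iff)
        then show "{x. f x = b x + e} \<in> ?\<S>" using per[OF f] by simp
      qed
      show "(\<lambda>S x. if x \<in> S then b x + e else b x) \<in> ?\<S> \<rightarrow> FL"
      proof
        fix S assume S: "S \<in> ?\<S>"
        define f where "f x = (if x \<in> S then b x + e else b x)" for x
        have cS: "cnt S = U" using S by (auto simp: cnt_def cell_def fun_eq_iff)
        have "f (x + int r) = f x + int n" for x using S b[of x] by (simp add: f_def)
        moreover have "int (card {x. b x = i \<and> f x = j}) = B i j" for i j
        proof -
          have g: "int (card (S \<inter> {x. b x = i})) = g i" using row[of S i] cS Ut(2) by simp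
          have "card {x. b x = i} = card ({x. b x = i} - S) + card (S \<inter> {x. b x = i})"
            using card_Int_Diff[OF rfin[of i], of S] by (simp add: Int_commute)
          then have be: "int (card ({x. b x = i} - S)) = \<beta> i" using lam[of i] g by simp
          consider "j = i" | "j = i + e" | "j \<noteq> i" "j \<noteq> i + e" by blast
          then show ?thesis
          proof cases
            case 1
            then have "{x. b x = i \<and> f x = j} = {x. b x = i} - S" using e by (auto simp: f_def)
            then show ?thesis using 1 be e by (simp add: B_eq)
          next
            case 2
            then have "{x. b x = i \<and> f x = j} = S \<inter> {x. b x = i}" using e by (auto simp: f_def)
            then show ?thesis using 2 g e by (simp add: B_eq)
          next
            case 3
            then have "{x. b x = i \<and> f x = j} = {}" by (auto simp: f_def)
            then have "card {x. b x = i \<and> f x = j} = 0" by (simp only: card.empty)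
            then show ?thesis using 3 by (simp add: B_eq)
          qed
        qed
        moreover have "int (card {x. f x = j \<and> h x = k}) = A j k" for j k
          using column[of f S j k, OF f_def] cS fun_cong[OF fun_cong[OF Ut(3), of j], of k] by (simp add: row_shift_by_def)
        ultimately have "f \<in> FL" by (simp add: FL_def)
        then show "(\<lambda>x. if x \<in> S then b x + e else b x) \<in> FL" by (simp add: f_def[abs_def])
      qed
      show "(\<lambda>x. if x \<in> {x. f x = b x + e} then b x + e else b x) = f" if "f \<in> FL" for f
        using flag[OF that] by (intro ext) metis
      show "{x. (if x \<in> S then b x + e else b x) = b x + e} = S" if "S \<in> ?\<S>" for S using e by auto
    qed
    from bij_betw_same_card[OF this] have "int (card FL) = int (card ?\<S>)" by simp
    also have "\<dots> = cell_choices n C U" by (rule count_periodic_subsets[OF n r b h CM C(2) Ut(1)])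
    finally show ?thesis by (simp add: U1)
  qed
  then show ?thesis by (simp add: FL_def \<U>_def)
qed

text \<open>
  The flag of \<open>u\<close> sends \<open>x\<close> to the block of \<open>u\<^sup>-\<^sup>1 x\<close>. The matrices of \<open>u\<close> and of \<open>u\<^sup>-\<^sup>1 w\<close> count its values
  on the fibres of \<open>b\<close> and of \<open>h\<close>. It determines the coset of \<open>u\<close>, in which the element that increases
  on blocks is unique; conversely \<open>matching\<close> builds such an element from a flag.
\<close>

lemma representatives_flags:
  assumes n: "n > 0" and r: "r > 0" and B: "B \<in> Theta_r n r" and A: "A \<in> Theta_r n r" and BA: "co B = ro A"
    and C: "C \<in> Theta_r n r" "ro C = ro B" "co C = co A" and w: "w \<in> Dset n r C"
  defines "b \<equiv> block_index n r (ro C)" and "h \<equiv> (\<lambda>x. block_index n r (co C) (inv w x))"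
  shows "card {u \<in> Dset n r B. incr n r (co B) u \<and> inv u \<circ> w \<in> Dset n r A} =
    card {f. (\<forall>x. f (x + int r) = f x + int n) \<and> (\<forall>i j. int (card {x. b x = i \<and> f x = j}) = B i j) \<and>
      (\<forall>j k. int (card {x. f x = j \<and> h x = k}) = A j k)}" (is "card ?R = card ?FL")
proof -
  note LB = ro_co_Lambda[OF n B] and LA = ro_co_Lambda[OF n A] and LC = ro_co_Lambda[OF n C(1)]
  have wa: "w \<in> aff_sym r" using w by (simp add: Dset_def)
  let ?m = "co B"
  define fl where "fl u x = block_index n r ?m (inv u x)" for u :: perm and x
  have shift1: "block_index n r l (x + int r) = block_index n r l x + int n" if "l \<in> Lambda n (int r)" for l x
    using block_index_shift[OF n that r, of x 1] by simp
  have flB: "triple_mat n r (ro B) u ?m i j = int (card {x. b x = i \<and> fl u x = j})" if "u \<in> aff_sym r" for u i j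
    unfolding triple_mat_def triple_mat_fibre[OF n LB that r] by (simp add: b_def fl_def C(2))
  have flA: "triple_mat n r (ro A) (inv u \<circ> w) (co A) j k = int (card {x. fl u x = j \<and> h x = k})"
    if u: "u \<in> aff_sym r" for u j k
  proof -
    have iuw: "inv u \<circ> w \<in> aff_sym r" using u wa by (intro aff_sym_comp aff_sym_inv)
    have "inv (inv u \<circ> w) x = inv w (u x)" for x
      using aff_sym_inv_comp[OF aff_sym_inv[OF u] wa] u by simp
    then have "{x. fl u x = j \<and> h x = k} = u ` {y. block_index n r (ro A) y = j \<and> block_index n r (co A) (inv (inv u \<circ> w) y) = k}"
      using BA C(3) u by (auto simp: fl_def h_def mem_image_aff[OF u] aff_sym_inv_left[OF u] aff_sym_inv_right[OF u] simp del: o_apply)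
    moreover have "card (u ` X) = card X" for X
      using u by (intro card_image) (auto simp: inj_on_def aff_sym_eq_iff[OF u])
    ultimately show ?thesis
      unfolding triple_mat_def triple_mat_fibre[OF n LA iuw r] by simp
  qed
  have "bij_betw fl ?R ?FL"
    unfolding bij_betw_def
  proof
    show "inj_on fl ?R"
    proof (rule inj_onI)
      fix u u' assume u: "u \<in> ?R" and u': "u' \<in> ?R" and eq: "fl u = fl u'"
      have ua: "u \<in> aff_sym r" and ua': "u' \<in> aff_sym r" using u u' by (auto simp: Dset_def)
      define y where "y = inv u \<circ> u'"
      have "block_index n r ?m (y x) = block_index n r ?m x" for x
        using fun_cong[OF eq, of "u' x"] by (simp add: y_def fl_def aff_sym_inv_left[OF ua'])
      then have "y \<in> young n r ?m"
        using ua ua' by (simp add: young_block_index[OF n LB(2) r] y_def aff_sym_comp aff_sym_inv)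
      moreover have "u \<circ> y = u' \<circ> id" using ua by (simp add: y_def flip: comp_assoc)
      ultimately have "u = u' \<and> y = id"
        using u u' ua ua' by (intro coset_factor_unique[OF n LB(2)] young_group(1)[OF n LB(2)]) auto
      then show "u = u'" by blast
    qed
    show "fl ` ?R = ?FL"
    proof (intro equalityI subsetI)
      fix f assume "f \<in> fl ` ?R"
      then obtain u where u: "u \<in> ?R" "f = fl u" by blast
      then have ua: "u \<in> aff_sym r" by (auto simp: Dset_def)
      have "fl u (x + int r) = fl u x + int n" for x
        by (simp add: fl_def aff_sym_shift1[OF aff_sym_inv[OF ua]] shift1[OF LB(2)])
      moreover have "int (card {x. b x = i \<and> fl u x = j}) = B i j" for i j
        using u flB[OF ua] by (auto simp: Dset_def)
      moreover have "int (card {x. fl u x = j \<and> h x = k}) = A j k" for j k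
        using u flA[OF ua] by (auto simp: Dset_def)
      ultimately show "f \<in> ?FL" using u by simp
    next
      fix f assume f: "f \<in> ?FL"
      then have fr: "\<And>x. f (x + int r) = f x + int n" and fB: "\<And>i j. int (card {x. b x = i \<and> f x = j}) = B i j"
        and fA: "\<And>j k. int (card {x. f x = j \<and> h x = k}) = A j k" by auto
      have ffin: "finite {x. f x = j}" for j by (rule finite_periodic_fibre[of n r f, OF n r fr])
      have "int (card {x. f x = j}) = ?m j" for j
      proof -
        have "{x \<in> {x. f x = j}. b x = i} = {x. b x = i \<and> f x = j}" for i by auto
        then show ?thesis using Sum_any_card_fibres[OF ffin[of j], of b] fB by (simp add: co_def)
      qed
      moreover have blk: "{x. block_index n r ?m x = k} = block n r ?m k" for k using block_index_iff[OF n LB(2) r] by auto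
      ultimately have "finite {x. block_index n r ?m x = k}" "card {x. block_index n r ?m x = k} = card {x. f x = k}" for k
        using card_block[OF n LB(2), of k] by (simp_all, metis of_nat_eq_iff)
      moreover have "inj (\<lambda>k. k + int n)" by (simp add: inj_def)
      ultimately obtain g where g: "g \<in> aff_sym r" "\<And>x. f (g x) = block_index n r ?m x"
        "\<And>x y. x < y \<Longrightarrow> block_index n r ?m x = block_index n r ?m y \<Longrightarrow> g x < g y"
        using matching[OF r, of "\<lambda>k. k + int n" "block_index n r ?m" f] ffin fr shift1[OF LB(2)] by metis
      have ff: "f = fl g" using g(2)[of "inv g _"] g(1) by (auto simp: fl_def fun_eq_iff)
      have "incr n r ?m g" unfolding incr_def block_index_iff[OF n LB(2) r, symmetric] using g(3) by metis
      moreover have "g \<in> Dset n r B" using g(1) flB[OF g(1)] fB ff by (auto simp: Dset_def fun_eq_iff)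
      moreover have "inv g \<circ> w \<in> Dset n r A"
        using g(1) wa flA[OF g(1)] fA ff by (auto simp: Dset_def fun_eq_iff aff_sym_comp aff_sym_inv simp del: o_apply)
      ultimately show "f \<in> fl ` ?R" using ff by blast
    qed
  qed
  then show ?thesis by (rule bij_betw_same_card)
qed

section \<open>Products with bidiagonal matrices\<close>

lemma row_shift_by_Mat: assumes U: "U \<in> Mat n" shows "row_shift_by e U \<in> Mat n"
proof -
  have "finite {i. U (i - e) k \<noteq> 0}" for k
  proof -
    have "{i. U (i - e) k \<noteq> 0} \<subseteq> (\<lambda>i. i + e) ` {i. U i k \<noteq> 0}"
    proof
      fix i assume "i \<in> {i. U (i - e) k \<noteq> 0}"
      then show "i \<in> (\<lambda>i. i + e) ` {i. U i k \<noteq> 0}" by (intro image_eqI[of _ _ "i - e"]) simp_all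
    qed
    moreover have "finite ((\<lambda>i. i + e) ` {i. U i k \<noteq> 0})" using U by (simp add: Mat_def)
    ultimately show ?thesis by (rule finite_subset)
  qed
  moreover have "U (i - e) k = U (i + int n - e) (k + int n)" for i k
    using Mat_shift[OF U, of "i - e" 1 k] by (simp add: algebra_simps)
  ultimately show ?thesis using U by (simp add: Mat_def row_shift_by_def)
qed

lemma Mat_add: assumes "A \<in> Mat n" "U \<in> Mat n" shows "A + U \<in> Mat n"
proof -
  have "finite {j. A i j + U i j \<noteq> 0}" for i
    by (rule finite_subset[of _ "{j. A i j \<noteq> 0} \<union> {j. U i j \<noteq> 0}"]) (use assms in \<open>auto simp: Mat_def\<close>)
  moreover have "finite {i. A i j + U i j \<noteq> 0}" for j
    by (rule finite_subset[of _ "{i. A i j \<noteq> 0} \<union> {i. U i j \<noteq> 0}"]) (use assms in \<open>auto simp: Mat_def\<close>)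
  moreover have "A i j + U i j = A (i + int n) (j + int n) + U (i + int n) (j + int n)" for i j
    using assms by (auto simp: Mat_def)
  ultimately show ?thesis by (auto simp: Mat_def)
qed

lemma Mat_uminus: "A \<in> Mat n \<Longrightarrow> - A \<in> Mat n"
  by (simp add: Mat_def)

lemma Mat_diff: assumes "A \<in> Mat n" "U \<in> Mat n" shows "A - U \<in> Mat n"
proof -
  have "A - U = A + - U" by (simp add: fun_eq_iff)
  then show ?thesis using Mat_add[OF assms(1) Mat_uminus[OF assms(2)]] by simp
qed

lemma ro_add: assumes "A \<in> Mat n" "U \<in> Mat n" shows "ro (A + U) = ro A + ro U"
proof
  fix i
  have "Sum_any (\<lambda>j. A i j + U i j) = Sum_any (A i) + Sum_any (U i)"
    using assms by (intro Sum_any.distrib) (auto simp: Mat_def)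
  then show "ro (A + U) i = (ro A + ro U) i" by (simp add: ro_def)
qed

lemma co_add: assumes "A \<in> Mat n" "U \<in> Mat n" shows "co (A + U) = co A + co U"
proof
  fix j
  have "Sum_any (\<lambda>i. A i j + U i j) = Sum_any (\<lambda>i. A i j) + Sum_any (\<lambda>i. U i j)"
    using assms by (intro Sum_any.distrib) (auto simp: Mat_def)
  then show "co (A + U) j = (co A + co U) j" by (simp add: co_def)
qed

lemma ro_diff: assumes "A \<in> Mat n" "U \<in> Mat n" shows "ro (A - U) = ro A - ro U"
proof -
  have "ro (A - U + U) = ro (A - U) + ro U" by (rule ro_add[OF Mat_diff[OF assms] assms(2)])
  moreover have "A - U + U = A" by (simp add: fun_eq_iff)
  ultimately show ?thesis by simp
qed

lemma co_diff: assumes "A \<in> Mat n" "U \<in> Mat n" shows "co (A - U) = co A - co U"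
proof -
  have "co (A - U + U) = co (A - U) + co U" by (rule co_add[OF Mat_diff[OF assms] assms(2)])
  moreover have "A - U + U = A" by (simp add: fun_eq_iff)
  ultimately show ?thesis by simp
qed

lemma ro_row_shift_by: "ro (row_shift_by e U) i = ro U (i - e)"
  by (simp add: ro_def row_shift_by_def)

lemma co_row_shift_by: "co (row_shift_by e U) = co U"
proof
  fix k
  have "bij (\<lambda>i::int. i - e)" by (rule o_bij[where g = "\<lambda>i. i + e"]) (auto simp: fun_eq_iff)
  then have "Sum_any (\<lambda>i. row_shift_by e U i k) = Sum_any (\<lambda>i. U i k)"
    by (rule Sum_any.reindex_cong[symmetric]) (simp add: fun_eq_iff row_shift_by_def)
  then show "co (row_shift_by e U) k = co U k" by (simp add: co_def)
qed

lemma msigma_eq_ro: "msigma n A = vsigma n (ro A)"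
  by (simp add: msigma_def vsigma_def ro_def)

lemma vsigma_add: "vsigma n (a + b) = vsigma n a + vsigma n b"
  by (simp add: vsigma_def sum.distrib)

lemma vsigma_diff: "vsigma n (a - b) = vsigma n a - vsigma n b"
  by (simp add: vsigma_def sum_subtractf)

lemma msigma_row_shift_by:
  assumes n: "n > 0" and U: "U \<in> Mat n" shows "msigma n (row_shift_by e U) = msigma n U"
  using vsigma_co[OF n row_shift_by_Mat[OF U, of e]] vsigma_co[OF n U] by (simp add: co_row_shift_by)

lemma msigma_add_diff:
  assumes n: "n > 0" and A: "A \<in> Mat n" and U: "U \<in> Mat n"
  shows "msigma n (A + U - row_shift_by e U) = msigma n A"
proof -
  have "msigma n (A + U - row_shift_by e U) = vsigma n (ro A) + vsigma n (ro U) - vsigma n (ro (row_shift_by e U))"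
    unfolding msigma_eq_ro ro_diff[OF Mat_add[OF A U] row_shift_by_Mat[OF U]] ro_add[OF A U] vsigma_diff vsigma_add ..
  then show ?thesis using msigma_row_shift_by[OF n U, of e] by (simp add: msigma_eq_ro)
qed

lemma ro_shifted_diag: "ro (shifted_diag e g) = g"
  by (simp add: fun_eq_iff ro_def shifted_diag_def Sum_any.delta)

lemma co_shifted_diag: "co (shifted_diag e g) j = g (j - e)"
proof -
  have "shifted_diag e g i j = (if i = j - e then g i else 0)" for i by (auto simp: shifted_diag_def)
  then show ?thesis by (simp add: co_def Sum_any.delta)
qed

lemma shifted_diag_Mat: assumes "g \<in> Zvec n" shows "shifted_diag e g \<in> Mat n"
proof -
  have "finite {i. shifted_diag e g i j \<noteq> 0}" for j
    by (rule finite_subset[of _ "{j - e}"]) (auto simp: shifted_diag_def)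
  moreover have "finite {j. shifted_diag e g i j \<noteq> 0}" for i
    by (rule finite_subset[of _ "{i + e}"]) (auto simp: shifted_diag_def)
  ultimately show ?thesis using assms by (auto simp: Mat_def shifted_diag_def Zvec_def)
qed

lemma cell_choices_zero [simp]: "cell_choices n C 0 = 1"
proof -
  have "ibinom m 0 = 1" for m by (simp add: ibinom_def)
  then show ?thesis by (simp add: cell_choices_def)
qed

lemma Theta_ro_zero: assumes "U \<in> Theta n" "ro U = 0" shows "U = 0"
proof (intro ext)
  fix i j
  have "0 \<le> U i j" using assms(1) by (simp add: Theta_def)
  then show "U i j = 0 i j" using entry_le_ro[OF assms(1), of i j] assms(2) by simp
qed

lemma zero_Theta: "0 \<in> Theta n"
  by (simp add: Theta_def Mat_def)

text \<open>
  For \<open>r > 0\<close> the representatives are flags, which have been counted, provided that the row and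
  column sums of \<open>C\<close> fit; otherwise both sides are zero. For \<open>r = 0\<close> all matrices are zero and both
  sides are one.
\<close>

lemma structure_constant:
  assumes n: "n > 0" and e: "e \<noteq> 0" and B: "B \<in> Theta_r n r" "B = shifted_diag e g + diag \<beta>"
    and A: "A \<in> Theta_r n r" and BA: "co B = ro A" and C: "C \<in> Theta_r n r"
  shows "at_one (Poly_Mapping.lookup (schur_const n r B A) C) =
    (\<Sum>U | U \<in> Theta n \<and> ro U = g \<and> A + U - row_shift_by e U = C. cell_choices n C U)"
proof -
  have BM: "B \<in> Mat n" and AM: "A \<in> Mat n" and CT: "C \<in> Theta n" using B A C by (auto simp: Theta_r_def Theta_def)
  (* The two diagonals of B do not meet, so that g and \<beta> are determined by B. *)
  have gz: "g i = B i (i + e)" for i using e by (simp add: B shifted_diag_def diag_def)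
  have gZ: "g \<in> Zvec n"
  proof -
    have "B (i + int n) (i + int n + e) = B i (i + e)" for i
      using Mat_shift[OF BM, of i 1 "i + e"] by (simp add: algebra_simps)
    then show ?thesis by (simp add: Zvec_def gz)
  qed
  have roB: "ro B = g + \<beta>" unfolding B(2) ro_add_diag[OF shifted_diag_Mat[OF gZ]] by (simp only: ro_shifted_diag)
  have coB: "co B = (\<lambda>j. g (j - e)) + \<beta>" unfolding B(2) co_add_diag[OF shifted_diag_Mat[OF gZ]]
    by (simp add: fun_eq_iff co_shifted_diag)
  show ?thesis
  proof (cases "ro C = ro B \<and> co C = co A")
    case False
    then have "C \<notin> Poly_Mapping.keys (schur_const n r B A)" using keys_schur_const[OF n B(1) A] by blast
    moreover have "{U. U \<in> Theta n \<and> ro U = g \<and> A + U - row_shift_by e U = C} = {}"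
    proof (rule ccontr)
      assume "\<not> ?thesis"
      then obtain U where U: "U \<in> Theta n" "ro U = g" "A + U - row_shift_by e U = C" by blast
      have UM: "U \<in> Mat n" using U by (simp add: Theta_def)
      have "co C = co A"
        unfolding U(3)[symmetric] co_diff[OF Mat_add[OF AM UM] row_shift_by_Mat[OF UM]] co_add[OF AM UM] co_row_shift_by by simp
      moreover have "ro C = ro B"
        unfolding U(3)[symmetric] ro_diff[OF Mat_add[OF AM UM] row_shift_by_Mat[OF UM]] ro_add[OF AM UM] roB
          BA[symmetric] coB by (simp add: fun_eq_iff ro_row_shift_by U(2))
      ultimately show False using False by blast
    qed
    ultimately show ?thesis by (simp only: sum.empty in_keys_iff not_not at_one_0)
  next
    case True
    then have C': "ro C = ro B" "co C = co A" by auto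
    obtain w where w: "w \<in> Dset n r C" using Dset_nonempty[OF n C] by blast
    note sc = at_one_schur_const[OF n B(1) A BA C C' w]
    show ?thesis
    proof (cases "r = 0")
      case False
      then have r: "r > 0" by simp
      note LB = ro_co_Lambda[OF n B(1)] and LC = ro_co_Lambda[OF n C]
      define b where "b = block_index n r (ro C)"
      define h where "h = (\<lambda>x. block_index n r (co C) (inv w x))"
      have wa: "w \<in> aff_sym r" using w by (simp add: Dset_def)
      note rf = representatives_flags[OF n r B(1) A BA C C' w, folded b_def h_def]
      have shift1: "block_index n r l (x + int r) = block_index n r l x + int n" if "l \<in> Lambda n (int r)" for l x
        using block_index_shift[OF n that r, of x 1] by simp
      have bs: "b (x + int r) = b x + int n" for x by (simp add: b_def shift1[OF LC(1)])
      have hs: "h (x + int r) = h x + int n" for x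
        by (simp add: h_def shift1[OF LC(2)] aff_sym_shift1[OF aff_sym_inv[OF wa]])
      have cells: "int (card {x. b x = i \<and> h x = k}) = C i k" for i k
      proof -
        have "triple_mat n r (ro C) w (co C) i k = C i k" using w by (simp add: Dset_def)
        then show ?thesis unfolding triple_mat_def triple_mat_fibre[OF n LC wa r] by (simp add: b_def h_def)
      qed
      have lam: "int (card {x. b x = i}) = \<beta> i + g i" for i
      proof -
        have "{x. b x = i} = block n r (ro C) i" using block_index_iff[OF n LC(1) r] by (auto simp: b_def)
        then show ?thesis using card_block[OF n LC(1), of i] C'(1) roB by simp
      qed
      show ?thesis unfolding sc rf using flags_card[OF n r e bs hs CT cells B(2) lam, of A] unfolding h_def .
    next
      case True
      have z: "A = 0" "B = 0" "C = 0" using Theta_r_zero[OF n] A B(1) C True by auto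
      have g0: "g = 0" using gz z by (simp add: fun_eq_iff)
      have D: "Dset n r X = {id}" if "X \<in> Theta_r n r" for X
        using Dset_aff[of n r X] Dset_nonempty[OF n that] True by auto
      have "incr n r (co B) id" by (simp add: incr_def)
      then have "{u \<in> Dset n r B. incr n r (co B) u \<and> inv u \<circ> w \<in> Dset n r A} = {id}"
      proof -
        have "inv id \<circ> w \<in> Dset n r A" using w D[OF A] D[OF C] by simp
        then show ?thesis unfolding D[OF B(1)] using \<open>incr n r (co B) id\<close> by blast
      qed
      then have "at_one (Poly_Mapping.lookup (schur_const n r B A) C) = 1" unfolding sc by simp
      moreover have "{U. U \<in> Theta n \<and> ro U = g \<and> A + U - row_shift_by e U = C} = {0}"
      proof (intro equalityI subsetI)
        fix U assume "U \<in> {U. U \<in> Theta n \<and> ro U = g \<and> A + U - row_shift_by e U = C}"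
        then have "U = 0" using g0 by (intro Theta_ro_zero[of U n]) simp_all
        then show "U \<in> {0}" by simp
      next
        fix U :: mat assume "U \<in> {0}"
        then have U: "U = 0" by simp
        have "ro (0 :: mat) = g" by (simp add: g0 ro_def fun_eq_iff)
        moreover have "row_shift_by e (0 :: mat) = 0" by (simp add: row_shift_by_def fun_eq_iff)
        ultimately show "U \<in> {U. U \<in> Theta n \<and> ro U = g \<and> A + U - row_shift_by e U = C}"
          unfolding U using zero_Theta z by simp
      qed
      ultimately show ?thesis by simp
    qed
  qed
qed

definition one_const :: "nat \<Rightarrow> nat \<Rightarrow> mat \<Rightarrow> mat \<Rightarrow> (mat \<Rightarrow>\<^sub>0 'k::comm_ring_1)" where
  "one_const n r B A = Poly_Mapping.map (\<lambda>p. of_int (at_one p)) (schur_const n r B A)"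

lemma lookup_one_const: "Poly_Mapping.lookup (one_const n r B A) C = of_int (at_one (Poly_Mapping.lookup (schur_const n r B A) C))"
  by (simp add: one_const_def Poly_Mapping.map.rep_eq when_def)

lemma schur_one_mult_superset:
  assumes "finite S" "Poly_Mapping.keys x \<subseteq> S" "finite T" "Poly_Mapping.keys y \<subseteq> T"
  shows "schur_one_mult n r x y =
    (\<Sum>B\<in>S. \<Sum>A\<in>T. smul (Poly_Mapping.lookup x B * Poly_Mapping.lookup y A) (one_const n r B A))"
proof -
  have "schur_one_mult n r x y =
      (\<Sum>B\<in>Poly_Mapping.keys x. \<Sum>A\<in>T. smul (Poly_Mapping.lookup x B * Poly_Mapping.lookup y A) (one_const n r B A))"
    unfolding schur_one_mult_def one_const_def[symmetric]
    by (intro sum.cong refl sum.mono_neutral_left assms) (auto simp: in_keys_iff)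
  also have "\<dots> = (\<Sum>B\<in>S. \<Sum>A\<in>T. smul (Poly_Mapping.lookup x B * Poly_Mapping.lookup y A) (one_const n r B A))"
    by (intro sum.mono_neutral_left assms) (auto simp: in_keys_iff)
  finally show ?thesis .
qed

lemma schur_one_mult_add_left:
  "schur_one_mult n r (x + x') y = schur_one_mult n r x y + schur_one_mult n r x' y"
proof -
  let ?S = "Poly_Mapping.keys x \<union> Poly_Mapping.keys x'" and ?T = "Poly_Mapping.keys y"
  have "Poly_Mapping.keys (x + x') \<subseteq> ?S" by (rule keys_add)
  then show ?thesis
    using schur_one_mult_superset[of ?S "x + x'" ?T y n r] schur_one_mult_superset[of ?S x ?T y n r]
      schur_one_mult_superset[of ?S x' ?T y n r]
    by (simp add: lookup_add distrib_right smul_add_left sum.distrib)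
qed

lemma schur_one_mult_add_right:
  "schur_one_mult n r y (x + x') = schur_one_mult n r y x + schur_one_mult n r y x'"
proof -
  let ?S = "Poly_Mapping.keys x \<union> Poly_Mapping.keys x'" and ?T = "Poly_Mapping.keys y"
  have "Poly_Mapping.keys (x + x') \<subseteq> ?S" by (rule keys_add)
  then show ?thesis
    using schur_one_mult_superset[of ?T y ?S "x + x'" n r] schur_one_mult_superset[of ?T y ?S x n r]
      schur_one_mult_superset[of ?T y ?S x' n r]
    by (simp add: lookup_add distrib_left smul_add_left sum.distrib)
qed

lemma schur_one_mult_smul:
  "schur_one_mult n r (smul c x) y = smul c (schur_one_mult n r x y)"
  "schur_one_mult n r y (smul c x) = smul c (schur_one_mult n r y x)"
proof -
  let ?S = "Poly_Mapping.keys x" and ?T = "Poly_Mapping.keys y"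
  have k: "Poly_Mapping.keys (smul c x) \<subseteq> ?S" by (rule keys_smul)
  show "schur_one_mult n r (smul c x) y = smul c (schur_one_mult n r x y)"
    using schur_one_mult_superset[of ?S "smul c x" ?T y n r] schur_one_mult_superset[of ?S x ?T y n r] k
    by (simp add: smul_sum mult.assoc)
  show "schur_one_mult n r y (smul c x) = smul c (schur_one_mult n r y x)"
    using schur_one_mult_superset[of ?T y ?S "smul c x" n r] schur_one_mult_superset[of ?T y ?S x n r] k
    by (simp add: smul_sum mult.left_commute)
qed

lemma schur_one_mult_0 [simp]: "schur_one_mult n r 0 y = 0" "schur_one_mult n r y 0 = 0"
  by (simp_all add: schur_one_mult_def)

lemma schur_one_mult_sum:
  "schur_one_mult n r (sum f I) y = (\<Sum>i\<in>I. schur_one_mult n r (f i) y)"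
  "schur_one_mult n r y (sum f I) = (\<Sum>i\<in>I. schur_one_mult n r y (f i))"
  by (induction I rule: infinite_finite_induct) (simp_all add: schur_one_mult_add_left schur_one_mult_add_right)

lemma schur_one_mult_single:
  "schur_one_mult n r (Poly_Mapping.single B 1) (Poly_Mapping.single A 1) = one_const n r B A"
  by (simp add: schur_one_mult_def one_const_def[symmetric])

text \<open>
  Only a product with nonnegative off-diagonal entries has a basis element, and this condition
  is what makes the set finite. The diagonal entries are left out: they depend on the diagonal
  that is added to \<open>A\<close>, and a negative one is taken care of by the convention that \<open>[X]\<^sub>1\<close> is then
  zero.
\<close>

definition moves :: "nat \<Rightarrow> int \<Rightarrow> vec \<Rightarrow> mat \<Rightarrow> mat set" where
  "moves n e g A = {U \<in> Theta n. ro U = g \<and> (\<forall>i j. i \<noteq> j \<longrightarrow> 0 \<le> (A + U - row_shift_by e U) i j)}"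

lemma Theta_r_diag_nonneg: "A \<in> Theta_r n r \<Longrightarrow> \<not> (\<exists>i. A i i < 0)"
  by (auto simp: Theta_r_def Theta_def not_less)

theorem schur_product:
  assumes n: "n > 0" and e: "e \<noteq> 0" and B: "B \<in> Theta_r n r" "B = shifted_diag e g + diag \<beta>"
    and A: "A \<in> Theta_r n r" and BA: "co B = ro A" and fin: "finite (moves n e g A)"
  shows "schur_one_mult n r (br_one B) (br_one A) =
    (\<Sum>U\<in>moves n e g A. smul (of_int (cell_choices n (A + U - row_shift_by e U) U)) (br_one (A + U - row_shift_by e U) :: mat \<Rightarrow>\<^sub>0 'k::comm_ring_1))"
proof (rule poly_mapping_eqI)
  fix C
  have AM: "A \<in> Mat n" "msigma n A = int r" using A by (auto simp: Theta_r_def Theta_def)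
  have "schur_one_mult n r (br_one B) (br_one A) = (one_const n r B A :: mat \<Rightarrow>\<^sub>0 'k)"
    using Theta_r_diag_nonneg[OF B(1)] Theta_r_diag_nonneg[OF A] by (simp add: br_one_def schur_one_mult_single)
  then have "Poly_Mapping.lookup (schur_one_mult n r (br_one B) (br_one A)) C =
      (of_int (at_one (Poly_Mapping.lookup (schur_const n r B A) C)) :: 'k)" by (simp add: lookup_one_const)
  also have "\<dots> = (\<Sum>U\<in>moves n e g A. of_int (cell_choices n (A + U - row_shift_by e U) U) *
      Poly_Mapping.lookup (br_one (A + U - row_shift_by e U) :: mat \<Rightarrow>\<^sub>0 'k) C)"
  proof (cases "C \<in> Theta_r n r")
    case False
    have "Poly_Mapping.lookup (br_one (A + U - row_shift_by e U) :: mat \<Rightarrow>\<^sub>0 'k) C = 0" if U: "U \<in> moves n e g A" for U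
    proof (rule ccontr)
      assume "\<not> ?thesis"
      then have C: "A + U - row_shift_by e U = C" "\<not> (\<exists>i. C i i < 0)"
        by (auto simp: br_one_def lookup_single when_def split: if_splits)
      have UM: "U \<in> Mat n" using U by (auto simp: moves_def Theta_def)
      have "0 \<le> C i j" for i j using U C by (cases "i = j") (auto simp: moves_def not_less)
      moreover have "C \<in> Mat n" using C(1) Mat_diff[OF Mat_add[OF AM(1) UM] row_shift_by_Mat[OF UM]] by blast
      moreover have "msigma n C = int r" using msigma_add_diff[OF n AM(1) UM, of e] C(1) AM(2) by simp
      ultimately show False using False by (simp add: Theta_r_def Theta_def)
    qed
    moreover have "C \<notin> Poly_Mapping.keys (schur_const n r B A)" using keys_schur_const[OF n B(1) A] False by blast
    then have "Poly_Mapping.lookup (schur_const n r B A) C = 0" by (simp add: in_keys_iff)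
    ultimately show ?thesis by simp
  next
    case True
    have C0: "0 \<le> C i j" for i j using True by (simp add: Theta_r_def Theta_def)
    let ?W = "{U. U \<in> Theta n \<and> ro U = g \<and> A + U - row_shift_by e U = C}"
    have "Poly_Mapping.lookup (br_one (A + U - row_shift_by e U) :: mat \<Rightarrow>\<^sub>0 'k) C = (if U \<in> ?W then 1 else 0)"
      if "U \<in> moves n e g A" for U
    proof (cases "A + U - row_shift_by e U = C")
      case True
      have "\<not> (\<exists>i. C i i < 0)" using C0 by (auto simp: not_less)
      then have "Poly_Mapping.lookup (br_one C :: mat \<Rightarrow>\<^sub>0 'k) C = 1" by (simp add: br_one_def)
      then show ?thesis using that True by (simp add: moves_def)
    next
      case False
      then have "Poly_Mapping.lookup (br_one (A + U - row_shift_by e U) :: mat \<Rightarrow>\<^sub>0 'k) C = 0"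
        unfolding br_one_def by (simp add: lookup_single when_def)
      then show ?thesis using False by simp
    qed
    then have "(\<Sum>U\<in>moves n e g A. of_int (cell_choices n (A + U - row_shift_by e U) U) *
        Poly_Mapping.lookup (br_one (A + U - row_shift_by e U) :: mat \<Rightarrow>\<^sub>0 'k) C)
       = (\<Sum>U\<in>moves n e g A. if U \<in> ?W then of_int (cell_choices n C U) else 0)" by (intro sum.cong) auto
    also have "\<dots> = (\<Sum>U\<in>moves n e g A \<inter> ?W. of_int (cell_choices n C U))" using fin by (simp add: sum.inter_restrict)
    also have "moves n e g A \<inter> ?W = ?W" using C0 by (auto simp: moves_def)
    finally show ?thesis by (simp only: structure_constant[OF n e B A BA True] of_int_sum)
  qed
  finally show "Poly_Mapping.lookup (schur_one_mult n r (br_one B) (br_one A)) C =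
      Poly_Mapping.lookup (\<Sum>U\<in>moves n e g A. smul (of_int (cell_choices n (A + U - row_shift_by e U) U)) (br_one (A + U - row_shift_by e U) :: mat \<Rightarrow>\<^sub>0 'k)) C"
    by (simp add: lookup_sum)
qed

section \<open>A binomial identity\<close>

text \<open>
  Vandermonde's identity for \<open>c\<close> out of \<open>t + (m - t)\<close>: \<open>b\<close> of the chosen elements are among the \<open>t\<close>.
\<close>

lemma binomial_product:
  fixes m :: int
  shows "ibinom m t * ibinom m c = (\<Sum>b\<le>c. int (t choose b) * (int ((t + (c - b)) choose t) * ibinom m (t + (c - b))))"
proof -
  let ?m = "of_int m :: rat"
  have "?m gchoose c = (\<Sum>b\<le>c. (of_nat t gchoose b) * ((?m - of_nat t) gchoose (c - b)))"
    using gbinomial_Vandermonde[of "of_nat t :: rat" "?m - of_nat t" c] by (simp add: atLeast0AtMost)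
  then have "(?m gchoose t) * (?m gchoose c) =
      (\<Sum>b\<le>c. (of_nat t gchoose b) * ((?m gchoose t) * ((?m - of_nat t) gchoose (c - b))))"
    by (simp add: sum_distrib_left algebra_simps)
  also have "\<dots> = (\<Sum>b\<le>c. of_nat (t choose b) * (of_nat ((t + (c - b)) choose t) * (?m gchoose (t + (c - b)))))"
  proof (intro sum.cong refl)
    fix b
    have "(?m gchoose (t + (c - b))) * (of_nat (t + (c - b)) gchoose t) = (?m gchoose t) * (?m - of_nat t gchoose (c - b))"
      using gbinomial_trinomial_revision[of t "t + (c - b)" ?m] by simp
    then show "(of_nat t gchoose b) * ((?m gchoose t) * ((?m - of_nat t) gchoose (c - b))) =
       of_nat (t choose b) * (of_nat ((t + (c - b)) choose t) * (?m gchoose (t + (c - b))))"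
      by (simp only: binomial_gbinomial mult.commute)
  qed
  finally have "(of_int (ibinom m t * ibinom m c) :: rat) =
      of_int (\<Sum>b\<le>c. int (t choose b) * (int ((t + (c - b)) choose t) * ibinom m (t + (c - b))))"
    by (simp add: of_int_ibinom)
  then show ?thesis by (simp only: of_int_eq_iff)
qed

lemma ibinom_add: "ibinom (m + k) l = (\<Sum>c\<le>l. ibinom m c * ibinom k (l - c))"
proof -
  have "(of_int (ibinom (m + k) l) :: rat) = of_int (\<Sum>c\<le>l. ibinom m c * ibinom k (l - c))"
    using gbinomial_Vandermonde[of "of_int m :: rat" "of_int k" l] by (simp add: of_int_ibinom atLeast0AtMost)
  then show ?thesis by (simp only: of_int_eq_iff)
qed

text \<open>
  Expand the first factor by Vandermonde's identity, then each product of two binomial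
  coefficients of \<open>m\<close>; \<open>b\<close> counts the overlap and \<open>d\<close> the surplus.
\<close>

lemma scalar_identity:
  "ibinom (m + k) l * ibinom m t =
    (\<Sum>d\<le>l. \<Sum>b\<le>min t (l - d). ibinom k (l - b - d) * int (((t + d) choose t) * (t choose b)) * ibinom m (t + d))"
proof -
  let ?f = "\<lambda>b d. ibinom k (l - b - d) * int (((t + d) choose t) * (t choose b)) * ibinom m (t + d)"
  have "ibinom (m + k) l * ibinom m t = (\<Sum>c\<le>l. ibinom k (l - c) * (ibinom m t * ibinom m c))"
    unfolding ibinom_add sum_distrib_right by (intro sum.cong refl) (simp add: algebra_simps)
  also have "\<dots> = (\<Sum>c\<le>l. \<Sum>b\<le>c. ?f b (c - b))"
    unfolding binomial_product[of m t] sum_distrib_left by (intro sum.cong refl) (simp add: algebra_simps)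
  also have "\<dots> = (\<Sum>p\<in>(SIGMA c:{..l}. {..c}). ?f (snd p) (fst p - snd p))"
    by (subst sum.Sigma) (auto simp: split_def)
  also have "\<dots> = (\<Sum>p\<in>(SIGMA d:{..l}. {..l - d}). ?f (snd p) (fst p))"
    by (rule sum.reindex_bij_witness[where i = "\<lambda>(d, b). (d + b, b)" and j = "\<lambda>(c, b). (c - b, b)"]) auto
  also have "\<dots> = (\<Sum>d\<le>l. \<Sum>b\<le>l - d. ?f b d)"
    by (subst sum.Sigma) (auto simp: split_def)
  also have "\<dots> = (\<Sum>d\<le>l. \<Sum>b\<le>min t (l - d). ?f b d)"
    by (intro sum.cong refl sum.mono_neutral_right) (auto simp: not_le)
  finally show ?thesis .
qed

lemma multinomial_factor:
  assumes "b \<le> t"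
  shows "(fact (t + d) :: int) div (fact b * (fact d * fact (t - b))) = int (((t + d) choose t) * (t choose b))"
proof -
  have "(fact (t + d) :: nat) = fact t * fact d * ((t + d) choose t)"
    using binomial_fact_lemma[of t "t + d"] by simp
  also have "(fact t :: nat) = fact b * fact (t - b) * (t choose b)"
    using binomial_fact_lemma[OF assms] by simp
  finally have "(fact (t + d) :: nat) = (fact b * (fact d * fact (t - b))) * (((t + d) choose t) * (t choose b))"
    by (simp add: algebra_simps)
  then have "int (fact (t + d)) = int (fact b * (fact d * fact (t - b))) * int (((t + d) choose t) * (t choose b))"
    by (simp only: of_nat_mult)
  then have "(fact (t + d) :: int) = (fact b * (fact d * fact (t - b))) * int (((t + d) choose t) * (t choose b))"
    by (simp only: of_nat_mult of_nat_fact)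
  moreover have "(fact b * (fact d * fact (t - b)) :: int) \<noteq> 0" by simp
  ultimately show ?thesis by (metis nonzero_mult_div_cancel_left)
qed

text \<open>Periodic vectors in a box are arbitrary choices of their entries in one period.\<close>

lemma sum_box:
  fixes F :: "int \<Rightarrow> int \<Rightarrow> 'a::comm_semiring_1"
  assumes n: "n > 0" and u: "u \<in> Zvec n"
  shows "(\<Sum>d | d \<in> Nvec n \<and> d \<le> u. \<Prod>i = 1..int n. F i (d i)) = (\<Prod>i = 1..int n. \<Sum>x\<in>{0..u i}. F i x)"
proof -
  let ?P = "\<Pi>\<^sub>E i\<in>{1..int n}. {0..u i}"
  let ?ext = "\<lambda>g i. g ((i - 1) mod int n + 1)"
  have nm: "(i - 1) mod int n + 1 \<in> {1..int n}" for i
  proof -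
    have "0 \<le> (i - 1) mod int n" "(i - 1) mod int n < int n" using n by simp_all
    then show ?thesis unfolding atLeastAtMost_iff by linarith
  qed
  have nmi: "(i - 1) mod int n + 1 = i" if "i \<in> {1..int n}" for i using that by simp
  have per: "v ((i - 1) mod int n + 1) = v i" if "v \<in> Zvec n" for v i
  proof -
    have "(i - 1) mod int n + 1 = i + - ((i - 1) div int n) * int n" by (simp add: minus_div_mult_eq_mod[symmetric])
    then show ?thesis using Zvec_shift[OF that, of i "- ((i - 1) div int n)"] by simp
  qed
  have "(\<Sum>d | d \<in> Nvec n \<and> d \<le> u. \<Prod>i = 1..int n. F i (d i)) = (\<Sum>g\<in>?P. \<Prod>i = 1..int n. F i (g i))"
  proof (rule sum.reindex_bij_witness[where i = ?ext and j = "\<lambda>d. restrict d {1..int n}"])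
    fix d assume d: "d \<in> {d. d \<in> Nvec n \<and> d \<le> u}"
    then show "(\<lambda>i. restrict d {1..int n} ((i - 1) mod int n + 1)) = d"
      using nm per[of d] by (auto simp: Nvec_def fun_eq_iff)
    show "restrict d {1..int n} \<in> ?P" using d by (auto simp: Nvec_def le_fun_def)
  next
    fix g assume g: "g \<in> ?P"
    show "restrict (\<lambda>i. g ((i - 1) mod int n + 1)) {1..int n} = g"
    proof
      fix i
      show "restrict (\<lambda>i. g ((i - 1) mod int n + 1)) {1..int n} i = g i"
      proof (cases "i \<in> {1..int n}")
        case True then show ?thesis using nmi by simp
      next
        case False then show ?thesis using PiE_arb[OF g False] by simp
      qed
    qed
    have "?ext g \<in> Zvec n"
    proof -
      have "(i + int n - 1) mod int n = (i - 1) mod int n" for i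
        by (metis add_diff_eq add.commute mod_add_self2 add_diff_cancel_left' diff_add_eq)
      then show ?thesis by (simp add: Zvec_def)
    qed
    moreover have "0 \<le> ?ext g i \<and> ?ext g i \<le> u i" for i
      using PiE_mem[OF g nm[of i]] per[OF u, of i] by simp
    ultimately show "(\<lambda>i. g ((i - 1) mod int n + 1)) \<in> {d. d \<in> Nvec n \<and> d \<le> u}"
      by (simp add: Nvec_def le_fun_def)
  qed (auto intro!: prod.cong)
  also have "\<dots> = (\<Prod>i = 1..int n. \<Sum>x\<in>{0..u i}. F i x)"
    by (rule prod_sum_PiE[symmetric]) auto
  finally show ?thesis .
qed

text \<open>The common form of the coefficients in all three formulas.\<close>

definition overlap_coef :: "nat \<Rightarrow> vec \<Rightarrow> vec \<Rightarrow> vec \<Rightarrow> vec \<Rightarrow> int" where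
  "overlap_coef n \<kappa> \<tau> l d =
     (\<Sum>b | b \<in> Nvec n \<and> b \<le> \<tau> \<and> b \<le> l - d. vbinom n \<kappa> (l - b - d) * vmultinom n (\<tau> + d) [b, d, \<tau> - b])"

lemma Zvec_closed:
  "a \<in> Zvec n \<Longrightarrow> b \<in> Zvec n \<Longrightarrow> a + b \<in> Zvec n" "a \<in> Zvec n \<Longrightarrow> b \<in> Zvec n \<Longrightarrow> a - b \<in> Zvec n" "0 \<in> Zvec n"
  by (auto simp: Zvec_def)

lemma sum_int_range: "0 \<le> L \<Longrightarrow> (\<Sum>x\<in>{0..L}. f x) = (\<Sum>k\<le>nat L. f (int k))"
  by (rule sum.reindex_bij_witness[where i = int and j = nat]) auto

text \<open>The product over one period of \<open>scalar_identity\<close>.\<close>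

lemma vector_identity:
  assumes n: "n > 0" and l: "l \<in> Nvec n" and \<tau>: "\<tau> \<in> Nvec n"
  shows "vbinom n (m + \<kappa>) l * vbinom n m \<tau> = (\<Sum>d | d \<in> Nvec n \<and> d \<le> l. overlap_coef n \<kappa> \<tau> l d * vbinom n m (\<tau> + d))"
proof -
  have lZ: "l \<in> Zvec n" "\<And>i. 0 \<le> l i" and tZ: "\<tau> \<in> Zvec n" "\<And>i. 0 \<le> \<tau> i" using l \<tau> by (auto simp: Nvec_def)
  define G where "G i y x = ibinom (\<kappa> i) (nat (l i - x - y)) *
     int (((nat (\<tau> i) + nat y) choose nat (\<tau> i)) * (nat (\<tau> i) choose nat x)) * ibinom (m i) (nat (\<tau> i + y))" for i y x
  have inner: "overlap_coef n \<kappa> \<tau> l d * vbinom n m (\<tau> + d) = (\<Prod>i = 1..int n. \<Sum>x\<in>{0..min (\<tau> i) (l i - d i)}. G i (d i) x)"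
    if d: "d \<in> Nvec n" "d \<le> l" for d
  proof -
    have dZ: "d \<in> Zvec n" "\<And>i. 0 \<le> d i" using d by (auto simp: Nvec_def)
    let ?u = "\<lambda>i. min (\<tau> i) (l i - d i)"
    have u: "?u \<in> Zvec n" using lZ tZ dZ by (simp add: Zvec_def)
    have "overlap_coef n \<kappa> \<tau> l d * vbinom n m (\<tau> + d) =
        (\<Sum>b | b \<in> Nvec n \<and> b \<le> ?u. vbinom n \<kappa> (l - b - d) * vmultinom n (\<tau> + d) [b, d, \<tau> - b] * vbinom n m (\<tau> + d))"
      unfolding overlap_coef_def sum_distrib_right by (intro sum.cong) (auto simp: le_fun_def)
    also have "\<dots> = (\<Sum>b | b \<in> Nvec n \<and> b \<le> ?u. \<Prod>i = 1..int n. G i (d i) (b i))"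
    proof (intro sum.cong refl)
      fix b assume b: "b \<in> {b. b \<in> Nvec n \<and> b \<le> ?u}"
      have m: "fact (nat ((\<tau> + d) i)) div (\<Prod>m\<leftarrow>[b, d, \<tau> - b]. fact (nat (m i))) =
          int (((nat (\<tau> i) + nat (d i)) choose nat (\<tau> i)) * (nat (\<tau> i) choose nat (b i)))" for i
      proof -
        have b': "0 \<le> b i" "b i \<le> \<tau> i" using b by (auto simp: Nvec_def le_fun_def)
        have "nat ((\<tau> + d) i) = nat (\<tau> i) + nat (d i)" "nat ((\<tau> - b) i) = nat (\<tau> i) - nat (b i)"
          using tZ(2)[of i] dZ(2)[of i] b' by (simp_all add: nat_add_distrib nat_diff_distrib)
        moreover have "nat (b i) \<le> nat (\<tau> i)" using b' by simp
        ultimately show ?thesis using multinomial_factor[of "nat (b i)" "nat (\<tau> i)" "nat (d i)"] by simp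
      qed
      show "vbinom n \<kappa> (l - b - d) * vmultinom n (\<tau> + d) [b, d, \<tau> - b] * vbinom n m (\<tau> + d) =
          (\<Prod>i = 1..int n. G i (d i) (b i))"
        unfolding vbinom_def vmultinom_def m prod.distrib[symmetric] by (simp add: G_def)
    qed
    also have "\<dots> = (\<Prod>i = 1..int n. \<Sum>x\<in>{0..?u i}. G i (d i) x)" by (rule sum_box[OF n u])
    finally show ?thesis .
  qed
  have "(\<Sum>d | d \<in> Nvec n \<and> d \<le> l. overlap_coef n \<kappa> \<tau> l d * vbinom n m (\<tau> + d)) =
      (\<Sum>d | d \<in> Nvec n \<and> d \<le> l. \<Prod>i = 1..int n. \<Sum>x\<in>{0..min (\<tau> i) (l i - d i)}. G i (d i) x)"
    by (intro sum.cong refl) (simp add: inner)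
  also have "\<dots> = (\<Prod>i = 1..int n. \<Sum>y\<in>{0..l i}. \<Sum>x\<in>{0..min (\<tau> i) (l i - y)}. G i y x)"
    by (rule sum_box[OF n lZ(1)])
  also have "\<dots> = (\<Prod>i = 1..int n. ibinom (m i + \<kappa> i) (nat (l i)) * ibinom (m i) (nat (\<tau> i)))"
  proof (intro prod.cong refl)
    fix i
    have "(\<Sum>y\<in>{0..l i}. \<Sum>x\<in>{0..min (\<tau> i) (l i - y)}. G i y x) =
        (\<Sum>d\<le>nat (l i). \<Sum>x\<in>{0..min (\<tau> i) (l i - int d)}. G i (int d) x)"
      by (rule sum_int_range[OF lZ(2)])
    also have "\<dots> = (\<Sum>d\<le>nat (l i). \<Sum>b\<le>min (nat (\<tau> i)) (nat (l i) - d). G i (int d) (int b))"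
    proof (intro sum.cong refl)
      fix d assume "d \<in> {..nat (l i)}"
      then have "0 \<le> min (\<tau> i) (l i - int d)" "nat (min (\<tau> i) (l i - int d)) = min (nat (\<tau> i)) (nat (l i) - d)"
        using tZ(2)[of i] lZ(2)[of i] by (auto simp: min_def nat_diff_distrib)
      then show "(\<Sum>x\<in>{0..min (\<tau> i) (l i - int d)}. G i (int d) x) =
          (\<Sum>b\<le>min (nat (\<tau> i)) (nat (l i) - d). G i (int d) (int b))"
        using sum_int_range by metis
    qed
    also have "\<dots> = ibinom (m i + \<kappa> i) (nat (l i)) * ibinom (m i) (nat (\<tau> i))"
      unfolding scalar_identity
    proof (intro sum.cong refl)
      fix d b
      have "nat (l i - int b - int d) = nat (l i) - b - d" "nat (\<tau> i + int d) = nat (\<tau> i) + d"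
        using tZ(2)[of i] lZ(2)[of i] by (simp_all add: nat_add_distrib)
      then show "G i (int d) (int b) = ibinom (\<kappa> i) (nat (l i) - b - d) *
          int (((nat (\<tau> i) + d) choose nat (\<tau> i)) * (nat (\<tau> i) choose b)) * ibinom (m i) (nat (\<tau> i) + d)"
        by (simp add: G_def)
    qed
    finally show "(\<Sum>y\<in>{0..l i}. \<Sum>x\<in>{0..min (\<tau> i) (l i - y)}. G i y x) =
        ibinom (m i + \<kappa> i) (nat (l i)) * ibinom (m i) (nat (\<tau> i))" .
  qed
  also have "\<dots> = vbinom n (m + \<kappa>) l * vbinom n m \<tau>" by (simp add: vbinom_def prod.distrib)
  finally show ?thesis by simp
qed

section \<open>Multiplication formulas in the affine Schur algebra\<close>

text \<open>The part of \<^const>\<open>cell_choices\<close> that does not change when a diagonal matrix is added to \<open>C\<close>.\<close>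

definition off_diag_choices :: "nat \<Rightarrow> mat \<Rightarrow> mat \<Rightarrow> int" where
  "off_diag_choices n C U = (\<Prod>i = 1..int n. Prod_any (\<lambda>j. if j = i then 1 else ibinom (C i j) (nat (U i j))))"

text \<open>
  The off-diagonal part of the product; it does not depend on the diagonals of the factors.
\<close>

definition moved_off_diag :: "int \<Rightarrow> mat \<Rightarrow> mat \<Rightarrow> mat" where
  "moved_off_diag e A U = A + off_diag U - off_diag (row_shift_by e U)"

lemma cell_choices_split:
  assumes U: "U \<in> Theta n" shows "cell_choices n C U = off_diag_choices n C U * vbinom n (diag_of C) (diag_of U)"
proof -
  have b0: "ibinom m 0 = 1" for m by (simp add: ibinom_def)
  have "Prod_any (\<lambda>j. ibinom (C i j) (nat (U i j))) =
      Prod_any (\<lambda>j. if j = i then 1 else ibinom (C i j) (nat (U i j))) * ibinom (C i i) (nat (U i i))" for i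
  proof -
    define J where "J = {j. U i j \<noteq> 0} - {i}"
    have fin: "finite J" using U by (auto simp: J_def Theta_def Mat_def)
    have iJ: "i \<notin> J" by (simp add: J_def)
    let ?f = "\<lambda>j. ibinom (C i j) (nat (U i j))"
    have "Prod_any ?f = (\<Prod>j\<in>insert i J. ?f j)"
      using fin b0 by (intro Prod_any.expand_superset) (auto simp: J_def)
    then have 1: "Prod_any ?f = ?f i * (\<Prod>j\<in>J. ?f j)" using fin iJ by simp
    have "Prod_any (\<lambda>j. if j = i then 1 else ?f j) = (\<Prod>j\<in>J. if j = i then 1 else ?f j)"
      using fin b0 by (intro Prod_any.expand_superset) (auto simp: J_def)
    also have "\<dots> = (\<Prod>j\<in>J. ?f j)" using iJ by (intro prod.cong) auto
    finally show ?thesis unfolding 1 by (simp add: mult.commute)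
  qed
  then show ?thesis by (simp add: cell_choices_def off_diag_choices_def vbinom_def diag_of_def prod.distrib)
qed

lemma off_diag_choices_cong: "(\<And>i j. i \<noteq> j \<Longrightarrow> C i j = C' i j) \<Longrightarrow> off_diag_choices n C U = off_diag_choices n C' U"
proof -
  assume eq: "\<And>i j. i \<noteq> j \<Longrightarrow> C i j = C' i j"
  have "(\<lambda>j. if j = i then 1 else ibinom (C i j) (nat (U i j))) = (\<lambda>j. if j = i then 1 else ibinom (C' i j) (nat (U i j)))" for i
    using eq[of i] by auto
  then show ?thesis by (simp only: off_diag_choices_def)
qed

lemma moves_add_diag: "moves n e g (A + diag \<mu>) = moves n e g A"
  unfolding moves_def by (intro Collect_cong) (simp add: diag_def)

lemma product_shape:
  "A + diag \<mu> + U - row_shift_by e U = moved_off_diag e A U + diag (\<mu> + diag_of U - diag_of (row_shift_by e U))"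
  by (auto simp: fun_eq_iff moved_off_diag_def off_diag_def diag_def diag_of_def)

lemma moved_off_diag_diag: "A \<in> Theta_pm n \<Longrightarrow> moved_off_diag e A U i i = 0"
  by (simp add: Theta_pm_def moved_off_diag_def off_diag_def)

lemma moved_off_diag_nonneg: assumes "U \<in> moves n e g A" "i \<noteq> j" shows "0 \<le> moved_off_diag e A U i j"
proof -
  have "moved_off_diag e A U i j = (A + U - row_shift_by e U) i j" using assms(2) by (simp add: moved_off_diag_def off_diag_def)
  then show ?thesis using assms by (simp add: moves_def)
qed

lemma diag_of_Zvec: assumes "U \<in> Mat n" shows "diag_of U \<in> Zvec n"
  using assms by (simp add: Zvec_def diag_of_def Mat_def)

lemma diag_of_Nvec: "U \<in> Theta n \<Longrightarrow> diag_of U \<in> Nvec n"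
  using diag_of_Zvec[of U n] by (simp add: Nvec_def Theta_def diag_of_def)

lemma row_shift_by_Theta: "U \<in> Theta n \<Longrightarrow> row_shift_by e U \<in> Theta n"
  using row_shift_by_Mat[of U n e] by (simp add: Theta_def row_shift_by_def)

lemma diag_add: "A + diag a + diag b = A + diag (a + b)"
  by (auto simp: fun_eq_iff diag_def)

lemma msigma_add_diag: "A \<in> Mat n \<Longrightarrow> msigma n (A + diag m) = msigma n A + vsigma n m"
  by (simp only: msigma_eq_ro ro_add_diag vsigma_add)

lemma Theta_r_add_diag:
  assumes "A \<in> Mat n" "\<And>i j. 0 \<le> A i j" "m \<in> Nvec n" "msigma n A + vsigma n m = int r"
  shows "A + diag m \<in> Theta_r n r"
  using assms add_diag_Mat[of A n m] by (simp add: Theta_r_def Theta_def msigma_add_diag Nvec_def) (simp add: diag_def)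

lemma diag_zero: "diag 0 = 0"
  by (simp add: fun_eq_iff diag_def)

lemma diag_inject: "A + diag a = A + diag b \<longleftrightarrow> a = b"
proof
  assume eq: "A + diag a = A + diag b"
  show "a = b"
  proof
    fix i
    from fun_cong[OF fun_cong[OF eq, of i], of i] show "a i = b i" by (simp add: diag_def)
  qed
qed simp

lemma neg_in_period:
  assumes n: "n > 0" and v: "v \<in> Zvec n" and "v i < 0"
  obtains k where "k \<in> {1..int n}" "v k < 0"
proof -
  obtain t where "i + t * int n \<in> {1..int n}" using residue[OF n] .
  moreover have "v (i + t * int n) < 0" using assms by (simp add: Zvec_shift)
  ultimately show thesis using that by blast
qed

lemma ibinom_eq_0: "0 \<le> c \<Longrightarrow> c < u \<Longrightarrow> ibinom c (nat u) = 0"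
  by (simp add: ibinom_nonneg_eq binomial_eq_0)

text \<open>
  This happens when the left factor that matches the right factor would need a negative diagonal
  entry. More is to be moved out of row \<open>i\<close> of \<open>A\<close> than it contains, so comparing row sums shows
  that some cell of the product has fewer elements than \<open>U\<close> asks for.
\<close>

lemma short_row_vanishes:
  assumes n: "n > 0" and A: "A \<in> Mat n" and U: "U \<in> moves n e g A" and i: "ro A i < g (i - e)"
  shows "smul (of_int (cell_choices n (A + U - row_shift_by e U) U)) (br_one (A + U - row_shift_by e U)) = (0 :: mat \<Rightarrow>\<^sub>0 'k::comm_ring_1)"
proof -
  have UT: "U \<in> Theta n" "ro U = g" using U by (auto simp: moves_def)
  have UM: "U \<in> Mat n" using UT by (simp add: Theta_def)
  let ?C = "A + U - row_shift_by e U"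
  have "ro (A - row_shift_by e U) \<in> Zvec n" by (intro ro_Zvec Mat_diff A row_shift_by_Mat UM)
  moreover have "ro (A - row_shift_by e U) i < 0" unfolding ro_diff[OF A row_shift_by_Mat[OF UM]] using i by (simp add: ro_row_shift_by UT(2))
  ultimately obtain i' where i': "i' \<in> {1..int n}" "ro (A - row_shift_by e U) i' < 0" using neg_in_period[OF n] by blast
  obtain k where k: "(A - row_shift_by e U) i' k < 0"
  proof (rule ccontr)
    assume "\<not> thesis"
    then have "0 \<le> (A - row_shift_by e U) i' k" for k using that by (meson not_less)
    then have "0 \<le> ro (A - row_shift_by e U) i'" unfolding ro_def Sum_any.expand_set by (intro sum_nonneg)
    then show False using i' by simp
  qed
  then have Ck: "?C i' k < U i' k" by simp
  show ?thesis
  proof (cases "?C i' k < 0")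
    case True
    have "i' = k"
    proof (rule ccontr)
      assume "i' \<noteq> k"
      then have "0 \<le> ?C i' k" using U unfolding moves_def by blast
      then show False using True by simp
    qed
    then have "br_one ?C = (0 :: mat \<Rightarrow>\<^sub>0 'k)" using True unfolding br_one_def by auto
    then show ?thesis by simp
  next
    case False
    have "finite {k. ibinom (?C i' k) (nat (U i' k)) \<noteq> 1}"
    proof (rule finite_subset)
      show "{k. ibinom (?C i' k) (nat (U i' k)) \<noteq> 1} \<subseteq> {k. U i' k \<noteq> 0}" by (auto simp: ibinom_def)
    qed (use UM in \<open>simp add: Mat_def\<close>)
    moreover have "ibinom (?C i' k) (nat (U i' k)) = 0" using False Ck by (intro ibinom_eq_0) auto
    ultimately have "Prod_any (\<lambda>k. ibinom (?C i' k) (nat (U i' k))) = 0" by (rule Prod_any_zero)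
    then have "cell_choices n ?C U = 0" unfolding cell_choices_def using i'(1) by (intro prod_zero) auto
    then show ?thesis by simp
  qed
qed

lemma Selt_expand:
  assumes "\<And>i j. i \<noteq> j \<Longrightarrow> 0 \<le> A i j"
  shows "Selt n r A l = (\<Sum>m\<in>Lambda n (int r - msigma n A). smul (vbinom n m l) (br_one (A + diag m)))"
proof -
  have "\<not> (\<exists>i j. i \<noteq> j \<and> A i j < 0)" using assms by (auto simp: not_less)
  then show ?thesis by (simp only: Selt_def if_False)
qed

lemma schur_mismatch:
  assumes n: "n > 0" and "B \<in> Theta_r n r" "A \<in> Theta_r n r" "co B \<noteq> ro A"
  shows "schur_one_mult n r (br_one B) (br_one A) = 0"
proof -
  have "schur_one_mult n r (br_one B) (br_one A) = one_const n r B A"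
    using Theta_r_diag_nonneg assms by (simp add: br_one_def schur_one_mult_single)
  also have "\<dots> = 0" by (rule poly_mapping_eqI) (simp add: lookup_one_const schur_const_mismatch[OF assms])
  finally show ?thesis .
qed

text \<open>
  Exactly one diagonal of the left factor matches a given diagonal of the right factor. If it is
  not nonnegative, then the left-hand side has no such term, and on the right all terms vanish
  by \<open>short_row_vanishes\<close>.
\<close>

lemma Selt_product:
  assumes n: "n > 0" and e: "e \<noteq> 0" and A: "A \<in> Theta_pm n" and g: "g \<in> Nvec n" and fin: "finite (moves n e g A)"
  shows "schur_one_mult n r (Selt n r (shifted_diag e g) \<nu>) (Selt n r A l) =
    (\<Sum>\<mu>\<in>Lambda n (int r - msigma n A). \<Sum>U\<in>moves n e g A.
       smul (vbinom n (ro A + \<mu> - co (shifted_diag e g)) \<nu> * vbinom n \<mu> l * cell_choices n (A + diag \<mu> + U - row_shift_by e U) U)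
         (br_one (A + diag \<mu> + U - row_shift_by e U)))"
proof -
  let ?B = "shifted_diag e g"
  have AT: "A \<in> Theta n" "\<And>i j. 0 \<le> A i j" and AM: "A \<in> Mat n" using A by (auto simp: Theta_pm_def Theta_def)
  have BM: "?B \<in> Mat n" using g by (intro shifted_diag_Mat) (simp add: Nvec_def)
  have B0: "0 \<le> ?B i j" for i j using g by (simp add: shifted_diag_def Nvec_def)
  let ?LB = "Lambda n (int r - msigma n ?B)" and ?LA = "Lambda n (int r - msigma n A)"
  have inner: "(\<Sum>\<rho>\<in>?LB. smul (vbinom n \<rho> \<nu>) (schur_one_mult n r (br_one (?B + diag \<rho>)) (br_one (A + diag \<mu>)))) =
      smul (vbinom n (ro A + \<mu> - co ?B) \<nu>) (\<Sum>U\<in>moves n e g A.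
        smul (cell_choices n (A + diag \<mu> + U - row_shift_by e U) U) (br_one (A + diag \<mu> + U - row_shift_by e U)))" (is "?l = smul ?v ?s")
    if \<mu>: "\<mu> \<in> ?LA" for \<mu>
  proof -
    have \<mu>N: "\<mu> \<in> Nvec n" "vsigma n \<mu> = int r - msigma n A" using \<mu> by (auto simp: Lambda_def)
    then have \<mu>Z: "\<mu> \<in> Zvec n" by (simp add: Nvec_def)
    define \<rho>0 where "\<rho>0 = ro A + \<mu> - co ?B"
    have A': "A + diag \<mu> \<in> Theta_r n r" using AM AT(2) \<mu>N by (intro Theta_r_add_diag) auto
    have B': "?B + diag \<rho> \<in> Theta_r n r" if "\<rho> \<in> ?LB" for \<rho>
      using that BM B0 by (intro Theta_r_add_diag) (auto simp: Lambda_def)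
    have match: "co (?B + diag \<rho>) = ro (A + diag \<mu>) \<longleftrightarrow> \<rho> = \<rho>0" for \<rho>
      unfolding co_add_diag[OF BM] ro_add_diag[OF AM] \<rho>0_def by (auto simp: fun_eq_iff algebra_simps)
    have off: "smul (vbinom n \<rho> \<nu>) (schur_one_mult n r (br_one (?B + diag \<rho>)) (br_one (A + diag \<mu>))) = (0 :: mat \<Rightarrow>\<^sub>0 int)"
      if "\<rho> \<in> ?LB" "\<rho> \<noteq> \<rho>0" for \<rho>
    proof -
      have "co (?B + diag \<rho>) \<noteq> ro (A + diag \<mu>)" using match that by simp
      then have "schur_one_mult n r (br_one (?B + diag \<rho>)) (br_one (A + diag \<mu>)) = (0 :: mat \<Rightarrow>\<^sub>0 int)"
        by (rule schur_mismatch[OF n B'[OF that(1)] A'])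
      then show ?thesis by simp
    qed
    show ?thesis
    (* \<rho>0 is the only diagonal of the left factor that matches. *)
    proof (cases "\<rho>0 \<in> ?LB")
      case True
      have "?l = (\<Sum>\<rho>\<in>{\<rho>0}. smul (vbinom n \<rho> \<nu>) (schur_one_mult n r (br_one (?B + diag \<rho>)) (br_one (A + diag \<mu>))))"
        using True off by (intro sum.mono_neutral_right finite_Lambda[OF n]) auto
      also have "\<dots> = smul ?v (schur_one_mult n r (br_one (?B + diag \<rho>0)) (br_one (A + diag \<mu>)))" by (simp add: \<rho>0_def)
      also have "schur_one_mult n r (br_one (?B + diag \<rho>0)) (br_one (A + diag \<mu>)) = ?s"
        using schur_product[OF n e B'[OF True] refl A', where 'k = int] match fin by (simp add: moves_add_diag)
      finally show ?thesis .
    next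
      case False
      have "?l = 0" using off False by (intro sum.neutral) blast
      moreover have "?s = 0"
      proof (intro sum.neutral ballI)
        fix U assume U: "U \<in> moves n e g A"
        have Z: "\<rho>0 \<in> Zvec n" unfolding \<rho>0_def by (intro Zvec_closed ro_Zvec co_Zvec AM BM \<mu>Z)
        have "vsigma n \<rho>0 = int r - msigma n ?B"
          unfolding \<rho>0_def vsigma_diff vsigma_add vsigma_co[OF n BM] using \<mu>N by (simp add: msigma_eq_ro)
        then obtain i where "\<rho>0 i < 0" using False Z by (auto simp: Lambda_def Nvec_def not_le)
        then have "ro (A + diag \<mu>) i < g (i - e)" unfolding ro_add_diag[OF AM] by (simp add: \<rho>0_def co_shifted_diag)
        then show "smul (cell_choices n (A + diag \<mu> + U - row_shift_by e U) U) (br_one (A + diag \<mu> + U - row_shift_by e U)) = (0 :: mat \<Rightarrow>\<^sub>0 int)"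
          using short_row_vanishes[OF n add_diag_Mat[OF AM \<mu>Z], of U e g i, where 'k = int] U by (simp add: moves_add_diag)
      qed
      ultimately show ?thesis by simp
    qed
  qed
  have "schur_one_mult n r (Selt n r ?B \<nu>) (Selt n r A l) =
      (\<Sum>\<rho>\<in>?LB. \<Sum>\<mu>\<in>?LA. smul (vbinom n \<mu> l)
        (smul (vbinom n \<rho> \<nu>) (schur_one_mult n r (br_one (?B + diag \<rho>)) (br_one (A + diag \<mu>)))))"
    unfolding Selt_expand[OF B0] Selt_expand[OF AT(2)] schur_one_mult_sum(1)
    unfolding schur_one_mult_sum(2) by (intro sum.cong refl) (simp add: schur_one_mult_smul mult.commute)
  also have "\<dots> = (\<Sum>\<mu>\<in>?LA. smul (vbinom n \<mu> l) (\<Sum>\<rho>\<in>?LB.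
        smul (vbinom n \<rho> \<nu>) (schur_one_mult n r (br_one (?B + diag \<rho>)) (br_one (A + diag \<mu>)))))"
    unfolding smul_sum by (rule sum.swap)
  also have "\<dots> = (\<Sum>\<mu>\<in>?LA. \<Sum>U\<in>moves n e g A.
       smul (vbinom n (ro A + \<mu> - co ?B) \<nu> * vbinom n \<mu> l * cell_choices n (A + diag \<mu> + U - row_shift_by e U) U)
         (br_one (A + diag \<mu> + U - row_shift_by e U)))"
    by (intro sum.cong refl) (simp add: inner smul_sum mult.assoc mult.left_commute)
  finally show ?thesis .
qed

lemma vbinom_zero_right [simp]: "vbinom n m 0 = 1"
  by (simp add: vbinom_def ibinom_def)

lemma vbinom_eq_0:
  assumes "i \<in> {1..int n}" "0 \<le> m i" "m i < t i" shows "vbinom n m t = 0"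
  unfolding vbinom_def using assms ibinom_eq_0[of "m i" "t i"] by (intro prod_zero) auto

lemma smul_sum_left: "smul (sum c I) x = (\<Sum>i\<in>I. smul (c i) x)"
  by (induction I rule: infinite_finite_induct) (simp_all add: smul_add_left)

text \<open>
  For fixed \<open>U\<close>, with diagonal \<open>\<tau>\<close> and shifted diagonal \<open>\<sigma>\<close>, sum over the diagonal \<open>m = \<mu>
  + \<tau> - \<sigma>\<close> of the product instead of \<open>\<mu>\<close>, and apply \<open>vector_identity\<close>. The ranges of
  \<open>\<mu>\<close> and \<open>m\<close> do not correspond exactly, but the terms in question vanish: if \<open>m\<close> has a negative
  entry, there is no basis element; if \<open>\<mu>\<close> has one, some \<open>m i\<close> is less than \<open>\<tau> i\<close>.
\<close>

theorem Selt_formula: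
  assumes n: "n > 0" and e: "e \<noteq> 0" and A: "A \<in> Theta_pm n" and g: "g \<in> Nvec n" and l: "l \<in> Nvec n"
    and fin: "finite (moves n e g A)"
  shows "schur_one_mult n r (Selt n r (shifted_diag e g) 0) (Selt n r A l) =
    (\<Sum>U\<in>moves n e g A. \<Sum>d | d \<in> Nvec n \<and> d \<le> l.
       smul (overlap_coef n (diag_of (row_shift_by e U) - diag_of U) (diag_of U) l d * off_diag_choices n (moved_off_diag e A U) U)
         (Selt n r (moved_off_diag e A U) (diag_of U + d)))"
proof -
  have AM: "A \<in> Mat n" using A by (auto simp: Theta_pm_def Theta_def)
  let ?LA = "Lambda n (int r - msigma n A)"
  have main: "(\<Sum>\<mu>\<in>?LA. smul (vbinom n \<mu> l * cell_choices n (A + diag \<mu> + U - row_shift_by e U) U) (br_one (A + diag \<mu> + U - row_shift_by e U))) =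
      (\<Sum>d | d \<in> Nvec n \<and> d \<le> l.
       smul (overlap_coef n (diag_of (row_shift_by e U) - diag_of U) (diag_of U) l d * off_diag_choices n (moved_off_diag e A U) U)
         (Selt n r (moved_off_diag e A U) (diag_of U + d)))" if U: "U \<in> moves n e g A" for U
  proof -
    define Y \<tau> \<sigma> where "Y = moved_off_diag e A U" and "\<tau> = diag_of U" and "\<sigma> = diag_of (row_shift_by e U)"
    have UT: "U \<in> Theta n" and UM: "U \<in> Mat n" using U by (auto simp: moves_def Theta_def)
    have tN: "\<tau> \<in> Nvec n" and sN: "\<sigma> \<in> Nvec n" unfolding \<tau>_def \<sigma>_def by (intro diag_of_Nvec UT row_shift_by_Theta)+
    then have tZ: "\<tau> \<in> Zvec n" "\<And>i. 0 \<le> \<tau> i" and sZ: "\<sigma> \<in> Zvec n" "\<And>i. 0 \<le> \<sigma> i" by (auto simp: Nvec_def)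
    have Yd: "Y i i = 0" for i by (simp add: Y_def moved_off_diag_diag[OF A])
    have shape: "A + diag \<mu> + U - row_shift_by e U = Y + diag (\<mu> + \<tau> - \<sigma>)" for \<mu>
      unfolding Y_def \<tau>_def \<sigma>_def by (rule product_shape)
    have fb: "cell_choices n (Y + diag m) U = off_diag_choices n Y U * vbinom n m \<tau>" for m
    proof -
      have "diag_of (Y + diag m) = m" using Yd by (simp add: fun_eq_iff diag_of_def diag_def)
      moreover have "off_diag_choices n (Y + diag m) U = off_diag_choices n Y U" by (rule off_diag_choices_cong) (simp add: diag_def)
      ultimately show ?thesis by (simp add: cell_choices_split[OF UT] \<tau>_def)
    qed
    have Ym: "Y + diag (\<tau> - \<sigma>) = A + U - row_shift_by e U" using shape[of 0] by (simp add: diag_zero)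
    have YM: "Y \<in> Mat n"
    proof -
      have "Y = A + U - row_shift_by e U + diag (\<sigma> - \<tau>)" unfolding Ym[symmetric] diag_add by (simp add: fun_eq_iff diag_def)
      then show ?thesis using AM UM tZ sZ by (simp add: add_diag_Mat Mat_diff Mat_add row_shift_by_Mat Zvec_closed)
    qed
    have ms: "msigma n Y = msigma n A - vsigma n (\<tau> - \<sigma>)"
      using msigma_add_diff[OF n AM UM, of e] msigma_add_diag[OF YM, of "\<tau> - \<sigma>"] unfolding Ym by simp
    let ?LY = "Lambda n (int r - msigma n Y)"
    let ?F = "\<lambda>m. smul (off_diag_choices n Y U * (vbinom n (m + (\<sigma> - \<tau>)) l * vbinom n m \<tau>)) (br_one (Y + diag m)) :: mat \<Rightarrow>\<^sub>0 int"
    have vs: "vsigma n (\<mu> + \<tau> - \<sigma>) = int r - msigma n Y \<longleftrightarrow> vsigma n \<mu> = int r - msigma n A" for \<mu>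
      unfolding ms vsigma_diff vsigma_add by auto
    have "(\<Sum>\<mu>\<in>?LA. smul (vbinom n \<mu> l * cell_choices n (A + diag \<mu> + U - row_shift_by e U) U) (br_one (A + diag \<mu> + U - row_shift_by e U)))
        = (\<Sum>\<mu>\<in>?LA. ?F (\<mu> + \<tau> - \<sigma>))"
    proof (intro sum.cong refl)
      fix \<mu>
      have "\<mu> + \<tau> - \<sigma> + (\<sigma> - \<tau>) = \<mu>" by (simp add: fun_eq_iff)
      then show "smul (vbinom n \<mu> l * cell_choices n (A + diag \<mu> + U - row_shift_by e U) U) (br_one (A + diag \<mu> + U - row_shift_by e U)) = ?F (\<mu> + \<tau> - \<sigma>)"
        unfolding shape fb by (simp add: mult.left_commute)
    qed
    (* Without the \<mu> whose products have a negative diagonal entry. *)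
    also have "\<dots> = (\<Sum>\<mu>\<in>{\<mu> \<in> ?LA. \<mu> + \<tau> - \<sigma> \<in> Nvec n}. ?F (\<mu> + \<tau> - \<sigma>))"
    proof (intro sum.mono_neutral_right finite_Lambda[OF n] ballI)
      fix \<mu> assume \<mu>: "\<mu> \<in> ?LA - {\<mu> \<in> ?LA. \<mu> + \<tau> - \<sigma> \<in> Nvec n}"
      then have "\<mu> + \<tau> - \<sigma> \<in> Zvec n" using tZ sZ by (intro Zvec_closed) (auto simp: Lambda_def Nvec_def)
      then obtain i where "(\<mu> + \<tau> - \<sigma>) i < 0" using \<mu> by (auto simp: Nvec_def not_le)
      then have "(Y + diag (\<mu> + \<tau> - \<sigma>)) i i < 0" using Yd by (simp add: diag_def)
      then have "br_one (Y + diag (\<mu> + \<tau> - \<sigma>)) = (0 :: mat \<Rightarrow>\<^sub>0 int)" unfolding br_one_def by auto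
      then show "?F (\<mu> + \<tau> - \<sigma>) = 0" by simp
    qed auto
    also have "\<dots> = (\<Sum>m\<in>{m \<in> ?LY. m + \<sigma> - \<tau> \<in> Nvec n}. ?F m)"
    proof (rule sum.reindex_bij_witness[where i = "\<lambda>m. m + \<sigma> - \<tau>" and j = "\<lambda>\<mu>. \<mu> + \<tau> - \<sigma>"])
      fix \<mu> assume "\<mu> \<in> {\<mu> \<in> ?LA. \<mu> + \<tau> - \<sigma> \<in> Nvec n}"
      moreover have "\<mu> + \<tau> - \<sigma> + \<sigma> - \<tau> = \<mu>" by (simp add: fun_eq_iff)
      ultimately show "\<mu> + \<tau> - \<sigma> + \<sigma> - \<tau> = \<mu>" "\<mu> + \<tau> - \<sigma> \<in> {m \<in> ?LY. m + \<sigma> - \<tau> \<in> Nvec n}"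
        using vs[of \<mu>] by (simp_all add: Lambda_def)
    next
      fix m assume m: "m \<in> {m \<in> ?LY. m + \<sigma> - \<tau> \<in> Nvec n}"
      moreover have e: "m + \<sigma> - \<tau> + \<tau> - \<sigma> = m" by (simp add: fun_eq_iff)
      ultimately show "m + \<sigma> - \<tau> + \<tau> - \<sigma> = m" "m + \<sigma> - \<tau> \<in> {\<mu> \<in> ?LA. \<mu> + \<tau> - \<sigma> \<in> Nvec n}"
        using vs[of "m + \<sigma> - \<tau>"] by (simp_all add: Lambda_def)
    qed simp
    (* Adding the m that come from a \<mu> with a negative entry: then m i < \<tau> i for some i, as
       \<sigma> is nonnegative, and the binomial coefficient of m over \<tau> is zero. *)
    also have "\<dots> = (\<Sum>m\<in>?LY. ?F m)"
    proof (intro sum.mono_neutral_left finite_Lambda[OF n] ballI)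
      fix m assume m: "m \<in> ?LY - {m \<in> ?LY. m + \<sigma> - \<tau> \<in> Nvec n}"
      then have mN: "\<And>i. 0 \<le> m i" "m \<in> Zvec n" by (auto simp: Lambda_def Nvec_def)
      have Z: "m + \<sigma> - \<tau> \<in> Zvec n" using mN tZ sZ by (intro Zvec_closed)
      then obtain i where "(m + \<sigma> - \<tau>) i < 0" using m by (auto simp: Nvec_def not_le)
      then obtain k where k: "k \<in> {1..int n}" "(m + \<sigma> - \<tau>) k < 0" using neg_in_period[OF n Z] by blast
      then have "vbinom n m \<tau> = 0" using mN(1)[of k] sZ(2)[of k] by (intro vbinom_eq_0[of k]) auto
      then show "?F m = 0" by simp
    qed auto
    also have "\<dots> = (\<Sum>m\<in>?LY. \<Sum>d | d \<in> Nvec n \<and> d \<le> l.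
        smul (overlap_coef n (\<sigma> - \<tau>) \<tau> l d * off_diag_choices n Y U) (smul (vbinom n m (\<tau> + d)) (br_one (Y + diag m))))"
    proof (intro sum.cong refl)
      fix m
      show "?F m = (\<Sum>d | d \<in> Nvec n \<and> d \<le> l.
        smul (overlap_coef n (\<sigma> - \<tau>) \<tau> l d * off_diag_choices n Y U) (smul (vbinom n m (\<tau> + d)) (br_one (Y + diag m))))"
        unfolding vector_identity[OF n l tN] sum_distrib_left smul_sum_left
        by (intro sum.cong refl) (simp add: mult.assoc mult.left_commute mult.commute)
    qed
    also have "\<dots> = (\<Sum>d | d \<in> Nvec n \<and> d \<le> l. smul (overlap_coef n (\<sigma> - \<tau>) \<tau> l d * off_diag_choices n Y U) (Selt n r Y (\<tau> + d)))"
    proof -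
      have "Selt n r Y \<nu> = (\<Sum>m\<in>?LY. smul (vbinom n m \<nu>) (br_one (Y + diag m)))" for \<nu>
        by (rule Selt_expand) (simp add: Y_def moved_off_diag_nonneg[OF U])
      then show ?thesis by (simp only: smul_sum) (rule sum.swap)
    qed
    finally show ?thesis by (simp only: Y_def \<tau>_def \<sigma>_def)
  qed
  have "schur_one_mult n r (Selt n r (shifted_diag e g) 0) (Selt n r A l) =
      (\<Sum>U\<in>moves n e g A. \<Sum>\<mu>\<in>?LA. smul (vbinom n \<mu> l * cell_choices n (A + diag \<mu> + U - row_shift_by e U) U) (br_one (A + diag \<mu> + U - row_shift_by e U)))"
    unfolding Selt_product[OF n e A g fin] vbinom_zero_right mult_1_left by (rule sum.swap)
  then show ?thesis by (simp add: main)
qed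

lemma moves_zero:
  assumes "A \<in> Theta_pm n" shows "moves n e 0 A = {0}"
proof (intro equalityI subsetI)
  fix U assume "U \<in> moves n e 0 A"
  then show "U \<in> {0}" using Theta_ro_zero[of U n] by (simp add: moves_def)
next
  fix U :: mat assume "U \<in> {0}"
  then have U: "U = 0" by simp
  have "ro (0 :: mat) = 0" by (simp add: ro_def fun_eq_iff)
  moreover have "row_shift_by e (0 :: mat) = 0" by (simp add: row_shift_by_def fun_eq_iff)
  ultimately show "U \<in> moves n e 0 A" using assms zero_Theta[of n]
    unfolding U moves_def by (simp add: Theta_pm_def Theta_def)
qed

lemma shifted_diag_zero: "shifted_diag e 0 = 0"
  by (simp add: shifted_diag_def fun_eq_iff)

lemma zero_identity:
  assumes n: "n > 0" and l: "l \<in> Nvec n" and \<mu>: "\<mu> \<in> Nvec n"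
  shows "vbinom n (ro A + m) \<mu> * vbinom n m l = (\<Sum>d | d \<in> Nvec n \<and> d \<le> \<mu>. coef_zero n A l \<mu> d * vbinom n m (l + d))"
proof -
  have "coef_zero n A l \<mu> d = overlap_coef n (ro A) l \<mu> d" for d
    unfolding coef_zero_def overlap_coef_def by (intro sum.cong) (auto simp: add.commute)
  then show ?thesis using vector_identity[OF n \<mu> l, of m "ro A"] by (simp add: add.commute)
qed

theorem Selt_zero_formula:
  assumes n: "n > 0" and A: "A \<in> Theta_pm n" and l: "l \<in> Nvec n" and \<mu>: "\<mu> \<in> Nvec n"
  shows "schur_one_mult n r (Selt n r 0 \<mu>) (Selt n r A l) =
    (\<Sum>d | d \<in> Nvec n \<and> d \<le> \<mu>. smul (coef_zero n A l \<mu> d) (Selt n r A (l + d)))"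
proof -
  let ?LA = "Lambda n (int r - msigma n A)"
  have A0: "0 \<le> A i j" for i j using A by (simp add: Theta_pm_def Theta_def)
  have z: "(0 :: vec) \<in> Nvec n" by (simp add: Nvec_def Zvec_def)
  have e: "(1::int) \<noteq> 0" by simp
  have "co (0 :: mat) = 0" by (simp add: co_def fun_eq_iff)
  moreover have "row_shift_by 1 (0 :: mat) = 0" by (simp add: row_shift_by_def fun_eq_iff)
  ultimately have "schur_one_mult n r (Selt n r 0 \<mu>) (Selt n r A l) =
      (\<Sum>m\<in>?LA. smul (vbinom n (ro A + m) \<mu> * vbinom n m l) (br_one (A + diag m)))"
    using Selt_product[OF n e A z, of r \<mu> l] by (simp add: moves_zero[OF A] shifted_diag_zero)
  also have "\<dots> = (\<Sum>m\<in>?LA. \<Sum>d | d \<in> Nvec n \<and> d \<le> \<mu>. smul (coef_zero n A l \<mu> d) (smul (vbinom n m (l + d)) (br_one (A + diag m))))"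
    by (simp add: zero_identity[OF n l \<mu>] smul_sum_left)
  also have "\<dots> = (\<Sum>d | d \<in> Nvec n \<and> d \<le> \<mu>. smul (coef_zero n A l \<mu> d) (Selt n r A (l + d)))"
    by (simp only: Selt_expand[OF A0] smul_sum) (rule sum.swap)
  finally show ?thesis .
qed

section \<open>Structure constants as polynomials\<close>

lemma Z1_zero: "0 \<in> Z1"
  using Z1.diff[OF Z1.one Z1.one] by simp

lemma Z1_add: "p \<in> Z1 \<Longrightarrow> q \<in> Z1 \<Longrightarrow> p + q \<in> Z1"
  using Z1.diff[of p "0 - q"] Z1.diff[OF Z1_zero, of q] by simp

lemma Z1_sum: "(\<And>i. i \<in> I \<Longrightarrow> f i \<in> Z1) \<Longrightarrow> sum f I \<in> Z1"
  by (induction I rule: infinite_finite_induct) (auto intro: Z1_zero Z1_add)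

lemma Z1_prod: "(\<And>i. i \<in> I \<Longrightarrow> f i \<in> Z1) \<Longrightarrow> prod f I \<in> Z1"
  by (induction I rule: infinite_finite_induct) (auto intro: Z1.one Z1.mult)

lemma Z1_of_int: "of_int c \<in> Z1"
proof (induction c rule: int_induct[where k = 0])
  case base then show ?case using Z1_zero by simp
next
  case (step1 c) then show ?case using Z1_add[OF _ Z1.one] by simp
next
  case (step2 c) then show ?case using Z1.diff[OF _ Z1.one] by simp
qed

lemma poly_binom_poly: "poly (binom_poly c t) (of_int x) = of_int (ibinom (c + x) t)"
  by (simp add: binom_poly_def of_int_ibinom poly_prod gbinomial_prod_rev atLeast0LessThan algebra_simps)

text \<open>The coefficient \<^const>\<open>cell_choices\<close> after adding \<open>x\<close> to the diagonal, as a polynomial in \<open>x\<close>.\<close>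

definition cell_choices_poly :: "nat \<Rightarrow> mat \<Rightarrow> mat \<Rightarrow> rat poly" where
  "cell_choices_poly n C U = of_int (off_diag_choices n C U) * (\<Prod>i = 1..int n. binom_poly (C i i) (nat (U i i)))"

lemma cell_choices_poly_Z1: "cell_choices_poly n C U \<in> Z1"
  unfolding cell_choices_poly_def by (intro Z1.mult Z1_of_int Z1_prod Z1.binom)

lemma poly_cell_choices_poly:
  assumes U: "U \<in> Theta n"
  shows "poly (cell_choices_poly n C U) (of_int x) = of_int (cell_choices n (add_id x C) U)"
proof -
  have "off_diag_choices n (add_id x C) U = off_diag_choices n C U" by (rule off_diag_choices_cong) (simp add: add_id_def diag_def)
  moreover have "vbinom n (diag_of (add_id x C)) (diag_of U) = (\<Prod>i = 1..int n. ibinom (C i i + x) (nat (U i i)))"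
    by (simp add: vbinom_def diag_of_def add_id_def diag_def)
  moreover have "poly (of_int c) y = of_int c" for c and y :: rat by (simp add: of_int_poly)
  ultimately show ?thesis
    by (simp add: cell_choices_poly_def cell_choices_split[OF U] poly_prod poly_binom_poly of_int_prod)
qed

lemma diag_bound:
  assumes n: "n > 0" and D: "D \<in> Zvec n" shows "\<exists>N::nat. \<forall>i. - int N \<le> D i"
proof (intro exI allI)
  fix i
  obtain k where k: "i + k * int n \<in> {1..int n}" using residue[OF n] .
  have "\<bar>D (i + k * int n)\<bar> \<le> (\<Sum>j = 1..int n. \<bar>D j\<bar>)" using k by (intro member_le_sum) auto
  then have "\<bar>D i\<bar> \<le> (\<Sum>j = 1..int n. \<bar>D j\<bar>)" by (simp add: Zvec_shift[OF D])
  then show "- int (nat (\<Sum>j = 1..int n. \<bar>D j\<bar>)) \<le> D i" by (simp add: sum_nonneg)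
qed

lemma add_id_nonneg_eventually:
  assumes n: "n > 0" and X: "X \<in> Mat n" shows "\<forall>\<^sub>F a::nat in sequentially. \<forall>i. 0 \<le> add_id (int a) X i i"
proof -
  obtain N :: nat where N: "\<And>i. - int N \<le> diag_of X i" using diag_bound[OF n diag_of_Zvec[OF X]] by blast
  have "\<forall>i. 0 \<le> add_id (int a) X i i" if "N \<le> a" for a
  proof
    fix i
    show "0 \<le> add_id (int a) X i i" using N[of i] that by (simp add: add_id_def diag_def diag_of_def)
  qed
  then show ?thesis unfolding eventually_sequentially by blast
qed

lemma add_id_Theta_r:
  assumes n: "n > 0" and X: "X \<in> Theta_tilde n" and a: "\<And>i. 0 \<le> add_id a X i i"
  shows "add_id a X \<in> Theta_r n (nat (a * int n + msigma n X))"
proof -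
  have XM: "X \<in> Mat n" using X by (simp add: Theta_tilde_def)
  have cZ: "(\<lambda>_. a) \<in> Zvec n" by (simp add: Zvec_def)
  have "0 \<le> add_id a X i j" for i j
    using a[of i] X by (cases "i = j") (auto simp: add_id_def diag_def Theta_tilde_def)
  then have T: "add_id a X \<in> Theta n" using add_diag_Mat[OF XM cZ] by (simp add: Theta_def add_id_def)
  have "msigma n (add_id a X) = a * int n + msigma n X"
    unfolding add_id_def msigma_add_diag[OF XM] by (simp add: vsigma_def)
  moreover have "0 \<le> msigma n (add_id a X)"
    using T by (auto simp: msigma_def Theta_def Sum_any.expand_set intro!: sum_nonneg)
  ultimately show ?thesis using T by (simp add: Theta_r_def)
qed

lemma add_id_inject: "add_id a X = add_id a Y \<longleftrightarrow> X = Y"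
proof
  assume eq: "add_id a X = add_id a Y"
  show "X = Y"
  proof (intro ext)
    fix i j
    from fun_cong[OF fun_cong[OF eq, of i], of j] show "X i j = Y i j" by (simp add: add_id_def)
  qed
qed simp

text \<open>The right-hand side of the equation that determines the product over \<^const>\<open>Z1\<close>.\<close>

definition combine :: "(mat \<Rightarrow>\<^sub>0 rat poly) \<Rightarrow> nat \<Rightarrow> (mat \<Rightarrow>\<^sub>0 rat)" where
  "combine P a = (\<Sum>X\<in>Poly_Mapping.keys P. smul (poly (Poly_Mapping.lookup P X) (of_nat a)) (br_one (add_id (int a) X)))"

lemma combine_superset:
  assumes "finite K" "Poly_Mapping.keys P \<subseteq> K"
  shows "combine P a = (\<Sum>X\<in>K. smul (poly (Poly_Mapping.lookup P X) (of_nat a)) (br_one (add_id (int a) X)))"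
  unfolding combine_def by (intro sum.mono_neutral_left assms) (auto simp: in_keys_iff)

text \<open>
  At large integers the matrices involved have nonnegative diagonal, so they are distinct basis
  elements and the values of the polynomials can be compared; infinitely many values determine a
  polynomial.
\<close>

lemma combine_injective:
  assumes n: "n > 0" and P: "Poly_Mapping.keys P \<subseteq> Mat n" "Poly_Mapping.keys P' \<subseteq> Mat n"
    and eq: "\<forall>\<^sub>F a::nat in sequentially. combine P a = combine P' a"
  shows "P = P'"
proof (rule poly_mapping_eqI)
  fix X
  let ?K = "Poly_Mapping.keys P \<union> Poly_Mapping.keys P'"
  show "Poly_Mapping.lookup P X = Poly_Mapping.lookup P' X"
  proof (cases "X \<in> ?K")
    case False then show ?thesis by (simp add: in_keys_iff)
  next
    case True
    have coeff: "Poly_Mapping.lookup (combine Q a) (add_id (int a) X) = poly (Poly_Mapping.lookup Q X) (of_nat a)"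
      if pos: "\<forall>i. 0 \<le> add_id (int a) X i i" and Q: "Poly_Mapping.keys Q \<subseteq> ?K" for Q a
    proof -
      have b: "Poly_Mapping.lookup (br_one (add_id (int a) Y)) (add_id (int a) X) = (if Y = X then 1 else (0::rat))" for Y
      proof (cases "Y = X")
        case True
        have "\<not> (\<exists>i. add_id (int a) X i i < 0)" using pos by (auto simp: not_less)
        then show ?thesis unfolding True br_one_def by simp
      next
        case False
        then show ?thesis unfolding br_one_def by (simp add: lookup_single when_def add_id_inject)
      qed
      have "Poly_Mapping.lookup (combine Q a) (add_id (int a) X) =
          (\<Sum>Y\<in>?K. poly (Poly_Mapping.lookup Q Y) (of_nat a) * (if Y = X then 1 else 0))"
        unfolding combine_superset[OF _ Q, simplified] by (simp add: lookup_sum b)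
      also have "\<dots> = (\<Sum>Y\<in>?K. if Y = X then poly (Poly_Mapping.lookup Q Y) (of_nat a) else 0)"
        by (intro sum.cong) auto
      also have "\<dots> = poly (Poly_Mapping.lookup Q X) (of_nat a)" using True by simp
      finally show ?thesis .
    qed
    have XM: "X \<in> Mat n" using True P by blast
    have "\<forall>\<^sub>F a::nat in sequentially. poly (Poly_Mapping.lookup P X - Poly_Mapping.lookup P' X) (of_nat a) = 0"
      using eventually_conj[OF eq add_id_nonneg_eventually[OF n XM]]
    proof (rule eventually_mono)
      fix a assume "combine P a = combine P' a \<and> (\<forall>i. 0 \<le> add_id (int a) X i i)"
      then show "poly (Poly_Mapping.lookup P X - Poly_Mapping.lookup P' X) (of_nat a) = 0"
        using coeff[of a P] coeff[of a P'] by simp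
    qed
    then obtain N where N: "\<And>a::nat. N \<le> a \<Longrightarrow> poly (Poly_Mapping.lookup P X - Poly_Mapping.lookup P' X) (of_nat a) = 0"
      unfolding eventually_sequentially by blast
    have "infinite ((of_nat :: nat \<Rightarrow> rat) ` {N..})"
      using finite_imageD[of "of_nat :: nat \<Rightarrow> rat" "{N..}"] infinite_Ici[of N] by (auto simp: inj_on_def)
    moreover have "(of_nat :: nat \<Rightarrow> rat) ` {N..} \<subseteq> {x. poly (Poly_Mapping.lookup P X - Poly_Mapping.lookup P' X) x = 0}"
      using N by auto
    ultimately have "Poly_Mapping.lookup P X - Poly_Mapping.lookup P' X = 0"
      using poly_roots_finite finite_subset by blast
    then show ?thesis by simp
  qed
qed

text \<open>
  After a large multiple of the identity is added, \<open>schur_product\<close> applies, and its coefficients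
  are values of the polynomials \<^const>\<open>cell_choices_poly\<close>. As these polynomials are unique, they define
  the product; at \<open>0\<close> they take the values without the multiple of the identity.
\<close>

theorem K_const_formula:
  assumes n: "n > 0" and e: "e \<noteq> 0" and A: "A \<in> Theta_tilde n" and g: "g \<in> Nvec n" and \<beta>: "\<beta> \<in> Zvec n"
    and BA: "co (shifted_diag e g + diag \<beta>) = ro A" and fin: "finite (moves n e g A)"
  shows "K_const n (shifted_diag e g + diag \<beta>) A X = (\<Sum>U\<in>{U \<in> moves n e g A. A + U - row_shift_by e U = X}. of_int (cell_choices n X U))"
proof -
  let ?V = "moves n e g A" and ?B = "shifted_diag e g + diag \<beta>" and ?X = "\<lambda>U. A + U - row_shift_by e U"
  have AM: "A \<in> Mat n" using A by (simp add: Theta_tilde_def)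
  have BM: "?B \<in> Mat n" using g \<beta> by (intro add_diag_Mat shifted_diag_Mat) (simp_all add: Nvec_def)
  have BT: "?B \<in> Theta_tilde n" using BM g by (simp add: Theta_tilde_def shifted_diag_def diag_def Nvec_def)
  have UT: "U \<in> Theta n" and UM: "U \<in> Mat n" if "U \<in> ?V" for U using that by (auto simp: moves_def Theta_def)
  define P where "P = (\<Sum>U\<in>?V. Poly_Mapping.single (?X U) (cell_choices_poly n (?X U) U))"
  have lP: "Poly_Mapping.lookup P X = (\<Sum>U\<in>{U \<in> ?V. ?X U = X}. cell_choices_poly n X U)" for X
  proof -
    have "Poly_Mapping.lookup P X = (\<Sum>U\<in>?V. if ?X U = X then cell_choices_poly n X U else 0)"
      by (auto simp: P_def lookup_sum lookup_single when_def intro!: sum.cong)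
    also have "\<dots> = (\<Sum>U\<in>{U \<in> ?V. ?X U = X}. cell_choices_poly n X U)" using fin by (simp add: sum.inter_filter)
    finally show ?thesis .
  qed
  have kP: "Poly_Mapping.keys P \<subseteq> ?X ` ?V"
  proof
    fix X assume "X \<in> Poly_Mapping.keys P"
    then have "{U \<in> ?V. ?X U = X} \<noteq> {}" unfolding in_keys_iff lP by (metis sum.empty)
    then show "X \<in> ?X ` ?V" by blast
  qed
  have XT: "?X U \<in> Theta_tilde n" "msigma n (?X U) = msigma n A" if "U \<in> ?V" for U
  proof -
    have "?X U \<in> Mat n" using UM[OF that] AM by (intro Mat_diff Mat_add row_shift_by_Mat)
    then show "?X U \<in> Theta_tilde n" using that unfolding Theta_tilde_def moves_def by blast
    show "msigma n (?X U) = msigma n A" by (rule msigma_add_diff[OF n AM UM[OF that]])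
  qed
  have msB: "msigma n ?B = msigma n A"
    using vsigma_co[OF n BM] BA by (simp add: msigma_eq_ro)
  let ?lhs = "\<lambda>a::nat. schur_one_mult n (nat (int a * int n + msigma n A))
                (br_one (add_id (int a) ?B)) (br_one (add_id (int a) A)) :: mat \<Rightarrow>\<^sub>0 rat"
  have ev: "\<forall>\<^sub>F a::nat in sequentially. ?lhs a = combine P a"
    using eventually_conj[OF add_id_nonneg_eventually[OF n BM] add_id_nonneg_eventually[OF n AM]]
  proof (rule eventually_mono)
    fix a :: nat assume a: "(\<forall>i. 0 \<le> add_id (int a) ?B i i) \<and> (\<forall>i. 0 \<le> add_id (int a) A i i)"
    let ?c = "(\<lambda>_. int a) :: vec"
    have B': "add_id (int a) ?B = shifted_diag e g + diag (\<beta> + ?c)" by (simp add: add_id_def diag_add)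
    have Br: "add_id (int a) ?B \<in> Theta_r n (nat (int a * int n + msigma n A))"
      using add_id_Theta_r[OF n BT, of "int a"] a msB by simp
    have Ar: "add_id (int a) A \<in> Theta_r n (nat (int a * int n + msigma n A))"
      using add_id_Theta_r[OF n A, of "int a"] a by simp
    have match: "co (add_id (int a) ?B) = ro (add_id (int a) A)"
      unfolding add_id_def co_add_diag[OF BM] ro_add_diag[OF AM] BA ..
    have V: "moves n e g (add_id (int a) A) = ?V" by (simp add: add_id_def moves_add_diag)
    have sh: "add_id (int a) A + U - row_shift_by e U = add_id (int a) (?X U)" for U
      by (simp add: add_id_def fun_eq_iff)
    have "?lhs a = (\<Sum>U\<in>?V. smul (of_int (cell_choices n (add_id (int a) (?X U)) U)) (br_one (add_id (int a) (?X U))))"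
      using schur_product[OF n e Br B' Ar match, where 'k = rat] fin unfolding V sh by blast
    also have "\<dots> = (\<Sum>U\<in>?V. smul (poly (cell_choices_poly n (?X U) U) (of_nat a)) (br_one (add_id (int a) (?X U))))"
      using poly_cell_choices_poly[OF UT, where x = "int a"] by (intro sum.cong) simp_all
    also have "\<dots> = (\<Sum>X\<in>?X ` ?V. \<Sum>U\<in>{U \<in> ?V. ?X U = X}. smul (poly (cell_choices_poly n (?X U) U) (of_nat a)) (br_one (add_id (int a) (?X U))))"
      by (rule sum.image_gen[OF fin])
    also have "\<dots> = (\<Sum>X\<in>?X ` ?V. smul (poly (Poly_Mapping.lookup P X) (of_nat a)) (br_one (add_id (int a) X)))"
      by (intro sum.cong refl) (simp add: lP poly_sum smul_sum_left)
    also have "\<dots> = combine P a" by (rule combine_superset[symmetric, OF _ kP]) (simp add: fin)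
    finally show "?lhs a = combine P a" .
  qed
  have "K_tilde_prod n ?B A = P"
    unfolding K_tilde_prod_def if_P[OF BA] combine_def[symmetric]
  proof (rule the_equality, intro conjI allI)
    show "Poly_Mapping.keys P \<subseteq> {X \<in> Theta_tilde n. msigma n X = msigma n A}" using kP XT by auto
    show "Poly_Mapping.lookup P X \<in> Z1" for X unfolding lP by (intro Z1_sum cell_choices_poly_Z1)
    show "\<forall>\<^sub>F a in sequentially. ?lhs a = combine P a" by (rule ev)
  next
    fix P' assume P': "Poly_Mapping.keys P' \<subseteq> {X \<in> Theta_tilde n. msigma n X = msigma n A} \<and>
        (\<forall>X. Poly_Mapping.lookup P' X \<in> Z1) \<and> (\<forall>\<^sub>F a in sequentially. ?lhs a = combine P' a)"
    show "P' = P"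
    proof (rule combine_injective[OF n])
      show "Poly_Mapping.keys P' \<subseteq> Mat n" using P' by (auto simp: Theta_tilde_def)
      show "Poly_Mapping.keys P \<subseteq> Mat n" using kP XT(1) by (auto simp: Theta_tilde_def)
      have "\<forall>\<^sub>F a in sequentially. ?lhs a = combine P' a" using P' by blast
      from eventually_conj[OF this ev] show "\<forall>\<^sub>F a in sequentially. combine P' a = combine P a"
        by (rule eventually_mono) metis
    qed
  qed
  moreover have "add_id 0 X = X" by (simp add: add_id_def diag_def fun_eq_iff)
  ultimately show ?thesis
    unfolding K_const_def using poly_cell_choices_poly[OF UT, where x = 0 and C = X]
    by (simp add: lP poly_sum)
qed

section \<open>Multiplication formulas in the completed algebra\<close>

lemma Kelt_eval:
  assumes "\<And>i j. i \<noteq> j \<Longrightarrow> 0 \<le> Y i j" "\<And>i. Y i i = 0"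
  shows "Kelt n Y \<nu> X = (if diag_of X \<in> Zvec n \<and> X = Y + diag (diag_of X) then of_int (vbinom n (diag_of X) \<nu>) else 0)"
proof -
  have u: "m = diag_of X" if "X = Y + diag m" for m
    using assms(2) by (simp add: that fun_eq_iff diag_of_def diag_def)
  have "\<not> (\<exists>i j. i \<noteq> j \<and> Y i j < 0)" using assms(1) by (auto simp: not_less)
  then have K: "Kelt n Y \<nu> X = (\<Sum>m | m \<in> Zvec n \<and> X = Y + diag m. of_int (vbinom n m \<nu>))"
    by (simp only: Kelt_def if_False)
  show ?thesis
  proof (cases "diag_of X \<in> Zvec n \<and> X = Y + diag (diag_of X)")
    case True
    then have "{m. m \<in> Zvec n \<and> X = Y + diag m} = {diag_of X}" using u by auto
    then show ?thesis using True by (simp add: K)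
  next
    case False
    then have "{m. m \<in> Zvec n \<and> X = Y + diag m} = {}" using u by auto
    then show ?thesis using False by (simp only: K sum.empty if_False)
  qed
qed

text \<open>
  The pairs of terms with a nonzero contribution to the coefficient of \<open>X\<close> are parametrised by the
  diagonal \<open>m\<close> of the right factor, since that of the left factor has to match. Each admissible \<open>U\<close> leads to
  \<open>X\<close> from exactly one \<open>m\<close>, which is \<open>\<mu> X U\<close>.
\<close>

lemma Kelt_product:
  assumes n: "n > 0" and e: "e \<noteq> 0" and A: "A \<in> Theta_pm n" and g: "g \<in> Nvec n" and fin: "finite (moves n e g A)"
  defines "\<mu> \<equiv> \<lambda>X U. diag_of X - diag_of U + diag_of (row_shift_by e U)"
  shows "K_hat_mult n (Kelt n (shifted_diag e g) \<nu>) (Kelt n A l) X =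
    (\<Sum>U\<in>{U \<in> moves n e g A. diag_of X \<in> Zvec n \<and> X = moved_off_diag e A U + diag (diag_of X)}.
       of_int (vbinom n (ro A + \<mu> X U - co (shifted_diag e g)) \<nu> * vbinom n (\<mu> X U) l * cell_choices n X U))"
proof -
  let ?B = "shifted_diag e g" and ?V = "moves n e g A"
  have AT: "A \<in> Theta n" "\<And>i j. 0 \<le> A i j" "\<And>i. A i i = 0" and AM: "A \<in> Mat n"
    using A by (auto simp: Theta_pm_def Theta_def)
  have BM: "?B \<in> Mat n" using g by (intro shifted_diag_Mat) (simp add: Nvec_def)
  have B0: "0 \<le> ?B i j" "?B i i = 0" for i j using g e by (simp_all add: shifted_diag_def Nvec_def)
  have UM: "U \<in> Mat n" if "U \<in> ?V" for U using that by (simp add: moves_def Theta_def)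
  define W where "W = {U \<in> ?V. diag_of X \<in> Zvec n \<and> X = moved_off_diag e A U + diag (diag_of X)}"
  (* The diagonal that the left factor must have when the right factor has diagonal m. *)
  define \<rho> where "\<rho> m = ro A + m - co ?B" for m
  define f where "f B' A' = Kelt n ?B \<nu> B' * Kelt n A l A' * K_const n B' A' X" for B' A'
  have fW: "finite W" using fin by (simp add: W_def)
  have muZ: "\<mu> X U \<in> Zvec n" if "U \<in> W" for U
  proof -
    have U: "U \<in> ?V" and X: "diag_of X \<in> Zvec n" using that unfolding W_def by blast+
    show ?thesis unfolding \<mu>_def
      by (intro Zvec_closed(1)[OF Zvec_closed(2)[OF X]] diag_of_Zvec row_shift_by_Mat UM[OF U])
  qed
  have rhoZ: "\<rho> m \<in> Zvec n" if "m \<in> Zvec n" for m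
    unfolding \<rho>_def by (intro Zvec_closed ro_Zvec co_Zvec AM BM that)
  have inW: "A + diag m + U - row_shift_by e U = X \<longleftrightarrow> U \<in> W \<and> \<mu> X U = m" if m: "m \<in> Zvec n" and U: "U \<in> ?V" for m U
  proof
    assume eq: "A + diag m + U - row_shift_by e U = X"
    then have X: "X = moved_off_diag e A U + diag (m + diag_of U - diag_of (row_shift_by e U))" by (simp add: product_shape)
    have d: "diag_of X = m + diag_of U - diag_of (row_shift_by e U)"
      unfolding X by (simp add: fun_eq_iff diag_of_def[of "_ + _"] moved_off_diag_diag[OF A] diag_def)
    have "diag_of X \<in> Zvec n" unfolding d by (intro Zvec_closed m diag_of_Zvec row_shift_by_Mat UM[OF U])
    moreover have "\<mu> X U = m" unfolding \<mu>_def d by (simp add: fun_eq_iff)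
    ultimately show "U \<in> W \<and> \<mu> X U = m" using X d U by (simp add: W_def)
  next
    assume a: "U \<in> W \<and> \<mu> X U = m"
    have "\<mu> X U + diag_of U - diag_of (row_shift_by e U) = diag_of X" by (simp add: \<mu>_def fun_eq_iff)
    then have "m + diag_of U - diag_of (row_shift_by e U) = diag_of X" using a by simp
    then show "A + diag m + U - row_shift_by e U = X" using a unfolding product_shape by (simp add: W_def)
  qed
  have kc: "K_const n (?B + diag (\<rho> m)) (A + diag m) X = (\<Sum>U\<in>{U \<in> W. \<mu> X U = m}. of_int (cell_choices n X U))"
    if m: "m \<in> Zvec n" for m
  proof -
    have At: "A + diag m \<in> Theta_tilde n"
      using add_diag_Mat[OF AM m] AT(2) by (simp add: Theta_tilde_def diag_def)
    have c: "co (?B + diag (\<rho> m)) = ro (A + diag m)"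
      unfolding co_add_diag[OF BM] ro_add_diag[OF AM] \<rho>_def by (simp add: fun_eq_iff)
    have "{U \<in> ?V. A + diag m + U - row_shift_by e U = X} = {U \<in> W. \<mu> X U = m}"
    proof (intro equalityI subsetI)
      fix U assume "U \<in> {U \<in> ?V. A + diag m + U - row_shift_by e U = X}"
      then have U: "U \<in> ?V" and eq: "A + diag m + U - row_shift_by e U = X" by blast+
      show "U \<in> {U \<in> W. \<mu> X U = m}" using iffD1[OF inW[OF m U] eq] by blast
    next
      fix U assume "U \<in> {U \<in> W. \<mu> X U = m}"
      then have a: "U \<in> W \<and> \<mu> X U = m" by blast
      then have U: "U \<in> ?V" unfolding W_def by blast
      show "U \<in> {U \<in> ?V. A + diag m + U - row_shift_by e U = X}"
        using iffD2[OF inW[OF m U] a] U by blast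
    qed
    then show ?thesis
      using K_const_formula[OF n e At g rhoZ[OF m] c, of X] fin by (simp add: moves_add_diag)
  qed
  have KB: "Kelt n ?B \<nu> (?B + diag m) = of_int (vbinom n m \<nu>)" if "m \<in> Zvec n" for m
  proof -
    have "diag_of (?B + diag m) = m" using B0(2) by (simp add: fun_eq_iff diag_of_def diag_def)
    then show ?thesis using that by (simp add: Kelt_eval[OF B0])
  qed
  have KA: "Kelt n A l (A + diag m) = of_int (vbinom n m l)" if "m \<in> Zvec n" for m
  proof -
    have "diag_of (A + diag m) = m" using AT(3) by (simp add: fun_eq_iff diag_of_def diag_def)
    then show ?thesis using that by (simp add: Kelt_eval[OF AT(2,3)])
  qed
  let ?pair = "\<lambda>m. (?B + diag (\<rho> m), A + diag m)"
  let ?M = "\<mu> X ` W"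
  have sup: "{p. (case p of (B', A') \<Rightarrow> f B' A') \<noteq> 0} \<subseteq> ?pair ` ?M"
  proof
    fix p assume "p \<in> {p. (case p of (B', A') \<Rightarrow> f B' A') \<noteq> 0}"
    then obtain B' A' where p: "p = (B', A')" and nz: "f B' A' \<noteq> 0" by (cases p) auto
    have nz': "Kelt n ?B \<nu> B' \<noteq> 0" "Kelt n A l A' \<noteq> 0" "K_const n B' A' X \<noteq> 0" using nz by (auto simp: f_def)
    define m where "m = diag_of A'"
    have A': "A' = A + diag m" "m \<in> Zvec n"
      using nz'(2) unfolding Kelt_eval[OF AT(2,3)] m_def by (auto split: if_splits)
    have B': "B' = ?B + diag (diag_of B')"
      using nz'(1) unfolding Kelt_eval[OF B0] by (auto split: if_splits)
    have "co B' = ro A'"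
    proof (rule ccontr)
      assume "co B' \<noteq> ro A'"
      then have "K_const n B' A' X = 0" by (simp add: K_const_def K_tilde_prod_def)
      then show False using nz'(3) by simp
    qed
    then have "co ?B + diag_of B' = ro A + m"
      using co_add_diag[OF BM, of "diag_of B'"] ro_add_diag[OF AM, of m] B' A'(1) by simp
    then have "diag_of B' = \<rho> m" unfolding \<rho>_def by (metis add_diff_cancel_left')
    then have Bm: "B' = ?B + diag (\<rho> m)" using B' by simp
    have "{U \<in> W. \<mu> X U = m} \<noteq> {}" using nz'(3) kc[OF A'(2)] unfolding Bm A'(1) by (metis sum.empty)
    then have "m \<in> ?M" by blast
    then show "p \<in> ?pair ` ?M" by (simp add: p Bm A'(1))
  qed
  have "K_hat_mult n (Kelt n ?B \<nu>) (Kelt n A l) X = Sum_any (\<lambda>(B', A'). f B' A')"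
    by (simp add: K_hat_mult_def f_def)
  also have "\<dots> = (\<Sum>p\<in>?pair ` ?M. case p of (B', A') \<Rightarrow> f B' A')"
    using fW by (intro Sum_any.expand_superset sup) simp
  also have "\<dots> = (\<Sum>m\<in>?M. f (?B + diag (\<rho> m)) (A + diag m))"
  proof (subst sum.reindex)
    show "inj_on ?pair ?M"
    proof (rule inj_onI)
      fix a b assume "?pair a = ?pair b"
      then have "A + diag a = A + diag b" unfolding prod.inject by (rule conjunct2)
      then show "a = b" unfolding diag_inject .
    qed
  qed (simp add: o_def)
  also have "\<dots> = (\<Sum>m\<in>?M. \<Sum>U\<in>{U \<in> W. \<mu> X U = m}.
      of_int (vbinom n (\<rho> (\<mu> X U)) \<nu> * vbinom n (\<mu> X U) l * cell_choices n X U))"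
  proof (intro sum.cong refl)
    fix m assume "m \<in> ?M"
    then have m: "m \<in> Zvec n" using muZ by blast
    show "f (?B + diag (\<rho> m)) (A + diag m) = (\<Sum>U\<in>{U \<in> W. \<mu> X U = m}.
      of_int (vbinom n (\<rho> (\<mu> X U)) \<nu> * vbinom n (\<mu> X U) l * cell_choices n X U))"
      unfolding f_def kc[OF m] KB[OF rhoZ[OF m]] KA[OF m] sum_distrib_left by (intro sum.cong) auto
  qed
  also have "\<dots> = (\<Sum>U\<in>W. of_int (vbinom n (\<rho> (\<mu> X U)) \<nu> * vbinom n (\<mu> X U) l * cell_choices n X U))"
    by (rule sum.image_gen[OF fW, symmetric])
  finally show ?thesis by (simp add: W_def \<rho>_def)
qed

lemma K_scale_sum: "(\<Sum>i\<in>I. K_scale (c i) (b i)) X = (\<Sum>i\<in>I. c i * b i X)"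
  by (simp add: sum_fun_at K_scale_def)

text \<open>
  The same use of \<open>vector_identity\<close> as in \<open>Selt_formula\<close>, now for each coefficient: the diagonal of
  \<open>X\<close> plays the role of \<open>m\<close>, and there are no boundary terms because diagonals may be negative.
\<close>

theorem Kelt_formula:
  assumes n: "n > 0" and e: "e \<noteq> 0" and A: "A \<in> Theta_pm n" and g: "g \<in> Nvec n" and l: "l \<in> Nvec n"
    and fin: "finite (moves n e g A)"
  shows "K_hat_mult n (Kelt n (shifted_diag e g) 0) (Kelt n A l) =
    (\<Sum>U\<in>moves n e g A. \<Sum>d | d \<in> Nvec n \<and> d \<le> l.
       K_scale (of_int (overlap_coef n (diag_of (row_shift_by e U) - diag_of U) (diag_of U) l d * off_diag_choices n (moved_off_diag e A U) U))
         (Kelt n (moved_off_diag e A U) (diag_of U + d)))"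
proof
  fix X
  let ?V = "moves n e g A"
  let ?in = "\<lambda>U. diag_of X \<in> Zvec n \<and> X = moved_off_diag e A U + diag (diag_of X)"
  let ?x = "diag_of X"
  have "K_hat_mult n (Kelt n (shifted_diag e g) 0) (Kelt n A l) X =
      (\<Sum>U\<in>{U \<in> ?V. ?in U}. of_int (vbinom n (?x - diag_of U + diag_of (row_shift_by e U)) l * cell_choices n X U))"
    unfolding Kelt_product[OF n e A g fin] by simp
  also have "\<dots> = (\<Sum>U\<in>?V. if ?in U then of_int (vbinom n (?x - diag_of U + diag_of (row_shift_by e U)) l * cell_choices n X U) else 0)"
    by (rule sum.inter_filter[OF fin])
  also have "\<dots> = (\<Sum>U\<in>?V. \<Sum>d | d \<in> Nvec n \<and> d \<le> l.
       of_int (overlap_coef n (diag_of (row_shift_by e U) - diag_of U) (diag_of U) l d * off_diag_choices n (moved_off_diag e A U) U) *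
         Kelt n (moved_off_diag e A U) (diag_of U + d) X)"
  proof (rule sum.cong[OF refl])
    fix U assume U: "U \<in> ?V"
    define \<tau> \<sigma> Y where "\<tau> = diag_of U" and "\<sigma> = diag_of (row_shift_by e U)" and "Y = moved_off_diag e A U"
    have UT: "U \<in> Theta n" using U by (simp add: moves_def)
    have tN: "\<tau> \<in> Nvec n" unfolding \<tau>_def by (rule diag_of_Nvec[OF UT])
    have K: "Kelt n Y \<nu> X = (if ?in U then of_int (vbinom n ?x \<nu>) else 0)" for \<nu>
      unfolding Y_def by (rule Kelt_eval) (simp_all add: moved_off_diag_nonneg[OF U] moved_off_diag_diag[OF A])
    show "(if ?in U then of_int (vbinom n (?x - diag_of U + diag_of (row_shift_by e U)) l * cell_choices n X U) else 0) =
      (\<Sum>d | d \<in> Nvec n \<and> d \<le> l.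
       of_int (overlap_coef n (diag_of (row_shift_by e U) - diag_of U) (diag_of U) l d * off_diag_choices n (moved_off_diag e A U) U) *
         Kelt n (moved_off_diag e A U) (diag_of U + d) X)"
    proof (cases "?in U")
      case True
      have "off_diag_choices n X U = off_diag_choices n Y U"
      proof (rule off_diag_choices_cong)
        fix i j :: int assume "i \<noteq> j"
        then show "X i j = Y i j" using fun_cong[OF fun_cong[OF conjunct2[OF True], of i], of j] by (simp add: Y_def diag_def)
      qed
      then have fb: "cell_choices n X U = off_diag_choices n Y U * vbinom n ?x \<tau>" by (simp add: cell_choices_split[OF UT] \<tau>_def)
      have x: "?x - \<tau> + \<sigma> = ?x + (\<sigma> - \<tau>)" by (simp add: fun_eq_iff)
      have "vbinom n (?x - \<tau> + \<sigma>) l * cell_choices n X U = off_diag_choices n Y U * (vbinom n (?x + (\<sigma> - \<tau>)) l * vbinom n ?x \<tau>)"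
        unfolding x fb by (rule mult.left_commute)
      also have "\<dots> = (\<Sum>d | d \<in> Nvec n \<and> d \<le> l. overlap_coef n (\<sigma> - \<tau>) \<tau> l d * off_diag_choices n Y U * vbinom n ?x (\<tau> + d))"
        unfolding vector_identity[OF n l tN] sum_distrib_left by (intro sum.cong) (simp_all add: algebra_simps)
      finally have "(of_int (vbinom n (?x - \<tau> + \<sigma>) l * cell_choices n X U) :: rat) =
          (\<Sum>d | d \<in> Nvec n \<and> d \<le> l. of_int (overlap_coef n (\<sigma> - \<tau>) \<tau> l d * off_diag_choices n Y U) * of_int (vbinom n ?x (\<tau> + d)))"
        by simp
      then show ?thesis using True K by (simp add: \<tau>_def \<sigma>_def Y_def)
    next
      case False
      have "Kelt n (moved_off_diag e A U) (diag_of U + d) X = 0" for d using K False by (simp only: Y_def if_False)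
      then show ?thesis using False by (simp only: if_False mult_zero_right sum.neutral_const)
    qed
  qed
  finally show "K_hat_mult n (Kelt n (shifted_diag e g) 0) (Kelt n A l) X =
    (\<Sum>U\<in>?V. \<Sum>d | d \<in> Nvec n \<and> d \<le> l.
       K_scale (of_int (overlap_coef n (diag_of (row_shift_by e U) - diag_of U) (diag_of U) l d * off_diag_choices n (moved_off_diag e A U) U))
         (Kelt n (moved_off_diag e A U) (diag_of U + d))) X"
    by (simp only: sum_fun_at[of _ ?V] K_scale_sum)
qed

theorem Kelt_zero_formula:
  assumes n: "n > 0" and A: "A \<in> Theta_pm n" and l: "l \<in> Nvec n" and \<mu>: "\<mu> \<in> Nvec n"
  shows "K_hat_mult n (Kelt n 0 \<mu>) (Kelt n A l) =
    (\<Sum>d | d \<in> Nvec n \<and> d \<le> \<mu>. K_scale (of_int (coef_zero n A l \<mu> d)) (Kelt n A (l + d)))"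
proof
  fix X
  let ?x = "diag_of X"
  let ?in = "?x \<in> Zvec n \<and> X = A + diag ?x"
  have A0: "\<And>i j. 0 \<le> A i j" "\<And>i. A i i = 0" using A by (auto simp: Theta_pm_def Theta_def)
  have z: "(0 :: vec) \<in> Nvec n" by (simp add: Nvec_def Zvec_def)
  have e: "(1::int) \<noteq> 0" by simp
  have zz: "co (0 :: mat) = 0" "row_shift_by 1 (0 :: mat) = 0" "diag_of (0 :: mat) = 0" "moved_off_diag 1 A 0 = A"
    by (simp_all add: co_def fun_eq_iff row_shift_by_def diag_of_def moved_off_diag_def off_diag_def)
  have "{U \<in> {0 :: mat}. ?x \<in> Zvec n \<and> X = moved_off_diag 1 A U + diag ?x} = (if ?in then {0} else {})" by (auto simp: zz)
  then have "K_hat_mult n (Kelt n 0 \<mu>) (Kelt n A l) X =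
      (if ?in then of_int (vbinom n (ro A + ?x) \<mu> * vbinom n ?x l) else 0)"
    using Kelt_product[OF n e A z, of \<mu> l X] by (simp add: moves_zero[OF A] shifted_diag_zero zz)
  also have "\<dots> = (\<Sum>d | d \<in> Nvec n \<and> d \<le> \<mu>. of_int (coef_zero n A l \<mu> d) * Kelt n A (l + d) X)"
  proof (cases ?in)
    case True
    then have "Kelt n A (l + d) X = of_int (vbinom n ?x (l + d))" for d unfolding Kelt_eval[OF A0] by (simp only: if_P)
    then show ?thesis using True by (simp add: zero_identity[OF n l \<mu>] flip: of_int_mult)
  next
    case False
    then have "Kelt n A (l + d) X = 0" for d unfolding Kelt_eval[OF A0] by (simp only: if_False)
    then show ?thesis using False by (simp only: if_False mult_zero_right sum.neutral_const)
  qed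
  finally show "K_hat_mult n (Kelt n 0 \<mu>) (Kelt n A l) X =
      (\<Sum>d | d \<in> Nvec n \<and> d \<le> \<mu>. K_scale (of_int (coef_zero n A l \<mu> d)) (Kelt n A (l + d))) X"
    by (simp only: K_scale_sum)
qed

section \<open>Raising and lowering\<close>

lemma Emat_diagonal_sum:
  assumes n: "n > 0" and a: "a \<in> Zvec n"
  shows "(\<Sum>i = 1..int n. a i * Emat n (i + c) (i + c') k k') = (if k' = k + c' - c then a (k - c) else 0)"
proof -
  obtain t where t: "k - c + t * int n \<in> {1..int n}" using residue[OF n] .
  let ?i = "k - c + t * int n"
  have other: "Emat n (i + c) (i + c') k k' = 0" if "i \<in> {1..int n}" "i \<noteq> ?i" for i
  proof -
    have "\<not> (\<exists>s. k = i + c + s * int n \<and> k' = i + c' + s * int n)"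
    proof
      assume "\<exists>s. k = i + c + s * int n \<and> k' = i + c' + s * int n"
      then obtain s where "i - ?i = - (s + t) * int n" by (auto simp: algebra_simps)
      moreover have "\<bar>i - ?i\<bar> < int n" using that(1) t by auto
      ultimately have "s + t = 0" using n by (simp add: abs_mult)
      then show False using \<open>i - ?i = - (s + t) * int n\<close> that(2) by simp
    qed
    then show ?thesis by (simp add: Emat_def)
  qed
  have at: "Emat n (?i + c) (?i + c') k k' = (if k' = k + c' - c then 1 else 0)"
  proof -
    have "(\<exists>s. k = ?i + c + s * int n \<and> k' = ?i + c' + s * int n) \<longleftrightarrow> k' = k + c' - c"
    proof
      assume "\<exists>s. k = ?i + c + s * int n \<and> k' = ?i + c' + s * int n"
      then show "k' = k + c' - c" by (auto simp: algebra_simps)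
    next
      assume "k' = k + c' - c"
      then show "\<exists>s. k = ?i + c + s * int n \<and> k' = ?i + c' + s * int n"
        by (intro exI[of _ "- t"]) (simp add: algebra_simps)
    qed
    then show ?thesis by (simp add: Emat_def)
  qed
  have "(\<Sum>i = 1..int n. a i * Emat n (i + c) (i + c') k k') = (\<Sum>i\<in>{?i}. a i * Emat n (i + c) (i + c') k k')"
    using t other by (intro sum.mono_neutral_right) auto
  then show ?thesis using at Zvec_shift[OF a, of "k - c" t] by simp
qed

lemma upper_mat_eq: assumes "n > 0" "a \<in> Zvec n" shows "upper_mat n a = shifted_diag 1 a"
  using Emat_diagonal_sum[OF assms, of 0 1] by (simp add: upper_mat_def shifted_diag_def fun_eq_iff)

lemma lower_mat_eq: assumes "n > 0" "a \<in> Zvec n" shows "lower_mat n a = shifted_diag (-1) (\<lambda>i. a (i - 1))"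
  using Emat_diagonal_sum[OF assms, of 1 0] by (simp add: lower_mat_def shifted_diag_def fun_eq_iff)

lemma row_shift_eq: "row_shift T = row_shift_by 1 T"
  by (simp add: row_shift_def row_shift_by_def fun_eq_iff)

lemma row_shift_by_row_shift_by: "row_shift_by a (row_shift_by b T) = row_shift_by (a + b) T"
  by (simp add: row_shift_by_def fun_eq_iff algebra_simps)

lemma row_shift_by_0: "row_shift_by 0 T = T"
  by (simp add: row_shift_by_def fun_eq_iff)

lemma moves_upper:
  "moves n 1 a A = {T \<in> Theta n. ro T = a \<and> (\<forall>i j. i \<noteq> j \<longrightarrow> 0 \<le> (A + off_diag T - off_diag (row_shift T)) i j)}"
  unfolding moves_def row_shift_eq by (simp add: off_diag_def cong: conj_cong)

definition lower_moves :: "nat \<Rightarrow> vec \<Rightarrow> mat \<Rightarrow> mat set" where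
  "lower_moves n a A = {T \<in> Theta n. ro T = a \<and> (\<forall>i j. i \<noteq> j \<longrightarrow> 0 \<le> (A - off_diag T + off_diag (row_shift T)) i j)}"

text \<open>
  With \<open>e = - 1\<close> the entry \<open>U i k\<close> counts what row \<open>i - 1\<close> gives to row \<open>i\<close>, which the theorem calls
  \<open>t\<^bsub>i-1,k\<^esub>\<close>; so \<open>U\<close> is the row shift of \<open>T\<close>.
\<close>

lemma moves_lower: "bij_betw (row_shift_by 1) (lower_moves n a A) (moves n (-1) (\<lambda>i. a (i - 1)) A)"
proof (rule bij_betwI[where g = "row_shift_by (-1)"])
  have c: "(A + row_shift_by 1 T - row_shift_by (- 1) (row_shift_by 1 T)) i j = (A - off_diag T + off_diag (row_shift T)) i j" if "i \<noteq> j" for T i j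
    using that by (simp add: row_shift_by_row_shift_by row_shift_by_0 row_shift_eq off_diag_def)
  show "row_shift_by 1 \<in> lower_moves n a A \<rightarrow> moves n (-1) (\<lambda>i. a (i - 1)) A"
  proof
    fix T assume T: "T \<in> lower_moves n a A"
    then have "ro (row_shift_by 1 T) = (\<lambda>i. a (i - 1))" by (auto simp: fun_eq_iff ro_row_shift_by lower_moves_def)
    moreover have "0 \<le> (A + row_shift_by 1 T - row_shift_by (- 1) (row_shift_by 1 T)) i j" if "i \<noteq> j" for i j
      unfolding c[OF that] using T that unfolding lower_moves_def by blast
    moreover have "row_shift_by 1 T \<in> Theta n" using T by (simp add: lower_moves_def row_shift_by_Theta)
    ultimately show "row_shift_by 1 T \<in> moves n (-1) (\<lambda>i. a (i - 1)) A" unfolding moves_def by blast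
  qed
  show "row_shift_by (-1) \<in> moves n (-1) (\<lambda>i. a (i - 1)) A \<rightarrow> lower_moves n a A"
  proof
    fix U assume U: "U \<in> moves n (-1) (\<lambda>i. a (i - 1)) A"
    have "ro (row_shift_by (-1) U) = a" using U by (simp add: fun_eq_iff ro_row_shift_by moves_def)
    moreover have "row_shift_by 1 (row_shift_by (-1) U) = U" by (simp add: row_shift_by_row_shift_by row_shift_by_0)
    moreover have "0 \<le> (A - off_diag (row_shift_by (-1) U) + off_diag (row_shift (row_shift_by (-1) U))) i j" if "i \<noteq> j" for i j
      unfolding c[OF that, symmetric] \<open>row_shift_by 1 (row_shift_by (-1) U) = U\<close> using U that unfolding moves_def by blast
    moreover have "row_shift_by (-1) U \<in> Theta n" using U by (simp add: moves_def row_shift_by_Theta)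
    ultimately show "row_shift_by (-1) U \<in> lower_moves n a A" unfolding lower_moves_def by blast
  qed
qed (simp_all add: row_shift_by_row_shift_by row_shift_by_0)

text \<open>
  The index set may be infinite, but all but finitely many of its members lead to a matrix with
  a negative off-diagonal entry and so to the zero element.
\<close>

lemma sum_index:
  fixes F :: "mat \<Rightarrow> vec \<Rightarrow> 'a::comm_monoid_add"
  assumes n: "n > 0" and V: "finite V" "V \<subseteq> {T \<in> Theta n. ro T = a}"
    and F: "\<And>T d. T \<in> Theta n \<Longrightarrow> ro T = a \<Longrightarrow> F T d \<noteq> 0 \<Longrightarrow> T \<in> V"
  shows "Sum_any (\<lambda>(T, d). if (T, d) \<in> index_set n a l then F T d else 0) =
    (\<Sum>T\<in>V. \<Sum>d | d \<in> Nvec n \<and> d \<le> l. F T d)"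
proof -
  let ?D = "{d. d \<in> Nvec n \<and> d \<le> l}"
  have "Sum_any (\<lambda>(T, d). if (T, d) \<in> index_set n a l then F T d else 0) =
      (\<Sum>p\<in>V \<times> ?D. case p of (T, d) \<Rightarrow> if (T, d) \<in> index_set n a l then F T d else 0)"
    using V(1) finite_vec_le[OF n, of l] F
    by (intro Sum_any.expand_superset) (auto simp: index_set_def split: if_splits)
  also have "\<dots> = (\<Sum>p\<in>V \<times> ?D. case p of (T, d) \<Rightarrow> F T d)"
    using V(2) by (intro sum.cong) (auto simp: index_set_def)
  also have "\<dots> = (\<Sum>T\<in>V. \<Sum>d\<in>?D. F T d)" by (simp add: sum.cartesian_product)
  finally show ?thesis .
qed

lemma upper_terms:
  "moved_off_diag 1 A T = A + off_diag T - off_diag (row_shift T)"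
  "overlap_coef n (diag_of (row_shift_by 1 T) - diag_of T) (diag_of T) l d = coef_a n l T d"
  "off_diag_choices n (moved_off_diag 1 A T) T = upper_binom n A T"
proof -
  show "moved_off_diag 1 A T = A + off_diag T - off_diag (row_shift T)" by (simp add: moved_off_diag_def row_shift_eq)
  show "overlap_coef n (diag_of (row_shift_by 1 T) - diag_of T) (diag_of T) l d = coef_a n l T d"
    by (simp add: overlap_coef_def coef_a_def row_shift_eq)
  have "(if j = i then 1 else ibinom (moved_off_diag 1 A T i j) (nat (T i j))) =
      (if j = i then 1 else ibinom (A i j - T (i - 1) j + T i j) (nat (T i j)))" for i j
    by (simp add: moved_off_diag_def off_diag_def row_shift_by_def algebra_simps)
  then show "off_diag_choices n (moved_off_diag 1 A T) T = upper_binom n A T" by (simp only: off_diag_choices_def upper_binom_def)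
qed

lemma lower_terms:
  "moved_off_diag (-1) A (row_shift_by 1 T) = A - off_diag T + off_diag (row_shift T)"
  "diag_of (row_shift_by 1 T) = diag_of (row_shift T)"
  "overlap_coef n (diag_of (row_shift_by (-1) (row_shift_by 1 T)) - diag_of (row_shift_by 1 T)) (diag_of (row_shift_by 1 T)) l d = coef_b n l T d"
  "off_diag_choices n (moved_off_diag (-1) A (row_shift_by 1 T)) (row_shift_by 1 T) = lower_binom n A T"
proof -
  show "moved_off_diag (-1) A (row_shift_by 1 T) = A - off_diag T + off_diag (row_shift T)"
    by (simp add: moved_off_diag_def row_shift_eq row_shift_by_row_shift_by row_shift_by_0 fun_eq_iff)
  show "diag_of (row_shift_by 1 T) = diag_of (row_shift T)" by (simp add: row_shift_eq)
  show "overlap_coef n (diag_of (row_shift_by (-1) (row_shift_by 1 T)) - diag_of (row_shift_by 1 T)) (diag_of (row_shift_by 1 T)) l d = coef_b n l T d"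
    by (simp add: overlap_coef_def coef_b_def row_shift_eq row_shift_by_row_shift_by row_shift_by_0)
  have "(if j = i then 1 else ibinom (moved_off_diag (-1) A (row_shift_by 1 T) i j) (nat (row_shift_by 1 T i j))) =
      (if j = i then 1 else ibinom (A i j + T (i - 1) j - T i j) (nat (T (i - 1) j)))" for i j
    by (simp add: moved_off_diag_def off_diag_def row_shift_by_def algebra_simps)
  then show "off_diag_choices n (moved_off_diag (-1) A (row_shift_by 1 T)) (row_shift_by 1 T) = lower_binom n A T" by (simp only: off_diag_choices_def lower_binom_def)
qed

lemma Selt_nonzero: "smul c (Selt n r Y \<nu>) \<noteq> 0 \<Longrightarrow> \<forall>i j. i \<noteq> j \<longrightarrow> 0 \<le> Y i j"
  unfolding Selt_def by (rule ccontr) (auto simp: not_le)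

lemma Kelt_nonzero: "K_scale c (Kelt n Y \<nu>) \<noteq> 0 \<Longrightarrow> \<forall>i j. i \<noteq> j \<longrightarrow> 0 \<le> Y i j"
  unfolding Kelt_def K_scale_def by (rule ccontr) (auto simp: not_le fun_eq_iff)

theorem proposition7p3:
  fixes n :: nat and A B C :: mat and \<alpha> l \<mu> :: vec
  assumes "n \<ge> 2"
    and "A \<in> Theta_pm n"
    and "\<alpha> \<in> Nvec n" and "l \<in> Nvec n" and "\<mu> \<in> Nvec n"
    and "B = upper_mat n \<alpha>" and "C = lower_mat n \<alpha>"
  shows
    "K_hat_mult n (Kelt n 0 \<mu>) (Kelt n A l) =
       (\<Sum>d | d \<in> Nvec n \<and> d \<le> \<mu>. K_scale (of_int (coef_zero n A l \<mu> d)) (Kelt n A (l + d)))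
     \<and>
     K_hat_mult n (Kelt n B 0) (Kelt n A l) =
       Sum_any (\<lambda>(T, d). if (T, d) \<in> index_set n \<alpha> l
         then K_scale (of_int (coef_a n l T d * upper_binom n A T))
                (Kelt n (A + off_diag T - off_diag (row_shift T)) (diag_of T + d))
         else 0)
     \<and>
     K_hat_mult n (Kelt n C 0) (Kelt n A l) =
       Sum_any (\<lambda>(T, d). if (T, d) \<in> index_set n \<alpha> l
         then K_scale (of_int (coef_b n l T d * lower_binom n A T))
                (Kelt n (A - off_diag T + off_diag (row_shift T)) (diag_of (row_shift T) + d))
         else 0)
     \<and>
     (\<forall>r.
       schur_one_mult n r (Selt n r 0 \<mu>) (Selt n r A l) =
         (\<Sum>d | d \<in> Nvec n \<and> d \<le> \<mu>. smul (coef_zero n A l \<mu> d) (Selt n r A (l + d)))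
       \<and>
       schur_one_mult n r (Selt n r B 0) (Selt n r A l) =
         Sum_any (\<lambda>(T, d). if (T, d) \<in> index_set n \<alpha> l
           then smul (coef_a n l T d * upper_binom n A T)
                  (Selt n r (A + off_diag T - off_diag (row_shift T)) (diag_of T + d))
           else 0)
       \<and>
       schur_one_mult n r (Selt n r C 0) (Selt n r A l) =
         Sum_any (\<lambda>(T, d). if (T, d) \<in> index_set n \<alpha> l
           then smul (coef_b n l T d * lower_binom n A T)
                  (Selt n r (A - off_diag T + off_diag (row_shift T)) (diag_of (row_shift T) + d))
           else 0))"
proof -
  have n: "n > 0" using assms(1) by simp
  note A = assms(2) and \<alpha> = assms(3) and l = assms(4) and \<mu> = assms(5)
  have AM: "A \<in> Mat n" using A by (auto simp: Theta_pm_def Theta_def)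
  have \<alpha>Z: "\<alpha> \<in> Zvec n" using \<alpha> by (simp add: Nvec_def)
  define \<gamma> where "\<gamma> = (\<lambda>i. \<alpha> (i - 1))"
  have \<gamma>: "\<gamma> \<in> Nvec n"
  proof -
    have "\<alpha> (i + int n - 1) = \<alpha> (i - 1)" for i using Zvec_shift[OF \<alpha>Z, of "i - 1" 1] by (simp add: algebra_simps)
    then show ?thesis using \<alpha> by (simp add: \<gamma>_def Nvec_def Zvec_def)
  qed
  have B: "B = shifted_diag 1 \<alpha>" using upper_mat_eq[OF n \<alpha>Z] assms(6) by simp
  have C: "C = shifted_diag (-1) \<gamma>" using lower_mat_eq[OF n \<alpha>Z] assms(7) by (simp add: \<gamma>_def)
  have fup: "finite (moves n 1 \<alpha> A)" unfolding moves_upper by (rule finite_upper_index[OF n AM])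
  have flow: "finite (lower_moves n \<alpha> A)" unfolding lower_moves_def by (rule finite_lower_index[OF n AM])
  note bij = moves_lower[of n \<alpha> A, folded \<gamma>_def]
  have flow': "finite (moves n (-1) \<gamma> A)" using bij_betw_finite[OF bij] flow by simp
  have e: "(1::int) \<noteq> 0" "(-1::int) \<noteq> 0" by simp_all
  have subs: "moves n 1 \<alpha> A \<subseteq> {T \<in> Theta n. ro T = \<alpha>}" "lower_moves n \<alpha> A \<subseteq> {T \<in> Theta n. ro T = \<alpha>}"
    by (auto simp: moves_def lower_moves_def)
  have K2: "K_hat_mult n (Kelt n B 0) (Kelt n A l) =
       Sum_any (\<lambda>(T, d). if (T, d) \<in> index_set n \<alpha> l
         then K_scale (of_int (coef_a n l T d * upper_binom n A T))
                (Kelt n (A + off_diag T - off_diag (row_shift T)) (diag_of T + d))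
         else 0)"
  proof -
    have v: "T \<in> moves n 1 \<alpha> A" if "T \<in> Theta n" "ro T = \<alpha>"
      "K_scale (of_int (coef_a n l T d * upper_binom n A T))
         (Kelt n (A + off_diag T - off_diag (row_shift T)) (diag_of T + d)) \<noteq> 0" for T d
      unfolding moves_upper using that(1,2) Kelt_nonzero[OF that(3)] by blast
    show ?thesis
      unfolding B Kelt_formula[OF n e(1) A \<alpha> l fup]
      unfolding upper_terms(2,3) unfolding upper_terms(1) by (rule sum_index[OF n fup subs(1) v, symmetric])
  qed
  have S2: "schur_one_mult n r (Selt n r B 0) (Selt n r A l) =
       Sum_any (\<lambda>(T, d). if (T, d) \<in> index_set n \<alpha> l
         then smul (coef_a n l T d * upper_binom n A T)
                (Selt n r (A + off_diag T - off_diag (row_shift T)) (diag_of T + d))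
         else 0)" for r
  proof -
    have v: "T \<in> moves n 1 \<alpha> A" if "T \<in> Theta n" "ro T = \<alpha>"
      "smul (coef_a n l T d * upper_binom n A T)
         (Selt n r (A + off_diag T - off_diag (row_shift T)) (diag_of T + d)) \<noteq> 0" for T d
      unfolding moves_upper using that(1,2) Selt_nonzero[OF that(3)] by blast
    show ?thesis
      unfolding B Selt_formula[OF n e(1) A \<alpha> l fup]
      unfolding upper_terms(2,3) unfolding upper_terms(1) by (rule sum_index[OF n fup subs(1) v, symmetric])
  qed
  have K3: "K_hat_mult n (Kelt n C 0) (Kelt n A l) =
       Sum_any (\<lambda>(T, d). if (T, d) \<in> index_set n \<alpha> l
         then K_scale (of_int (coef_b n l T d * lower_binom n A T))
                (Kelt n (A - off_diag T + off_diag (row_shift T)) (diag_of (row_shift T) + d))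
         else 0)"
  proof -
    have v: "T \<in> lower_moves n \<alpha> A" if "T \<in> Theta n" "ro T = \<alpha>"
      "K_scale (of_int (coef_b n l T d * lower_binom n A T))
         (Kelt n (A - off_diag T + off_diag (row_shift T)) (diag_of (row_shift T) + d)) \<noteq> 0" for T d
      unfolding lower_moves_def using that(1,2) Kelt_nonzero[OF that(3)] by blast
    show ?thesis
      unfolding C Kelt_formula[OF n e(2) A \<gamma> l flow']
        sum.reindex_bij_betw[OF bij, symmetric]
      unfolding lower_terms(3,4) unfolding lower_terms(1,2) by (rule sum_index[OF n flow subs(2) v, symmetric])
  qed
  have S3: "schur_one_mult n r (Selt n r C 0) (Selt n r A l) =
       Sum_any (\<lambda>(T, d). if (T, d) \<in> index_set n \<alpha> l
         then smul (coef_b n l T d * lower_binom n A T)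
                (Selt n r (A - off_diag T + off_diag (row_shift T)) (diag_of (row_shift T) + d))
         else 0)" for r
  proof -
    have v: "T \<in> lower_moves n \<alpha> A" if "T \<in> Theta n" "ro T = \<alpha>"
      "smul (coef_b n l T d * lower_binom n A T)
         (Selt n r (A - off_diag T + off_diag (row_shift T)) (diag_of (row_shift T) + d)) \<noteq> 0" for T d
      unfolding lower_moves_def using that(1,2) Selt_nonzero[OF that(3)] by blast
    show ?thesis
      unfolding C Selt_formula[OF n e(2) A \<gamma> l flow']
        sum.reindex_bij_betw[OF bij, symmetric]
      unfolding lower_terms(3,4) unfolding lower_terms(1,2) by (rule sum_index[OF n flow subs(2) v, symmetric])
  qed
  show ?thesis
    using Kelt_zero_formula[OF n A l \<mu>] K2 K3 Selt_zero_formula[OF n A l \<mu>] S2 S3 by blast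
qed

end
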